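(* Let $V,W,U$ be finite-dimensional real vector spaces, $\mathbf X\in\mathscr C^p_\omega([0,T],V)$ with trace $X$, $F\in C^\infty(V,W)$ and $\overline H\in\mathscr D_{F_*\mathbf X}(\mathcal L(W,U))$. Then $$\Big(\overline{\int}\overline H\,\mathrm d(F_*\mathbf X)\Big)*\overline F(X)=\overline{\int}F^*\overline H\,\mathrm d\mathbf X\quad\text{in }\mathscr D_{\mathbf X}(U),$$ and therefore $$\boldsymbol{\int}\overline H\,\mathrm d(F_*\mathbf X)=\boldsymbol{\int}F^*\overline H\,\mathrm d\mathbf X\quad\text{in }\mathscr C^p_\omega([0,T],U).$$
   Context: All vector spaces are finite-dimensional and real; $T^N(V)=\bigoplus_{n=0}^N V^{\otimes n}$, with $a^n$ the component of $a$ in $V^{\otimes n}$. $T>0$, $p\ge1$, $\Delta_T=\{(s,t):0\le s\le t\le T\}$. A control is a continuous $\omega:\Delta_T\to[0,\infty)$ with $\omega(t,t)=0$ and $\omega(s,u)+\omega(u,t)\le\omega(s,t)$ for $s\le u\le t$. For a path $Y$, $Y_{st}:=Y_t-Y_s$; $\mathcal C^p_\omega([0,T],E)$ is the set of continuous $E$-valued paths with $|Y_{st}|\le C\omega(s,t)^{1/p}$ for some $C$. We write $a_{st}\approx_m b_{st}$ if $a_{st}-b_{st}=O(\omega(s,t)^{m/p})$, i.e. $|a_{st}-b_{st}|\le C\omega(s,t)^{m/p}$ for a constant $C$; $\approx$ means $\approx_{\lfloor p\rfloor+1}$. Shuffles: $\mathrm{Sh}(n_1,\ldots,n_m)$ is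 the set of permutations $\sigma$ of $\{1,\ldots,n_1+\cdots+n_m\}$ increasing on each of the consecutive blocks of sizes $n_1,\ldots,n_m$; $\overline{\mathrm{Sh}}(n_1,\ldots,n_m)$ (for $n_i\ge1$) is the subset of those with also $\sigma(n_1)<\sigma(n_1+n_2)<\cdots<\sigma(n_1+\cdots+n_m)$. For $n=n_1+\cdots+n_m$ define on $V^{\otimes n}$ $$\widetilde\Delta^{n_1,\ldots,n_m}_{\mathrm{osh}}(v_1\otimes\cdots\otimes v_n)=\sum_{\sigma\in\overline{\mathrm{Sh}}(n_1,\ldots,n_m)}(v_{\sigma(1)}\otimes\cdots\otimes v_{\sigma(n_1)})\boxtimes\cdots\boxtimes(v_{\sigma(n-n_m+1)}\otimes\cdots\otimes v_{\sigma(n)}),$$ and $\Delta^{a,b}_{\mathrm{sh}}$ on $V^{\otimes(a+b)}$ by the same formula with $\mathrm{Sh}(a,b)$ ($a,b\ge0$); $\boxtimes$ is the external tensor product. Rough paths: $\mathbf X\in\mathscr C^p_\omega([0,T],V)$ is a continuous map $\mathbf X:\Delta_T\to T^{\lfloor p\rfloor}(V)$ with $\mathbf X^0=1$ and: $|\mathbf X^n_{st}|\le C\omega(s,t)^{n/p}$ for $1\le n\le\lfloor p\rfloor$; $\mathbf X_{st}=\mathbf X_{su}\otimes\mathbf X_{ut}$ truncated at degree $\lfloor p\rfloor$, $s\le u\le t$; $\mathbf X^a_{st}\boxtimes\mathbf X^b_{st}=\Delta^{a,b}_{\mathrm{sh}}\mathbf X^{a+b}_{st}$ for $a+b\le\lfloor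 p\rfloor$. Its trace is the path $X$ with increments $\mathbf X^1$ and a given initial value $X_0$. Controlled paths: $\overline H\in\mathscr D_{\mathbf X}(U)$ is an element of $\mathcal C^p_\omega([0,T],\mathcal L(T^{\lfloor p\rfloor-1}(V),U))$ such that, with $\overline H_n:=\overline H|_{V^{\otimes n}}$, for $n=0,\ldots,\lfloor p\rfloor-2$ and $a\in V^{\otimes n}$: $\langle\overline H_{n;t},a\rangle\approx_{\lfloor p\rfloor-n}\sum_{k=0}^{\lfloor p\rfloor-1-n}\langle\overline H_{n+k;s},\mathbf X^k_{st}\otimes a\rangle$. Its trace is $H:=\overline H_0$. Lift: for $\overline H\in\mathscr D_{\mathbf X}(U)$, $\uparrow_{\mathbf X}\overline H$ is the unique element of $\mathscr C^p_\omega([0,T],U)$ (it exists), with trace $H$, such that $(\uparrow_{\mathbf X}\overline H)^m_{st}\approx\sum_{n_1,\ldots,n_m\ge1,\ n_1+\cdots+n_m\le\lfloor p\rfloor}\langle\overline H_{n_1;s}\boxtimes\cdots\boxtimes\overline H_{n_m;s},\widetilde\Delta^{n_1,\ldots,n_m}_{\mathrm{osh}}\mathbf X^{n_1+\cdots+n_m}_{st}\rangle$ for $2\le m\le\lfloor p\rfloor$. Smooth functions: for $F\in C^\infty(V,U)$, $\overline F(X):=(F(X),DF(X),\ldots,D^{\lfloor p\rfloor-1}F(X))\in\mathscr D_{\mathbf X}(U)$, and $F_*\mathbf X:=\uparrow_{\mathbf X}\overline F(X)$. Rough integral: for $\overline H\in\mathscr D_{\mathbf X}(\mathcal L(V,W))$,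 identify $\mathcal L(V^{\otimes(n-1)},\mathcal L(V,W))=\mathcal L(V^{\otimes n},W)$ (the last tensor slot is the argument in $V$). Then $I=\int_0^\cdot\overline H\,\mathrm d\mathbf X$ is the unique path in $\mathcal C^p_\omega([0,T],W)$ with $I_0=0$ and $I_{st}\approx\sum_{n=1}^{\lfloor p\rfloor}\langle\overline H_{n-1;s},\mathbf X^n_{st}\rangle$. The controlled integral $\overline{\int}\overline H\,\mathrm d\mathbf X\in\mathscr D_{\mathbf X}(W)$ has trace $I$ and $n$-th level $\overline H_{n-1}$ for $1\le n\le\lfloor p\rfloor-1$. The rough-path integral is $\boldsymbol{\int}\overline H\,\mathrm d\mathbf X:=\uparrow_{\mathbf X}\overline{\int}\overline H\,\mathrm d\mathbf X$. Change of controlling path: for $\overline H\in\mathscr D_{\mathbf X}(U)$, $\mathbf H=\uparrow_{\mathbf X}\overline H$, $\overline K\in\mathscr D_{\mathbf H}(S)$, the controlled path $\overline K*\overline H\in\mathscr D_{\mathbf X}(S)$ is given by $(\overline K*\overline H)_0=K$ and, for $1\le n\le\lfloor p\rfloor-1$, $(\overline K*\overline H)_n=\sum_{m=1}^n\sum_{n_1,\ldots,n_m\ge1,\ n_1+\cdots+n_m=n}\overline K_m\circ(\overline H_{n_1}\boxtimes\cdots\boxtimes\overline H_{n_m})\circ\widetilde\Delta^{n_1,\ldots,n_m}_{\mathrm{osh}}$. Leibniz product: for $\overline H\in\mathscr D_{\mathbf X}(\mathcal L(U_1,U_2))$, $\overline K\in\mathscr D_{\mathbf X}(\mathcal L(U_2,U_3))$,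 $\overline K\cdot\overline H\in\mathscr D_{\mathbf X}(\mathcal L(U_1,U_3))$ is given by $(\overline K\cdot\overline H)_n=\sum_{a+b=n,\ a,b\ge0}\times\circ(\overline K_a\boxtimes\overline H_b)\circ\Delta^{a,b}_{\mathrm{sh}}$, with $\times(k\boxtimes h)=k\circ h$. Pullback: for $F\in C^\infty(V,W)$, $\overline H\in\mathscr D_{F_*\mathbf X}(\mathcal L(W,U))$, $F^*\overline H:=(\overline H*\overline F(X))\cdot\overline{DF}(X)\in\mathscr D_{\mathbf X}(\mathcal L(V,U))$, where $DF\in C^\infty(V,\mathcal L(V,W))$. *)

theory Defs
  imports "HOL-Analysis.Analysis"
begin

text \<open>
  A finite-dimensional real vector space \<open>V\<close> is a type of class \<open>euclidean_space\<close>, with its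
  distinguished basis \<open>Basis\<close>.  The basis of \<open>V\<^sup>\<otimes>\<^sup>n\<close> consists of the words of length \<open>n\<close> over
  \<open>Basis\<close>, and

  \<^item> a tensor is the family \<open>a :: 'v list \<Rightarrow> real\<close> of its coordinates, where \<open>a w\<close> for
    \<open>w \<in> words n\<close> are the coordinates of the component of \<open>a\<close> in \<open>V\<^sup>\<otimes>\<^sup>n\<close>;
  \<^item> a linear map from (a truncation of) the tensor algebra to \<open>U\<close> is the family
    \<open>h :: 'v list \<Rightarrow> 'u\<close> of its values on basis words;
  \<^item> an element of \<open>V\<^sup>\<otimes>\<^sup>n\<^sup>1 \<boxtimes> \<dots> \<boxtimes> V\<^sup>\<otimes>\<^sup>n\<^sup>m\<close> is the family \<open>c :: 'v list list \<Rightarrow> real\<close> of its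
    coordinates with respect to lists of words of lengths \<open>n\<^sub>1, \<dots>, n\<^sub>m\<close>.

  As all norms on a finite-dimensional space are equivalent, estimates up to a constant
  and continuity are stated coordinatewise.  The space of linear maps from \<open>V\<close> to \<open>W\<close> is
  the type of bounded linear maps.
\<close>

subsection \<open>Tensors\<close>

definition words :: "nat \<Rightarrow> 'v::euclidean_space list set" where
  "words n = {w. length w = n \<and> set w \<subseteq> Basis}"

definition words_upto :: "nat \<Rightarrow> 'v::euclidean_space list set" where
  "words_upto N = {w. length w \<le> N \<and> set w \<subseteq> Basis}"

definition tensors_upto :: "nat \<Rightarrow> ('v::euclidean_space list \<Rightarrow> real) set" where
  "tensors_upto N = {a. \<forall>w. w \<notin> words_upto N \<longrightarrow> a w = 0}"

definition homogeneous :: "nat \<Rightarrow> ('v::euclidean_space list \<Rightarrow> real) set" where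
  "homogeneous n = {a. \<forall>w. w \<notin> words n \<longrightarrow> a w = 0}"

definition component :: "nat \<Rightarrow> ('v::euclidean_space list \<Rightarrow> real) \<Rightarrow> 'v list \<Rightarrow> real" where
  "component n a = (\<lambda>w. if w \<in> words n then a w else 0)"

definition pure_tensor :: "'v::euclidean_space list \<Rightarrow> 'v list \<Rightarrow> real" where
  "pure_tensor vs w =
     (if w \<in> words (length vs) then \<Prod>i<length vs. (vs ! i) \<bullet> (w ! i) else 0)"

definition tensor_mult ::
    "('v list \<Rightarrow> real) \<Rightarrow> ('v list \<Rightarrow> real) \<Rightarrow> 'v list \<Rightarrow> real" where
  "tensor_mult a b w = (\<Sum>k\<le>length w. a (take k w) * b (drop k w))"

text \<open>\<open>pair n h a\<close> is the pairing of the degree \<open>n\<close> parts of \<open>h\<close> and \<open>a\<close>.\<close>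

definition pair ::
    "nat \<Rightarrow> ('v::euclidean_space list \<Rightarrow> 'u::real_normed_vector) \<Rightarrow> ('v list \<Rightarrow> real) \<Rightarrow> 'u" where
  "pair n h a = (\<Sum>w\<in>words n. a w *\<^sub>R h w)"

subsection \<open>Shuffles and coproducts\<close>

text \<open>Positions are counted from \<open>0\<close>.\<close>

definition block :: "nat list \<Rightarrow> nat \<Rightarrow> nat set" where
  "block ns j = {sum_list (take j ns) ..< sum_list (take (Suc j) ns)}"

definition block_last :: "nat list \<Rightarrow> nat \<Rightarrow> nat" where
  "block_last ns j = sum_list (take (Suc j) ns) - 1"

definition shuffles_of :: "nat list \<Rightarrow> (nat \<Rightarrow> nat) set" where
  "shuffles_of ns =
     {\<sigma>. \<sigma> permutes {..<sum_list ns} \<and> (\<forall>j<length ns. strict_mono_on (block ns j) \<sigma>)}"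

definition ordered_shuffles_of :: "nat list \<Rightarrow> (nat \<Rightarrow> nat) set" where
  "ordered_shuffles_of ns =
     {\<sigma> \<in> shuffles_of ns. \<forall>j. Suc j < length ns \<longrightarrow> \<sigma> (block_last ns j) < \<sigma> (block_last ns (Suc j))}"

fun chop :: "nat list \<Rightarrow> 'v list \<Rightarrow> 'v list list" where
  "chop [] xs = []"
| "chop (n # ns) xs = take n xs # chop ns (drop n xs)"

definition permute_word :: "(nat \<Rightarrow> nat) \<Rightarrow> 'v list \<Rightarrow> 'v list" where
  "permute_word \<sigma> w = map (\<lambda>i. w ! \<sigma> i) [0..<length w]"

text \<open>
  The linear map on the component of degree \<open>sum_list ns\<close> which sends the basis tensor of a
  word \<open>w\<close> to the sum over \<open>\<sigma> \<in> P\<close> of the external products given by \<open>chop ns (permute_word \<sigma> w)\<close>.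
\<close>

definition coproduct ::
    "(nat \<Rightarrow> nat) set \<Rightarrow> nat list \<Rightarrow> ('v::euclidean_space list \<Rightarrow> real) \<Rightarrow> 'v list list \<Rightarrow> real" where
  "coproduct P ns a ws =
     (\<Sum>w\<in>words (sum_list ns). \<Sum>\<sigma>\<in>P. if chop ns (permute_word \<sigma> w) = ws then a w else 0)"

definition coproduct_sh ::
    "nat \<Rightarrow> nat \<Rightarrow> ('v::euclidean_space list \<Rightarrow> real) \<Rightarrow> 'v list list \<Rightarrow> real" where
  "coproduct_sh a b = coproduct (shuffles_of [a, b]) [a, b]"

definition coproduct_osh ::
    "nat list \<Rightarrow> ('v::euclidean_space list \<Rightarrow> real) \<Rightarrow> 'v list list \<Rightarrow> real" where
  "coproduct_osh ns = coproduct (ordered_shuffles_of ns) ns"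

text \<open>
  \<open>box_apply h [n\<^sub>1, \<dots>, n\<^sub>m] c\<close> is the value in \<open>U\<^sup>\<otimes>\<^sup>m\<close> of \<open>h\<^sub>n\<^sub>1 \<boxtimes> \<dots> \<boxtimes> h\<^sub>n\<^sub>m\<close> at
  \<open>c \<in> V\<^sup>\<otimes>\<^sup>n\<^sup>1 \<boxtimes> \<dots> \<boxtimes> V\<^sup>\<otimes>\<^sup>n\<^sup>m\<close>.
\<close>

definition box_apply ::
    "('v::euclidean_space list \<Rightarrow> 'u::euclidean_space) \<Rightarrow> nat list \<Rightarrow> ('v list list \<Rightarrow> real)
       \<Rightarrow> 'u list \<Rightarrow> real" where
  "box_apply h ns c u = (\<Sum>ws\<in>listset (map words ns). c ws * pure_tensor (map h ws) u)"

definition positive_lists :: "nat \<Rightarrow> nat list set" where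
  "positive_lists m = {ns. length ns = m \<and> (\<forall>n\<in>set ns. 1 \<le> n)}"

subsection \<open>Controls and rough paths\<close>

definition Simplex :: "real \<Rightarrow> (real \<times> real) set" where
  "Simplex T = {(s, t). 0 \<le> s \<and> s \<le> t \<and> t \<le> T}"

definition is_control :: "real \<Rightarrow> (real \<Rightarrow> real \<Rightarrow> real) \<Rightarrow> bool" where
  "is_control T \<omega> \<longleftrightarrow>
     continuous_on (Simplex T) (\<lambda>(s, t). \<omega> s t) \<and>
     (\<forall>(s, t)\<in>Simplex T. 0 \<le> \<omega> s t) \<and>
     (\<forall>t\<in>{0..T}. \<omega> t t = 0) \<and>
     (\<forall>s u t. 0 \<le> s \<and> s \<le> u \<and> u \<le> t \<and> t \<le> T \<longrightarrow> \<omega> s u + \<omega> u t \<le> \<omega> s t)"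

definition approx ::
    "real \<Rightarrow> real \<Rightarrow> (real \<Rightarrow> real \<Rightarrow> real) \<Rightarrow> nat
       \<Rightarrow> (real \<Rightarrow> real \<Rightarrow> 'e::real_normed_vector) \<Rightarrow> (real \<Rightarrow> real \<Rightarrow> 'e) \<Rightarrow> bool" where
  "approx p T \<omega> m a b \<longleftrightarrow>
     (\<exists>C. \<forall>(s, t)\<in>Simplex T. norm (a s t - b s t) \<le> C * \<omega> s t powr (real m / p))"

definition lev :: "real \<Rightarrow> nat" where
  "lev p = nat \<lfloor>p\<rfloor>"

definition Cp_paths ::
    "real \<Rightarrow> real \<Rightarrow> (real \<Rightarrow> real \<Rightarrow> real) \<Rightarrow> (real \<Rightarrow> 'e::real_normed_vector) set" where
  "Cp_paths p T \<omega> =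
     {Y. continuous_on {0..T} Y \<and>
         (\<exists>C. \<forall>(s, t)\<in>Simplex T. norm (Y t - Y s) \<le> C * \<omega> s t powr (1 / p))}"

definition rough_paths ::
    "real \<Rightarrow> real \<Rightarrow> (real \<Rightarrow> real \<Rightarrow> real)
       \<Rightarrow> (real \<Rightarrow> real \<Rightarrow> 'v::euclidean_space list \<Rightarrow> real) set" where
  "rough_paths p T \<omega> =
     {X. (\<forall>(s, t)\<in>Simplex T. X s t \<in> tensors_upto (lev p)) \<and>
         (\<forall>w\<in>words_upto (lev p). continuous_on (Simplex T) (\<lambda>(s, t). X s t w)) \<and>
         (\<forall>(s, t)\<in>Simplex T. X s t [] = 1) \<and>
         (\<forall>n\<in>{1..lev p}. \<forall>w\<in>words n.
            \<exists>C. \<forall>(s, t)\<in>Simplex T. \<bar>X s t w\<bar> \<le> C * \<omega> s t powr (real n / p)) \<and>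
         (\<forall>s u t. 0 \<le> s \<and> s \<le> u \<and> u \<le> t \<and> t \<le> T \<longrightarrow>
            (\<forall>w\<in>words_upto (lev p). X s t w = tensor_mult (X s u) (X u t) w)) \<and>
         (\<forall>a b. a + b \<le> lev p \<longrightarrow>
            (\<forall>(s, t)\<in>Simplex T. \<forall>v\<in>words a. \<forall>w\<in>words b.
               X s t v * X s t w = coproduct_sh a b (component (a + b) (X s t)) [v, w]))}"

definition is_trace ::
    "real \<Rightarrow> (real \<Rightarrow> real \<Rightarrow> 'v::euclidean_space list \<Rightarrow> real) \<Rightarrow> (real \<Rightarrow> 'v) \<Rightarrow> bool" where
  "is_trace T X x \<longleftrightarrow> (\<forall>(s, t)\<in>Simplex T. \<forall>b\<in>Basis. X s t [b] = (x t - x s) \<bullet> b)"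

subsection \<open>Controlled paths and their lifts\<close>

text \<open>
  Only the values \<open>H t w\<close> with \<open>t \<in> {0..T}\<close> and \<open>w \<in> words_upto (lev p - 1)\<close> are meaningful; two
  functions which agree there represent the same controlled path.
\<close>

definition controlled_paths ::
    "real \<Rightarrow> real \<Rightarrow> (real \<Rightarrow> real \<Rightarrow> real)
       \<Rightarrow> (real \<Rightarrow> real \<Rightarrow> 'v::euclidean_space list \<Rightarrow> real)
       \<Rightarrow> (real \<Rightarrow> 'v list \<Rightarrow> 'u::real_normed_vector) set" where
  "controlled_paths p T \<omega> X =
     {H. (\<forall>w\<in>words_upto (lev p - 1). (\<lambda>t. H t w) \<in> Cp_paths p T \<omega>) \<and>
         (\<forall>n. n + 2 \<le> lev p \<longrightarrow> (\<forall>a\<in>homogeneous n.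
            approx p T \<omega> (lev p - n)
              (\<lambda>s t. pair n (H t) a)
              (\<lambda>s t. \<Sum>k\<le>lev p - 1 - n.
                 pair (n + k) (H s) (tensor_mult (component k (X s t)) a))))}"

definition controlled_eq ::
    "real \<Rightarrow> real \<Rightarrow> (real \<Rightarrow> 'v::euclidean_space list \<Rightarrow> 'u) \<Rightarrow> (real \<Rightarrow> 'v list \<Rightarrow> 'u) \<Rightarrow> bool" where
  "controlled_eq p T H K \<longleftrightarrow> (\<forall>t\<in>{0..T}. \<forall>w\<in>words_upto (lev p - 1). H t w = K t w)"

definition is_rough_lift ::
    "real \<Rightarrow> real \<Rightarrow> (real \<Rightarrow> real \<Rightarrow> real)
       \<Rightarrow> (real \<Rightarrow> real \<Rightarrow> 'v::euclidean_space list \<Rightarrow> real)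
       \<Rightarrow> (real \<Rightarrow> 'v list \<Rightarrow> 'u::euclidean_space)
       \<Rightarrow> (real \<Rightarrow> real \<Rightarrow> 'u list \<Rightarrow> real) \<Rightarrow> bool" where
  "is_rough_lift p T \<omega> X H Y \<longleftrightarrow>
     Y \<in> rough_paths p T \<omega> \<and>
     is_trace T Y (\<lambda>t. H t []) \<and>
     (\<forall>m\<in>{2..lev p}. \<forall>u\<in>words m.
        approx p T \<omega> (lev p + 1)
          (\<lambda>s t. Y s t u)
          (\<lambda>s t. \<Sum>ns\<in>{ns \<in> positive_lists m. sum_list ns \<le> lev p}.
             box_apply (H s) ns (coproduct_osh ns (component (sum_list ns) (X s t))) u))"

text \<open>
  A rough path is determined on \<open>Simplex T\<close> only; it is set to \<open>0\<close> off \<open>Simplex T\<close> to make the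
  definite description meaningful.  The same convention is used for \<open>rough_integral\<close> below.
\<close>

definition rough_lift ::
    "real \<Rightarrow> real \<Rightarrow> (real \<Rightarrow> real \<Rightarrow> real)
       \<Rightarrow> (real \<Rightarrow> real \<Rightarrow> 'v::euclidean_space list \<Rightarrow> real)
       \<Rightarrow> (real \<Rightarrow> 'v list \<Rightarrow> 'u::euclidean_space)
       \<Rightarrow> real \<Rightarrow> real \<Rightarrow> 'u list \<Rightarrow> real" where
  "rough_lift p T \<omega> X H =
     (THE Y. is_rough_lift p T \<omega> X H Y \<and> (\<forall>s t. (s, t) \<notin> Simplex T \<longrightarrow> Y s t = (\<lambda>_. 0)))"

subsection \<open>Smooth functions\<close>

text \<open>\<open>iter_deriv F [v\<^sub>1, \<dots>, v\<^sub>n] x\<close> is the value of the \<open>n\<close>-th derivative of \<open>F\<close> at \<open>x\<close> on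
  \<open>v\<^sub>1 \<otimes> \<dots> \<otimes> v\<^sub>n\<close>.\<close>

primrec iter_deriv ::
    "('v::real_normed_vector \<Rightarrow> 'u::real_normed_vector) \<Rightarrow> 'v list \<Rightarrow> 'v \<Rightarrow> 'u" where
  "iter_deriv F [] = F"
| "iter_deriv F (v # vs) = (\<lambda>x. frechet_derivative (iter_deriv F vs) (at x) v)"

definition smooth :: "('v::real_normed_vector \<Rightarrow> 'u::real_normed_vector) \<Rightarrow> bool" where
  "smooth F \<longleftrightarrow> (\<forall>vs x. iter_deriv F vs differentiable (at x))"

definition smooth_controlled ::
    "('v::euclidean_space \<Rightarrow> 'u::real_normed_vector) \<Rightarrow> (real \<Rightarrow> 'v) \<Rightarrow> real \<Rightarrow> 'v list \<Rightarrow> 'u" where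
  "smooth_controlled F x t w = iter_deriv F w (x t)"

definition Dfun ::
    "('v::real_normed_vector \<Rightarrow> 'u::real_normed_vector) \<Rightarrow> 'v \<Rightarrow> 'v \<Rightarrow>\<^sub>L 'u" where
  "Dfun F x = Blinfun (frechet_derivative F (at x))"

definition pushforward ::
    "real \<Rightarrow> real \<Rightarrow> (real \<Rightarrow> real \<Rightarrow> real) \<Rightarrow> ('v::euclidean_space \<Rightarrow> 'w::euclidean_space)
       \<Rightarrow> (real \<Rightarrow> real \<Rightarrow> 'v list \<Rightarrow> real) \<Rightarrow> (real \<Rightarrow> 'v) \<Rightarrow> real \<Rightarrow> real \<Rightarrow> 'w list \<Rightarrow> real" where
  "pushforward p T \<omega> F X x = rough_lift p T \<omega> X (smooth_controlled F x)"

subsection \<open>Rough integrals\<close>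

text \<open>The identification of linear maps \<open>V\<^sup>\<otimes>\<^sup>(\<^sup>n\<^sup>-\<^sup>1\<^sup>) \<rightarrow> \<L>(V, W)\<close> with linear maps \<open>V\<^sup>\<otimes>\<^sup>n \<rightarrow> W\<close>.\<close>

definition uncurry_last ::
    "('v::real_normed_vector list \<Rightarrow> 'v \<Rightarrow>\<^sub>L 'w::real_normed_vector) \<Rightarrow> 'v list \<Rightarrow> 'w" where
  "uncurry_last h w = blinfun_apply (h (butlast w)) (last w)"

definition is_rough_integral ::
    "real \<Rightarrow> real \<Rightarrow> (real \<Rightarrow> real \<Rightarrow> real)
       \<Rightarrow> (real \<Rightarrow> real \<Rightarrow> 'v::euclidean_space list \<Rightarrow> real)
       \<Rightarrow> (real \<Rightarrow> 'v list \<Rightarrow> 'v \<Rightarrow>\<^sub>L 'w::real_normed_vector) \<Rightarrow> (real \<Rightarrow> 'w) \<Rightarrow> bool" where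
  "is_rough_integral p T \<omega> X H I \<longleftrightarrow>
     I \<in> Cp_paths p T \<omega> \<and> I 0 = 0 \<and>
     approx p T \<omega> (lev p + 1)
       (\<lambda>s t. I t - I s)
       (\<lambda>s t. \<Sum>n\<in>{1..lev p}. pair n (uncurry_last (H s)) (component n (X s t)))"

definition rough_integral ::
    "real \<Rightarrow> real \<Rightarrow> (real \<Rightarrow> real \<Rightarrow> real)
       \<Rightarrow> (real \<Rightarrow> real \<Rightarrow> 'v::euclidean_space list \<Rightarrow> real)
       \<Rightarrow> (real \<Rightarrow> 'v list \<Rightarrow> 'v \<Rightarrow>\<^sub>L 'w::real_normed_vector) \<Rightarrow> real \<Rightarrow> 'w" where
  "rough_integral p T \<omega> X H =
     (THE I. is_rough_integral p T \<omega> X H I \<and> (\<forall>t. t \<notin> {0..T} \<longrightarrow> I t = 0))"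

definition controlled_integral ::
    "real \<Rightarrow> real \<Rightarrow> (real \<Rightarrow> real \<Rightarrow> real)
       \<Rightarrow> (real \<Rightarrow> real \<Rightarrow> 'v::euclidean_space list \<Rightarrow> real)
       \<Rightarrow> (real \<Rightarrow> 'v list \<Rightarrow> 'v \<Rightarrow>\<^sub>L 'w::real_normed_vector) \<Rightarrow> real \<Rightarrow> 'v list \<Rightarrow> 'w" where
  "controlled_integral p T \<omega> X H t w =
     (if w = [] then rough_integral p T \<omega> X H t else uncurry_last (H t) w)"

definition rough_path_integral ::
    "real \<Rightarrow> real \<Rightarrow> (real \<Rightarrow> real \<Rightarrow> real)
       \<Rightarrow> (real \<Rightarrow> real \<Rightarrow> 'v::euclidean_space list \<Rightarrow> real)
       \<Rightarrow> (real \<Rightarrow> 'v list \<Rightarrow> 'v \<Rightarrow>\<^sub>L 'w::euclidean_space) \<Rightarrow> real \<Rightarrow> real \<Rightarrow> 'w list \<Rightarrow> real" where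
  "rough_path_integral p T \<omega> X H = rough_lift p T \<omega> X (controlled_integral p T \<omega> X H)"

subsection \<open>Operations on controlled paths\<close>

text \<open>The values on a basis word \<open>w\<close> of length \<open>n\<close> are those on the tensor \<open>pure_tensor w\<close>.\<close>

definition change_path ::
    "(real \<Rightarrow> 'u::euclidean_space list \<Rightarrow> 's::real_normed_vector)
       \<Rightarrow> (real \<Rightarrow> 'v::euclidean_space list \<Rightarrow> 'u) \<Rightarrow> real \<Rightarrow> 'v list \<Rightarrow> 's" where
  "change_path K H t w =
     (if w = [] then K t []
      else \<Sum>m\<in>{1..length w}. \<Sum>ns\<in>{ns \<in> positive_lists m. sum_list ns = length w}.
             pair m (K t) (box_apply (H t) ns (coproduct_osh ns (pure_tensor w))))"

definition leibniz_product ::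
    "(real \<Rightarrow> 'v::euclidean_space list \<Rightarrow> 'b::real_normed_vector \<Rightarrow>\<^sub>L 'c::real_normed_vector)
       \<Rightarrow> (real \<Rightarrow> 'v list \<Rightarrow> 'a::real_normed_vector \<Rightarrow>\<^sub>L 'b) \<Rightarrow> real \<Rightarrow> 'v list \<Rightarrow> 'a \<Rightarrow>\<^sub>L 'c" where
  "leibniz_product K H t w =
     (\<Sum>a\<le>length w. \<Sum>v1\<in>words a. \<Sum>v2\<in>words (length w - a).
        coproduct_sh a (length w - a) (pure_tensor w) [v1, v2] *\<^sub>R (K t v1 o\<^sub>L H t v2))"

definition pullback ::
    "('v::euclidean_space \<Rightarrow> 'w::euclidean_space) \<Rightarrow> (real \<Rightarrow> 'v)
       \<Rightarrow> (real \<Rightarrow> 'w list \<Rightarrow> 'w \<Rightarrow>\<^sub>L 'u::real_normed_vector) \<Rightarrow> real \<Rightarrow> 'v list \<Rightarrow> 'v \<Rightarrow>\<^sub>L 'u" where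
  "pullback F x H =
     leibniz_product (change_path H (smooth_controlled F x)) (smooth_controlled (Dfun F) x)"

end

theory Submission
  imports Defs "HOL-Library.Landau_Symbols"
begin

text \<open>
  A controlled path is handled through its scalar components \<open>h u = \<langle>H, u\<rangle>\<close>, which are functionals on
  words.  The ordered coproduct turns into an iterated half-shuffle product of such functionals, so
  that the germ of the lift is multiplicative for the shuffle product and, up to the order
  \<open>\<omega>\<^sup>(\<^sup>N\<^sup>+\<^sup>1\<^sup>)\<^sup>/\<^sup>p\<close> with \<open>N = \<lfloor>p\<rfloor>\<close>, satisfies Chen's identity.  Sewing corrects the germs of lifts and of
  rough integrals to the objects themselves, and a germ determines its object because an additive
  function of the interval of order \<open>\<omega>\<^sup>(\<^sup>N\<^sup>+\<^sup>1\<^sup>)\<^sup>/\<^sup>p\<close> vanishes.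

  Change of controlling path is composition of functionals, \<open>\<langle>K * H, w\<rangle> = \<Sum>\<^sub>u \<langle>K, u\<rangle> (h u\<^sub>1 \<prec> \<dots> \<prec> h u\<^sub>m)(w)\<close>
  with \<open>\<prec>\<close> the half-shuffle product bracketed to the left.  Splitting the last factor off shows that
  in positive degree \<open>\<integral>H d(F\<^sub>*X) * F(X)\<close> coincides with \<open>\<integral>F\<^sup>*H dX\<close> word by word; hence the two integrals
  have the same germ, and are equal.  The lift of \<open>K * H\<close> along \<open>X\<close> has the same germ as the lift of
  \<open>K\<close> along the lift of \<open>H\<close>, by associativity of the composition, which gives the equality of rough
  paths.
\<close>

section \<open>Shuffle products of functionals on words\<close>

text \<open>A controlled path stops at degree \<open>N - 1\<close>, whereas germs are needed up to
  an error of order \<open>N + 1\<close>. Two or more nonempty blocks that fill a word of length at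
  most \<open>N\<close> have at most \<open>N - 1\<close> letters each, so nothing is missing for
  the higher levels of a lift; a single block may call for the absent degree \<open>N\<close>. Hence
  the first level is exceptional throughout. Its germ is correct to order \<open>N\<close> only, the
  lift takes the exact increments of the trace there, and in the Chen and shuffle relations such an
  error is always multiplied by a factor of order at least one. In the germ of the integral along
  the push-forward the coefficients are merely bounded and this gain is lost; there the first level
  is expanded with the derivative of order \<open>N\<close> of \<open>F\<close>, which is no part of
  the controlled path of \<open>F\<close>.

  Lifts and integrals are definite descriptions, so existence is needed besides uniqueness; both
  rest on \<open>\<theta> > 1\<close>. Estimates are uniform over intervals or triples of points and
  are kept as Landau bounds for a principal filter: orders add under products and constants stay
  implicit.\<close>

primrec splits_rev :: "'a list \<Rightarrow> ('a list \<times> 'a list) list" where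
  "splits_rev [] = [([], [])]"
| "splits_rev (b # w) =
     map (\<lambda>(l, r). (l @ [b], r)) (splits_rev w) @ map (\<lambda>(l, r). (l, r @ [b])) (splits_rev w)"

text \<open>The unshuffle coproduct of a word. It is a list rather than a set because repeated
  letters produce equal pairs that count separately. The recursion runs over the reversed word so
  that it strips the last letter, the one that singles out a factor in the half-shuffle
  product.\<close>

definition splits :: "'a list \<Rightarrow> ('a list \<times> 'a list) list" where
  "splits w = splits_rev (rev w)"

lemma splits_Nil [simp]: "splits [] = [([], [])]"
  by (simp add: splits_def)

lemma splits_snoc [simp]:
  "splits (w @ [b]) =
     map (\<lambda>(l, r). (l @ [b], r)) (splits w) @ map (\<lambda>(l, r). (l, r @ [b])) (splits w)"
  by (simp add: splits_def)

lemma in_splitsD: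
  assumes "(l, r) \<in> set (splits w)"
  shows "length l + length r = length w" "set l \<union> set r = set w"
proof -
  have "length l + length r = length w \<and> set l \<union> set r = set w"
    using assms by (induction w arbitrary: l r rule: rev_induct) (fastforce+)
  then show "length l + length r = length w" "set l \<union> set r = set w" by auto
qed

lemma splits_map: "splits (map f w) = map (map_prod (map f) (map f)) (splits w)"
  by (induction w rule: rev_induct) (auto simp: comp_def case_prod_beta)

text \<open>Values lie in any commutative monoid, so that the same rules serve real functionals and
  the operator-valued terms of the Leibniz product.\<close>

definition split_sum :: "('a list \<Rightarrow> 'a list \<Rightarrow> 'b::comm_monoid_add) \<Rightarrow> 'a list \<Rightarrow> 'b" where
  "split_sum \<phi> w = (\<Sum>(l, r)\<leftarrow>splits w. \<phi> l r)"

lemma split_sum_Nil [simp]: "split_sum \<phi> [] = \<phi> [] []"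
  by (simp add: split_sum_def)

lemma split_sum_snoc [simp]:
  "split_sum \<phi> (w @ [b]) = split_sum (\<lambda>l r. \<phi> (l @ [b]) r) w + split_sum (\<lambda>l r. \<phi> l (r @ [b])) w"
  by (simp add: split_sum_def comp_def case_prod_unfold)

lemma split_sum_cong:
  assumes "\<And>l r. (l, r) \<in> set (splits w) \<Longrightarrow> \<phi> l r = \<psi> l r"
  shows "split_sum \<phi> w = split_sum \<psi> w"
  unfolding split_sum_def by (rule arg_cong[of _ _ sum_list], rule map_cong) (auto simp: assms)

lemma split_sum_add: "split_sum (\<lambda>l r. \<phi> l r + \<psi> l r) w = split_sum \<phi> w + split_sum \<psi> w"
  unfolding split_sum_def by (simp add: case_prod_unfold sum_list_addf)

lemma split_sum_zero [simp]: "split_sum (\<lambda>_ _. 0) w = 0"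
  unfolding split_sum_def by (simp add: case_prod_unfold)

lemma split_sum_sum:
  "split_sum (\<lambda>l r. \<Sum>i\<in>I. \<phi> i l r) w = (\<Sum>i\<in>I. split_sum (\<phi> i) w)"
  by (induction I rule: infinite_finite_induct) (simp_all add: split_sum_add)

lemma split_sum_hom:
  assumes "\<And>a b. h (a + b) = h a + h b"
  shows "h (split_sum \<phi> w) = split_sum (\<lambda>l r. h (\<phi> l r)) w"
  by (induction w arbitrary: \<phi> rule: rev_induct) (simp_all add: assms)

lemma split_sum_mult_left:
  fixes \<phi> :: "'a list \<Rightarrow> 'a list \<Rightarrow> 'b::semiring_0"
  shows "split_sum (\<lambda>l r. c * \<phi> l r) w = c * split_sum \<phi> w"
  by (rule split_sum_hom[symmetric]) (rule distrib_left)

text \<open>Unshuffling is multiplicative for concatenation, the bialgebra property: the letters of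
  \<open>w\<close> and those of \<open>y\<close> are distributed independently.\<close>

lemma split_sum_append:
  "split_sum \<phi> (w @ y) = split_sum (\<lambda>l r. split_sum (\<lambda>a b. \<phi> (a @ l) (b @ r)) w) y"
proof (induction y arbitrary: \<phi> rule: rev_induct)
  case Nil
  then show ?case by simp
next
  case (snoc b y)
  have "split_sum \<phi> (w @ y @ [b]) = split_sum \<phi> ((w @ y) @ [b])" by simp
  also have "\<dots> = split_sum (\<lambda>l r. \<phi> (l @ [b]) r) (w @ y) + split_sum (\<lambda>l r. \<phi> l (r @ [b])) (w @ y)"
    by (rule split_sum_snoc)
  finally show ?case by (simp add: snoc.IH)
qed

lemma split_sum_swap: "split_sum (\<lambda>l r. \<phi> r l) w = split_sum \<phi> w"
proof (induction w arbitrary: \<phi> rule: rev_induct)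
  case (snoc b w)
  show ?case
    using snoc[of "\<lambda>l r. \<phi> (l @ [b]) r"] snoc[of "\<lambda>l r. \<phi> l (r @ [b])"]
    by (simp add: add.commute)
qed simp

definition shuffle_prod ::
    "('a list \<Rightarrow> 'b) \<Rightarrow> ('a list \<Rightarrow> 'b) \<Rightarrow> 'a list \<Rightarrow> 'b::comm_semiring_1" where
  "shuffle_prod f g w = split_sum (\<lambda>l r. f l * g r) w"

abbreviation (input) deriv_word :: "'a \<Rightarrow> ('a list \<Rightarrow> 'b) \<Rightarrow> 'a list \<Rightarrow> 'b" where
  "deriv_word b f \<equiv> (\<lambda>w. f (w @ [b]))"

lemma shuffle_prod_Nil [simp]: "shuffle_prod f g [] = f [] * g []"
  by (simp add: shuffle_prod_def)

text \<open>Removing the last letter is a derivation of the shuffle product, since that letter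
  belongs to exactly one factor. Together with the value at the empty word this determines the
  product, which is what inductions over words exploit.\<close>

lemma shuffle_prod_snoc:
  "shuffle_prod f g (w @ [b]) =
     shuffle_prod (deriv_word b f) g w + shuffle_prod f (deriv_word b g) w"
  by (simp add: shuffle_prod_def)

lemma shuffle_prod_cong:
  assumes "\<And>l. length l \<le> length w \<Longrightarrow> set l \<subseteq> set w \<Longrightarrow> f l = f' l"
    and "\<And>l. length l \<le> length w \<Longrightarrow> set l \<subseteq> set w \<Longrightarrow> g l = g' l"
  shows "shuffle_prod f g w = shuffle_prod f' g' w"
  unfolding shuffle_prod_def
proof (rule split_sum_cong)
  fix l r assume "(l, r) \<in> set (splits w)"
  from in_splitsD[OF this] have "length l \<le> length w" "set l \<subseteq> set w" "length r \<le> length w" "set r \<subseteq> set w"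
    by auto
  with assms show "f l * g r = f' l * g' r" by simp
qed

lemma shuffle_prod_add_left:
  "shuffle_prod (\<lambda>l. f l + f' l) g w = shuffle_prod f g w + shuffle_prod f' g w"
  by (simp add: shuffle_prod_def distrib_right split_sum_add)

lemma shuffle_prod_commute: "shuffle_prod f g w = shuffle_prod g f w"
  unfolding shuffle_prod_def by (subst split_sum_swap[symmetric]) (simp add: mult.commute)

lemma shuffle_prod_add_right:
  "shuffle_prod f (\<lambda>l. g l + g' l) w = shuffle_prod f g w + shuffle_prod f g' w"
  by (simp add: shuffle_prod_def distrib_left split_sum_add)

lemma shuffle_prod_sum_left:
  "shuffle_prod (\<lambda>l. \<Sum>i\<in>I. f i l) g w = (\<Sum>i\<in>I. shuffle_prod (f i) g w)"
  by (simp add: shuffle_prod_def sum_distrib_right split_sum_sum)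

lemma shuffle_prod_sum_right:
  "shuffle_prod f (\<lambda>l. \<Sum>i\<in>I. g i l) w = (\<Sum>i\<in>I. shuffle_prod f (g i) w)"
  by (simp add: shuffle_prod_def sum_distrib_left split_sum_sum)

lemma shuffle_prod_mult_left: "shuffle_prod (\<lambda>l. c * f l) g w = c * shuffle_prod f g w"
  by (simp add: shuffle_prod_def split_sum_mult_left mult.assoc)

lemma shuffle_prod_mult_right: "shuffle_prod f (\<lambda>l. c * g l) w = c * shuffle_prod f g w"
  by (simp add: shuffle_prod_def split_sum_mult_left mult.left_commute)

text \<open>Both sides obey the Leibniz rule with the same three terms; the induction generalises
  over the functionals because their derivatives appear.\<close>

lemma shuffle_prod_assoc:
  "shuffle_prod (shuffle_prod f g) k w = shuffle_prod f (shuffle_prod g k) w"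
  by (induction w arbitrary: f g k rule: rev_induct)
    (simp_all add: shuffle_prod_snoc shuffle_prod_add_left shuffle_prod_add_right mult.assoc add.assoc)

text \<open>
  The Zinbiel product: the last letter belongs to the right factor.
\<close>

definition half_shuffle ::
    "('a list \<Rightarrow> 'b) \<Rightarrow> ('a list \<Rightarrow> 'b) \<Rightarrow> 'a list \<Rightarrow> 'b::comm_semiring_1" where
  "half_shuffle f g w = (if w = [] then 0 else shuffle_prod f (deriv_word (last w) g) (butlast w))"

lemma half_shuffle_Nil [simp]: "half_shuffle f g [] = 0"
  by (simp add: half_shuffle_def)

lemma half_shuffle_snoc: "half_shuffle f g (w @ [b]) = shuffle_prod f (deriv_word b g) w"
  by (simp add: half_shuffle_def)

definition unit_word :: "'a list \<Rightarrow> 'b::comm_semiring_1" where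
  "unit_word w = (if w = [] then 1 else 0)"

lemma unit_word_simps [simp]: "unit_word [] = 1" "unit_word (w @ [b]) = 0" "w \<noteq> [] \<Longrightarrow> unit_word w = 0"
  by (simp_all add: unit_word_def)

lemma shuffle_prod_zero_left [simp]: "shuffle_prod (\<lambda>_. 0) g w = 0"
  by (simp add: shuffle_prod_def)

lemma shuffle_prod_unit_left [simp]: "shuffle_prod unit_word g w = g w"
  by (induction w arbitrary: g rule: rev_induct) (simp_all add: shuffle_prod_snoc)

lemma half_shuffle_unit_left: "w \<noteq> [] \<Longrightarrow> half_shuffle unit_word g w = g w"
  by (cases w rule: rev_cases) (simp_all add: half_shuffle_snoc)

section \<open>Ordered shuffles\<close>

text \<open>
  \<open>osh h [u\<^sub>1, \<dots>, u\<^sub>m] w\<close> is the pairing of \<open>h u\<^sub>1 \<boxtimes> \<dots> \<boxtimes> h u\<^sub>m\<close> with the sum of the ordered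
  coproducts of the word \<open>w\<close>: ordering the blocks by their last letters amounts to iterating the
  half-shuffle product (\<open>sum_ordered_shuffles_eq_osh\<close>).
\<close>

definition osh :: "('c \<Rightarrow> 'a list \<Rightarrow> 'b) \<Rightarrow> 'c list \<Rightarrow> 'a list \<Rightarrow> 'b::comm_semiring_1" where
  "osh h us = foldl (\<lambda>f u. half_shuffle f (h u)) unit_word us"

lemma osh_Nil [simp]: "osh h [] = unit_word"
  by (simp add: osh_def)

lemma osh_snoc: "osh h (us @ [u]) = half_shuffle (osh h us) (h u)"
  by (simp add: osh_def)

text \<open>Each factor of the iterated half-shuffle product takes at least one letter, namely the
  last letter of its block.\<close>

lemma osh_eq_0: "length w < length us \<Longrightarrow> osh h us w = 0"
proof (induction us arbitrary: w rule: rev_induct)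
  case (snoc u us)
  show ?case
  proof (cases w rule: rev_cases)
    case (snoc v b)
    have "shuffle_prod (osh h us) (deriv_word b (h u)) v = shuffle_prod (\<lambda>_. 0) (deriv_word b (h u)) v"
      by (rule shuffle_prod_cong) (use snoc snoc.prems snoc.IH in auto)
    then show ?thesis by (simp add: snoc osh_snoc half_shuffle_snoc)
  qed (simp add: osh_snoc)
qed auto

lemma osh_at_Nil: "us \<noteq> [] \<Longrightarrow> osh h us [] = 0"
  by (simp add: osh_eq_0)

text \<open>Blocks are nonempty, so one of \<open>length us\<close> blocks of \<open>w\<close> has
  at most \<open>length w + 1 - length us\<close> letters. This count decides up to which degree the
  functionals must be known; it makes truncation at \<open>N - 1\<close> harmless for two or more
  blocks.\<close>

lemma osh_cong:
  assumes "\<And>u v. u \<in> set us \<Longrightarrow> v \<noteq> [] \<Longrightarrow> length v + length us \<le> length w + 1 \<Longrightarrow> set v \<subseteq> set w \<Longrightarrow> h u v = h' u v"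
  shows "osh h us w = osh h' us w"
  using assms
proof (induction us arbitrary: w rule: rev_induct)
  case (snoc u us)
  show ?case
  proof (cases w rule: rev_cases)
    case (snoc v b)
    show ?thesis unfolding snoc osh_snoc half_shuffle_snoc shuffle_prod_def
    proof (rule split_sum_cong)
      fix l r assume lr: "(l, r) \<in> set (splits v)"
      note D = in_splitsD[OF lr]
      show "osh h us l * h u (r @ [b]) = osh h' us l * h' u (r @ [b])"
      proof (cases "length l < length us")
        case True
        then show ?thesis by (simp add: osh_eq_0)
      next
        case False
        have "osh h us l = osh h' us l"
          by (rule snoc.IH, rule snoc.prems) (use D snoc in auto)
        moreover have "h u (r @ [b]) = h' u (r @ [b])"
          by (rule snoc.prems) (use D snoc False in auto)
        ultimately show ?thesis by simp
      qed
    qed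
  qed (simp add: osh_snoc)
qed auto

section \<open>Sums over basis words\<close>

lemma finite_words [simp, intro]: "finite (words n)"
proof (rule finite_subset)
  show "words n \<subseteq> {w. set w \<subseteq> Basis \<and> length w = n}" by (auto simp: words_def)
qed (rule finite_lists_length_eq, simp)

lemma words_upto_eq_UN: "words_upto N = (\<Union>n\<le>N. words n)"
  by (auto simp: words_def words_upto_def)

lemma finite_words_upto [simp, intro]: "finite (words_upto n)"
  unfolding words_upto_eq_UN by (rule finite_UN_I) simp_all

lemma words_0 [simp]: "words 0 = {[]}"
  by (auto simp: words_def)

lemma words_upto_0 [simp]: "words_upto 0 = {[]}"
  by (auto simp: words_upto_def)

lemma sum_words_upto: "(\<Sum>w\<in>words_upto N. \<phi> w) = (\<Sum>n\<le>N. \<Sum>w\<in>words n. \<phi> w)"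
  unfolding words_upto_eq_UN
  by (rule sum.UNION_disjoint) (simp_all, auto simp: words_def)

lemma sum_words_add:
  "(\<Sum>w\<in>words (a + b). \<phi> w) = (\<Sum>v\<in>words a. \<Sum>w\<in>words b. \<phi> (v @ w))"
proof -
  have "(\<Sum>v\<in>words a. \<Sum>w\<in>words b. \<phi> (v @ w)) = (\<Sum>(v, w)\<in>words a \<times> words b. \<phi> (v @ w))"
    by (simp add: sum.cartesian_product)
  also have "\<dots> = (\<Sum>w\<in>words (a + b). \<phi> w)"
    by (rule sum.reindex_bij_witness[where i = "\<lambda>w. (take a w, drop a w)" and j = "\<lambda>(v, w). v @ w"])
      (auto simp: words_def dest: in_set_takeD in_set_dropD)
  finally show ?thesis by simp
qed

lemma sum_words_1: "(\<Sum>w\<in>words (Suc 0). \<phi> w) = (\<Sum>b\<in>Basis. \<phi> [b])"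
  by (rule sum.reindex_bij_witness[where i = "\<lambda>b. [b]" and j = hd])
    (auto simp: words_def length_Suc_conv)

lemma sum_words_Suc:
  "(\<Sum>w\<in>words (Suc n). \<phi> w) = (\<Sum>b\<in>Basis. \<Sum>w\<in>words n. \<phi> (w @ [b]))"
  using sum_words_add[of \<phi> n 1] sum_words_1[of "\<lambda>b. \<Sum>w\<in>words n. \<phi> (w @ b)"]
    sum.swap[of "\<lambda>v w. \<phi> (v @ w)" "words (Suc 0)" "words n"]
  by simp

lemma sum_words_upto_Suc:
  "(\<Sum>w\<in>words_upto (Suc N). \<phi> w) = \<phi> [] + (\<Sum>b\<in>Basis. \<Sum>w\<in>words_upto N. \<phi> (w @ [b]))"
proof -
  have "(\<Sum>w\<in>words_upto (Suc N). \<phi> w) = \<phi> [] + (\<Sum>n\<le>N. \<Sum>w\<in>words (Suc n). \<phi> w)"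
    by (simp add: sum_words_upto sum.atMost_Suc_shift del: sum.atMost_Suc)
  also have "(\<Sum>n\<le>N. \<Sum>w\<in>words (Suc n). \<phi> w) = (\<Sum>b\<in>Basis. \<Sum>w\<in>words_upto N. \<phi> (w @ [b]))"
    by (simp add: sum_words_upto sum_words_Suc sum.swap[of _ Basis])
  finally show ?thesis .
qed

lemma words_upto_mono: "M \<le> N \<Longrightarrow> words_upto M \<subseteq> words_upto N"
  by (auto simp: words_upto_def)

lemma words_append_iff [simp]: "v @ w \<in> words_upto N \<longleftrightarrow> length v + length w \<le> N \<and> set v \<subseteq> Basis \<and> set w \<subseteq> Basis"
  by (auto simp: words_upto_def)

text \<open>
  The composition \<open>f * h\<close> of the change of controlling path: it is a homomorphism for both products,
  which gives associativity (\<open>osh_osh_comp\<close>).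
\<close>

definition osh_comp ::
    "('u::euclidean_space list \<Rightarrow> real) \<Rightarrow> ('u \<Rightarrow> 'a list \<Rightarrow> real) \<Rightarrow> 'a list \<Rightarrow> real" where
  "osh_comp f h w = (\<Sum>us\<in>words_upto (length w). f us * osh h us w)"

text \<open>Longer words \<open>us\<close> contribute nothing by \<open>osh_eq_0\<close>, so the
  range of summation may be fixed independently of \<open>w\<close>.\<close>

lemma osh_comp_eq:
  assumes "length w \<le> M"
  shows "osh_comp f h w = (\<Sum>us\<in>words_upto M. f us * osh h us w)"
  unfolding osh_comp_def
proof (rule sum.mono_neutral_left)
  show "\<forall>us\<in>words_upto M - words_upto (length w). f us * osh h us w = 0"
    by (auto simp: words_upto_def intro!: osh_eq_0)
qed (use assms in \<open>simp_all add: words_upto_mono\<close>)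

lemma osh_comp_Nil [simp]: "osh_comp f h [] = f []"
  by (simp add: osh_comp_def)

text \<open>A chain rule: the last letter of \<open>w\<close> closes the last block, and this block
  is fed to the last letter of \<open>us\<close>. Removing both leaves the composition of the
  derived functional.\<close>

lemma osh_comp_snoc:
  "osh_comp f h (w @ [b]) =
     (\<Sum>u\<in>Basis. shuffle_prod (osh_comp (deriv_word u f) h) (deriv_word b (h u)) w)"
proof -
  have "osh_comp f h (w @ [b]) =
      (\<Sum>u\<in>Basis. \<Sum>us\<in>words_upto (length w). f (us @ [u]) * shuffle_prod (osh h us) (deriv_word b (h u)) w)"
    by (simp add: osh_comp_def sum_words_upto_Suc osh_snoc half_shuffle_snoc)
  also have "\<dots> = (\<Sum>u\<in>Basis. shuffle_prod (\<lambda>l. \<Sum>us\<in>words_upto (length w). f (us @ [u]) * osh h us l)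
      (deriv_word b (h u)) w)"
    by (simp add: shuffle_prod_sum_left shuffle_prod_mult_left)
  also have "\<dots> = (\<Sum>u\<in>Basis. shuffle_prod (osh_comp (deriv_word u f) h) (deriv_word b (h u)) w)"
    by (intro sum.cong refl shuffle_prod_cong) (simp_all add: osh_comp_eq)
  finally show ?thesis .
qed

lemma osh_comp_add: "osh_comp (\<lambda>us. f us + g us) h = (\<lambda>w. osh_comp f h w + osh_comp g h w)"
  by (rule ext) (simp add: osh_comp_def distrib_right sum.distrib)

text \<open>Strip the last letter, using the Leibniz rule on the inner functionals and the chain
  rule outside. The induction is on length because the hypothesis is applied to the subwords of
  \<open>v\<close> that occur under a further shuffle product, not only to \<open>v\<close>.\<close>

lemma osh_comp_shuffle_prod:
  "osh_comp (shuffle_prod f g) h w = shuffle_prod (osh_comp f h) (osh_comp g h) w"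
proof (induction "length w" arbitrary: f g w rule: less_induct)
  case less
  show ?case
  proof (cases w rule: rev_cases)
    case (snoc v b)
    let ?C = "\<lambda>f. osh_comp f h" and ?h = "\<lambda>u. deriv_word b (h u)"
    have IH: "shuffle_prod (?C (shuffle_prod f g)) k v = shuffle_prod (shuffle_prod (?C f) (?C g)) k v" for f g k
      by (rule shuffle_prod_cong[OF less]) (simp_all add: snoc)
    have "?C (shuffle_prod f g) w = (\<Sum>u\<in>Basis. shuffle_prod (?C (deriv_word u (shuffle_prod f g))) (?h u) v)"
      by (simp add: snoc osh_comp_snoc)
    also have "\<dots> = (\<Sum>u\<in>Basis. shuffle_prod (?C (shuffle_prod (deriv_word u f) g)) (?h u) v
         + shuffle_prod (?C (shuffle_prod f (deriv_word u g))) (?h u) v)"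
      by (simp add: shuffle_prod_snoc osh_comp_add shuffle_prod_add_left)
    also have "\<dots> = (\<Sum>u\<in>Basis. shuffle_prod (shuffle_prod (?C (deriv_word u f)) (?h u)) (?C g) v)
         + (\<Sum>u\<in>Basis. shuffle_prod (?C f) (shuffle_prod (?C (deriv_word u g)) (?h u)) v)"
    proof -
      have "shuffle_prod (shuffle_prod (?C (deriv_word u f)) (?C g)) (?h u) v
          = shuffle_prod (shuffle_prod (?C (deriv_word u f)) (?h u)) (?C g) v" for u
        by (simp add: shuffle_prod_assoc shuffle_prod_commute[of "?C g"] cong: shuffle_prod_cong)
      then show ?thesis by (simp add: IH sum.distrib shuffle_prod_assoc)
    qed
    also have "\<dots> = shuffle_prod (deriv_word b (?C f)) (?C g) v + shuffle_prod (?C f) (deriv_word b (?C g)) v"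
      by (simp add: osh_comp_snoc shuffle_prod_sum_left shuffle_prod_sum_right)
    also have "\<dots> = shuffle_prod (?C f) (?C g) w"
      by (simp add: snoc shuffle_prod_snoc)
    finally show ?thesis .
  qed simp
qed

lemma osh_comp_half_shuffle:
  "osh_comp (half_shuffle f g) h w = half_shuffle (osh_comp f h) (osh_comp g h) w"
proof (cases w rule: rev_cases)
  case (snoc v b)
  have *: "osh_comp (shuffle_prod f g) h = shuffle_prod (osh_comp f h) (osh_comp g h)" for f g :: "'a list \<Rightarrow> real"
    by (rule ext) (rule osh_comp_shuffle_prod)
  show ?thesis
    by (simp add: snoc osh_comp_snoc half_shuffle_snoc * shuffle_prod_assoc shuffle_prod_sum_right)
qed simp

lemma osh_comp_unit: "osh_comp unit_word h w = unit_word w"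
proof (cases w rule: rev_cases)
  case (snoc v b)
  have "osh_comp (\<lambda>_. 0) h = (\<lambda>_. 0)"
    by (rule ext) (simp add: osh_comp_def)
  then show ?thesis by (simp add: snoc osh_comp_snoc)
qed simp

lemma osh_osh_comp: "osh_comp (osh k us) h w = osh (\<lambda>u. osh_comp (k u) h) us w"
proof (induction us arbitrary: w rule: rev_induct)
  case (snoc u us)
  have "osh_comp (osh k us) h = osh (\<lambda>u. osh_comp (k u) h) us"
    by (rule ext) (rule snoc)
  then show ?case by (simp add: osh_snoc osh_comp_half_shuffle)
qed (simp add: osh_comp_unit)

text \<open>Dual basis of the words. The value of
  \<open>shuffle_prod (delta_word v) (delta_word w)\<close> at \<open>u\<close> counts the ways to
  obtain \<open>u\<close> as a shuffle of \<open>v\<close> and \<open>w\<close>, so no separate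
  shuffle product of words is introduced.\<close>

definition delta_word :: "'a list \<Rightarrow> 'a list \<Rightarrow> real" where
  "delta_word v w = (if v = w then 1 else 0)"

lemma osh_comp_delta:
  assumes "us \<in> words_upto n"
  shows "osh_comp (delta_word us) h w = osh h us w"
proof -
  have "osh_comp (delta_word us) h w = (\<Sum>vs\<in>words_upto (max n (length w)). delta_word us vs * osh h vs w)"
    by (rule osh_comp_eq) simp
  also have "\<dots> = (\<Sum>vs\<in>words_upto (max n (length w)). if us = vs then osh h us w else 0)"
    by (intro sum.cong) (simp_all add: delta_word_def)
  also have "\<dots> = osh h us w"
    using assms subsetD[OF words_upto_mono[of n "max n (length w)"] assms] by simp
  finally show ?thesis .
qed

lemma shuffle_prod_delta_eq_0:
  assumes "length w \<noteq> length u + length v"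
  shows "shuffle_prod (delta_word u) (delta_word v) w = 0"
proof -
  have "shuffle_prod (delta_word u) (delta_word v) w = split_sum (\<lambda>_ _. 0) w"
    unfolding shuffle_prod_def
    by (rule split_sum_cong) (use assms in \<open>auto simp: delta_word_def dest: in_splitsD\<close>)
  then show ?thesis by simp
qed

text \<open>The homomorphism property of \<open>osh_comp\<close> applied to two dual basis
  functionals. The coefficients are counts of shuffles, in the form that the shuffle relation of a
  lift requires.\<close>

lemma osh_shuffle_prod:
  fixes us vs :: "'a::euclidean_space list"
  assumes "us \<in> words a" "vs \<in> words b"
  shows "shuffle_prod (osh h us) (osh h vs) w =
    (\<Sum>z\<in>words (a + b). shuffle_prod (delta_word us) (delta_word vs) z * osh h z w)"
proof -
  let ?d = "shuffle_prod (delta_word us) (delta_word vs)" and ?M = "max (a + b) (length w)"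
  have "shuffle_prod (osh h us) (osh h vs) w = osh_comp ?d h w"
    unfolding osh_comp_shuffle_prod
    by (intro shuffle_prod_cong osh_comp_delta[symmetric])
      (use assms in \<open>auto simp: words_def words_upto_def\<close>)
  also have "\<dots> = (\<Sum>z\<in>words_upto ?M. ?d z * osh h z w)"
    by (rule osh_comp_eq) simp
  also have "\<dots> = (\<Sum>z\<in>words (a + b). ?d z * osh h z w)"
  proof (rule sum.mono_neutral_right)
    show "\<forall>z\<in>words_upto ?M - words (a + b). ?d z * osh h z w = 0"
    proof
      fix z :: "'a list" assume "z \<in> words_upto ?M - words (a + b)"
      then have "length z \<noteq> length us + length vs"
        using assms by (auto simp: words_def words_upto_def)
      then show "?d z * osh h z w = 0" by (simp add: shuffle_prod_delta_eq_0)
    qed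
  qed (simp, auto simp: words_def words_upto_def)
  finally show ?thesis .
qed

section \<open>Ordered shuffles as sets of permutations\<close>

text \<open>The recursion of the iterated half-shuffle product carried out on blocks of letters: the
  last letter closes the last block. It links \<open>osh\<close> to the sets of permutations in the
  definition of the coproduct.\<close>

primrec ordered_parts :: "nat \<Rightarrow> 'a list \<Rightarrow> 'a list list list" where
  "ordered_parts 0 w = (if w = [] then [[]] else [])"
| "ordered_parts (Suc m) w =
     (if w = [] then []
      else concat (map (\<lambda>(l, r). map (\<lambda>Ls. Ls @ [r @ [last w]]) (ordered_parts m l)) (splits (butlast w))))"

lemma sum_list_concat_map: "sum_list (map \<phi> (concat (map F ys))) = (\<Sum>y\<leftarrow>ys. sum_list (map \<phi> (F y)))"
  by (induction ys) auto

lemma length_in_ordered_parts: "Ls \<in> set (ordered_parts m w) \<Longrightarrow> length Ls = m"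
  by (induction m arbitrary: Ls w) (auto split: if_splits)

lemma osh_eq_sum_ordered_parts:
  "osh h us w = (\<Sum>Ls\<leftarrow>ordered_parts (length us) w. \<Prod>i<length us. h (us ! i) (Ls ! i))"
proof (induction us arbitrary: w rule: rev_induct)
  case (snoc u us)
  show ?case
  proof (cases w rule: rev_cases)
    case (snoc v b)
    let ?m = "length us"
    have *: "(\<Sum>Ls\<leftarrow>ordered_parts ?m l. \<Prod>i<Suc ?m. h ((us @ [u]) ! i) ((Ls @ [r @ [b]]) ! i))
        = osh h us l * h u (r @ [b])" for l r
    proof -
      have "(\<Sum>Ls\<leftarrow>ordered_parts ?m l. \<Prod>i<Suc ?m. h ((us @ [u]) ! i) ((Ls @ [r @ [b]]) ! i))
          = (\<Sum>Ls\<leftarrow>ordered_parts ?m l. (\<Prod>i<?m. h (us ! i) (Ls ! i)) * h u (r @ [b]))"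
        by (intro arg_cong[of _ _ sum_list] map_cong refl)
          (auto dest!: length_in_ordered_parts simp: nth_append)
      also have "\<dots> = osh h us l * h u (r @ [b])"
        by (simp add: snoc.IH sum_list_mult_const)
      finally show ?thesis .
    qed
    show ?thesis
      unfolding snoc osh_snoc half_shuffle_snoc shuffle_prod_def split_sum_def
      by (simp add: sum_list_concat_map case_prod_unfold comp_def * del: prod.lessThan_Suc)
  qed (simp add: osh_snoc)
qed simp

lemma ordered_parts_map: "ordered_parts m (map f w) = map (map (map f)) (ordered_parts m w)"
proof (induction m arbitrary: w)
  case (Suc m)
  show ?case
    by (cases w rule: rev_cases) (simp_all add: splits_map Suc map_concat comp_def case_prod_unfold)
qed simp

section \<open>Splittings of increasing lists of positions\<close>

lemma sorted_wrt_snocE: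
  fixes b :: "'a::linorder"
  assumes "sorted_wrt (<) l" "b \<in> set l" "\<And>x. x \<in> set l \<Longrightarrow> x \<le> b"
  obtains l' where "l = l' @ [b]" "sorted_wrt (<) l'" "b \<notin> set l'"
proof (cases l rule: rev_cases)
  case (snoc l' c)
  with assms have "c = b"
    by (fastforce simp: sorted_wrt_append)
  with snoc assms show thesis by (intro that[of l']) (auto simp: sorted_wrt_append)
qed (use assms in auto)

lemma sorted_wrt_less_unique:
  fixes l :: "'a::linorder list"
  assumes "sorted_wrt (<) l" "sorted_wrt (<) l'" "set l = set l'"
  shows "l = l'"
  using assms strict_sorted_equal by blast

text \<open>A strictly increasing list is determined by its set, so a splitting of increasing
  positions amounts to an ordered pair of complementary subsets. Positions are used because on words
  with repeated letters this correspondence fails.\<close>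

lemma set_splits_sorted:
  fixes xs :: "'a::linorder list"
  assumes "sorted_wrt (<) xs"
  shows "set (splits xs) =
    {(l, r). sorted_wrt (<) l \<and> sorted_wrt (<) r \<and> set l \<inter> set r = {} \<and> set l \<union> set r = set xs}"
  using assms
proof (induction xs rule: rev_induct)
  case (snoc b xs)
  then have xs: "sorted_wrt (<) xs" and b: "\<And>x. x \<in> set xs \<Longrightarrow> x < b"
    by (auto simp: sorted_wrt_append)
  note IH = snoc.IH[OF xs]
  show ?case (is "_ = ?R")
  proof (intro equalityI subsetI)
    fix z assume "z \<in> set (splits (xs @ [b]))"
    then obtain l r where lr: "(l, r) \<in> set (splits xs)" "z = (l @ [b], r) \<or> z = (l, r @ [b])"
      by auto
    have "set l \<union> set r = set xs" using lr(1) by (simp add: IH)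
    then have "\<forall>x\<in>set l \<union> set r. x < b" "b \<notin> set l \<union> set r"
      using b by auto
    with lr show "z \<in> ?R"
      unfolding IH by (fastforce simp: sorted_wrt_append)
  next
    fix z assume "z \<in> ?R"
    then obtain l r where z: "z = (l, r)" and lr: "sorted_wrt (<) l" "sorted_wrt (<) r"
      "set l \<inter> set r = {}" "set l \<union> set r = insert b (set xs)" by auto
    have bs: "x \<le> b" if "x \<in> set l \<union> set r" for x
      using that b unfolding lr(4) by (auto intro: less_imp_le)
    have bxs: "b \<notin> set xs" using b by auto
    from lr(4) have "b \<in> set l \<or> b \<in> set r" by auto
    then show "z \<in> set (splits (xs @ [b]))"
    proof
      assume "b \<in> set l"
      with lr(1) bs obtain l' where l': "l = l' @ [b]" "sorted_wrt (<) l'" "b \<notin> set l'"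
        by (auto elim: sorted_wrt_snocE)
      have "(l', r) \<in> set (splits xs)"
        using l' lr bxs by (auto simp: IH)
      then show ?thesis by (force simp: z l')
    next
      assume "b \<in> set r"
      with lr(2) bs obtain r' where r': "r = r' @ [b]" "sorted_wrt (<) r'" "b \<notin> set r'"
        by (auto elim: sorted_wrt_snocE)
      have "(l, r') \<in> set (splits xs)"
        using r' lr bxs by (auto simp: IH)
      then show ?thesis by (force simp: z r')
    qed
  qed
qed auto

lemma distinct_splits: "distinct xs \<Longrightarrow> distinct (splits xs)"
proof (induction xs rule: rev_induct)
  case (snoc b xs)
  have "b \<notin> set l" "b \<notin> set r" if "(l, r) \<in> set (splits xs)" for l r
    using in_splitsD(2)[OF that] snoc.prems by auto
  with snoc show ?case
    by (fastforce simp: distinct_map inj_on_def)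
qed simp

lemma distinct_concat_map:
  assumes "distinct ys" "\<And>y. y \<in> set ys \<Longrightarrow> distinct (F y)"
    and "\<And>y z. y \<in> set ys \<Longrightarrow> z \<in> set ys \<Longrightarrow> y \<noteq> z \<Longrightarrow> set (F y) \<inter> set (F z) = {}"
  shows "distinct (concat (map F ys))"
  using assms
proof (induction ys)
  case (Cons y ys)
  have "set (F y) \<inter> set (F z) = {}" if "z \<in> set ys" for z
    using Cons.prems(1) by (intro Cons.prems(3)) (use that in auto)
  with Cons show ?case by auto
qed simp

text \<open>Read on positions, the recursion yields every partition into increasing blocks ordered
  by their last entries, since the largest position can only end the last block.\<close>

lemma set_ordered_parts:
  fixes xs :: "'a::linorder list"
  assumes "sorted_wrt (<) xs"
  shows "set (ordered_parts m xs) =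
    {Ls. length Ls = m \<and> (\<forall>L\<in>set Ls. L \<noteq> [] \<and> sorted_wrt (<) L) \<and> distinct (concat Ls) \<and>
         set (concat Ls) = set xs \<and> sorted_wrt (<) (map last Ls)}"
  using assms
proof (induction m arbitrary: xs)
  case (Suc m)
  show ?case (is "_ = ?R")
  proof (cases xs rule: rev_cases)
    case Nil
    have "Ls \<notin> ?R" for Ls
      using Nil by (cases Ls) auto
    then show ?thesis using Nil by auto
  next
    case (snoc ys b)
    have ys: "sorted_wrt (<) ys" and b: "\<And>x. x \<in> set ys \<Longrightarrow> x < b"
      using Suc.prems by (auto simp: snoc sorted_wrt_append)
    have bys: "b \<notin> set ys" using b by auto
    show ?thesis
    proof (intro equalityI subsetI)
      fix Ls assume "Ls \<in> set (ordered_parts (Suc m) xs)"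
      then obtain l r Ks where lr: "(l, r) \<in> set (splits ys)" and Ks: "Ks \<in> set (ordered_parts m l)"
        and Ls: "Ls = Ks @ [r @ [b]]"
        by (auto simp: snoc)
      from lr have lr': "sorted_wrt (<) l" "sorted_wrt (<) r" "set l \<inter> set r = {}" "set l \<union> set r = set ys"
        by (auto simp: set_splits_sorted[OF ys])
      note Ks' = Ks[unfolded Suc.IH[OF lr'(1)]]
      have "last L < b" if "L \<in> set Ks" for L
      proof -
        have "last L \<in> set L" using that Ks' by simp
        with that have "last L \<in> set (concat Ks)" by auto
        also have "set (concat Ks) = set l" using Ks' by auto
        finally have "last L \<in> set l" .
        with lr'(4) show ?thesis by (intro b) auto
      qed
      moreover have "sorted_wrt (<) (r @ [b])" "distinct r"
        using lr' b by (auto simp: sorted_wrt_append strict_sorted_iff)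
      ultimately show "Ls \<in> ?R" using Ks' lr' bys
        by (auto simp: Ls snoc sorted_wrt_append simp del: set_concat)
    next
      fix Ls assume "Ls \<in> ?R"
      then have Ls: "length Ls = Suc m" "\<And>L. L \<in> set Ls \<Longrightarrow> L \<noteq> []" "\<And>L. L \<in> set Ls \<Longrightarrow> sorted_wrt (<) L"
        "distinct (concat Ls)" "set (concat Ls) = insert b (set ys)" "sorted_wrt (<) (map last Ls)"
        by (simp_all add: snoc)
      from Ls(1) obtain Ks L where KL: "Ls = Ks @ [L]"
        by (cases Ls rule: rev_cases) auto
      \<comment> \<open>The last entry of the last block dominates every position, by the order of
        the last entries; it is therefore \<open>b\<close>, and removing it leaves a splitting of
        the remaining positions.\<close>
      have lastL: "x \<le> last L" if "x \<in> set (concat Ls)" for x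
      proof -
        from that obtain K where K: "K \<in> set Ls" "x \<in> set K" by auto
        have "x \<le> last K"
          using Ls(3)[OF K(1)] K(2) by (cases K rule: rev_cases) (auto simp: sorted_wrt_append)
        also have "last K \<le> last L"
          using Ls(6) K(1) by (auto simp: KL sorted_wrt_append)
        finally show ?thesis .
      qed
      have "L \<noteq> []" using Ls(2) KL by auto
      then have "last L \<in> set (concat Ls)" by (auto simp: KL)
      then have "last L \<le> b" using b unfolding Ls(5) by (auto intro: less_imp_le)
      moreover have "b \<le> last L" using Ls(5) by (intro lastL) auto
      ultimately obtain r where r: "L = r @ [b]"
        using \<open>L \<noteq> []\<close> by (metis append_butlast_last_id antisym)
      \<comment> \<open>The positions of the earlier blocks in increasing order, as the induction
        hypothesis speaks of a sorted list.\<close>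
      define l where "l = sorted_list_of_set (set (concat Ks))"
      have l: "sorted_wrt (<) l" "set l = set (concat Ks)"
        by (simp_all add: l_def)
      have sr: "sorted_wrt (<) r" using Ls(3)[of L] by (simp add: KL r sorted_wrt_append)
      have "(l, r) \<in> set (splits ys)"
        unfolding set_splits_sorted[OF ys]
        using l sr Ls(4,5) bys by (auto simp: KL r simp del: set_concat)
      moreover have "Ks \<in> set (ordered_parts m l)"
        unfolding Suc.IH[OF l(1)] using Ls l by (auto simp: KL sorted_wrt_append)
      ultimately show "Ls \<in> set (ordered_parts (Suc m) xs)"
        by (force simp: snoc KL r)
    qed
  qed
qed auto

text \<open>The blocks of a partition determine the splitting from which it arose, so none is listed
  twice and the sum over the list is a sum over a set.\<close>

lemma distinct_ordered_parts:
  fixes xs :: "'a::linorder list"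
  shows "sorted_wrt (<) xs \<Longrightarrow> distinct (ordered_parts m xs)"
proof (induction m arbitrary: xs)
  case (Suc m)
  show ?case
  proof (cases xs rule: rev_cases)
    case (snoc ys b)
    have ys: "sorted_wrt (<) ys" using Suc.prems by (auto simp: snoc sorted_wrt_append)
    note S = set_splits_sorted[OF ys]
    have "distinct (concat (map (\<lambda>(l, r). map (\<lambda>Ls. Ls @ [r @ [b]]) (ordered_parts m l)) (splits ys)))"
    proof (rule distinct_concat_map)
      show "distinct (splits ys)" using ys by (intro distinct_splits) (simp add: strict_sorted_iff)
    next
      fix y assume "y \<in> set (splits ys)"
      then show "distinct (case y of (l, r) \<Rightarrow> map (\<lambda>Ls. Ls @ [r @ [b]]) (ordered_parts m l))"
        by (auto simp: S distinct_map inj_on_def intro: Suc.IH)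
    next
      fix y z assume yz: "y \<in> set (splits ys)" "z \<in> set (splits ys)" "y \<noteq> z"
      obtain l r l' r' where y: "y = (l, r)" and z: "z = (l', r')" by fastforce
      have l: "sorted_wrt (<) l" "sorted_wrt (<) l'" using yz by (auto simp: S y z)
      show "set (case y of (l, r) \<Rightarrow> map (\<lambda>Ls. Ls @ [r @ [b]]) (ordered_parts m l)) \<inter>
            set (case z of (l, r) \<Rightarrow> map (\<lambda>Ls. Ls @ [r @ [b]]) (ordered_parts m l)) = {}"
      proof (rule ccontr)
        assume "\<not> ?thesis"
        then obtain Ls where "Ls \<in> set (ordered_parts m l)" "Ls \<in> set (ordered_parts m l')" "r = r'"
          by (auto simp: y z)
        then have "set l = set l'" unfolding l[THEN set_ordered_parts] by auto
        with l have "l = l'" by (rule sorted_wrt_less_unique)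
        with \<open>r = r'\<close> yz show False by (simp add: y z)
      qed
    qed
    then show ?thesis by (simp add: snoc)
  qed simp
qed simp

section \<open>Permutations in one-line notation cut into blocks\<close>

lemma map_length_chop: "length xs = sum_list ns \<Longrightarrow> map length (chop ns xs) = ns"
  by (induction ns xs rule: chop.induct) auto

lemma concat_chop: "length xs = sum_list ns \<Longrightarrow> concat (chop ns xs) = xs"
  by (induction ns xs rule: chop.induct) auto

lemma chop_concat: "chop (map length Ls) (concat Ls) = Ls"
  by (induction Ls) auto

lemma chop_map: "chop ns (map f xs) = map (map f) (chop ns xs)"
  by (induction ns xs rule: chop.induct) (auto simp: take_map drop_map)

lemma length_chop [simp]: "length (chop ns xs) = length ns"
  by (induction ns xs rule: chop.induct) auto

lemma nth_chop_upt:
  assumes "a + sum_list ns \<le> b" "j < length ns"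
  shows "chop ns (map \<sigma> [a..<b]) ! j =
     map \<sigma> [a + sum_list (take j ns)..<a + sum_list (take (Suc j) ns)]"
  using assms
proof (induction ns arbitrary: a j)
  case (Cons n ns)
  have "take n [a..<b] = [a..<a + n]" "drop n [a..<b] = [a + n..<b]"
    using Cons.prems by simp_all
  with Cons show ?case
    by (cases j) (simp_all add: take_map drop_map add.assoc)
qed simp

lemma sorted_wrt_map_upt: "sorted_wrt (<) (map \<sigma> [a..<b]) \<longleftrightarrow> strict_mono_on {a..<b} (\<sigma> :: nat \<Rightarrow> nat)"
proof
  assume *: "sorted_wrt (<) (map \<sigma> [a..<b])"
  show "strict_mono_on {a..<b} \<sigma>"
  proof (rule strict_mono_onI)
    fix r s assume rs: "r \<in> {a..<b}" "s \<in> {a..<b}" "r < s"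
    have "map \<sigma> [a..<b] ! (r - a) < map \<sigma> [a..<b] ! (s - a)"
      using rs by (intro sorted_wrt_nth_less[OF *]) auto
    then show "\<sigma> r < \<sigma> s" using rs by simp
  qed
next
  assume "strict_mono_on {a..<b} \<sigma>"
  then show "sorted_wrt (<) (map \<sigma> [a..<b])"
    by (auto simp: sorted_wrt_iff_nth_less strict_mono_on_def less_diff_conv add.commute)
qed

lemma nth_chop:
  "j < length ns \<Longrightarrow> chop ns (map \<sigma> [0..<sum_list ns]) ! j =
     map \<sigma> [sum_list (take j ns)..<sum_list (take (Suc j) ns)]"
  using nth_chop_upt[of 0 ns "sum_list ns" j \<sigma>] by simp

lemma permutes_iff_distinct:
  "\<sigma> permutes {..<n} \<longleftrightarrow>
     distinct (map \<sigma> [0..<n]) \<and> set (map \<sigma> [0..<n]) = {..<n} \<and> (\<forall>i\<ge>n. \<sigma> i = i)"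
proof
  assume \<sigma>: "\<sigma> permutes {..<n}"
  then show "distinct (map \<sigma> [0..<n]) \<and> set (map \<sigma> [0..<n]) = {..<n} \<and> (\<forall>i\<ge>n. \<sigma> i = i)"
    using permutes_image[OF \<sigma>] permutes_inj_on[OF \<sigma>, of "{..<n}"]
    by (auto simp: distinct_map permutes_not_in atLeast0LessThan)
next
  assume "distinct (map \<sigma> [0..<n]) \<and> set (map \<sigma> [0..<n]) = {..<n} \<and> (\<forall>i\<ge>n. \<sigma> i = i)"
  then show "\<sigma> permutes {..<n}"
    by (intro bij_imp_permutes) (auto simp: distinct_map bij_betw_def atLeast0LessThan)
qed

lemma mem_shuffles_of:
  "\<sigma> \<in> shuffles_of ns \<longleftrightarrow> \<sigma> permutes {..<sum_list ns} \<and>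
     (\<forall>L\<in>set (chop ns (map \<sigma> [0..<sum_list ns])). sorted_wrt (<) L)"
  by (auto simp: shuffles_of_def block_def all_set_conv_all_nth nth_chop sorted_wrt_map_upt)

lemma sorted_wrt_less_Suc:
  fixes xs :: "'a::order list"
  shows "sorted_wrt (<) xs \<longleftrightarrow> (\<forall>j. Suc j < length xs \<longrightarrow> xs ! j < xs ! Suc j)"
  by (rule sorted_wrt_iff_nth_Suc_transp) (rule transp_on_less)

text \<open>Positivity of the entries of \<open>ns\<close> places \<open>block_last ns j\<close>
  inside block \<open>j\<close>, so that it indexes the last entry of the chopped list.\<close>

lemma mem_ordered_shuffles_of:
  assumes "\<forall>n\<in>set ns. 1 \<le> n"
  shows "\<sigma> \<in> ordered_shuffles_of ns \<longleftrightarrow> \<sigma> \<in> shuffles_of ns \<and>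
     sorted_wrt (<) (map last (chop ns (map \<sigma> [0..<sum_list ns])))"
proof -
  have "last (chop ns (map \<sigma> [0..<sum_list ns]) ! j) = \<sigma> (block_last ns j)" if j: "j < length ns" for j
  proof -
    have "1 \<le> ns ! j" using assms j by simp
    then have "sum_list (take j ns) < sum_list (take (Suc j) ns)"
      using j by (simp add: take_Suc_conv_app_nth)
    then have L1: "last [sum_list (take j ns)..<sum_list (take (Suc j) ns)] = sum_list (take (Suc j) ns) - 1"
      and L2: "[sum_list (take j ns)..<sum_list (take (Suc j) ns)] \<noteq> []"
      by (simp, metis not_less_zero upt_eq_Nil_conv not_le)
    show ?thesis unfolding nth_chop[OF j] block_last_def last_map[OF L2] L1 ..
  qed
  then show ?thesis
    by (auto simp: ordered_shuffles_of_def sorted_wrt_less_Suc)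
qed

lemma permute_word_eq: "length w = n \<Longrightarrow> permute_word \<sigma> w = map ((!) w) (map \<sigma> [0..<n])"
  by (simp add: permute_word_def)

text \<open>Inverse of one-line notation; being the identity beyond the list is what
  \<open>permutes\<close> demands.\<close>

definition perm_of_list :: "nat list \<Rightarrow> nat \<Rightarrow> nat" where
  "perm_of_list xs i = (if i < length xs then xs ! i else i)"

lemma map_perm_of_list: "length xs = n \<Longrightarrow> map (perm_of_list xs) [0..<n] = xs"
  by (intro nth_equalityI) (simp_all add: perm_of_list_def)

lemma perm_of_list_map:
  assumes "\<sigma> permutes {..<n}"
  shows "perm_of_list (map \<sigma> [0..<n]) = \<sigma>"
  using assms by (auto simp: perm_of_list_def fun_eq_iff permutes_not_in)

lemma length_eq_of_distinct_cover:
  assumes "distinct xs" "set xs = {..<n}"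
  shows "length xs = n"
  using distinct_card[OF assms(1)] assms(2) by simp

lemma perm_of_list_permutes:
  assumes "distinct xs" "set xs = {..<n}"
  shows "perm_of_list xs permutes {..<n}"
  unfolding permutes_iff_distinct
  using map_perm_of_list[OF length_eq_of_distinct_cover[OF assms]] assms length_eq_of_distinct_cover[OF assms]
  by (auto simp: perm_of_list_def)

text \<open>In one-line notation a shuffle is a pair of increasing lists that partition the
  positions, hence a splitting with left part of length \<open>a\<close>. The word \<open>w\<close>
  is the image of the list of positions, and mapping the splittings to \<open>w\<close> restores
  their multiplicities.\<close>

lemma sum_shuffles_eq_splits:
  assumes w: "length w = a + b"
  shows "(\<Sum>\<sigma>\<in>shuffles_of [a, b]. \<phi> (chop [a, b] (permute_word \<sigma> w))) =
     split_sum (\<lambda>l r. if length l = a then \<phi> [l, r] else 0) w"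
proof -
  let ?n = "a + b" and ?f = "map ((!) w)"
  let ?xs = "[0..<?n]"
  have wm: "w = ?f ?xs" using w by (metis map_nth)
  have S: "set (splits ?xs) = {(l, r). sorted_wrt (<) l \<and> sorted_wrt (<) r \<and> set l \<inter> set r = {} \<and> set l \<union> set r = {..<?n}}"
    using set_splits_sorted[of ?xs] by (simp add: atLeast0LessThan)
  have fin: "finite {(l, r). (l, r) \<in> set (splits ?xs) \<and> length l = a}"
    by (rule finite_subset[of _ "set (splits ?xs)"]) auto
  have "split_sum (\<lambda>l r. if length l = a then \<phi> [l, r] else 0) w
      = (\<Sum>(l, r)\<leftarrow>splits ?xs. if length l = a then \<phi> [?f l, ?f r] else 0)"
    unfolding split_sum_def
    by (subst arg_cong[OF wm, of splits]) (simp add: splits_map comp_def case_prod_unfold cong: if_cong)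
  also have "\<dots> = (\<Sum>(l, r)\<in>set (splits ?xs). if length l = a then \<phi> [?f l, ?f r] else 0)"
    by (subst sum_list_distinct_conv_sum_set) (simp_all add: distinct_splits)
  also have "\<dots> = (\<Sum>(l, r)\<in>{(l, r). (l, r) \<in> set (splits ?xs) \<and> length l = a}. \<phi> [?f l, ?f r])"
    by (rule sum.mono_neutral_cong_right) (auto split: if_splits)
  also have "\<dots> = (\<Sum>\<sigma>\<in>shuffles_of [a, b]. \<phi> (chop [a, b] (permute_word \<sigma> w)))"
  proof (rule sum.reindex_bij_witness[where
        i = "\<lambda>\<sigma>. (take a (map \<sigma> ?xs), drop a (map \<sigma> ?xs))" and j = "\<lambda>(l, r). perm_of_list (l @ r)"])
    fix z assume "z \<in> {(l, r). (l, r) \<in> set (splits ?xs) \<and> length l = a}"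
    then obtain l r where z: "z = (l, r)" "(l, r) \<in> set (splits ?xs)" "length l = a" by auto
    then have lr: "sorted_wrt (<) l" "sorted_wrt (<) r" "set l \<inter> set r = {}" "set l \<union> set r = {..<?n}"
      unfolding S by auto
    have c: "distinct (l @ r)" "set (l @ r) = {..<?n}"
      using lr by (auto simp: strict_sorted_iff)
    note m = map_perm_of_list[OF length_eq_of_distinct_cover[OF c]]
    show "(take a (map (case z of (l, r) \<Rightarrow> perm_of_list (l @ r)) ?xs), drop a (map (case z of (l, r) \<Rightarrow> perm_of_list (l @ r)) ?xs)) = z"
      by (simp only: z(1) prod.case m) (simp add: z(3)[symmetric])
    have ch: "chop [a, b] (l @ r) = [l, r]"
      using length_eq_of_distinct_cover[OF c] z(3) by simp
    then show "(case z of (l, r) \<Rightarrow> perm_of_list (l @ r)) \<in> shuffles_of [a, b]"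
      using lr perm_of_list_permutes[OF c] m
      by (simp add: z(1) mem_shuffles_of del: chop.simps)
    show "\<phi> (chop [a, b] (permute_word (case z of (l, r) \<Rightarrow> perm_of_list (l @ r)) w)) = (case z of (l, r) \<Rightarrow> \<phi> [?f l, ?f r])"
      by (simp only: z(1) prod.case permute_word_eq[OF w] m) (simp only: chop_map ch list.map)
  next
    fix \<sigma> assume \<sigma>: "\<sigma> \<in> shuffles_of [a, b]"
    then have p: "\<sigma> permutes {..<?n}" by (simp add: mem_shuffles_of)
    then show "(case (take a (map \<sigma> ?xs), drop a (map \<sigma> ?xs)) of (l, r) \<Rightarrow> perm_of_list (l @ r)) = \<sigma>"
      by (simp add: perm_of_list_map)
    have d: "distinct (take a (map \<sigma> ?xs) @ drop a (map \<sigma> ?xs))"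
      "set (take a (map \<sigma> ?xs) @ drop a (map \<sigma> ?xs)) = {..<?n}"
      using p unfolding permutes_iff_distinct append_take_drop_id by blast+
    have "take b (drop a (map \<sigma> ?xs)) = drop a (map \<sigma> ?xs)" by (rule take_all) simp
    then show "(take a (map \<sigma> ?xs), drop a (map \<sigma> ?xs)) \<in> {(l, r). (l, r) \<in> set (splits ?xs) \<and> length l = a}"
      using \<sigma> d unfolding S mem_shuffles_of distinct_append set_append by simp
  qed
  finally show ?thesis by simp
qed

text \<open>The blocks concatenate to the one-line notation of the permutation and their lengths
  form the composition \<open>ns\<close>. The sum over compositions is thus absorbed into a single
  sum over ordered partitions.\<close>

lemma sum_ordered_shuffles_eq_ordered_parts:
  assumes w: "length w = n"
  shows "(\<Sum>ns\<in>{ns \<in> positive_lists m. sum_list ns = n}. \<Sum>\<sigma>\<in>ordered_shuffles_of ns.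
      \<phi> (chop ns (permute_word \<sigma> w))) = (\<Sum>Ls\<leftarrow>ordered_parts m w. \<phi> Ls)"
proof -
  let ?f = "map ((!) w)" and ?xs = "[0..<n]" and ?N = "{ns \<in> positive_lists m. sum_list ns = n}"
  have wm: "w = ?f ?xs" using w by (metis map_nth)
  have S: "set (ordered_parts m ?xs) = {Ls. length Ls = m \<and> (\<forall>L\<in>set Ls. L \<noteq> [] \<and> sorted_wrt (<) L) \<and>
      distinct (concat Ls) \<and> set (concat Ls) = {..<n} \<and> sorted_wrt (<) (map last Ls)}"
    using set_ordered_parts[of ?xs m] by (simp add: atLeast0LessThan)
  have finN: "finite ?N"
  proof (rule finite_subset)
    show "?N \<subseteq> {ns. set ns \<subseteq> {..n} \<and> length ns = m}"
      by (auto simp: positive_lists_def intro: member_le_sum_list)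
  qed (simp add: finite_lists_length_eq)
  have finS: "finite (ordered_shuffles_of ns)" for ns
    by (rule finite_subset[OF _ finite_permutations[of "{..<sum_list ns}"]])
      (auto simp: ordered_shuffles_of_def shuffles_of_def)
  have "(\<Sum>Ls\<leftarrow>ordered_parts m w. \<phi> Ls) = (\<Sum>Ls\<leftarrow>ordered_parts m ?xs. \<phi> (map ?f Ls))"
    by (subst arg_cong[OF wm, of "ordered_parts m"]) (simp add: ordered_parts_map comp_def)
  also have "\<dots> = (\<Sum>Ls\<in>set (ordered_parts m ?xs). \<phi> (map ?f Ls))"
    by (rule sum_list_distinct_conv_sum_set) (simp add: distinct_ordered_parts)
  also have "\<dots> = (\<Sum>(ns, \<sigma>)\<in>Sigma ?N ordered_shuffles_of. \<phi> (chop ns (permute_word \<sigma> w)))"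
  proof (rule sum.reindex_bij_witness[where i = "\<lambda>(ns, \<sigma>). chop ns (map \<sigma> ?xs)" and
        j = "\<lambda>Ls. (map length Ls, perm_of_list (concat Ls))"])
    fix Ls assume "Ls \<in> set (ordered_parts m ?xs)"
    then have Ls: "length Ls = m" "\<And>L. L \<in> set Ls \<Longrightarrow> L \<noteq> []" "\<And>L. L \<in> set Ls \<Longrightarrow> sorted_wrt (<) L"
      "distinct (concat Ls)" "set (concat Ls) = {..<n}" "sorted_wrt (<) (map last Ls)"
      unfolding S by auto
    note len = length_eq_of_distinct_cover[OF Ls(4,5)]
    note m = map_perm_of_list[OF len]
    have sl: "sum_list (map length Ls) = n" using len by (simp add: length_concat)
    have pos: "map length Ls \<in> positive_lists m"
      using Ls(1,2) by (auto simp: positive_lists_def Suc_le_eq)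
    then have pos': "\<forall>n\<in>set (map length Ls). 1 \<le> n" by (simp add: positive_lists_def)
    show "(case (map length Ls, perm_of_list (concat Ls)) of (ns, \<sigma>) \<Rightarrow> chop ns (map \<sigma> ?xs)) = Ls"
      by (simp add: m chop_concat)
    show "(map length Ls, perm_of_list (concat Ls)) \<in> Sigma ?N ordered_shuffles_of"
      using pos sl perm_of_list_permutes[OF Ls(4,5)] Ls(3,6)
      by (simp add: mem_ordered_shuffles_of[OF pos'] mem_shuffles_of sl m chop_concat)
    show "(case (map length Ls, perm_of_list (concat Ls)) of (ns, \<sigma>) \<Rightarrow> \<phi> (chop ns (permute_word \<sigma> w))) = \<phi> (map ?f Ls)"
      by (simp only: prod.case permute_word_eq[OF w] m) (simp only: chop_map chop_concat)
  next
    fix z assume "z \<in> Sigma ?N ordered_shuffles_of"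
    then obtain ns \<sigma> where z: "z = (ns, \<sigma>)" and ns: "length ns = m" "\<forall>n\<in>set ns. 1 \<le> n" "sum_list ns = n"
      and \<sigma>: "\<sigma> \<in> ordered_shuffles_of ns" by (auto simp: positive_lists_def)
    from \<sigma> have \<sigma>': "\<sigma> permutes {..<n}" "\<forall>L\<in>set (chop ns (map \<sigma> ?xs)). sorted_wrt (<) L"
      "sorted_wrt (<) (map last (chop ns (map \<sigma> ?xs)))"
      by (simp_all add: mem_ordered_shuffles_of[OF ns(2)] mem_shuffles_of ns(3))
    have cc: "concat (chop ns (map \<sigma> ?xs)) = map \<sigma> ?xs" by (rule concat_chop) (simp add: ns)
    have ml: "map length (chop ns (map \<sigma> ?xs)) = ns" by (rule map_length_chop) (simp add: ns)
    show "(map length (case z of (ns, \<sigma>) \<Rightarrow> chop ns (map \<sigma> ?xs)),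
           perm_of_list (concat (case z of (ns, \<sigma>) \<Rightarrow> chop ns (map \<sigma> ?xs)))) = z"
      by (simp only: z prod.case cc ml perm_of_list_map[OF \<sigma>'(1)])
    have "L \<noteq> []" if "L \<in> set (chop ns (map \<sigma> ?xs))" for L
    proof -
      have "length L \<in> set (map length (chop ns (map \<sigma> ?xs)))" using that by simp
      then show ?thesis unfolding ml using ns(2) by force
    qed
    then show "(case z of (ns, \<sigma>) \<Rightarrow> chop ns (map \<sigma> ?xs)) \<in> set (ordered_parts m ?xs)"
      unfolding S z prod.case mem_Collect_eq cc
      using \<sigma>' \<sigma>'(1)[unfolded permutes_iff_distinct] ns(1) by auto
  qed
  also have "\<dots> = (\<Sum>ns\<in>?N. \<Sum>\<sigma>\<in>ordered_shuffles_of ns. \<phi> (chop ns (permute_word \<sigma> w)))"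
    by (rule sum.Sigma[symmetric]) (use finN finS in auto)
  finally show ?thesis by simp
qed

section \<open>Sewing\<close>

locale control_setup =
  fixes p T :: real and \<omega> :: "real \<Rightarrow> real \<Rightarrow> real"
  assumes T_pos: "0 < T" and p_ge_1: "1 \<le> p" and control: "is_control T \<omega>"
begin

abbreviation "N \<equiv> lev p"

text \<open>Exponent that belongs to order \<open>N + 1\<close>. It exceeds one because
  \<open>N\<close> is the integer part of \<open>p\<close>, and this excess makes bisection and
  sewing converge.\<close>

definition \<theta> :: real where "\<theta> = real (N + 1) / p"

text \<open>Unit of homogeneity: a rough path component of degree \<open>n\<close> has order
  \<open>\<rho> s t ^ n\<close>.\<close>

definition \<rho> :: "real \<Rightarrow> real \<Rightarrow> real" where "\<rho> s t = \<omega> s t powr (1 / p)"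

lemma N_ge_1: "1 \<le> N"
  using p_ge_1 by (simp add: lev_def le_nat_iff)

lemma \<theta>_gt_1: "1 < \<theta>"
proof -
  have "p < real (N + 1)" using p_ge_1 unfolding lev_def by linarith
  then show ?thesis using p_ge_1 by (simp add: \<theta>_def)
qed

section \<open>Bisection of a control\<close>

lemma control_nonneg: "0 \<le> s \<Longrightarrow> s \<le> t \<Longrightarrow> t \<le> T \<Longrightarrow> 0 \<le> \<omega> s t"
  using control by (auto simp: is_control_def Simplex_def)

lemma control_refl: "0 \<le> t \<Longrightarrow> t \<le> T \<Longrightarrow> \<omega> t t = 0"
  using control by (auto simp: is_control_def)

lemma control_superadd: "0 \<le> s \<Longrightarrow> s \<le> u \<Longrightarrow> u \<le> t \<Longrightarrow> t \<le> T \<Longrightarrow> \<omega> s u + \<omega> u t \<le> \<omega> s t"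
  using control by (auto simp: is_control_def)

lemma control_mono:
  assumes "0 \<le> s'" "s' \<le> s" "s \<le> t" "t \<le> t'" "t' \<le> T"
  shows "\<omega> s t \<le> \<omega> s' t'"
proof -
  have "\<omega> s t \<le> \<omega> s' t"
    using control_superadd[of s' s t] control_nonneg[of s' s] assms by linarith
  also have "\<dots> \<le> \<omega> s' t'"
    using control_superadd[of s' t t'] control_nonneg[of t t'] assms by linarith
  finally show ?thesis .
qed

text \<open>The intermediate value theorem halves \<open>\<omega> s u\<close> as a function of
  \<open>u\<close>; superadditivity bounds the other part by the remaining half.\<close>

lemma control_midpoint:
  assumes "0 \<le> s" "s \<le> t" "t \<le> T"
  obtains u where "s \<le> u" "u \<le> t" "\<omega> s u \<le> \<omega> s t / 2" "\<omega> u t \<le> \<omega> s t / 2"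
proof -
  have "continuous_on {s..t} (\<lambda>u. (\<lambda>(s, t). \<omega> s t) (s, u))"
    by (rule continuous_on_compose2[of "Simplex T"])
      (use control assms in \<open>auto simp: is_control_def Simplex_def intro!: continuous_intros\<close>)
  then have "continuous_on {s..t} (\<lambda>u. \<omega> s u)" by simp
  moreover have "\<omega> s s \<le> \<omega> s t / 2" "\<omega> s t / 2 \<le> \<omega> s t"
    using control_nonneg[of s t] control_refl[of s] assms by auto
  ultimately obtain u where u: "s \<le> u" "u \<le> t" "\<omega> s u = \<omega> s t / 2"
    using IVT'[of "\<lambda>u. \<omega> s u" s "\<omega> s t / 2" t] assms by auto
  then show thesis
    using control_superadd[of s u t] assms by (intro that[of u]) auto
qed

lemma half_powr_\<theta>:
  assumes "0 \<le> a" "a \<le> b / 2"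
  shows "a powr \<theta> \<le> (1/2) powr \<theta> * b powr \<theta>"
proof -
  have "a powr \<theta> \<le> (b / 2) powr \<theta>"
    by (rule powr_mono2) (use assms \<theta>_gt_1 in auto)
  also have "\<dots> = (1/2) powr \<theta> * b powr \<theta>"
    by (subst powr_mult[symmetric]) (use assms in auto)
  finally show ?thesis .
qed

lemma two_half_powr_\<theta>: "2 * (1/2) powr \<theta> < 1" "0 \<le> (2::real) * (1/2) powr \<theta>"
proof -
  have "(1/2) powr \<theta> < (1/2::real) powr 1"
    using \<theta>_gt_1 by (intro powr_less_mono') auto
  then show "2 * (1/2) powr \<theta> < (1::real)" by simp
qed simp

text \<open>Each bisection at a point that halves the control multiplies the bound by
  \<open>2 * (1/2) powr \<theta>\<close>, which is below one; iterating drives the bound to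
  zero.\<close>

lemma additive_eq_0:
  fixes D :: "real \<Rightarrow> real \<Rightarrow> real"
  assumes add: "\<And>s u t. 0 \<le> s \<Longrightarrow> s \<le> u \<Longrightarrow> u \<le> t \<Longrightarrow> t \<le> T \<Longrightarrow> D s t = D s u + D u t"
    and bd: "\<And>s t. 0 \<le> s \<Longrightarrow> s \<le> t \<Longrightarrow> t \<le> T \<Longrightarrow> \<bar>D s t\<bar> \<le> K * \<omega> s t powr \<theta>"
    and st: "0 \<le> s" "s \<le> t" "t \<le> T"
  shows "D s t = 0"
proof -
  define q where "q = 2 * (1/2::real) powr \<theta>"
  have q: "0 \<le> q" "q < 1" using two_half_powr_\<theta> by (auto simp: q_def)
  have K: "\<bar>D s t\<bar> \<le> \<bar>K\<bar> * q ^ n * \<omega> s t powr \<theta>" if "0 \<le> s" "s \<le> t" "t \<le> T" for s t n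
    using that
  proof (induction n arbitrary: s t)
    case 0
    then show ?case
      using order_trans[OF bd[of s t] mult_right_mono[of K "\<bar>K\<bar>" "\<omega> s t powr \<theta>"]] by simp
  next
    case (Suc n)
    obtain u where u: "s \<le> u" "u \<le> t" "\<omega> s u \<le> \<omega> s t / 2" "\<omega> u t \<le> \<omega> s t / 2"
      using control_midpoint[OF Suc.prems] by blast
    have h: "\<omega> s u powr \<theta> \<le> (1/2) powr \<theta> * \<omega> s t powr \<theta>" "\<omega> u t powr \<theta> \<le> (1/2) powr \<theta> * \<omega> s t powr \<theta>"
      using u Suc.prems by (auto intro!: half_powr_\<theta> control_nonneg)
    have "\<bar>D s t\<bar> \<le> \<bar>D s u\<bar> + \<bar>D u t\<bar>"
      using add[of s u t] u Suc.prems by simp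
    also have "\<dots> \<le> \<bar>K\<bar> * q ^ n * \<omega> s u powr \<theta> + \<bar>K\<bar> * q ^ n * \<omega> u t powr \<theta>"
      using Suc.IH[of s u] Suc.IH[of u t] u Suc.prems by auto
    also have "\<dots> \<le> \<bar>K\<bar> * q ^ n * ((1/2) powr \<theta> * \<omega> s t powr \<theta>) + \<bar>K\<bar> * q ^ n * ((1/2) powr \<theta> * \<omega> s t powr \<theta>)"
      using h q by (intro add_mono mult_left_mono) auto
    also have "\<dots> = \<bar>K\<bar> * q ^ Suc n * \<omega> s t powr \<theta>"
      by (simp add: q_def)
    finally show ?case .
  qed
  have "(\<lambda>n. \<bar>K\<bar> * q ^ n * \<omega> s t powr \<theta>) \<longlonglongrightarrow> \<bar>K\<bar> * 0 * \<omega> s t powr \<theta>"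
    by (intro tendsto_intros LIMSEQ_realpow_zero q)
  then have "\<bar>D s t\<bar> \<le> 0"
    using K[OF st] by (intro LIMSEQ_le_const[where a = "\<bar>D s t\<bar>"]) auto
  then show ?thesis by simp
qed

text \<open>
  Young's argument: cut the partition at the last point before half of the control is used up.
\<close>

lemma sewing_partition:
  fixes \<Xi> :: "real \<Rightarrow> real \<Rightarrow> real" and \<tau> :: "nat \<Rightarrow> real"
  assumes L: "0 \<le> L"
    and \<delta>: "\<And>s u t. 0 \<le> s \<Longrightarrow> s \<le> u \<Longrightarrow> u \<le> t \<Longrightarrow> t \<le> T \<Longrightarrow>
      \<bar>\<Xi> s t - \<Xi> s u - \<Xi> u t\<bar> \<le> L * \<omega> s t powr \<theta>"
    and \<tau>: "\<And>i j. i \<le> j \<Longrightarrow> j \<le> n \<Longrightarrow> \<tau> i \<le> \<tau> j" "0 \<le> \<tau> 0" "\<tau> n \<le> T"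
    and ab: "a \<le> b" "b \<le> n"
  shows "\<bar>(\<Sum>i\<in>{a..<b}. \<Xi> (\<tau> i) (\<tau> (Suc i))) - \<Xi> (\<tau> a) (\<tau> b)\<bar>
     \<le> 2 * L / (1 - 2 * (1/2) powr \<theta>) * \<omega> (\<tau> a) (\<tau> b) powr \<theta>"
  using ab
proof (induction "b - a" arbitrary: a b rule: less_induct)
  case less
  define K where "K = 2 * L / (1 - 2 * (1/2) powr \<theta>)"
  \<comment> \<open>Fixed point of the recursion: two parts that carry at most half of the control
    each, and two defects of the germ.\<close>
  have K: "K = 2 * K * (1/2) powr \<theta> + 2 * L"
  proof -
    have "K * (1 - 2 * (1/2) powr \<theta>) = 2 * L"
      using two_half_powr_\<theta> by (simp add: K_def)
    then show ?thesis by (simp add: algebra_simps)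
  qed
  have \<tau>0: "0 \<le> \<tau> i" "\<tau> i \<le> T" if "i \<le> n" for i
    using \<tau>(1)[of 0 i] \<tau>(1)[of i n] \<tau>(2,3) that by auto
  show ?case
  proof (cases "a = b")
    case True
    have "\<Xi> (\<tau> a) (\<tau> a) = 0"
      using \<delta>[of "\<tau> a" "\<tau> a" "\<tau> a"] \<tau>0[of a] less.prems \<theta>_gt_1 by (simp add: control_refl)
    then show ?thesis using True \<tau>0[of a] less.prems \<theta>_gt_1 by (simp add: control_refl)
  next
    case False
    then have "a < b" using less.prems by simp
    define W where "W = \<omega> (\<tau> a) (\<tau> b)"
    have W0: "0 \<le> W" unfolding W_def using less.prems \<tau>0 \<tau>(1) by (intro control_nonneg) auto
    define J where "J = {j \<in> {a..<b}. \<omega> (\<tau> a) (\<tau> j) \<le> W / 2}"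
    have J: "a \<in> J" "finite J"
      using \<open>a < b\<close> W0 control_refl[OF \<tau>0[of a]] less.prems by (simp_all add: J_def)
    define j where "j = Max J"
    have "j \<in> J" unfolding j_def using J by (intro Max_in) auto
    then have j: "a \<le> j" "j < b" "\<omega> (\<tau> a) (\<tau> j) \<le> W / 2" by (auto simp: J_def)
    have j2: "\<omega> (\<tau> (Suc j)) (\<tau> b) \<le> W / 2"
    proof (cases "Suc j = b")
      case True
      then show ?thesis using control_refl[OF \<tau>0[of b]] less.prems W0 by simp
    next
      case False
      have "\<not> \<omega> (\<tau> a) (\<tau> (Suc j)) \<le> W / 2"
      proof
        assume "\<omega> (\<tau> a) (\<tau> (Suc j)) \<le> W / 2"
        then have "Suc j \<in> J" using j False by (simp add: J_def)
        then have "Suc j \<le> j" unfolding j_def by (intro Max_ge J)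
        then show False by simp
      qed
      then show ?thesis
        using control_superadd[of "\<tau> a" "\<tau> (Suc j)" "\<tau> b"] \<tau>0 \<tau>(1) j less.prems by (simp add: W_def)
    qed
    let ?S = "\<lambda>a b. (\<Sum>i\<in>{a..<b}. \<Xi> (\<tau> i) (\<tau> (Suc i)))"
    have K0: "0 \<le> K"
      using L two_half_powr_\<theta> by (simp add: K_def)
    have Kmono: "K * \<omega> (\<tau> c) (\<tau> d) powr \<theta> \<le> K * ((1/2) powr \<theta> * W powr \<theta>)"
      if cd: "a \<le> c" "c \<le> d" "d \<le> b" "\<omega> (\<tau> c) (\<tau> d) \<le> W / 2" for c d
      using K0 cd \<tau>0 \<tau>(1) less.prems by (intro mult_left_mono half_powr_\<theta> control_nonneg) auto
    have 1: "\<bar>?S a j - \<Xi> (\<tau> a) (\<tau> j)\<bar> \<le> K * ((1/2) powr \<theta> * W powr \<theta>)"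
      by (rule order_trans[OF less.hyps[of j a, folded K_def] Kmono[of a j]]) (use j less.prems in auto)
    have 2: "\<bar>?S (Suc j) b - \<Xi> (\<tau> (Suc j)) (\<tau> b)\<bar> \<le> K * ((1/2) powr \<theta> * W powr \<theta>)"
      by (rule order_trans[OF less.hyps[of b "Suc j", folded K_def] Kmono[of "Suc j" b]])
        (use j j2 less.prems in auto)
    \<comment> \<open>The interval from \<open>j\<close> to \<open>Suc j\<close> may carry any share
      of the control, so it is kept as one value of the germ; joining it to its neighbours costs one
      defect at \<open>j\<close> and one at \<open>Suc j\<close>.\<close>
    have "?S a b = ?S a j + \<Xi> (\<tau> j) (\<tau> (Suc j)) + ?S (Suc j) b"
      using sum.atLeastLessThan_concat[of a j b "\<lambda>i. \<Xi> (\<tau> i) (\<tau> (Suc i))"] j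
      by (simp add: sum.atLeast_Suc_lessThan)
    moreover have "\<bar>\<Xi> (\<tau> a) (\<tau> b) - \<Xi> (\<tau> a) (\<tau> j) - \<Xi> (\<tau> j) (\<tau> b)\<bar> \<le> L * W powr \<theta>"
      unfolding W_def using j less.prems \<tau>0 \<tau>(1) by (intro \<delta>) auto
    moreover have "\<bar>\<Xi> (\<tau> j) (\<tau> b) - \<Xi> (\<tau> j) (\<tau> (Suc j)) - \<Xi> (\<tau> (Suc j)) (\<tau> b)\<bar> \<le> L * W powr \<theta>"
    proof -
      have "\<bar>\<Xi> (\<tau> j) (\<tau> b) - \<Xi> (\<tau> j) (\<tau> (Suc j)) - \<Xi> (\<tau> (Suc j)) (\<tau> b)\<bar> \<le> L * \<omega> (\<tau> j) (\<tau> b) powr \<theta>"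
        using j less.prems \<tau>0 \<tau>(1) by (intro \<delta>) auto
      also have "\<dots> \<le> L * W powr \<theta>"
        unfolding W_def using L j less.prems \<tau>0 \<tau>(1) \<theta>_gt_1
        by (intro mult_left_mono powr_mono2 control_mono control_nonneg) auto
      finally show ?thesis .
    qed
    ultimately have "\<bar>?S a b - \<Xi> (\<tau> a) (\<tau> b)\<bar> \<le> 2 * (K * ((1/2) powr \<theta> * W powr \<theta>)) + 2 * (L * W powr \<theta>)"
      using 1 2 by linarith
    also have "\<dots> = (2 * K * (1/2) powr \<theta> + 2 * L) * W powr \<theta>"
      by (simp add: algebra_simps)
    finally show ?thesis unfolding K[symmetric] by (simp add: K_def W_def)
  qed
qed

text \<open>Partial sums of the germ along the sorted points of \<open>D\<close>. The partition
  estimate holds between any two points of \<open>D\<close> with a constant that does not depend on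
  \<open>D\<close>, which is the uniformity that compactness needs.\<close>

lemma sewing_finite:
  fixes \<Xi> :: "real \<Rightarrow> real \<Rightarrow> real"
  assumes L: "0 \<le> L"
    and \<delta>: "\<And>s u t. 0 \<le> s \<Longrightarrow> s \<le> u \<Longrightarrow> u \<le> t \<Longrightarrow> t \<le> T \<Longrightarrow>
      \<bar>\<Xi> s t - \<Xi> s u - \<Xi> u t\<bar> \<le> L * \<omega> s t powr \<theta>"
    and D: "finite D" "D \<subseteq> {0..T}" "0 \<in> D"
  obtains I where "I 0 = (0::real)" "\<And>x. x \<notin> D \<Longrightarrow> I x = 0"
    "\<And>s t. s \<in> D \<Longrightarrow> t \<in> D \<Longrightarrow> s \<le> t \<Longrightarrow>
      \<bar>I t - I s - \<Xi> s t\<bar> \<le> 2 * L / (1 - 2 * (1/2) powr \<theta>) * \<omega> s t powr \<theta>"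
proof -
  define xs where "xs = sorted_list_of_set D"
  have xs: "sorted_wrt (<) xs" "set xs = D" "distinct xs"
    using D by (auto simp: xs_def)
  define n where "n = length xs"
  have n: "0 < n" using xs(2) D(3) by (auto simp: n_def)
  define \<tau> where "\<tau> i = xs ! i" for i
  have mono: "\<tau> i \<le> \<tau> j" if "i \<le> j" "j \<le> n - 1" for i j
  proof -
    have "j < length xs" using that(2) n unfolding n_def by linarith
    with that(1) xs(1) show ?thesis
      unfolding \<tau>_def by (intro sorted_nth_mono) (simp_all add: strict_sorted_iff)
  qed
  have in_D: "\<tau> i \<in> D" if "i \<le> n - 1" for i
  proof -
    have "i < length xs" using that n unfolding n_def by linarith
    then show ?thesis unfolding \<tau>_def xs(2)[symmetric] by (rule nth_mem)
  qed
  have "\<exists>k. \<forall>x\<in>D. k x \<le> n - 1 \<and> \<tau> (k x) = x"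
  proof (rule bchoice, rule ballI)
    fix x assume "x \<in> D"
    then obtain k where "k < length xs" "xs ! k = x" using xs(2) by (metis in_set_conv_nth)
    then show "\<exists>k. k \<le> n - 1 \<and> \<tau> k = x" by (intro exI[of _ k]) (auto simp: \<tau>_def n_def)
  qed
  then obtain k where k: "\<And>x. x \<in> D \<Longrightarrow> k x \<le> n - 1" "\<And>x. x \<in> D \<Longrightarrow> \<tau> (k x) = x" by blast
  have inj: "i = j" if "\<tau> i = \<tau> j" "i \<le> n - 1" "j \<le> n - 1" for i j
  proof -
    have "i < length xs" "j < length xs" using that n unfolding n_def by linarith+
    with that(1) show ?thesis using nth_eq_iff_index_eq[OF xs(3)] by (simp add: \<tau>_def)
  qed
  have kmono: "k s \<le> k t" if "s \<in> D" "t \<in> D" "s \<le> t" for s t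
    using that k[of s] k[of t] mono[of "k t" "k s"] inj[of "k t" "k s"] by (cases "k s \<le> k t") auto
  define S where "S m = (\<Sum>i\<in>{0..<m}. \<Xi> (\<tau> i) (\<tau> (Suc i)))" for m
  define I where "I x = (if x \<in> D then S (k x) else 0)" for x
  have "\<tau> 0 = 0"
    using k[OF D(3)] mono[of 0 "k 0"] in_D[of 0] D(2) by auto
  then have "k 0 = 0" using inj[of "k 0" 0] k[OF D(3)] by simp
  show thesis
  proof (rule that[of I])
    show "I 0 = 0" by (simp add: I_def S_def \<open>k 0 = 0\<close>)
    show "I x = 0" if "x \<notin> D" for x using that by (simp add: I_def)
    fix s t assume st: "s \<in> D" "t \<in> D" "s \<le> t"
    have "I t - I s = (\<Sum>i\<in>{k s..<k t}. \<Xi> (\<tau> i) (\<tau> (Suc i)))"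
      using sum.atLeastLessThan_concat[of 0 "k s" "k t" "\<lambda>i. \<Xi> (\<tau> i) (\<tau> (Suc i))"] kmono[OF st] st
      by (simp add: I_def S_def)
    moreover have "\<bar>(\<Sum>i\<in>{k s..<k t}. \<Xi> (\<tau> i) (\<tau> (Suc i))) - \<Xi> (\<tau> (k s)) (\<tau> (k t))\<bar>
        \<le> 2 * L / (1 - 2 * (1/2) powr \<theta>) * \<omega> (\<tau> (k s)) (\<tau> (k t)) powr \<theta>"
    proof (rule sewing_partition[OF L])
      show "0 \<le> \<tau> 0" "\<tau> (n - 1) \<le> T"
        using in_D[of 0] in_D[of "n - 1"] D(2) by (auto dest: subsetD)
      show "k s \<le> k t" by (rule kmono[OF st])
      show "k t \<le> n - 1" by (rule k(1)[OF st(2)])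
    qed (fact \<delta>, fact mono)
    ultimately show "\<bar>I t - I s - \<Xi> s t\<bar> \<le> 2 * L / (1 - 2 * (1/2) powr \<theta>) * \<omega> s t powr \<theta>"
      by (simp only: k(2)[OF st(1)] k(2)[OF st(2)])
  qed
qed

text \<open>Passage from finite sets of points to the whole interval by Tychonoff's theorem.\<close>

lemma sewing:
  fixes \<Xi> :: "real \<Rightarrow> real \<Rightarrow> real"
  assumes L: "0 \<le> L"
    and \<delta>: "\<And>s u t. 0 \<le> s \<Longrightarrow> s \<le> u \<Longrightarrow> u \<le> t \<Longrightarrow> t \<le> T \<Longrightarrow>
      \<bar>\<Xi> s t - \<Xi> s u - \<Xi> u t\<bar> \<le> L * \<omega> s t powr \<theta>"
  obtains I K where "I 0 = (0::real)"
    "\<And>s t. 0 \<le> s \<Longrightarrow> s \<le> t \<Longrightarrow> t \<le> T \<Longrightarrow> \<bar>I t - I s - \<Xi> s t\<bar> \<le> K * \<omega> s t powr \<theta>"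
proof -
  define K where "K = 2 * L / (1 - 2 * (1/2) powr \<theta>)"
  \<comment> \<open>The estimate at \<open>s = 0\<close>, with \<open>I 0 = 0\<close>, confines the
    value at \<open>x\<close> to this radius whatever finite set was used; outside the interval the
    value is zero.\<close>
  define M where "M x = (if x \<in> {0..T} then \<bar>\<Xi> 0 x\<bar> + K * \<omega> 0 x powr \<theta> else 0)" for x
  define B where "B = PiE UNIV (\<lambda>x. cball (0::real) (M x))"
  define E where "E = (\<lambda>(s, t). {I. \<bar>I t - I s - \<Xi> s t\<bar> \<le> K * \<omega> s t powr \<theta>})"
  define Z where "Z = {I :: real \<Rightarrow> real. I 0 = 0}"
  have c1: "compact B"
    unfolding B_def compactin_euclidean_iff[symmetric] euclidean_product_topology[symmetric]
    by (simp add: compactin_PiE)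
  have c2: "closed A" if "A \<in> insert Z (E ` Simplex T)" for A
  proof -
    note cont = continuous_on_product_coordinates continuous_on_diff continuous_on_const continuous_on_rabs
    have "closed Z" unfolding Z_def by (intro closed_Collect_eq cont)
    moreover have "closed (E (s, t))" for s t
      unfolding E_def prod.case by (intro closed_Collect_le cont)
    ultimately show ?thesis using that by auto
  qed
  \<comment> \<open>Finitely many conditions involve finitely many points, and for these
    \<open>sewing_finite\<close> provides a path in the box.\<close>
  have c3: "B \<inter> \<Inter> \<A> \<noteq> {}" if fin: "finite \<A>" and sub: "\<A> \<subseteq> insert Z (E ` Simplex T)" for \<A>
  proof -
    from fin sub obtain P where P: "finite P" "P \<subseteq> Simplex T" "\<A> \<subseteq> insert Z (E ` P)"
    proof -
      have "\<A> - {Z} \<subseteq> E ` Simplex T" using sub by auto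
      from finite_subset_image[OF finite_Diff[OF fin] this]
      obtain P where P: "P \<subseteq> Simplex T" "finite P" "\<A> - {Z} = E ` P" by blast
      have "\<A> \<subseteq> insert Z (\<A> - {Z})" by blast
      then show thesis using P by (intro that[of P]) simp_all
    qed
    define D where "D = insert 0 (fst ` P \<union> snd ` P)"
    have D: "finite D" "D \<subseteq> {0..T}" "0 \<in> D"
      using P T_pos by (auto simp: D_def Simplex_def)
    obtain I where I: "I 0 = (0::real)" "\<And>x. x \<notin> D \<Longrightarrow> I x = 0"
      "\<And>s t. s \<in> D \<Longrightarrow> t \<in> D \<Longrightarrow> s \<le> t \<Longrightarrow> \<bar>I t - I s - \<Xi> s t\<bar> \<le> K * \<omega> s t powr \<theta>"
      using sewing_finite[OF L \<delta> D] unfolding K_def by blast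
    have "I \<in> B"
    proof -
      have Kn: "0 \<le> K * \<omega> 0 x powr \<theta>" if "x \<in> {0..T}" for x
        using L two_half_powr_\<theta> by (auto simp: K_def)
      have "\<bar>I x\<bar> \<le> M x" for x
      proof (cases "x \<in> D")
        case True
        then show ?thesis using I(3)[of 0 x] I(1) D by (auto simp: M_def)
      next
        case False
        then show ?thesis using I(2) Kn[of x] by (auto simp: M_def)
      qed
      then show ?thesis by (auto simp: B_def)
    qed
    moreover have "I \<in> E z" if "z \<in> P" for z
    proof -
      obtain s t where z: "z = (s, t)" by fastforce
      with that P(2) have "s \<in> D" "t \<in> D" "s \<le> t" by (force simp: D_def Simplex_def)+
      then show ?thesis using I(3) by (simp add: z E_def)
    qed
    moreover have "I \<in> Z" using I(1) by (simp add: Z_def)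
    ultimately have "I \<in> B \<inter> \<Inter> \<A>" using P(3) by blast
    then show ?thesis by blast
  qed
  have "B \<inter> \<Inter> (insert Z (E ` Simplex T)) \<noteq> {}"
    by (rule compact_imp_fip[OF c1 c2 c3])
  then obtain I where "I \<in> Z" "\<And>z. z \<in> Simplex T \<Longrightarrow> I \<in> E z" by blast
  then show thesis
    by (intro that[of I K]) (force simp: Z_def E_def Simplex_def)+
qed

end

section \<open>Translation of functionals by an approximate character\<close>

text \<open>For a principal filter nothing is asymptotic: the bound holds on all of \<open>S\<close>
  with one constant. The Landau rules for sums and products then take care of the constants.\<close>

lemma bigo_principal_iff: "f \<in> O[principal S](g) \<longleftrightarrow> (\<exists>C. \<forall>z\<in>S. norm (f z) \<le> C * norm (g z))"
proof
  assume "f \<in> O[principal S](g)"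
  then show "\<exists>C. \<forall>z\<in>S. norm (f z) \<le> C * norm (g z)"
    by (elim landau_o.bigE) (auto simp: eventually_principal)
next
  assume "\<exists>C. \<forall>z\<in>S. norm (f z) \<le> C * norm (g z)"
  then show "f \<in> O[principal S](g)"
    by (auto simp: eventually_principal intro: bigoI)
qed

lemma bigo_principal_cong:
  "(\<And>z. z \<in> S \<Longrightarrow> f z = g z) \<Longrightarrow> f \<in> O[principal S](h) \<longleftrightarrow> g \<in> O[principal S](h)"
  by (auto simp: bigo_principal_iff)

lemma bounded_mult:
  fixes f g :: "'a \<Rightarrow> real"
  shows "f \<in> O[F](\<lambda>_. 1) \<Longrightarrow> g \<in> O[F](\<lambda>_. 1) \<Longrightarrow> (\<lambda>z. f z * g z) \<in> O[F](\<lambda>_. 1)"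
  using landau_o.big.mult[of f F "\<lambda>_. 1" g "\<lambda>_. 1"] by simp

lemma split_sum_in_bigo:
  assumes "\<And>l r. (l, r) \<in> set (splits w) \<Longrightarrow> (\<lambda>z. \<phi> z l r) \<in> O[F](g)"
  shows "(\<lambda>z. split_sum (\<phi> z) w) \<in> O[F](g)"
proof -
  have "(\<lambda>z. \<Sum>(l, r)\<leftarrow>ps. \<phi> z l r) \<in> O[F](g)" if "set ps \<subseteq> set (splits w)" for ps
    using that
  proof (induction ps)
    case (Cons q ps)
    then show ?case
      by (cases q) (auto intro!: sum_in_bigo assms)
  qed simp
  then show ?thesis by (simp add: split_sum_def)
qed

text \<open>
  The functional \<open>y \<mapsto> \<langle>f, x \<otimes> y\<rangle>\<close> of the definition of a controlled path.
\<close>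

definition translate :: "nat \<Rightarrow> ('v::euclidean_space list \<Rightarrow> real) \<Rightarrow> ('v list \<Rightarrow> real) \<Rightarrow> 'v list \<Rightarrow> real" where
  "translate N x f y = (\<Sum>w\<in>words_upto N. x w * f (w @ y))"

lemma translate_deriv: "translate N x f (y @ [b]) = translate N x (deriv_word b f) y"
  by (simp add: translate_def)

lemma translate_shift: "translate N x (\<lambda>v. f (v @ l)) [] = translate N x f l"
  by (simp add: translate_def)

lemma shuffle_prod_append:
  "shuffle_prod f g (w @ y) = split_sum (\<lambda>l r. shuffle_prod (\<lambda>v. f (v @ l)) (\<lambda>v. g (v @ r)) w) y"
  by (simp add: shuffle_prod_def split_sum_append)

text \<open>Splitting the fixed tail \<open>y\<close> first leaves shuffle products on the
  translated part only, so the case of the empty tail decides the general one.\<close>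

lemma translate_shuffle_prod:
  "translate N x (shuffle_prod f g) y =
     split_sum (\<lambda>l r. translate N x (shuffle_prod (\<lambda>v. f (v @ l)) (\<lambda>v. g (v @ r))) []) y"
  unfolding translate_def shuffle_prod_append
  by (simp add: split_sum_sum split_sum_mult_left)

lemma sum_delta_word:
  assumes "l \<in> words_upto N"
  shows "(\<Sum>v\<in>words_upto N. f v * delta_word v l) = f l"
proof -
  have "(\<Sum>v\<in>words_upto N. f v * delta_word v l) = (\<Sum>v\<in>words_upto N. if v = l then f l else 0)"
    by (intro sum.cong) (auto simp: delta_word_def)
  then show ?thesis using assms by simp
qed

lemma shuffle_prod_expand:
  assumes "u \<in> words_upto N"
  shows "shuffle_prod f g u =
    (\<Sum>v\<in>words_upto N. \<Sum>w\<in>words_upto N. f v * g w * shuffle_prod (delta_word v) (delta_word w) u)"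
proof -
  have "shuffle_prod f g u = shuffle_prod (\<lambda>l. \<Sum>v\<in>words_upto N. f v * delta_word v l)
      (\<lambda>l. \<Sum>w\<in>words_upto N. g w * delta_word w l) u"
    by (rule shuffle_prod_cong; rule sum_delta_word[symmetric]) (use assms in \<open>auto simp: words_upto_def\<close>)
  also have "\<dots> = (\<Sum>v\<in>words_upto N. \<Sum>w\<in>words_upto N. f v * g w * shuffle_prod (delta_word v) (delta_word w) u)"
    by (simp add: shuffle_prod_sum_left shuffle_prod_sum_right shuffle_prod_mult_left
        shuffle_prod_mult_right sum_distrib_left mult_ac)
  finally show ?thesis .
qed

text \<open>A character of the shuffle algebra truncated at degree \<open>N\<close>. Beyond that
  degree there are no components to compare, and this is the source of the errors of order
  \<open>N + 1\<close>.\<close>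

definition is_character :: "nat \<Rightarrow> ('v::euclidean_space list \<Rightarrow> real) \<Rightarrow> bool" where
  "is_character N x \<longleftrightarrow> x [] = 1 \<and> (\<forall>v w. length v + length w \<le> N \<longrightarrow> set v \<subseteq> Basis \<longrightarrow> set w \<subseteq> Basis \<longrightarrow>
     x v * x w = (\<Sum>u\<in>words (length v + length w). x u * shuffle_prod (delta_word v) (delta_word w) u))"

text \<open>Expand both functionals in the dual basis and apply the shuffle relation to each pair.
  Pairs of total degree above \<open>N\<close> drop out here, whereas they are present in the
  product of the two pairings.\<close>

lemma translate_shuffle_prod_Nil:
  assumes x: "is_character N x"
  shows "translate N x (shuffle_prod f g) [] =
    (\<Sum>v\<in>words_upto N. \<Sum>w\<in>words_upto N. if length v + length w \<le> N then x v * x w * (f v * g w) else 0)"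
proof -
  have inner: "(\<Sum>u\<in>words_upto N. x u * shuffle_prod (delta_word v) (delta_word w) u)
      = (if length v + length w \<le> N then x v * x w else 0)"
    if vw: "v \<in> words_upto N" "w \<in> words_upto N" for v w
  proof (cases "length v + length w \<le> N")
    case True
    have "(\<Sum>u\<in>words_upto N. x u * shuffle_prod (delta_word v) (delta_word w) u)
        = (\<Sum>u\<in>words (length v + length w). x u * shuffle_prod (delta_word v) (delta_word w) u)"
    proof (rule sum.mono_neutral_right)
      show "\<forall>u\<in>words_upto N - words (length v + length w). x u * shuffle_prod (delta_word v) (delta_word w) u = 0"
      proof
        fix u :: "'a list" assume "u \<in> words_upto N - words (length v + length w)"
        then have "length u \<noteq> length v + length w" by (auto simp: words_def words_upto_def)
        then show "x u * shuffle_prod (delta_word v) (delta_word w) u = 0"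
          by (simp add: shuffle_prod_delta_eq_0)
      qed
    qed (simp, use True in \<open>auto simp: words_def words_upto_def\<close>)
    then show ?thesis using x True vw by (simp add: is_character_def words_upto_def)
  next
    case False
    have "shuffle_prod (delta_word v) (delta_word w) u = 0" if "u \<in> words_upto N" for u
      using that False by (intro shuffle_prod_delta_eq_0) (auto simp: words_upto_def)
    then show ?thesis using False by simp
  qed
  have "translate N x (shuffle_prod f g) [] =
     (\<Sum>u\<in>words_upto N. \<Sum>v\<in>words_upto N. \<Sum>w\<in>words_upto N. f v * g w * (x u * shuffle_prod (delta_word v) (delta_word w) u))"
    by (simp add: translate_def shuffle_prod_expand[where f = f] sum_distrib_left mult_ac)
  also have "\<dots> = (\<Sum>v\<in>words_upto N. \<Sum>w\<in>words_upto N. \<Sum>u\<in>words_upto N. f v * g w * (x u * shuffle_prod (delta_word v) (delta_word w) u))"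
    by (rule trans[OF sum.swap], rule sum.cong[OF refl], rule sum.swap)
  also have "\<dots> = (\<Sum>v\<in>words_upto N. \<Sum>w\<in>words_upto N. f v * g w * (if length v + length w \<le> N then x v * x w else 0))"
    by (intro sum.cong refl) (simp add: sum_distrib_left[symmetric] inner)
  also have "\<dots> = (\<Sum>v\<in>words_upto N. \<Sum>w\<in>words_upto N. if length v + length w \<le> N then x v * x w * (f v * g w) else 0)"
    by (intro sum.cong refl) (simp add: mult_ac)
  finally show ?thesis .
qed

section \<open>Orders graded by powers of the control\<close>

locale graded_bounds =
  fixes S :: "'z set" and r :: "'z \<Rightarrow> real"
  assumes r_bounded: "r \<in> O[principal S](\<lambda>_. 1)"
begin

abbreviation order_ge :: "nat \<Rightarrow> ('z \<Rightarrow> real) set" where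
  "order_ge n \<equiv> O[principal S](\<lambda>z. r z ^ n)"

lemma order_ge_mult: "f \<in> order_ge m \<Longrightarrow> g \<in> order_ge n \<Longrightarrow> (\<lambda>z. f z * g z) \<in> order_ge (m + n)"
  using landau_o.big.mult[of f "principal S" "\<lambda>z. r z ^ m" g "\<lambda>z. r z ^ n"] by (simp add: power_add)

lemma order_ge_mono:
  assumes "f \<in> order_ge m" "n \<le> m"
  shows "f \<in> order_ge n"
proof -
  have "(\<lambda>z. r z ^ (m - n)) \<in> O[principal S](\<lambda>z. 1 ^ (m - n))"
    by (intro landau_o.big_power r_bounded)
  then have "(\<lambda>z. r z ^ n * r z ^ (m - n)) \<in> O[principal S](\<lambda>z. r z ^ n * 1)"
    by (intro landau_o.big.mult) simp_all
  then have "(\<lambda>z. r z ^ m) \<in> order_ge n"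
    using assms(2) by (simp flip: power_add)
  with assms(1) show ?thesis by (rule landau_o.big_trans)
qed

lemma order_ge_mult':
  "f \<in> order_ge m \<Longrightarrow> g \<in> order_ge n \<Longrightarrow> k \<le> m + n \<Longrightarrow> (\<lambda>z. f z * g z) \<in> order_ge k"
  by (rule order_ge_mono[OF order_ge_mult])

lemma order_ge_mult_bounded:
  "f \<in> order_ge m \<Longrightarrow> g \<in> O[principal S](\<lambda>_. 1) \<Longrightarrow> (\<lambda>z. f z * g z) \<in> order_ge m"
  using order_ge_mult[of f m g 0] by simp

lemma bounded_mult_order_ge:
  "f \<in> O[principal S](\<lambda>_. 1) \<Longrightarrow> g \<in> order_ge m \<Longrightarrow> (\<lambda>z. f z * g z) \<in> order_ge m"
  using order_ge_mult[of f 0 g m] by simp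

lemma order_ge_bounded: "f \<in> order_ge n \<Longrightarrow> f \<in> O[principal S](\<lambda>_. 1)"
  using order_ge_mono[of f n 0] by simp

end

text \<open>The index set is arbitrary so that the estimates hold both over intervals and over
  triples of points, where \<open>x\<close> belongs to the first of two adjacent intervals.\<close>

locale rough_family = graded_bounds S r
  for S :: "'z set" and r :: "'z \<Rightarrow> real" +
  fixes N :: nat and x :: "'z \<Rightarrow> 'v::euclidean_space list \<Rightarrow> real"
  assumes x_character: "\<And>z. z \<in> S \<Longrightarrow> is_character N (x z)"
    and x_bound: "\<And>w. w \<in> words_upto N \<Longrightarrow> (\<lambda>z. x z w) \<in> order_ge (length w)"
begin

text \<open>Components of length below \<open>m\<close> meet a vanishing value, and all others are
  themselves of order at least \<open>m\<close>.\<close>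

lemma translate_Nil_order:
  assumes "\<And>w. w \<in> words_upto N \<Longrightarrow> (\<lambda>z. f z w) \<in> O[principal S](\<lambda>_. 1)"
    and "\<And>z w. z \<in> S \<Longrightarrow> w \<in> words_upto N \<Longrightarrow> length w < m \<Longrightarrow> f z w = 0"
  shows "(\<lambda>z. translate N (x z) (f z) []) \<in> order_ge m"
  unfolding translate_def
proof (rule big_sum_in_bigo)
  fix w :: "'v list" assume w: "w \<in> words_upto N"
  show "(\<lambda>z. x z w * f z (w @ [])) \<in> order_ge m"
  proof (cases "length w < m")
    case True
    have "(\<lambda>z. x z w * f z (w @ [])) \<in> order_ge m \<longleftrightarrow> (\<lambda>_. 0) \<in> order_ge m"
      by (rule bigo_principal_cong) (simp add: assms(2) w True)
    then show ?thesis by simp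
  next
    case False
    have "(\<lambda>z. x z w * f z (w @ [])) \<in> order_ge (length w)"
      using w by (intro order_ge_mult_bounded x_bound) (simp_all add: assms(1))
    then show ?thesis by (rule order_ge_mono) (use False in simp)
  qed
qed

lemma translate_bounded:
  assumes "\<And>w. (\<lambda>z. f z w) \<in> O[principal S](\<lambda>_. 1)"
  shows "(\<lambda>z. translate N (x z) (f z) y) \<in> O[principal S](\<lambda>_. 1)"
  unfolding translate_def
  using order_ge_bounded[OF x_bound] assms
  by (intro big_sum_in_bigo bounded_mult)

lemma shuffle_prod_bounded:
  assumes "\<And>w. (\<lambda>z. f z w) \<in> O[principal S](\<lambda>_. 1)" "\<And>w. (\<lambda>z. g z w) \<in> O[principal S](\<lambda>_. 1)"
  shows "(\<lambda>z. shuffle_prod (f z) (g z) w) \<in> O[principal S](\<lambda>_. 1 :: real)"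
  unfolding shuffle_prod_def by (intro split_sum_in_bigo bounded_mult assms)

lemma osh_bounded:
  assumes "\<And>u w. (\<lambda>z. h z u w) \<in> O[principal S](\<lambda>_. 1)"
  shows "(\<lambda>z. osh (h z) us w) \<in> O[principal S](\<lambda>_. 1 :: real)"
proof (induction us arbitrary: w rule: rev_induct)
  case Nil
  then show ?case by simp
next
  case (snoc u us)
  show ?case
  proof (cases w rule: rev_cases)
    case (snoc v b)
    show ?thesis unfolding snoc osh_snoc half_shuffle_snoc
      by (intro shuffle_prod_bounded assms snoc.IH)
  qed (simp add: osh_snoc)
qed

text \<open>The difference consists of the pairs of total degree above \<open>N\<close>, each of
  order at least \<open>N + 1\<close>.\<close>

lemma translate_shuffle_prod_Nil_approx:
  assumes f: "\<And>w. (\<lambda>z. f z w) \<in> O[principal S](\<lambda>_. 1)"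
    and g: "\<And>w. (\<lambda>z. g z w) \<in> O[principal S](\<lambda>_. 1)"
  shows "(\<lambda>z. translate N (x z) (shuffle_prod (f z) (g z)) []
      - translate N (x z) (f z) [] * translate N (x z) (g z) []) \<in> order_ge (N + 1)"
proof -
  let ?e = "\<lambda>z v w. if length v + length w \<le> N then 0 else - (x z v * x z w * (f z v * g z w))"
  have "(\<lambda>z. \<Sum>v\<in>words_upto N. \<Sum>w\<in>words_upto N. ?e z v w) \<in> order_ge (N + 1)"
  proof (intro big_sum_in_bigo)
    fix v w :: "'v list" assume vw: "v \<in> words_upto N" "w \<in> words_upto N"
    show "(\<lambda>z. ?e z v w) \<in> order_ge (N + 1)"
    proof (cases "length v + length w \<le> N")
      case False
      have "(\<lambda>z. x z v * x z w * (f z v * g z w)) \<in> order_ge (length v + length w)"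
        by (rule order_ge_mult_bounded[OF order_ge_mult[OF x_bound[OF vw(1)] x_bound[OF vw(2)]] bounded_mult[OF f g]])
      then have "(\<lambda>z. x z v * x z w * (f z v * g z w)) \<in> order_ge (N + 1)"
        by (rule order_ge_mono) (use False in simp)
      then show ?thesis using False by simp
    qed simp
  qed
  moreover have "translate N (x z) (shuffle_prod (f z) (g z)) []
      - translate N (x z) (f z) [] * translate N (x z) (g z) [] = (\<Sum>v\<in>words_upto N. \<Sum>w\<in>words_upto N. ?e z v w)"
    if "z \<in> S" for z
    unfolding translate_shuffle_prod_Nil[OF x_character[OF that]]
    by (simp add: translate_def sum_product sum_subtractf[symmetric] mult_ac cong: sum.cong if_cong)
      (intro sum.cong refl, simp)
  ultimately show ?thesis by (subst bigo_principal_cong) auto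
qed

lemma translate_shuffle_prod_approx:
  assumes f: "\<And>w. (\<lambda>z. f z w) \<in> O[principal S](\<lambda>_. 1)"
    and g: "\<And>w. (\<lambda>z. g z w) \<in> O[principal S](\<lambda>_. 1)"
  shows "(\<lambda>z. translate N (x z) (shuffle_prod (f z) (g z)) y
      - shuffle_prod (translate N (x z) (f z)) (translate N (x z) (g z)) y) \<in> order_ge (N + 1)"
proof -
  have "(\<lambda>z. split_sum (\<lambda>l r. translate N (x z) (shuffle_prod (\<lambda>v. f z (v @ l)) (\<lambda>v. g z (v @ r))) []
      - translate N (x z) (\<lambda>v. f z (v @ l)) [] * translate N (x z) (\<lambda>v. g z (v @ r)) []) y) \<in> order_ge (N + 1)"
    by (intro split_sum_in_bigo translate_shuffle_prod_Nil_approx f g)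
  moreover have "split_sum (\<lambda>l r. a l r - b l r) y = split_sum a y - split_sum b y" for a b :: "'v list \<Rightarrow> 'v list \<Rightarrow> real"
    using split_sum_add[of "\<lambda>l r. a l r - b l r" b y] by simp
  ultimately show ?thesis
    by (simp only: translate_shuffle_prod[of _ _ "f _"] translate_shift shuffle_prod_def[of "translate _ _ _"])
qed

lemma osh_pairing_order:
  assumes "\<And>u w. (\<lambda>z. h z u w) \<in> O[principal S](\<lambda>_. 1)"
  shows "(\<lambda>z. translate N (x z) (osh (h z) us) []) \<in> order_ge (length us)"
  by (intro translate_Nil_order osh_bounded assms) (simp add: osh_eq_0)

text \<open>Pairing with \<open>x\<close> is multiplicative up to order \<open>N + 1\<close>, and
  the product of two iterated half-shuffle products expands exactly over shuffles by
  \<open>osh_shuffle_prod\<close>.\<close>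

lemma osh_pairing_shuffle:
  fixes us vs :: "'u::euclidean_space list"
  assumes h: "\<And>u w. (\<lambda>z. h z u w) \<in> O[principal S](\<lambda>_. 1)"
    and "us \<in> words a" "vs \<in> words b"
  shows "(\<lambda>z. translate N (x z) (osh (h z) us) [] * translate N (x z) (osh (h z) vs) []
     - (\<Sum>us'\<in>words (a + b). translate N (x z) (osh (h z) us') [] * shuffle_prod (delta_word us) (delta_word vs) us'))
     \<in> order_ge (N + 1)"
proof -
  have "translate N (x z) (shuffle_prod (osh (h z) us) (osh (h z) vs)) [] =
      (\<Sum>us'\<in>words (a + b). translate N (x z) (osh (h z) us') [] * shuffle_prod (delta_word us) (delta_word vs) us')" for z
    unfolding translate_def osh_shuffle_prod[OF assms(2,3)]
    by (simp add: sum_distrib_left sum_distrib_right mult_ac) (rule sum.swap)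
  moreover have "(\<lambda>z. translate N (x z) (shuffle_prod (osh (h z) us) (osh (h z) vs)) []
      - translate N (x z) (osh (h z) us) [] * translate N (x z) (osh (h z) vs) []) \<in> order_ge (N + 1)"
    by (rule translate_shuffle_prod_Nil_approx; rule osh_bounded; rule h)
  ultimately show ?thesis
    by (subst landau_o.big.uminus_in_iff[symmetric]) simp
qed

text \<open>
  Deconcatenation: a block of an ordered partition of a concatenated word either ends in the first
  word, and then so do all earlier blocks, or ends in the second, and then its part in the first word
  is integrated out, which turns \<open>h\<close> into \<open>h'\<close>.
\<close>

lemma osh_translate_approx:
  fixes h h' :: "'z \<Rightarrow> 'u \<Rightarrow> 'v list \<Rightarrow> real"
  assumes h: "\<And>u w. (\<lambda>z. h z u w) \<in> O[principal S](\<lambda>_. 1)"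
    and h': "\<And>u w. (\<lambda>z. h' z u w) \<in> O[principal S](\<lambda>_. 1)"
    and ctrl: "\<And>u y. y \<noteq> [] \<Longrightarrow> (\<lambda>z. translate N (x z) (h z u) y - h' z u y) \<in> order_ge (N - length y)"
  shows "(\<lambda>z. translate N (x z) (osh (h z) us) y
      - (\<Sum>i\<le>length us. translate N (x z) (osh (h z) (take i us)) [] * osh (h' z) (drop i us) y))
      \<in> order_ge ((if length us = 1 then N else N + 1) - length y)"
proof (induction us arbitrary: y rule: rev_induct)
  case Nil
  have "translate N x unit_word y = translate N x unit_word [] * unit_word y" for x :: "'v list \<Rightarrow> real"
    by (cases "y = []") (simp_all add: translate_def unit_word_def)
  then show ?case by simp
next
  case (snoc u us)
  let ?Z = "\<lambda>z us. translate N (x z) (osh (h z) us) []"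
  let ?A = "\<lambda>z us y. \<Sum>i\<le>length us. ?Z z (take i us) * osh (h' z) (drop i us) y"
  let ?n = "\<lambda>us y. (if length us = 1 then N else N + 1) - length y"
  have ob: "(\<lambda>z. osh (h z) us w) \<in> O[principal S](\<lambda>_. 1)" "(\<lambda>z. osh (h' z) us w) \<in> O[principal S](\<lambda>_. 1)" for us w
    by (rule osh_bounded, rule h) (rule osh_bounded, rule h')
  have A_bd: "(\<lambda>z. ?A z us y) \<in> O[principal S](\<lambda>_. 1)" for us y
    by (intro big_sum_in_bigo bounded_mult translate_bounded ob)
  have A_Nil: "?A z us [] = ?Z z us" for z us
  proof -
    have "?A z us [] = (\<Sum>i\<le>length us. if i = length us then ?Z z us else 0)"
      by (intro sum.cong refl) (auto simp: osh_at_Nil)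
    then show ?thesis by simp
  qed
  show ?case
  proof (cases y rule: rev_cases)
    case Nil
    then show ?thesis using A_Nil[of _ "us @ [u]"] by simp
  next
    case (snoc y' b)
    let ?T = "\<lambda>z l. translate N (x z) (osh (h z) us) l"
    let ?H = "\<lambda>z r. translate N (x z) (deriv_word b (h z u)) r" and ?H' = "\<lambda>z r. h' z u (r @ [b])"
    have A: "?A z (us @ [u]) y = shuffle_prod (?A z us) (deriv_word b (h' z u)) y'" for z
      by (simp add: snoc osh_snoc half_shuffle_snoc shuffle_prod_sum_left shuffle_prod_mult_left)
    have T: "translate N (x z) (osh (h z) (us @ [u])) y
        = translate N (x z) (shuffle_prod (osh (h z) us) (deriv_word b (h z u))) y'" for z
      using half_shuffle_snoc[of "osh (h z) us" "h z u" "_ @ y'" b]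
      by (simp add: snoc osh_snoc translate_def)
    have 1: "(\<lambda>z. translate N (x z) (shuffle_prod (osh (h z) us) (deriv_word b (h z u))) y'
        - shuffle_prod (?T z) (?H z) y') \<in> order_ge (?n (us @ [u]) y)"
      by (rule order_ge_mono, rule translate_shuffle_prod_approx) (auto intro: ob h)
    \<comment> \<open>The two factors are replaced one after the other. As \<open>b\<close> belongs
      to the last block, \<open>l\<close> is shorter than \<open>y\<close>, so the error from the
      induction hypothesis has the required order even if \<open>us\<close> is a single
      letter.\<close>
    have 2: "(\<lambda>z. split_sum (\<lambda>l r. (?T z l - ?A z us l) * ?H z r + ?A z us l * (?H z r - ?H' z r)) y')
        \<in> order_ge (?n (us @ [u]) y)"
    proof (intro split_sum_in_bigo sum_in_bigo)
      fix l r assume "(l, r) \<in> set (splits y')"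
      note len = in_splitsD(1)[OF this]
      have "(\<lambda>z. (?T z l - ?A z us l) * ?H z r) \<in> order_ge (?n us l)"
        by (intro order_ge_mult_bounded snoc.IH translate_bounded h)
      then show "(\<lambda>z. (?T z l - ?A z us l) * ?H z r) \<in> order_ge (?n (us @ [u]) y)"
        by (rule order_ge_mono) (use len snoc in auto)
      have c: "(\<lambda>z. ?H z r - ?H' z r) \<in> order_ge (N - (length r + 1))"
        using ctrl[of "r @ [b]" u] by (simp add: translate_deriv)
      \<comment> \<open>For empty \<open>l\<close> the word \<open>r @ [b]\<close> is all of
        \<open>y\<close> and \<open>ctrl\<close> is one order short. The expansion of
        \<open>us\<close> at the empty word is the germ itself, of order \<open>length us\<close>,
        and makes up for it. Only \<open>us = []\<close> leaves the deficit, and then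
        \<open>us @ [u]\<close> is a single letter.\<close>
      show "(\<lambda>z. ?A z us l * (?H z r - ?H' z r)) \<in> order_ge (?n (us @ [u]) y)"
      proof (cases "l = [] \<and> us \<noteq> []")
        case True
        have "(\<lambda>z. ?Z z us) \<in> order_ge (length us)"
          by (rule osh_pairing_order) (rule h)
        then have "(\<lambda>z. ?A z us l) \<in> order_ge (length us)"
          using True A_Nil by simp
        moreover have "0 < length us" using True by simp
        then have "?n (us @ [u]) y \<le> length us + (N - (length r + 1))"
          using len snoc True by (cases us) simp_all
        ultimately show ?thesis by (intro order_ge_mult'[OF _ c])
      next
        case False
        have "(\<lambda>z. ?A z us l * (?H z r - ?H' z r)) \<in> order_ge (N - (length r + 1))"
          by (intro bounded_mult_order_ge A_bd c)
        then show ?thesis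
        proof (rule order_ge_mono)
          show "?n (us @ [u]) y \<le> N - (length r + 1)"
          proof (cases "us = []")
            case True
            then show ?thesis using len snoc by simp
          next
            case us: False
            then have "0 < length l" using False by simp
            then show ?thesis using len snoc us by (cases l) simp_all
          qed
        qed
      qed
    qed
    have eq: "split_sum (\<lambda>l r. (?T z l - ?A z us l) * ?H z r + ?A z us l * (?H z r - ?H' z r)) y'
        = shuffle_prod (?T z) (?H z) y' - shuffle_prod (?A z us) (deriv_word b (h' z u)) y'" for z
    proof -
      have "split_sum (\<lambda>l r. (?T z l - ?A z us l) * ?H z r + ?A z us l * (?H z r - ?H' z r)) y' +
          shuffle_prod (?A z us) (deriv_word b (h' z u)) y' = shuffle_prod (?T z) (?H z) y'"
        unfolding shuffle_prod_def split_sum_add[symmetric] by (simp add: algebra_simps)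
      then show ?thesis by linarith
    qed
    show ?thesis
      unfolding A T using sum_in_bigo(1)[OF 1 2] by (simp add: eq)
  qed
qed

end

section \<open>Almost rough paths\<close>

lemma tensor_mult_assoc: "tensor_mult (tensor_mult a b) c w = tensor_mult a (tensor_mult b c) w"
proof -
  let ?n = "length w"
  let ?t = "\<lambda>i j. a (take i w) * b (take (j - i) (drop i w)) * c (drop j w)"
  have "tensor_mult (tensor_mult a b) c w = (\<Sum>j\<le>?n. \<Sum>i\<le>j. ?t i j)"
    unfolding tensor_mult_def sum_distrib_right
    by (intro sum.cong) (auto simp: drop_take min_def)
  also have "\<dots> = (\<Sum>(j, i)\<in>Sigma {..?n} (\<lambda>j. {..j}). ?t i j)"
    by (rule sum.Sigma) auto
  also have "\<dots> = (\<Sum>(i, k)\<in>Sigma {..?n} (\<lambda>i. {..?n - i}). ?t i (i + k))"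
    by (rule sum.reindex_bij_witness[where i = "\<lambda>(i, k). (i + k, i)" and j = "\<lambda>(j, i). (i, j - i)"]) auto
  also have "\<dots> = (\<Sum>i\<le>?n. \<Sum>k\<le>?n - i. ?t i (i + k))"
    by (rule sum.Sigma[symmetric]) auto
  also have "\<dots> = tensor_mult a (tensor_mult b c) w"
    unfolding tensor_mult_def sum_distrib_left
    by (intro sum.cong refl) (simp_all add: add.commute mult.assoc)
  finally show ?thesis .
qed

lemma tensor_mult_cong:
  assumes "\<And>i. i \<le> length w \<Longrightarrow> a (take i w) = a' (take i w)"
    and "\<And>i. i \<le> length w \<Longrightarrow> b (drop i w) = b' (drop i w)"
  shows "tensor_mult a b w = tensor_mult a' b' w"
  unfolding tensor_mult_def using assms by (intro sum.cong) auto

lemma tensor_mult_Nil [simp]: "tensor_mult a b [] = a [] * b []"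
  by (simp add: tensor_mult_def)

lemma tensor_mult_split_first:
  "tensor_mult a b w = a [] * b w + (\<Sum>i\<in>{1..length w}. a (take i w) * b (drop i w))"
  unfolding tensor_mult_def
  by (simp add: atMost_atLeast0 sum.atLeast_Suc_atMost)

lemma tensor_mult_split_last:
  "tensor_mult a b w = a w * b [] + (\<Sum>i<length w. a (take i w) * b (drop i w))"
  unfolding tensor_mult_def by (simp add: lessThan_Suc_atMost[symmetric])

text \<open>Left cancellation in the triangular system formed by Chen's identity: once the right
  factors agree on proper suffixes, only their values at \<open>w\<close> remain.\<close>

lemma tensor_mult_diff_right:
  assumes "a [] = (1::real)" "\<And>i. 1 \<le> i \<Longrightarrow> i \<le> length w \<Longrightarrow> b (drop i w) = c (drop i w)"
  shows "tensor_mult a b w - tensor_mult a c w = b w - c w"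
  using assms by (simp add: tensor_mult_split_first)

lemma in_words_upto_take_drop:
  "w \<in> words_upto m \<Longrightarrow> take i w \<in> words_upto m" "w \<in> words_upto m \<Longrightarrow> drop i w \<in> words_upto m"
  by (auto simp: words_upto_def dest: in_set_takeD in_set_dropD)

text \<open>In each word \<open>u\<close> the sum over shuffles is a sum over splittings of
  \<open>u\<close>, which is the shuffle product of the two dual functionals.\<close>

lemma coproduct_sh_component:
  assumes "v \<in> words a" "w \<in> words b"
  shows "coproduct_sh a b (component (a + b) x) [v, w] =
    (\<Sum>u\<in>words (a + b). x u * shuffle_prod (delta_word v) (delta_word w) u)"
  unfolding coproduct_sh_def coproduct_def
proof (intro sum.cong)
  show "words (sum_list [a, b]) = words (a + b)" by simp
  fix u :: "'a list" assume u: "u \<in> words (a + b)"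
  then have "length u = a + b" by (simp add: words_def)
  have "(\<Sum>\<sigma>\<in>shuffles_of [a, b]. if chop [a, b] (permute_word \<sigma> u) = [v, w] then component (a + b) x u else 0)
     = split_sum (\<lambda>l r. if length l = a then (if [l, r] = [v, w] then component (a + b) x u else 0) else 0) u"
    using sum_shuffles_eq_splits[OF \<open>length u = a + b\<close>, of "\<lambda>ws. if ws = [v, w] then component (a + b) x u else 0"] .
  also have "\<dots> = split_sum (\<lambda>l r. x u * (delta_word v l * delta_word w r)) u"
    by (rule split_sum_cong) (use assms u in \<open>auto simp: delta_word_def words_def component_def\<close>)
  finally show "(\<Sum>\<sigma>\<in>shuffles_of [a, b]. if chop [a, b] (permute_word \<sigma> u) = [v, w] then component (a + b) x u else 0)
     = x u * shuffle_prod (delta_word v) (delta_word w) u"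
    by (simp add: shuffle_prod_def split_sum_mult_left)
qed

section \<open>Shuffle relations under the tensor product\<close>

lemma delta_word_append:
  "delta_word v (x @ y) = (\<Sum>i\<le>length v. delta_word (drop i v) y * delta_word (take i v) x)"
proof -
  have "delta_word (drop i v) y * delta_word (take i v) x = (if i = length x then delta_word v (x @ y) else 0)"
    if "i \<le> length v" for i
  proof (cases "i = length x")
    case True
    have "v = x @ y \<longleftrightarrow> take i v = x \<and> drop i v = y"
      unfolding True by (metis append_take_drop_id append_eq_conv_conj)
    with True show ?thesis by (simp add: delta_word_def)
  next
    case False
    have "take i v \<noteq> x" using that False by (metis length_take min.absorb2)
    with False show ?thesis by (simp add: delta_word_def)
  qed
  then have "(\<Sum>i\<le>length v. delta_word (drop i v) y * delta_word (take i v) x)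
      = (\<Sum>i\<le>length v. if i = length x then delta_word v (x @ y) else 0)"
    by (intro sum.cong) auto
  also have "\<dots> = delta_word v (x @ y)"
    by (auto simp: delta_word_def)
  finally show ?thesis ..
qed

text \<open>Pairing of \<open>x\<close> with the shuffle of \<open>v\<close> and \<open>w\<close>,
  counted with multiplicity.\<close>

definition shuffle_pairing ::
    "('v::euclidean_space list \<Rightarrow> real) \<Rightarrow> 'v list \<Rightarrow> 'v list \<Rightarrow> real" where
  "shuffle_pairing x v w =
     (\<Sum>u\<in>words (length v + length w). x u * shuffle_prod (delta_word v) (delta_word w) u)"

lemma shuffle_prod_delta_append:
  "shuffle_prod (delta_word v) (delta_word w) (u1 @ u2) =
    (\<Sum>i\<le>length v. \<Sum>j\<le>length w. shuffle_prod (delta_word (take i v)) (delta_word (take j w)) u1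
       * shuffle_prod (delta_word (drop i v)) (delta_word (drop j w)) u2)"
proof -
  have "shuffle_prod (delta_word v) (delta_word w) (u1 @ u2) = split_sum (\<lambda>l r.
      \<Sum>i\<le>length v. \<Sum>j\<le>length w. shuffle_prod (delta_word (take i v)) (delta_word (take j w)) u1
       * (delta_word (drop i v) l * delta_word (drop j w) r)) u2"
    unfolding shuffle_prod_append delta_word_append[of v] delta_word_append[of w]
    by (simp add: shuffle_prod_sum_left shuffle_prod_sum_right shuffle_prod_mult_left
        shuffle_prod_mult_right mult_ac)
  then show ?thesis
    by (simp add: split_sum_sum split_sum_mult_left shuffle_prod_def)
qed

text \<open>Cut every shuffle of \<open>v\<close> and \<open>w\<close> after \<open>k\<close>
  letters: the first part is a shuffle of two prefixes, the second a shuffle of the two suffixes.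
  The lengths of the prefixes add up to \<open>k\<close>, so summing over \<open>k\<close> leaves
  the sum over pairs of prefixes.\<close>

lemma shuffle_pairing_tensor_mult:
  "shuffle_pairing (tensor_mult a b) v w =
    (\<Sum>i\<le>length v. \<Sum>j\<le>length w. shuffle_pairing a (take i v) (take j w) * shuffle_pairing b (drop i v) (drop j w))"
proof -
  let ?n = "length v + length w"
  let ?d = "\<lambda>v w. shuffle_prod (delta_word v) (delta_word w)"
  let ?P = "\<lambda>k x v w. \<Sum>u\<in>words k. x u * ?d v w u"
  have P: "?P k x v w = (if k = length v + length w then shuffle_pairing x v w else 0)" for k x v w
  proof (cases "k = length v + length w")
    case False
    then have "?P k x v w = 0"
      by (intro sum.neutral ballI) (simp add: words_def shuffle_prod_delta_eq_0)
    then show ?thesis using False by simp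
  qed (simp add: shuffle_pairing_def)
  have "shuffle_pairing (tensor_mult a b) v w
      = (\<Sum>u\<in>words ?n. \<Sum>k\<le>?n. a (take k u) * b (drop k u) * ?d v w u)"
    unfolding shuffle_pairing_def tensor_mult_def
    by (intro sum.cong refl) (auto simp: words_def sum_distrib_right)
  also have "\<dots> = (\<Sum>k\<le>?n. \<Sum>u\<in>words (k + (?n - k)). a (take k u) * b (drop k u) * ?d v w u)"
    by (rule trans[OF sum.swap], rule sum.cong[OF refl]) simp
  also have "\<dots> = (\<Sum>k\<le>?n. \<Sum>u1\<in>words k. \<Sum>u2\<in>words (?n - k). a u1 * b u2 * ?d v w (u1 @ u2))"
    unfolding sum_words_add by (intro sum.cong refl) (auto simp: words_def)
  also have "\<dots> = (\<Sum>k\<le>?n. \<Sum>u1\<in>words k. \<Sum>u2\<in>words (?n - k). \<Sum>i\<le>length v. \<Sum>j\<le>length w.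
      (a u1 * ?d (take i v) (take j w) u1) * (b u2 * ?d (drop i v) (drop j w) u2))"
    unfolding shuffle_prod_delta_append sum_distrib_left
    by (intro sum.cong refl) (simp add: mult_ac)
  also have "\<dots> = (\<Sum>k\<le>?n. \<Sum>i\<le>length v. \<Sum>j\<le>length w. \<Sum>u1\<in>words k. \<Sum>u2\<in>words (?n - k).
      (a u1 * ?d (take i v) (take j w) u1) * (b u2 * ?d (drop i v) (drop j w) u2))"
    by (simp only: sum.swap[of _ "{..length v}" "words _"] sum.swap[of _ "{..length w}" "words _"])
  also have "\<dots> = (\<Sum>k\<le>?n. \<Sum>i\<le>length v. \<Sum>j\<le>length w.
      ?P k a (take i v) (take j w) * ?P (?n - k) b (drop i v) (drop j w))"
    by (simp only: sum_product)
  also have "\<dots> = (\<Sum>i\<le>length v. \<Sum>j\<le>length w. \<Sum>k\<le>?n.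
      ?P k a (take i v) (take j w) * ?P (?n - k) b (drop i v) (drop j w))"
    by (rule trans[OF sum.swap], rule sum.cong[OF refl], rule sum.swap)
  also have "\<dots> = (\<Sum>i\<le>length v. \<Sum>j\<le>length w. \<Sum>k\<le>?n. if k = i + j then
      shuffle_pairing a (take i v) (take j w) * shuffle_pairing b (drop i v) (drop j w) else 0)"
  proof (rule sum.cong[OF refl], rule sum.cong[OF refl], rule sum.cong[OF refl])
    fix i j k assume ijk: "i \<in> {..length v}" "j \<in> {..length w}" "k \<in> {..?n}"
    show "?P k a (take i v) (take j w) * ?P (?n - k) b (drop i v) (drop j w) = (if k = i + j then
        shuffle_pairing a (take i v) (take j w) * shuffle_pairing b (drop i v) (drop j w) else 0)"
    proof (cases "k = i + j")
      case True
      have "length (take i v) + length (take j w) = k" "length (drop i v) + length (drop j w) = ?n - k"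
        using ijk True by auto
      then show ?thesis unfolding P using True by (simp only: if_True simp_thms)
    next
      case False
      have "k \<noteq> length (take i v) + length (take j w)"
        using ijk False by auto
      with False show ?thesis unfolding P by (simp only: if_False mult_zero_left simp_thms)
    qed
  qed
  also have "\<dots> = (\<Sum>i\<le>length v. \<Sum>j\<le>length w. shuffle_pairing a (take i v) (take j w) * shuffle_pairing b (drop i v) (drop j w))"
    by (rule sum.cong[OF refl], rule sum.cong[OF refl]) simp
  finally show ?thesis .
qed

context control_setup
begin

section \<open>Orders on intervals and on triples of points\<close>

definition Tri :: "(real \<times> real \<times> real) set" where
  "Tri = {(s, u, t). 0 \<le> s \<and> s \<le> u \<and> u \<le> t \<and> t \<le> T}"

definition \<rho>2 :: "real \<times> real \<Rightarrow> real" where "\<rho>2 z = \<rho> (fst z) (snd z)"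

text \<open>Order is measured by the outer interval, which dominates both subintervals by
  monotonicity of the control.\<close>

definition \<rho>3 :: "real \<times> real \<times> real \<Rightarrow> real" where "\<rho>3 z = \<rho> (fst z) (snd (snd z))"

lemma in_Simplex_iff: "z \<in> Simplex T \<longleftrightarrow> 0 \<le> fst z \<and> fst z \<le> snd z \<and> snd z \<le> T"
  by (auto simp: Simplex_def)

lemma in_Tri_iff: "z \<in> Tri \<longleftrightarrow> 0 \<le> fst z \<and> fst z \<le> fst (snd z) \<and> fst (snd z) \<le> snd (snd z) \<and> snd (snd z) \<le> T"
  by (auto simp: Tri_def)

lemma \<rho>_nonneg [simp]: "0 \<le> \<rho> s t"
  by (simp add: \<rho>_def)

lemma \<rho>_mono: "0 \<le> s' \<Longrightarrow> s' \<le> s \<Longrightarrow> s \<le> t \<Longrightarrow> t \<le> t' \<Longrightarrow> t' \<le> T \<Longrightarrow> \<rho> s t \<le> \<rho> s' t'"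
  unfolding \<rho>_def using p_ge_1 by (intro powr_mono2 control_mono control_nonneg) auto

text \<open>Exponent zero is excluded because \<open>0 powr 0\<close> is \<open>0\<close> while a
  zeroth power is \<open>1\<close>.\<close>

lemma \<rho>_power: "1 \<le> n \<Longrightarrow> \<rho> s t ^ n = \<omega> s t powr (real n / p)"
  by (cases "\<omega> s t = 0") (simp_all add: \<rho>_def powr_power)

lemma \<rho>_power_\<theta>: "\<rho> s t ^ (N + 1) = \<omega> s t powr \<theta>"
  by (subst \<rho>_power) (simp_all add: \<theta>_def)

sublocale S2: graded_bounds "Simplex T" \<rho>2
proof
  show "\<rho>2 \<in> O[principal (Simplex T)](\<lambda>_. 1)"
    unfolding bigo_principal_iff
    by (intro exI[of _ "\<rho> 0 T"] ballI) (auto simp: \<rho>2_def in_Simplex_iff intro!: \<rho>_mono)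
qed

sublocale S3: graded_bounds Tri \<rho>3
proof
  show "\<rho>3 \<in> O[principal Tri](\<lambda>_. 1)"
    unfolding bigo_principal_iff
    by (intro exI[of _ "\<rho> 0 T"] ballI) (auto simp: \<rho>3_def in_Tri_iff intro!: \<rho>_mono)
qed

abbreviation "ord2 \<equiv> S2.order_ge"
abbreviation "ord3 \<equiv> S3.order_ge"

lemma ord2_iff: "f \<in> ord2 n \<longleftrightarrow> (\<exists>C. \<forall>s t. 0 \<le> s \<longrightarrow> s \<le> t \<longrightarrow> t \<le> T \<longrightarrow> \<bar>f (s, t)\<bar> \<le> C * \<rho> s t ^ n)"
  unfolding bigo_principal_iff by (auto simp: Simplex_def \<rho>2_def)

lemma ord3_iff: "f \<in> ord3 n \<longleftrightarrow>
    (\<exists>C. \<forall>s u t. 0 \<le> s \<longrightarrow> s \<le> u \<longrightarrow> u \<le> t \<longrightarrow> t \<le> T \<longrightarrow> \<bar>f (s, u, t)\<bar> \<le> C * \<rho> s t ^ n)"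
  unfolding bigo_principal_iff by (auto simp: Tri_def \<rho>3_def)

lemma ord2_to_ord3_subinterval:
  assumes "f \<in> ord2 n"
    and "\<And>z. z \<in> Tri \<Longrightarrow> 0 \<le> a z \<and> fst z \<le> a z \<and> a z \<le> b z \<and> b z \<le> snd (snd z)"
  shows "(\<lambda>z. f (a z, b z)) \<in> ord3 n"
proof -
  obtain C where C: "\<And>s t. 0 \<le> s \<Longrightarrow> s \<le> t \<Longrightarrow> t \<le> T \<Longrightarrow> \<bar>f (s, t)\<bar> \<le> C * \<rho> s t ^ n"
    using assms(1) unfolding ord2_iff by blast
  have "norm (f (a z, b z)) \<le> \<bar>C\<bar> * norm (\<rho>3 z ^ n)" if z: "z \<in> Tri" for z
  proof -
    have z': "0 \<le> fst z" "snd (snd z) \<le> T" using z by (auto simp: in_Tri_iff)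
    have "\<bar>f (a z, b z)\<bar> \<le> C * \<rho> (a z) (b z) ^ n"
      using assms(2)[OF z] z' by (intro C) auto
    also have "\<dots> \<le> \<bar>C\<bar> * \<rho> (a z) (b z) ^ n"
      by (intro mult_right_mono) auto
    also have "\<dots> \<le> \<bar>C\<bar> * \<rho>3 z ^ n"
      unfolding \<rho>3_def using assms(2)[OF z] z' by (intro mult_left_mono power_mono \<rho>_mono) auto
    finally show ?thesis by (simp add: \<rho>3_def)
  qed
  then show ?thesis unfolding bigo_principal_iff by blast
qed

lemma ord2_to_ord3:
  assumes "f \<in> ord2 n"
  shows "(\<lambda>z. f (fst z, fst (snd z))) \<in> ord3 n" "(\<lambda>z. f (fst (snd z), snd (snd z))) \<in> ord3 n"
    "(\<lambda>z. f (fst z, snd (snd z))) \<in> ord3 n"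
  by (rule ord2_to_ord3_subinterval[OF assms], simp add: in_Tri_iff)+

lemma additive_order_eq_0:
  assumes "\<And>s u t. 0 \<le> s \<Longrightarrow> s \<le> u \<Longrightarrow> u \<le> t \<Longrightarrow> t \<le> T \<Longrightarrow> D s t = D s u + D u t"
    and "(\<lambda>z. D (fst z) (snd z)) \<in> ord2 (N + 1)"
    and "0 \<le> s" "s \<le> t" "t \<le> T"
  shows "D s t = (0::real)"
proof -
  obtain K where "\<And>s t. 0 \<le> s \<Longrightarrow> s \<le> t \<Longrightarrow> t \<le> T \<Longrightarrow> \<bar>D s t\<bar> \<le> K * \<omega> s t powr \<theta>"
    using assms(2) unfolding ord2_iff \<rho>_power_\<theta> by auto
  from additive_eq_0[OF assms(1) this] show ?thesis using assms by blast
qed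

lemma sewing_order:
  assumes "(\<lambda>z. \<Xi> (fst z) (snd (snd z)) - \<Xi> (fst z) (fst (snd z)) - \<Xi> (fst (snd z)) (snd (snd z))) \<in> ord3 (N + 1)"
  obtains I where "I 0 = (0::real)" "(\<lambda>z. I (snd z) - I (fst z) - \<Xi> (fst z) (snd z)) \<in> ord2 (N + 1)"
proof -
  obtain L where L: "\<And>s u t. 0 \<le> s \<Longrightarrow> s \<le> u \<Longrightarrow> u \<le> t \<Longrightarrow> t \<le> T \<Longrightarrow>
      \<bar>\<Xi> s t - \<Xi> s u - \<Xi> u t\<bar> \<le> L * \<omega> s t powr \<theta>"
    using assms unfolding ord3_iff \<rho>_power_\<theta> by auto
  have "\<bar>\<Xi> s t - \<Xi> s u - \<Xi> u t\<bar> \<le> \<bar>L\<bar> * \<omega> s t powr \<theta>" if "0 \<le> s" "s \<le> u" "u \<le> t" "t \<le> T" for s u t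
    by (rule order_trans[OF L[OF that]]) (intro mult_right_mono, auto)
  from sewing[OF abs_ge_zero this] obtain I K where "I 0 = (0::real)"
    "\<And>s t. 0 \<le> s \<Longrightarrow> s \<le> t \<Longrightarrow> t \<le> T \<Longrightarrow> \<bar>I t - I s - \<Xi> s t\<bar> \<le> K * \<omega> s t powr \<theta>"
    by blast
  moreover from this have "(\<lambda>z. I (snd z) - I (fst z) - \<Xi> (fst z) (snd z)) \<in> ord2 (N + 1)"
    unfolding ord2_iff \<rho>_power_\<theta> by auto
  ultimately show thesis by (intro that[of I])
qed

text \<open>The control is continuous and vanishes on the diagonal, so increments at
  \<open>a\<close> tend to zero; \<open>min\<close> and \<open>max\<close> treat both sides of
  \<open>a\<close> at once.\<close>

lemma continuous_of_increments:
  fixes f :: "real \<Rightarrow> 'e::real_normed_vector"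
  assumes "\<And>s t. 0 \<le> s \<Longrightarrow> s \<le> t \<Longrightarrow> t \<le> T \<Longrightarrow> norm (f t - f s) \<le> C * \<rho> s t"
  shows "continuous_on {0..T} f"
  unfolding continuous_on_def
proof
  fix a assume a: "a \<in> {0..T}"
  have "continuous_on {0..T} (\<lambda>t. (\<lambda>(s, t). \<omega> s t) (min a t, max a t))"
  proof (rule continuous_on_compose2[of "Simplex T"])
    show "continuous_on {0..T} (\<lambda>t. (min a t, max a t))"
      by (intro continuous_intros)
    show "(\<lambda>t. (min a t, max a t)) ` {0..T} \<subseteq> Simplex T"
      using a by (auto simp: Simplex_def)
  qed (use control in \<open>simp add: is_control_def\<close>)
  then have "continuous_on {0..T} (\<lambda>t. \<omega> (min a t) (max a t) powr (1 / p))"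
    using a p_ge_1 by (intro continuous_on_powr') (auto intro!: control_nonneg)
  then have "((\<lambda>t. \<rho> (min a t) (max a t)) \<longlongrightarrow> \<rho> (min a a) (max a a)) (at a within {0..T})"
    using a unfolding continuous_on_def \<rho>_def by blast
  then have "((\<lambda>t. C * \<rho> (min a t) (max a t)) \<longlongrightarrow> C * \<rho> a a) (at a within {0..T})"
    by (intro tendsto_intros) simp
  moreover have "\<rho> a a = 0" using a by (simp add: \<rho>_def control_refl)
  ultimately have "((\<lambda>t. C * \<rho> (min a t) (max a t)) \<longlongrightarrow> 0) (at a within {0..T})" by simp
  moreover have "\<forall>\<^sub>F t in at a within {0..T}. norm (f t - f a) \<le> C * \<rho> (min a t) (max a t)"
    unfolding eventually_at_topological
  proof (intro exI[of _ UNIV] conjI ballI impI)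
    fix t assume "t \<in> {0..T}"
    then show "norm (f t - f a) \<le> C * \<rho> (min a t) (max a t)"
      using assms[of a t] assms[of t a] a by (cases "a \<le> t") (auto simp: norm_minus_commute)
  qed simp_all
  ultimately have "((\<lambda>t. f t - f a) \<longlongrightarrow> 0) (at a within {0..T})"
    by (rule Lim_null_comparison[rotated])
  then show "(f \<longlongrightarrow> f a) (at a within {0..T})" by (simp add: LIM_zero_iff)
qed

lemma Simplex_pairs_of_Tri:
  "z \<in> Tri \<Longrightarrow> (fst z, fst (snd z)) \<in> Simplex T" "z \<in> Tri \<Longrightarrow> (fst (snd z), snd (snd z)) \<in> Simplex T"
  "z \<in> Tri \<Longrightarrow> (fst z, snd (snd z)) \<in> Simplex T"
  by (auto simp: Tri_def Simplex_def)

section \<open>Level by level construction of a multiplicative map\<close>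

lemma tensor_mult_diff_order:
  fixes a b a' b' :: "'z \<Rightarrow> 'a list \<Rightarrow> real"
  assumes r: "graded_bounds S r"
    and "\<And>i. i \<le> length w \<Longrightarrow> (\<lambda>z. a z (take i w) - a' z (take i w)) \<in> O[principal S](\<lambda>z. r z ^ n)"
    and "\<And>i. i \<le> length w \<Longrightarrow> (\<lambda>z. b z (drop i w) - b' z (drop i w)) \<in> O[principal S](\<lambda>z. r z ^ n)"
    and "\<And>i. i \<le> length w \<Longrightarrow> (\<lambda>z. a z (take i w)) \<in> O[principal S](\<lambda>_. 1)"
    and "\<And>i. i \<le> length w \<Longrightarrow> (\<lambda>z. b' z (drop i w)) \<in> O[principal S](\<lambda>_. 1)"
  shows "(\<lambda>z. tensor_mult (a z) (b z) w - tensor_mult (a' z) (b' z) w) \<in> O[principal S](\<lambda>z. r z ^ n)"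
proof -
  interpret graded_bounds S r by (rule r)
  have "(\<lambda>z. \<Sum>i\<le>length w. (a z (take i w) - a' z (take i w)) * b' z (drop i w) +
      a z (take i w) * (b z (drop i w) - b' z (drop i w))) \<in> order_ge n"
    by (intro big_sum_in_bigo sum_in_bigo(1) order_ge_mult_bounded bounded_mult_order_ge) (simp_all add: assms)
  then show ?thesis
    unfolding tensor_mult_def sum_subtractf[symmetric] by (simp add: algebra_simps)
qed

text \<open>Extension by one level. A two-point map is not additive on level \<open>Suc m\<close>,
  but the path started at \<open>0\<close> is a genuine path and is obtained by sewing; the
  two-point map is then solved from Chen's identity between \<open>0\<close>, \<open>s\<close> and
  \<open>t\<close>.\<close>

lemma multiplicative_extension_step:
  fixes Z Y :: "real \<Rightarrow> real \<Rightarrow> 'u::euclidean_space list \<Rightarrow> real"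
  assumes Z_Nil: "\<And>s t. (s, t) \<in> Simplex T \<Longrightarrow> Z s t [] = 1"
    and Z_bounded: "\<And>w. w \<in> words_upto N \<Longrightarrow> (\<lambda>z. Z (fst z) (snd z) w) \<in> O[principal (Simplex T)](\<lambda>_. 1)"
    and Z_chen: "\<And>w. w \<in> words_upto N \<Longrightarrow> (\<lambda>z. Z (fst z) (snd (snd z)) w -
        tensor_mult (Z (fst z) (fst (snd z))) (Z (fst (snd z)) (snd (snd z))) w) \<in> ord3 (N + 1)"
    and Y_Nil: "\<And>s t. (s, t) \<in> Simplex T \<Longrightarrow> Y s t [] = 1"
    and Y_chen: "\<And>s u t w. (s, u, t) \<in> Tri \<Longrightarrow> w \<in> words_upto m \<Longrightarrow> Y s t w = tensor_mult (Y s u) (Y u t) w"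
    and Y_close: "\<And>w. w \<in> words_upto m \<Longrightarrow> (\<lambda>z. Y (fst z) (snd z) w - Z (fst z) (snd z) w) \<in> ord2 (N + 1)"
    and m: "Suc m \<le> N"
  obtains Y' where "\<And>s t. (s, t) \<in> Simplex T \<Longrightarrow> Y' s t [] = 1"
    "\<And>s u t w. (s, u, t) \<in> Tri \<Longrightarrow> w \<in> words_upto (Suc m) \<Longrightarrow> Y' s t w = tensor_mult (Y' s u) (Y' u t) w"
    "\<And>w. w \<in> words_upto (Suc m) \<Longrightarrow> (\<lambda>z. Y' (fst z) (snd z) w - Z (fst z) (snd z) w) \<in> ord2 (N + 1)"
proof -
  \<comment> \<open>The levels already corrected, completed by the uncorrected top level of
    \<open>Z\<close>.\<close>
  define Yt where "Yt s t w = (if length w \<le> m then Y s t w else Z s t w)" for s t w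
  have Yt_close: "(\<lambda>z. Yt (fst z) (snd z) w - Z (fst z) (snd z) w) \<in> ord2 (N + 1)" if "w \<in> words_upto (Suc m)" for w
  proof (cases "length w \<le> m")
    case True
    then have "w \<in> words_upto m" using that by (auto simp: words_upto_def)
    with Y_close[of w] True show ?thesis by (simp add: Yt_def)
  qed (simp add: Yt_def)
  have Zb: "(\<lambda>z. Z (fst z) (snd z) w) \<in> O[principal (Simplex T)](\<lambda>_. 1)" if "w \<in> words_upto (Suc m)" for w
    using Z_bounded subsetD[OF words_upto_mono[OF m] that] .
  have Ytb: "(\<lambda>z. Yt (fst z) (snd z) w) \<in> O[principal (Simplex T)](\<lambda>_. 1)" if "w \<in> words_upto (Suc m)" for w
    using sum_in_bigo(1)[OF S2.order_ge_bounded[OF Yt_close[OF that]] Zb[OF that]] by simp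
  \<comment> \<open>The increment at \<open>w\<close> of the path from \<open>0\<close> that
    \<open>Yt\<close> predicts over one interval. As the lower levels are multiplicative, its defect
    is exactly the failure of \<open>Yt\<close> to be multiplicative at \<open>w\<close>.\<close>
  define \<Xi> where "\<Xi> w s t = tensor_mult (Y 0 s) (Yt s t) w - Y 0 s w" for w s t
  have Yt_Nil: "Yt s t [] = 1" if "(s, t) \<in> Simplex T" for s t
    using Y_Nil[OF that] by (simp add: Yt_def)
  have \<delta>: "\<Xi> w s t - \<Xi> w s u - \<Xi> w u t = Yt s t w - tensor_mult (Yt s u) (Yt u t) w"
    if w: "w \<in> words (Suc m)" and sut: "(s, u, t) \<in> Tri" for w s u t
  proof -
    have S: "(0, s) \<in> Simplex T" "(u, t) \<in> Simplex T" "(s, u) \<in> Simplex T" "(0, s, u) \<in> Tri"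
      using sut T_pos by (auto simp: Tri_def Simplex_def)
    have lw: "length w = Suc m" "set w \<subseteq> Basis" using w by (auto simp: words_def)
    have sm: "take i w \<in> words_upto m" if "i \<le> m" for i
      using that lw by (auto simp: words_upto_def dest: in_set_takeD)
    have sd: "drop i w \<in> words_upto m" if "1 \<le> i" for i
      using that lw by (auto simp: words_upto_def dest: in_set_dropD)
    have "tensor_mult (Y 0 u) (Yt u t) w - Y 0 u w
        = tensor_mult (tensor_mult (Y 0 s) (Yt s u)) (Yt u t) w - tensor_mult (Y 0 s) (Yt s u) w"
    proof -
      have "Y 0 u (take i w) = tensor_mult (Y 0 s) (Yt s u) (take i w)" if "i < length w" for i
      proof -
        have "take i w \<in> words_upto m" using that lw by (intro sm) auto
        then show ?thesis
          using Y_chen[OF S(4)] by (auto simp: Yt_def words_upto_def intro!: tensor_mult_cong)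
      qed
      then show ?thesis
        by (simp add: tensor_mult_split_last Yt_Nil[OF S(2)])
    qed
    then have "\<Xi> w s t - \<Xi> w s u - \<Xi> w u t
        = tensor_mult (Y 0 s) (Yt s t) w - tensor_mult (Y 0 s) (tensor_mult (Yt s u) (Yt u t)) w"
      by (simp add: \<Xi>_def tensor_mult_assoc)
    also have "\<dots> = Yt s t w - tensor_mult (Yt s u) (Yt u t) w"
    proof (rule tensor_mult_diff_right)
      show "Y 0 s [] = 1" using Y_Nil[OF S(1)] .
      fix i assume "1 \<le> i" "i \<le> length w"
      from sd[OF this(1)] show "Yt s t (drop i w) = tensor_mult (Yt s u) (Yt u t) (drop i w)"
        using Y_chen[OF sut] by (auto simp: Yt_def words_upto_def intro!: tensor_mult_cong)
    qed
    finally show ?thesis .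
  qed
  have "\<exists>I. I 0 = (0::real) \<and> (\<lambda>z. I (snd z) - I (fst z) - \<Xi> w (fst z) (snd z)) \<in> ord2 (N + 1)"
    if w: "w \<in> words (Suc m)" for w
  proof -
    have w': "w \<in> words_upto (Suc m)" using w by (auto simp: words_def words_upto_def)
    have "(\<lambda>z. tensor_mult (Z (fst z) (fst (snd z))) (Z (fst (snd z)) (snd (snd z))) w
        - tensor_mult (Yt (fst z) (fst (snd z))) (Yt (fst (snd z)) (snd (snd z))) w) \<in> ord3 (N + 1)"
    proof (rule tensor_mult_diff_order[OF S3.graded_bounds_axioms])
      fix i
      note tw = in_words_upto_take_drop(1)[OF w', of i] and dw = in_words_upto_take_drop(2)[OF w', of i]
      show "(\<lambda>z. Z (fst z) (fst (snd z)) (take i w) - Yt (fst z) (fst (snd z)) (take i w)) \<in> ord3 (N + 1)"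
        using ord2_to_ord3(1)[OF Yt_close[OF tw]]
        by (subst landau_o.big.uminus_in_iff[symmetric]) simp
      show "(\<lambda>z. Z (fst (snd z)) (snd (snd z)) (drop i w) - Yt (fst (snd z)) (snd (snd z)) (drop i w)) \<in> ord3 (N + 1)"
        using ord2_to_ord3(2)[OF Yt_close[OF dw]]
        by (subst landau_o.big.uminus_in_iff[symmetric]) simp
      show "(\<lambda>z. Z (fst z) (fst (snd z)) (take i w)) \<in> O[principal Tri](\<lambda>_. 1)"
        using ord2_to_ord3(1)[of _ 0] Zb[OF tw] by fastforce
      show "(\<lambda>z. Yt (fst (snd z)) (snd (snd z)) (drop i w)) \<in> O[principal Tri](\<lambda>_. 1)"
        using ord2_to_ord3(2)[of _ 0] Ytb[OF dw] by fastforce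
    qed
    moreover have "(\<lambda>z. Z (fst z) (snd (snd z)) w -
        tensor_mult (Z (fst z) (fst (snd z))) (Z (fst (snd z)) (snd (snd z))) w) \<in> ord3 (N + 1)"
      using w' m by (intro Z_chen) (auto simp: words_upto_def)
    ultimately have "(\<lambda>z. Z (fst z) (snd (snd z)) w -
        tensor_mult (Yt (fst z) (fst (snd z))) (Yt (fst (snd z)) (snd (snd z))) w) \<in> ord3 (N + 1)"
      using sum_in_bigo(1) by fastforce
    moreover have "Z s t w = Yt s t w" for s t using w by (simp add: Yt_def words_def)
    ultimately have "(\<lambda>z. \<Xi> w (fst z) (snd (snd z)) - \<Xi> w (fst z) (fst (snd z)) - \<Xi> w (fst (snd z)) (snd (snd z))) \<in> ord3 (N + 1)"
      using \<delta>[OF w] by (subst bigo_principal_cong) auto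
    then show ?thesis by (rule sewing_order) blast
  qed
  then have "\<exists>I. \<forall>w\<in>words (Suc m). I w 0 = (0::real) \<and>
      (\<lambda>z. I w (snd z) - I w (fst z) - \<Xi> w (fst z) (snd z)) \<in> ord2 (N + 1)"
    by (intro bchoice ballI)
  then obtain I where I: "\<And>w. w \<in> words (Suc m) \<Longrightarrow> (\<lambda>z. I w (snd z) - I w (fst z) - \<Xi> w (fst z) (snd z)) \<in> ord2 (N + 1)"
    by blast
  \<comment> \<open>The top level is dictated by
    \<open>tensor_mult (X0 s) (Y' s t) w = X0 t w\<close>: the extreme cuts give
    \<open>Y' s t w\<close> and \<open>I w s\<close>, and the cuts in between involve levels that
    are already known.\<close>
  define Y' where "Y' s t w = (if length w \<le> m then Y s t w else
      I w t - I w s - (\<Sum>i\<in>{1..m}. Y 0 s (take i w) * Y s t (drop i w)))" for s t w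
  define X0 where "X0 t w = (if length w \<le> m then Y 0 t w else I w t)" for t w
  have Y'_Nil: "Y' s t [] = 1" if "(s, t) \<in> Simplex T" for s t
    using Y_Nil[OF that] by (simp add: Y'_def)
  have Y'_short: "tensor_mult (Y' s u) (Y' u t) w = Y' s t w" if "(s, u, t) \<in> Tri" "w \<in> words_upto m" for s u t w
  proof -
    have "tensor_mult (Y' s u) (Y' u t) w = tensor_mult (Y s u) (Y u t) w"
      using that(2) by (intro tensor_mult_cong) (auto simp: Y'_def words_upto_def)
    then show ?thesis using Y_chen[OF that] that(2) by (simp add: Y'_def words_upto_def)
  qed
  have sum_eq: "tensor_mult a b w = b w + (\<Sum>i\<in>{1..m}. a (take i w) * b (drop i w)) + a w"
    if "length w = Suc m" "a [] = 1" "b [] = 1" for a b :: "'u list \<Rightarrow> real" and w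
    using that by (simp add: tensor_mult_split_first)
  have X0_Nil: "X0 s [] = 1" if "0 \<le> s" "s \<le> T" for s
    using Y_Nil[of 0 s] that by (simp add: X0_def Simplex_def)
  have X0: "tensor_mult (X0 s) (Y' s t) w = X0 t w" if st: "(s, t) \<in> Simplex T" and w: "w \<in> words_upto (Suc m)" for s t w
  proof (cases "length w \<le> m")
    case True
    have "(0, s, t) \<in> Tri" using st by (auto simp: Tri_def Simplex_def)
    moreover have "w \<in> words_upto m" using True w by (auto simp: words_upto_def)
    ultimately have "tensor_mult (Y 0 s) (Y s t) w = Y 0 t w" using Y_chen by simp
    moreover have "tensor_mult (X0 s) (Y' s t) w = tensor_mult (Y 0 s) (Y s t) w"
      using True by (intro tensor_mult_cong) (auto simp: X0_def Y'_def)
    ultimately show ?thesis using True by (simp add: X0_def)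
  next
    case False
    then have lw: "length w = Suc m" using w by (auto simp: words_upto_def)
    have "tensor_mult (X0 s) (Y' s t) w = Y' s t w + (\<Sum>i\<in>{1..m}. X0 s (take i w) * Y' s t (drop i w)) + X0 s w"
      using st by (intro sum_eq lw X0_Nil Y'_Nil) (auto simp: Simplex_def)
    also have "(\<Sum>i\<in>{1..m}. X0 s (take i w) * Y' s t (drop i w)) = (\<Sum>i\<in>{1..m}. Y 0 s (take i w) * Y s t (drop i w))"
      using lw by (intro sum.cong refl) (auto simp: X0_def Y'_def)
    finally have "tensor_mult (X0 s) (Y' s t) w =
        Y' s t w + (\<Sum>i\<in>{1..m}. Y 0 s (take i w) * Y s t (drop i w)) + X0 s w" .
    moreover have "Y' s t w = I w t - I w s - (\<Sum>i\<in>{1..m}. Y 0 s (take i w) * Y s t (drop i w))"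
      "X0 s w = I w s" "X0 t w = I w t" using lw by (simp_all add: Y'_def X0_def)
    ultimately show ?thesis by linarith
  qed
  show thesis
  proof (rule that[of Y'])
    show "Y' s t [] = 1" if "(s, t) \<in> Simplex T" for s t by (rule Y'_Nil[OF that])
  next
    fix s u t and w :: "'u list" assume sut: "(s, u, t) \<in> Tri" and w: "w \<in> words_upto (Suc m)"
    have S: "(s, u) \<in> Simplex T" "(u, t) \<in> Simplex T" "(s, t) \<in> Simplex T" "0 \<le> s" "s \<le> T"
      using sut by (auto simp: Tri_def Simplex_def)
    \<comment> \<open>Both sides of Chen's identity agree after multiplication by
      \<open>X0 s\<close> on the left, and a factor with scalar part one cancels.\<close>
    have "tensor_mult (X0 s) (Y' s t) w = tensor_mult (X0 u) (Y' u t) w"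
      using X0[OF S(3) w] X0[OF S(2) w] by simp
    also have "\<dots> = tensor_mult (tensor_mult (X0 s) (Y' s u)) (Y' u t) w"
      by (intro tensor_mult_cong X0[OF S(1), symmetric] in_words_upto_take_drop w refl)
    also have "\<dots> = tensor_mult (X0 s) (tensor_mult (Y' s u) (Y' u t)) w"
      by (rule tensor_mult_assoc)
    finally have "tensor_mult (X0 s) (Y' s t) w - tensor_mult (X0 s) (tensor_mult (Y' s u) (Y' u t)) w = 0" by simp
    moreover have "tensor_mult (X0 s) (Y' s t) w - tensor_mult (X0 s) (tensor_mult (Y' s u) (Y' u t)) w
        = Y' s t w - tensor_mult (Y' s u) (Y' u t) w"
    proof (rule tensor_mult_diff_right)
      show "X0 s [] = 1" using X0_Nil S by simp
      fix i :: nat assume "1 \<le> i"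
      then have "drop i w \<in> words_upto m" using w by (auto simp: words_upto_def dest: in_set_dropD)
      from Y'_short[OF sut this] show "Y' s t (drop i w) = tensor_mult (Y' s u) (Y' u t) (drop i w)" by simp
    qed
    ultimately show "Y' s t w = tensor_mult (Y' s u) (Y' u t) w" by simp
  next
    fix w :: "'u list" assume w: "w \<in> words_upto (Suc m)"
    show "(\<lambda>z. Y' (fst z) (snd z) w - Z (fst z) (snd z) w) \<in> ord2 (N + 1)"
    proof (cases "length w \<le> m")
      case True
      then show ?thesis using Yt_close[OF w] by (simp add: Y'_def Yt_def)
    next
      case False
      then have lw: "length w = Suc m" "w \<in> words (Suc m)" using w by (auto simp: words_upto_def words_def)
      have "Y' s t w - Z s t w = I w t - I w s - \<Xi> w s t" if st: "(s, t) \<in> Simplex T" for s t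
      proof -
        have "(0, s) \<in> Simplex T" using st by (auto simp: Simplex_def)
        then have "tensor_mult (Y 0 s) (Yt s t) w = Yt s t w + (\<Sum>i\<in>{1..m}. Y 0 s (take i w) * Yt s t (drop i w)) + Y 0 s w"
          by (intro sum_eq lw Y_Nil Yt_Nil st)
        also have "(\<Sum>i\<in>{1..m}. Y 0 s (take i w) * Yt s t (drop i w)) = (\<Sum>i\<in>{1..m}. Y 0 s (take i w) * Y s t (drop i w))"
          using lw by (intro sum.cong refl) (auto simp: Yt_def)
        finally have "\<Xi> w s t = Yt s t w + (\<Sum>i\<in>{1..m}. Y 0 s (take i w) * Y s t (drop i w))"
          by (simp add: \<Xi>_def)
        moreover have "Y' s t w = I w t - I w s - (\<Sum>i\<in>{1..m}. Y 0 s (take i w) * Y s t (drop i w))"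
          "Yt s t w = Z s t w" using lw by (simp_all add: Y'_def Yt_def)
        ultimately show ?thesis by linarith
      qed
      then show ?thesis using I[OF lw(2)] by (subst bigo_principal_cong) auto
    qed
  qed
qed

lemma multiplicative_extension:
  fixes Z :: "real \<Rightarrow> real \<Rightarrow> 'u::euclidean_space list \<Rightarrow> real"
  assumes Z_Nil: "\<And>s t. (s, t) \<in> Simplex T \<Longrightarrow> Z s t [] = 1"
    and Z_bounded: "\<And>w. w \<in> words_upto N \<Longrightarrow> (\<lambda>z. Z (fst z) (snd z) w) \<in> O[principal (Simplex T)](\<lambda>_. 1)"
    and Z_chen: "\<And>w. w \<in> words_upto N \<Longrightarrow> (\<lambda>z. Z (fst z) (snd (snd z)) w -
        tensor_mult (Z (fst z) (fst (snd z))) (Z (fst (snd z)) (snd (snd z))) w) \<in> ord3 (N + 1)"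
  obtains Y where "\<And>s t. (s, t) \<in> Simplex T \<Longrightarrow> Y s t [] = 1"
    "\<And>s u t w. (s, u, t) \<in> Tri \<Longrightarrow> w \<in> words_upto N \<Longrightarrow> Y s t w = tensor_mult (Y s u) (Y u t) w"
    "\<And>w. w \<in> words_upto N \<Longrightarrow> (\<lambda>z. Y (fst z) (snd z) w - Z (fst z) (snd z) w) \<in> ord2 (N + 1)"
proof -
  define P where "P m Y \<longleftrightarrow> (\<forall>s t. (s, t) \<in> Simplex T \<longrightarrow> Y s t [] = 1) \<and>
    (\<forall>s u t w. (s, u, t) \<in> Tri \<longrightarrow> w \<in> words_upto m \<longrightarrow> Y s t w = tensor_mult (Y s u) (Y u t) w) \<and>
    (\<forall>w\<in>words_upto m. (\<lambda>z. Y (fst z) (snd z) w - Z (fst z) (snd z) w) \<in> ord2 (N + 1))"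
    for m and Y :: "real \<Rightarrow> real \<Rightarrow> 'u list \<Rightarrow> real"
  have "\<exists>Y. P m Y" if "m \<le> N" for m
    using that
  proof (induction m)
    case 0
    \<comment> \<open>Level zero tests the empty word only, so the constant map qualifies.\<close>
    have "(\<lambda>z. 1 - Z (fst z) (snd z) []) \<in> ord2 (N + 1)"
      using Z_Nil by (subst bigo_principal_cong[where g = "\<lambda>_. 0"]) auto
    then have "P 0 (\<lambda>_ _ _. 1)" by (simp add: P_def)
    then show ?case by blast
  next
    case (Suc m)
    then obtain Y where "P m Y" by auto
    then have Y: "\<And>s t. (s, t) \<in> Simplex T \<Longrightarrow> Y s t [] = 1"
      "\<And>s u t w. (s, u, t) \<in> Tri \<Longrightarrow> w \<in> words_upto m \<Longrightarrow> Y s t w = tensor_mult (Y s u) (Y u t) w"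
      "\<And>w. w \<in> words_upto m \<Longrightarrow> (\<lambda>z. Y (fst z) (snd z) w - Z (fst z) (snd z) w) \<in> ord2 (N + 1)"
      unfolding P_def by blast+
    show ?case
    proof (rule multiplicative_extension_step[OF Z_Nil Z_bounded Z_chen Y Suc.prems])
      fix Y' assume "\<And>s t. (s, t) \<in> Simplex T \<Longrightarrow> Y' s t [] = 1"
        "\<And>s u t w. (s, u, t) \<in> Tri \<Longrightarrow> w \<in> words_upto (Suc m) \<Longrightarrow> Y' s t w = tensor_mult (Y' s u) (Y' u t) w"
        "\<And>w. w \<in> words_upto (Suc m) \<Longrightarrow> (\<lambda>z. Y' (fst z) (snd z) w - Z (fst z) (snd z) w) \<in> ord2 (N + 1)"
      then have "P (Suc m) Y'" unfolding P_def by blast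
      then show ?thesis by blast
    qed
  qed
  then obtain Y where "P N Y" by blast
  then show thesis by (intro that[of Y]) (auto simp: P_def)
qed

section \<open>Rough paths described through orders\<close>

lemma ord2_increments_continuous:
  fixes f :: "real \<Rightarrow> real"
  assumes "(\<lambda>z. f (snd z) - f (fst z)) \<in> ord2 1"
  shows "continuous_on {0..T} f"
proof -
  obtain C where "\<And>s t. 0 \<le> s \<Longrightarrow> s \<le> t \<Longrightarrow> t \<le> T \<Longrightarrow> \<bar>f t - f s\<bar> \<le> C * \<rho> s t"
    using assms unfolding ord2_iff by auto
  then show ?thesis by (intro continuous_of_increments) simp
qed

text \<open>Joint continuity follows from the rest. The path from \<open>0\<close> is continuous
  since each term of its increment has a factor of positive degree, and solving Chen's identity
  recursively expresses \<open>X s t\<close> through paths from \<open>0\<close>.\<close>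

lemma rough_pathsI:
  fixes X :: "real \<Rightarrow> real \<Rightarrow> 'v::euclidean_space list \<Rightarrow> real"
  assumes supp: "\<And>s t w. (s, t) \<in> Simplex T \<Longrightarrow> w \<notin> words_upto N \<Longrightarrow> X s t w = 0"
    and Nil: "\<And>s t. (s, t) \<in> Simplex T \<Longrightarrow> X s t [] = 1"
    and bound: "\<And>w. w \<in> words_upto N \<Longrightarrow> (\<lambda>z. X (fst z) (snd z) w) \<in> ord2 (length w)"
    and chen: "\<And>s u t w. (s, u, t) \<in> Tri \<Longrightarrow> w \<in> words_upto N \<Longrightarrow> X s t w = tensor_mult (X s u) (X u t) w"
    and shuffle: "\<And>s t v w. (s, t) \<in> Simplex T \<Longrightarrow> v @ w \<in> words_upto N \<Longrightarrow>
       X s t v * X s t w = shuffle_pairing (X s t) v w"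
  shows "X \<in> rough_paths p T \<omega>"
proof -
  have path_cont: "continuous_on {0..T} (\<lambda>t. X 0 t w)" if w: "w \<in> words_upto N" for w
  proof (rule ord2_increments_continuous)
    have "(\<lambda>z. \<Sum>i<length w. X 0 (fst z) (take i w) * X (fst z) (snd z) (drop i w)) \<in> ord2 1"
    proof (rule big_sum_in_bigo)
      fix i assume "i \<in> {..<length w}"
      then have i: "1 \<le> length (drop i w)" by simp
      note tw = in_words_upto_take_drop(1)[OF w, of i] and dw = in_words_upto_take_drop(2)[OF w, of i]
      obtain C where C: "\<And>s t. 0 \<le> s \<Longrightarrow> s \<le> t \<Longrightarrow> t \<le> T \<Longrightarrow> \<bar>X s t (take i w)\<bar> \<le> C"
        using S2.order_ge_mono[OF bound[OF tw], of 0] unfolding ord2_iff by auto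
      have "(\<lambda>z. X 0 (fst z) (take i w)) \<in> O[principal (Simplex T)](\<lambda>_. 1)"
        unfolding bigo_principal_iff by (intro exI[of _ C] ballI) (auto simp: in_Simplex_iff intro!: C)
      then show "(\<lambda>z. X 0 (fst z) (take i w) * X (fst z) (snd z) (drop i w)) \<in> ord2 1"
        using S2.order_ge_mono[OF bound[OF dw] i] by (rule S2.bounded_mult_order_ge)
    qed
    moreover have "X 0 t w - X 0 s w = (\<Sum>i<length w. X 0 s (take i w) * X s t (drop i w))" if "(s, t) \<in> Simplex T" for s t
    proof -
      have "(0, s, t) \<in> Tri" using that by (auto simp: Simplex_def Tri_def)
      from chen[OF this w] show ?thesis by (simp add: tensor_mult_split_last Nil[OF that])
    qed
    ultimately show "(\<lambda>z. X 0 (snd z) w - X 0 (fst z) w) \<in> ord2 1"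
      by (subst bigo_principal_cong) auto
  qed
  have cont: "continuous_on (Simplex T) (\<lambda>z. X (fst z) (snd z) w)" if "w \<in> words_upto N" for w
    using that
  proof (induction "length w" arbitrary: w rule: less_induct)
    case less
    have comp: "continuous_on (Simplex T) (\<lambda>z. X 0 (fst z) v)" "continuous_on (Simplex T) (\<lambda>z. X 0 (snd z) v)"
      if "v \<in> words_upto N" for v
      by (rule continuous_on_compose2[OF path_cont[OF that]], intro continuous_intros, force simp: Simplex_def)+
    have "continuous_on (Simplex T) (\<lambda>z. X 0 (snd z) w -
        (\<Sum>i\<in>{1..length w}. X 0 (fst z) (take i w) * X (fst z) (snd z) (drop i w)))"
      by (intro continuous_intros comp less in_words_upto_take_drop) (use less.prems in auto)
    moreover have "X 0 t w - (\<Sum>i\<in>{1..length w}. X 0 s (take i w) * X s t (drop i w)) = X s t w" if "(s, t) \<in> Simplex T" for s t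
    proof -
      have "(0, s, t) \<in> Tri" "(0, s) \<in> Simplex T" using that by (auto simp: Simplex_def Tri_def)
      with chen[OF this(1) less.prems] show ?thesis by (simp add: tensor_mult_split_first Nil)
    qed
    ultimately show ?case
      by (rule continuous_on_eq) auto
  qed
  show ?thesis
    unfolding rough_paths_def mem_Collect_eq
  proof (intro conjI)
    show "\<forall>(s, t)\<in>Simplex T. X s t \<in> tensors_upto N"
      using supp by (auto simp: tensors_upto_def)
    show "\<forall>w\<in>words_upto N. continuous_on (Simplex T) (\<lambda>(s, t). X s t w)"
      using cont by (simp add: case_prod_unfold)
    show "\<forall>(s, t)\<in>Simplex T. X s t [] = 1" using Nil by auto
    show "\<forall>n\<in>{1..N}. \<forall>w\<in>words n. \<exists>C. \<forall>(s, t)\<in>Simplex T. \<bar>X s t w\<bar> \<le> C * \<omega> s t powr (real n / p)"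
    proof (intro ballI)
      fix n and w :: "'v list" assume n: "n \<in> {1..N}" and w: "w \<in> words n"
      then have "w \<in> words_upto N" "length w = n" by (auto simp: words_def words_upto_def)
      with bound[of w] obtain C where "\<And>s t. 0 \<le> s \<Longrightarrow> s \<le> t \<Longrightarrow> t \<le> T \<Longrightarrow> \<bar>X s t w\<bar> \<le> C * \<rho> s t ^ n"
        unfolding ord2_iff by auto
      then show "\<exists>C. \<forall>(s, t)\<in>Simplex T. \<bar>X s t w\<bar> \<le> C * \<omega> s t powr (real n / p)"
        using n by (intro exI[of _ C]) (auto simp: \<rho>_power Simplex_def)
    qed
    show "\<forall>s u t. 0 \<le> s \<and> s \<le> u \<and> u \<le> t \<and> t \<le> T \<longrightarrow> (\<forall>w\<in>words_upto N. X s t w = tensor_mult (X s u) (X u t) w)"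
      using chen by (auto simp: Tri_def)
    show "\<forall>a b. a + b \<le> N \<longrightarrow> (\<forall>(s, t)\<in>Simplex T. \<forall>v\<in>words a. \<forall>w\<in>words b.
        X s t v * X s t w = coproduct_sh a b (component (a + b) (X s t)) [v, w])"
    proof (intro allI impI ballI, clarify)
      fix a b s t and v w :: "'v list"
      assume *: "a + b \<le> N" "(s, t) \<in> Simplex T" "v \<in> words a" "w \<in> words b"
      then have "v @ w \<in> words_upto N" "length v = a" "length w = b" by (auto simp: words_def)
      with shuffle[OF *(2) this(1)] show "X s t v * X s t w = coproduct_sh a b (component (a + b) (X s t)) [v, w]"
        by (simp add: coproduct_sh_component[OF *(3,4)] shuffle_pairing_def)
    qed
  qed
qed

lemma rough_pathsD:
  fixes X :: "real \<Rightarrow> real \<Rightarrow> 'v::euclidean_space list \<Rightarrow> real"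
  assumes X: "X \<in> rough_paths p T \<omega>"
  shows "(s, t) \<in> Simplex T \<Longrightarrow> w \<notin> words_upto N \<Longrightarrow> X s t w = 0"
    and "(s, t) \<in> Simplex T \<Longrightarrow> X s t [] = 1"
    and "w \<in> words_upto N \<Longrightarrow> (\<lambda>z. X (fst z) (snd z) w) \<in> ord2 (length w)"
    and "(s, u, t) \<in> Tri \<Longrightarrow> w \<in> words_upto N \<Longrightarrow> X s t w = tensor_mult (X s u) (X u t) w"
    and "(s, t) \<in> Simplex T \<Longrightarrow> is_character N (X s t)"
proof -
  show Nil: "(s, t) \<in> Simplex T \<Longrightarrow> X s t [] = 1" for s t
    using X by (auto simp: rough_paths_def)
  show "(s, t) \<in> Simplex T \<Longrightarrow> w \<notin> words_upto N \<Longrightarrow> X s t w = 0"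
    using X by (auto simp: rough_paths_def tensors_upto_def)
  show "(\<lambda>z. X (fst z) (snd z) w) \<in> ord2 (length w)" if w: "w \<in> words_upto N"
  proof (cases "w = []")
    case True
    then show ?thesis using Nil by (subst bigo_principal_cong[where g = "\<lambda>_. 1"]) auto
  next
    case False
    then have n: "length w \<in> {1..N}" "w \<in> words (length w)" "1 \<le> length w"
      using w by (auto simp: words_def words_upto_def Suc_le_eq)
    then obtain C where "\<forall>(s, t)\<in>Simplex T. \<bar>X s t w\<bar> \<le> C * \<omega> s t powr (real (length w) / p)"
      using X unfolding rough_paths_def by blast
    then show ?thesis unfolding ord2_iff \<rho>_power[OF n(3)] by (auto simp: Simplex_def)
  qed
  show "(s, u, t) \<in> Tri \<Longrightarrow> w \<in> words_upto N \<Longrightarrow> X s t w = tensor_mult (X s u) (X u t) w"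
    using X by (auto simp: rough_paths_def Tri_def)
  show "is_character N (X s t)" if st: "(s, t) \<in> Simplex T"
    unfolding is_character_def
  proof (intro conjI allI impI)
    show "X s t [] = 1" by (rule Nil[OF st])
    fix v w :: "'v list" assume *: "length v + length w \<le> N" "set v \<subseteq> Basis" "set w \<subseteq> Basis"
    then have vw: "v \<in> words (length v)" "w \<in> words (length w)" by (auto simp: words_def)
    then have "X s t v * X s t w = coproduct_sh (length v) (length w) (component (length v + length w) (X s t)) [v, w]"
      using X *(1) st unfolding rough_paths_def by blast
    then show "X s t v * X s t w = (\<Sum>u\<in>words (length v + length w). X s t u * shuffle_prod (delta_word v) (delta_word w) u)"
      by (simp add: coproduct_sh_component[OF vw])
  qed
qed

lemma rough_family_simplex:
  assumes "X \<in> rough_paths p T \<omega>"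
  shows "rough_family (Simplex T) \<rho>2 N (\<lambda>z. X (fst z) (snd z))"
  by unfold_locales (use rough_pathsD(3,5)[OF assms] in auto)

text \<open>Consider a pair of words all of whose shorter pairs satisfy the relation. Chen's
  identity and \<open>shuffle_pairing_tensor_mult\<close> make its defect additive over adjacent
  intervals, and an additive function of order \<open>N + 1\<close> vanishes.\<close>

lemma shuffle_of_approx:
  fixes Y Z :: "real \<Rightarrow> real \<Rightarrow> 'u::euclidean_space list \<Rightarrow> real"
  assumes Nil: "\<And>s t. (s, t) \<in> Simplex T \<Longrightarrow> Y s t [] = 1"
    and chen: "\<And>s u t w. (s, u, t) \<in> Tri \<Longrightarrow> w \<in> words_upto N \<Longrightarrow> Y s t w = tensor_mult (Y s u) (Y u t) w"
    and defect: "\<And>v w. v @ w \<in> words_upto N \<Longrightarrow>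
      (\<lambda>z. Y (fst z) (snd z) v * Y (fst z) (snd z) w - shuffle_pairing (Y (fst z) (snd z)) v w) \<in> ord2 (N + 1)"
    and "(s, t) \<in> Simplex T" "v @ w \<in> words_upto N"
  shows "Y s t v * Y s t w = shuffle_pairing (Y s t) v w"
  using assms(4,5)
proof (induction "length v + length w" arbitrary: s t v w rule: less_induct)
  case less
  show ?case
  proof (cases "v = [] \<and> w = []")
    case True
    then show ?thesis using Nil[OF less.prems(1)] by (simp add: shuffle_pairing_def delta_word_def)
  next
    case False
    let ?P = "shuffle_pairing"
    define Q where "Q s t = Y s t v * Y s t w - ?P (Y s t) v w" for s t
    have B: "set v \<subseteq> Basis" "set w \<subseteq> Basis" "length v + length w \<le> N" using less.prems by auto
    have add: "Q s t = Q s u + Q u t" if "0 \<le> s" "s \<le> u" "u \<le> t" "t \<le> T" for s u t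
    proof -
      have S: "(s, u, t) \<in> Tri" "(s, u) \<in> Simplex T" "(u, t) \<in> Simplex T"
        using that by (auto simp: Tri_def Simplex_def)
      let ?A = "\<lambda>i j. Y s u (take i v) * Y s u (take j w)" and ?B = "\<lambda>i j. Y u t (drop i v) * Y u t (drop j w)"
      let ?PA = "\<lambda>i j. ?P (Y s u) (take i v) (take j w)" and ?PB = "\<lambda>i j. ?P (Y u t) (drop i v) (drop j w)"
      have t: "Y s t x = (\<Sum>i\<le>length x. Y s u (take i x) * Y u t (drop i x))" if "x \<in> words_upto N" for x
        using chen[OF S(1) that] by (simp add: tensor_mult_def)
      have vw: "v \<in> words_upto N" "w \<in> words_upto N" using B by (auto simp: words_upto_def)
      have 1: "Y s t v * Y s t w = (\<Sum>i\<le>length v. \<Sum>j\<le>length w. ?A i j * ?B i j)"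
        unfolding t[OF vw(1)] t[OF vw(2)] sum_product by (simp add: mult_ac)
      have "?P (Y s t) v w = ?P (tensor_mult (Y s u) (Y u t)) v w"
        unfolding shuffle_pairing_def
        by (intro sum.cong refl arg_cong2[where f = "(*)"] chen[OF S(1)]) (use B in \<open>auto simp: words_def words_upto_def\<close>)
      then have 2: "?P (Y s t) v w = (\<Sum>i\<le>length v. \<Sum>j\<le>length w. ?PA i j * ?PB i j)"
        by (simp add: shuffle_pairing_tensor_mult)
      \<comment> \<open>A pair of prefixes or suffixes that is not the whole pair is shorter and
        satisfies the relation. Only the two extreme cuts keep a defect, and the other factor there
        is one.\<close>
      have "?A i j * ?B i j - ?PA i j * ?PB i j
          = (if i = 0 then if j = 0 then Q u t else 0 else 0) + (if i = length v then if j = length w then Q s u else 0 else 0)"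
        if ij: "i \<in> {..length v}" "j \<in> {..length w}" for i j
      proof -
        have PA: "?PA i j = ?A i j" if "\<not> (i = length v \<and> j = length w)"
          by (rule less.hyps[symmetric])
            (use that ij S B in \<open>auto dest: in_set_takeD simp: min_def\<close>)
        have PB: "?PB i j = ?B i j" if "\<not> (i = 0 \<and> j = 0)"
          by (rule less.hyps[symmetric])
            (use that ij S B in \<open>auto dest: in_set_dropD\<close>)
        have 0: "?A 0 0 = 1" "?PA 0 0 = 1" "?B (length v) (length w) = 1" "?PB (length v) (length w) = 1"
          using Nil[OF S(2)] Nil[OF S(3)] by (simp_all add: shuffle_pairing_def delta_word_def)
        consider "i = length v" "j = length w" | "i = 0" "j = 0" "\<not> (i = length v \<and> j = length w)"
          | "\<not> (i = length v \<and> j = length w)" "\<not> (i = 0 \<and> j = 0)" by blast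
        then show ?thesis
        proof cases
          case 1
          then have "\<not> (i = 0 \<and> j = 0)" using False by auto
          then show ?thesis using 1 0(3,4) False by (auto simp: Q_def)
        next
          case 2
          then show ?thesis using 0(1,2) by (auto simp: Q_def)
        next
          case 3
          then show ?thesis using PA PB by auto
        qed
      qed
      then have "Q s t = (\<Sum>i\<le>length v. \<Sum>j\<le>length w.
          (if i = 0 then if j = 0 then Q u t else 0 else 0) + (if i = length v then if j = length w then Q s u else 0 else 0))"
        unfolding Q_def[of s t] 1 2 sum_subtractf[symmetric] by (intro sum.cong refl) blast
      also have "\<dots> = Q u t + Q s u"
      proof -
        have "(\<Sum>j\<le>length w. if i = a then if j = b then x else 0 else 0) = (if i = a then x else 0)"
          if "b \<le> length w" for a b i :: nat and x :: real using that by simp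
        then show ?thesis by (simp add: sum.distrib)
      qed
      finally show ?thesis by simp
    qed
    have ordq: "(\<lambda>z. Q (fst z) (snd z)) \<in> ord2 (N + 1)"
      unfolding Q_def by (rule defect) (rule less.prems)
    have st: "0 \<le> s" "s \<le> t" "t \<le> T" using less.prems(1) by (auto simp: Simplex_def)
    have "Q s t = 0" by (rule additive_order_eq_0[of Q, OF _ ordq st]) (rule add)
    then show ?thesis by (simp add: Q_def)
  qed
qed

text \<open>Making the map multiplicative changes it by order \<open>N + 1\<close> only. Bounds and
  approximate shuffle relations survive such a change, and multiplicativity makes the latter
  exact.\<close>

lemma almost_rough_path:
  fixes Z :: "real \<Rightarrow> real \<Rightarrow> 'u::euclidean_space list \<Rightarrow> real"
  assumes Z_Nil: "\<And>s t. (s, t) \<in> Simplex T \<Longrightarrow> Z s t [] = 1"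
    and Z_bound: "\<And>w. w \<in> words_upto N \<Longrightarrow> (\<lambda>z. Z (fst z) (snd z) w) \<in> ord2 (length w)"
    and Z_chen: "\<And>w. w \<in> words_upto N \<Longrightarrow> (\<lambda>z. Z (fst z) (snd (snd z)) w -
        tensor_mult (Z (fst z) (fst (snd z))) (Z (fst (snd z)) (snd (snd z))) w) \<in> ord3 (N + 1)"
    and Z_shuffle: "\<And>v w. v @ w \<in> words_upto N \<Longrightarrow>
      (\<lambda>z. Z (fst z) (snd z) v * Z (fst z) (snd z) w - shuffle_pairing (Z (fst z) (snd z)) v w) \<in> ord2 (N + 1)"
  obtains Y where "Y \<in> rough_paths p T \<omega>" "\<And>s t. (s, t) \<notin> Simplex T \<Longrightarrow> Y s t = (\<lambda>_. 0)"
    "\<And>w. w \<in> words_upto N \<Longrightarrow> (\<lambda>z. Y (fst z) (snd z) w - Z (fst z) (snd z) w) \<in> ord2 (N + 1)"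
proof -
  note Zb = S2.order_ge_bounded[OF Z_bound]
  obtain Y0 where Y0: "\<And>s t. (s, t) \<in> Simplex T \<Longrightarrow> Y0 s t [] = 1"
    "\<And>s u t w. (s, u, t) \<in> Tri \<Longrightarrow> w \<in> words_upto N \<Longrightarrow> Y0 s t w = tensor_mult (Y0 s u) (Y0 u t) w"
    "\<And>w. w \<in> words_upto N \<Longrightarrow> (\<lambda>z. Y0 (fst z) (snd z) w - Z (fst z) (snd z) w) \<in> ord2 (N + 1)"
    using multiplicative_extension[OF Z_Nil Zb Z_chen] by blast
  \<comment> \<open>Zero above degree \<open>N\<close>, as rough paths require, and off the simplex,
    as the definite description of the lift requires.\<close>
  define Y where "Y s t w = (if (s, t) \<in> Simplex T \<and> w \<in> words_upto N then Y0 s t w else 0)" for s t w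
  have Y_Nil: "Y s t [] = 1" if "(s, t) \<in> Simplex T" for s t
    using Y0(1)[OF that] that by (simp add: Y_def words_upto_def)
  have Y_chen: "Y s t w = tensor_mult (Y s u) (Y u t) w" if "(s, u, t) \<in> Tri" "w \<in> words_upto N" for s u t w
  proof -
    have "tensor_mult (Y s u) (Y u t) w = tensor_mult (Y0 s u) (Y0 u t) w"
      using that in_words_upto_take_drop[OF that(2)] by (intro tensor_mult_cong) (auto simp: Y_def Tri_def Simplex_def)
    then show ?thesis using Y0(2)[OF that] that by (auto simp: Y_def Tri_def Simplex_def)
  qed
  have Y_close: "(\<lambda>z. Y (fst z) (snd z) w - Z (fst z) (snd z) w) \<in> ord2 (N + 1)" if "w \<in> words_upto N" for w
    using Y0(3)[OF that] that by (subst bigo_principal_cong) (auto simp: Y_def)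
  have Y_bound: "(\<lambda>z. Y (fst z) (snd z) w) \<in> ord2 (length w)" if w: "w \<in> words_upto N" for w
    using sum_in_bigo(1)[OF S2.order_ge_mono[OF Y_close[OF w], of "length w"] Z_bound[OF w]] w
    by (simp add: words_upto_def)
  have Y_shuffle: "Y s t v * Y s t w = shuffle_pairing (Y s t) v w"
    if st: "(s, t) \<in> Simplex T" "v @ w \<in> words_upto N" for s t v w
  proof (rule shuffle_of_approx[OF Y_Nil Y_chen _ that])
    fix v w :: "'u list" assume vw: "v @ w \<in> words_upto N"
    then have v: "v \<in> words_upto N" and w: "w \<in> words_upto N" by (auto simp: words_upto_def)
    let ?Y = "\<lambda>z. Y (fst z) (snd z)" and ?Z = "\<lambda>z. Z (fst z) (snd z)"
    have 1: "(\<lambda>z. (?Y z v - ?Z z v) * ?Y z w + ?Z z v * (?Y z w - ?Z z w)) \<in> ord2 (N + 1)"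
      using S2.order_ge_bounded[OF Y_bound[OF w]] Zb[OF v]
      by (intro sum_in_bigo(1) S2.order_ge_mult_bounded S2.bounded_mult_order_ge Y_close v w)
    have 2: "(\<lambda>z. \<Sum>u\<in>words (length v + length w). (?Y z u - ?Z z u) * shuffle_prod (delta_word v) (delta_word w) u) \<in> ord2 (N + 1)"
      using vw by (intro big_sum_in_bigo S2.order_ge_mult_bounded Y_close) (auto simp: words_def words_upto_def)
    from sum_in_bigo(1)[OF sum_in_bigo(2)[OF 1 2] Z_shuffle[OF vw]]
    show "(\<lambda>z. ?Y z v * ?Y z w - shuffle_pairing (?Y z) v w) \<in> ord2 (N + 1)"
      by (simp add: shuffle_pairing_def algebra_simps sum_subtractf)
  qed
  show thesis
  proof (rule that[of Y])
    show "Y \<in> rough_paths p T \<omega>"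
      by (rule rough_pathsI[OF _ Y_Nil Y_bound Y_chen Y_shuffle]) (simp add: Y_def)
    show "Y s t = (\<lambda>_. 0)" if "(s, t) \<notin> Simplex T" for s t
      using that by (simp add: Y_def fun_eq_iff)
  qed (rule Y_close)
qed

end

section \<open>Controlled paths\<close>

lemma pair_tensor_mult:
  fixes h :: "'v::euclidean_space list \<Rightarrow> 'u::real_normed_vector"
  assumes "a \<in> homogeneous n"
  shows "pair (n + k) h (tensor_mult (component k x) a) =
    (\<Sum>v\<in>words k. \<Sum>y\<in>words n. (x v * a y) *\<^sub>R h (v @ y))"
proof -
  have "tensor_mult (component k x) a (v @ y) = x v * a y" if v: "v \<in> words k" and y: "y \<in> words n" for v y
  proof -
    have k: "length v = k" using v by (simp add: words_def)
    have "tensor_mult (component k x) a (v @ y)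
        = (\<Sum>i\<le>length (v @ y). if i = k then x v * a y else 0)"
      unfolding tensor_mult_def
    proof (rule sum.cong[OF refl])
      fix i assume i: "i \<in> {..length (v @ y)}"
      have "take i (v @ y) \<notin> words k" if "i \<noteq> k" using i that by (auto simp: words_def)
      then show "component k x (take i (v @ y)) * a (drop i (v @ y)) = (if i = k then x v * a y else 0)"
        using v k by (auto simp: component_def)
    qed
    then show ?thesis using k by simp
  qed
  then show ?thesis
    unfolding pair_def add.commute[of n k] sum_words_add by (intro sum.cong refl) auto
qed

lemma pair_delta_word: "y \<in> words n \<Longrightarrow> pair n h (delta_word y) = h y"
  unfolding pair_def
  by (simp add: delta_word_def if_distrib[of "\<lambda>c. c *\<^sub>R _"] cong: if_cong)

lemma delta_word_homogeneous: "y \<in> words n \<Longrightarrow> delta_word y \<in> homogeneous n"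
  by (auto simp: homogeneous_def delta_word_def)

lemma Nil_in_words_upto [simp]: "[] \<in> words_upto N"
  by (simp add: words_upto_def)

text \<open>Extension by zero turns a controlled path into a functional on all words, so that
  expansions may run over all of \<open>words_upto N\<close> whatever the tail.\<close>

definition trunc :: "nat \<Rightarrow> ('v::euclidean_space list \<Rightarrow> real) \<Rightarrow> 'v list \<Rightarrow> real" where
  "trunc M f w = (if w \<in> words_upto M then f w else 0)"

lemma translate_trunc_eq_0: "y \<notin> words_upto M \<Longrightarrow> translate N x (trunc M f) y = 0"
  unfolding translate_def by (rule sum.neutral) (auto simp: trunc_def words_upto_def)

context control_setup
begin

lemma norm_sum_ord2:
  fixes f :: "'i \<Rightarrow> real \<times> real \<Rightarrow> 'a::real_normed_vector"
  assumes "\<And>i. i \<in> I \<Longrightarrow> (\<lambda>z. norm (f i z)) \<in> ord2 n"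
  shows "(\<lambda>z. norm (\<Sum>i\<in>I. f i z)) \<in> ord2 n"
proof (rule landau_o.big_trans)
  show "(\<lambda>z. \<Sum>i\<in>I. norm (f i z)) \<in> ord2 n" by (rule big_sum_in_bigo) (rule assms)
  show "(\<lambda>z. norm (\<Sum>i\<in>I. f i z)) \<in> O[principal (Simplex T)](\<lambda>z. \<Sum>i\<in>I. norm (f i z))"
    unfolding bigo_principal_iff by (intro exI[of _ 1]) (auto intro!: order_trans[OF norm_sum])
qed

lemma norm_ord2_linear:
  fixes f :: "real \<times> real \<Rightarrow> 'a::real_normed_vector"
    and L :: "'a \<Rightarrow> 'b::real_normed_vector"
  assumes "(\<lambda>z. norm (f z)) \<in> ord2 n" "bounded_linear L"
  shows "(\<lambda>z. norm (L (f z))) \<in> ord2 n"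
proof (rule landau_o.big_trans[OF _ assms(1)])
  obtain K where "\<And>x. norm (L x) \<le> norm x * K"
    using bounded_linear.bounded[OF assms(2)] by blast
  then show "(\<lambda>z. norm (L (f z))) \<in> O[principal (Simplex T)](\<lambda>z. norm (f z))"
    unfolding bigo_principal_iff by (intro exI[of _ K]) (auto simp: mult.commute)
qed

lemma norm_ord2_coords:
  fixes f :: "real \<times> real \<Rightarrow> 'u::euclidean_space"
  assumes "\<And>e. e \<in> Basis \<Longrightarrow> (\<lambda>z. f z \<bullet> e) \<in> ord2 n"
  shows "(\<lambda>z. norm (f z)) \<in> ord2 n"
proof -
  have "(\<lambda>z. norm (\<Sum>e\<in>Basis. (f z \<bullet> e) *\<^sub>R e)) \<in> ord2 n"
    by (rule norm_sum_ord2) (use assms in simp)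
  then show ?thesis by (simp add: euclidean_representation)
qed

lemma approx_iff:
  assumes "1 \<le> m"
  shows "approx p T \<omega> m a b \<longleftrightarrow> (\<lambda>z. norm (a (fst z) (snd z) - b (fst z) (snd z))) \<in> ord2 m"
  unfolding approx_def ord2_iff \<rho>_power[OF assms] by (auto simp: Simplex_def)

lemma Cp_paths_iff: "f \<in> Cp_paths p T \<omega> \<longleftrightarrow> (\<lambda>z. norm (f (snd z) - f (fst z))) \<in> ord2 1"
proof
  assume "f \<in> Cp_paths p T \<omega>"
  then show "(\<lambda>z. norm (f (snd z) - f (fst z))) \<in> ord2 1"
    unfolding ord2_iff Cp_paths_def by (auto simp: Simplex_def \<rho>_def)
next
  assume "(\<lambda>z. norm (f (snd z) - f (fst z))) \<in> ord2 1"
  then obtain C where C: "\<And>s t. 0 \<le> s \<Longrightarrow> s \<le> t \<Longrightarrow> t \<le> T \<Longrightarrow> norm (f t - f s) \<le> C * \<rho> s t"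
    unfolding ord2_iff by auto
  then have "continuous_on {0..T} f" by (rule continuous_of_increments)
  with C show "f \<in> Cp_paths p T \<omega>" by (auto simp: Cp_paths_def Simplex_def \<rho>_def)
qed

text \<open>Homogeneous tensors are finite combinations of basis words, so the defining estimates
  need testing on words only.\<close>

lemma controlled_paths_iff:
  fixes X :: "real \<Rightarrow> real \<Rightarrow> 'v::euclidean_space list \<Rightarrow> real"
    and H :: "real \<Rightarrow> 'v list \<Rightarrow> 'u::real_normed_vector"
  shows "H \<in> controlled_paths p T \<omega> X \<longleftrightarrow>
    (\<forall>w\<in>words_upto (N - 1). (\<lambda>z. norm (H (snd z) w - H (fst z) w)) \<in> ord2 1) \<and>
    (\<forall>y. length y + 2 \<le> N \<longrightarrow> set y \<subseteq> Basis \<longrightarrow>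
       (\<lambda>z. norm (H (snd z) y - (\<Sum>w\<in>words_upto (N - 1 - length y). X (fst z) (snd z) w *\<^sub>R H (fst z) (w @ y)))) \<in> ord2 (N - length y))"
    (is "_ \<longleftrightarrow> ?C \<and> (\<forall>y. _ \<longrightarrow> _ \<longrightarrow> ?E y)")
proof -
  let ?D = "\<lambda>n a z. pair n (H (snd z)) a - (\<Sum>k\<le>N - 1 - n. pair (n + k) (H (fst z)) (tensor_mult (component k (X (fst z) (snd z))) a))"
  let ?G = "\<lambda>y z. H (snd z) y - (\<Sum>w\<in>words_upto (N - 1 - length y). X (fst z) (snd z) w *\<^sub>R H (fst z) (w @ y))"
  have D: "?D n a z = (\<Sum>y\<in>words n. a y *\<^sub>R ?G y z)" if a: "a \<in> homogeneous n" for n a and z :: "real \<times> real"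
  proof -
    have "(\<Sum>k\<le>N - 1 - n. pair (n + k) (H (fst z)) (tensor_mult (component k (X (fst z) (snd z))) a))
        = (\<Sum>w\<in>words_upto (N - 1 - n). \<Sum>y\<in>words n. (X (fst z) (snd z) w * a y) *\<^sub>R H (fst z) (w @ y))"
      by (simp add: pair_tensor_mult[OF a] sum_words_upto)
    also have "\<dots> = (\<Sum>y\<in>words n. \<Sum>w\<in>words_upto (N - 1 - n). (X (fst z) (snd z) w * a y) *\<^sub>R H (fst z) (w @ y))"
      by (rule sum.swap)
    also have "\<dots> = (\<Sum>y\<in>words n. a y *\<^sub>R (\<Sum>w\<in>words_upto (N - 1 - length y). X (fst z) (snd z) w *\<^sub>R H (fst z) (w @ y)))"
      by (intro sum.cong refl) (auto simp: words_def scaleR_sum_right mult.commute)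
    finally show ?thesis
      by (simp add: pair_def scaleR_diff_right sum_subtractf)
  qed
  have "(\<forall>n. n + 2 \<le> N \<longrightarrow> (\<forall>a\<in>homogeneous n. (\<lambda>z. norm (?D n a z)) \<in> ord2 (N - n)))
     \<longleftrightarrow> (\<forall>y. length y + 2 \<le> N \<longrightarrow> set y \<subseteq> Basis \<longrightarrow> ?E y)" (is "?L \<longleftrightarrow> ?R")
  proof
    assume L: ?L
    show ?R
    proof (intro allI impI)
      fix y :: "'v list" assume y: "length y + 2 \<le> N" "set y \<subseteq> Basis"
      then have yw: "y \<in> words (length y)" by (simp add: words_def)
      have "?D (length y) (delta_word y) z = ?G y z" for z
        unfolding D[OF delta_word_homogeneous[OF yw]]
        using pair_delta_word[OF yw, of "\<lambda>y. ?G y z"] by (simp only: pair_def)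
      then have eq: "(\<lambda>z. norm (?D (length y) (delta_word y) z)) = (\<lambda>z. norm (?G y z))" by simp
      from L y(1) delta_word_homogeneous[OF yw]
      have "(\<lambda>z. norm (?D (length y) (delta_word y) z)) \<in> ord2 (N - length y)" by blast
      then show "?E y" unfolding eq .
    qed
  next
    assume R: ?R
    show ?L
    proof (intro allI impI ballI)
      fix n and a :: "'v list \<Rightarrow> real" assume n: "n + 2 \<le> N" and a: "a \<in> homogeneous n"
      have "(\<lambda>z. norm (\<Sum>y\<in>words n. a y *\<^sub>R ?G y z)) \<in> ord2 (N - n)"
      proof (rule norm_sum_ord2)
        fix y :: "'v list" assume "y \<in> words n"
        then have "?E y" "length y = n" using R n by (auto simp: words_def)
        then show "(\<lambda>z. norm (a y *\<^sub>R ?G y z)) \<in> ord2 (N - n)"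
          by (simp add: norm_scaleR)
      qed
      then show "(\<lambda>z. norm (?D n a z)) \<in> ord2 (N - n)" by (simp only: D[OF a])
    qed
  qed
  moreover have "(\<forall>n. n + 2 \<le> N \<longrightarrow> (\<forall>a\<in>homogeneous n. approx p T \<omega> (N - n)
              (\<lambda>s t. pair n (H t) a)
              (\<lambda>s t. \<Sum>k\<le>N - 1 - n. pair (n + k) (H s) (tensor_mult (component k (X s t)) a))))
     \<longleftrightarrow> (\<forall>n. n + 2 \<le> N \<longrightarrow> (\<forall>a\<in>homogeneous n. (\<lambda>z. norm (?D n a z)) \<in> ord2 (N - n)))"
    by (intro all_cong1 imp_cong refl ball_cong approx_iff) simp
  ultimately show ?thesis
    unfolding controlled_paths_def mem_Collect_eq Cp_paths_iff by blast
qed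

text \<open>One estimate for tails of every length. For truncated functionals it is the Hoelder
  condition at length \<open>N - 1\<close> and the defining expansion below that; from length
  \<open>N\<close> on, subtraction of naturals reduces it to boundedness.\<close>

definition scalar_controlled ::
    "(real \<Rightarrow> real \<Rightarrow> 'v::euclidean_space list \<Rightarrow> real) \<Rightarrow> (real \<Rightarrow> 'v list \<Rightarrow> real) \<Rightarrow> bool" where
  "scalar_controlled X h \<longleftrightarrow>
     (\<forall>w. \<exists>C. \<forall>t\<in>{0..T}. \<bar>h t w\<bar> \<le> C) \<and>
     (\<forall>y. (\<lambda>z. translate N (X (fst z) (snd z)) (h (fst z)) y - h (snd z) y) \<in> ord2 (N - length y))"

lemma bounded_path_ord2:
  fixes h :: "real \<Rightarrow> real"
  assumes "\<exists>C. \<forall>t\<in>{0..T}. \<bar>h t\<bar> \<le> C"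
  shows "(\<lambda>z. h (fst z)) \<in> O[principal (Simplex T)](\<lambda>_. 1)" "(\<lambda>z. h (snd z)) \<in> O[principal (Simplex T)](\<lambda>_. 1)"
    "(\<lambda>z. h (fst z)) \<in> O[principal Tri](\<lambda>_. 1)" "(\<lambda>z. h (fst (snd z))) \<in> O[principal Tri](\<lambda>_. 1)"
proof -
  obtain C where "\<forall>t\<in>{0..T}. \<bar>h t\<bar> \<le> C" using assms by blast
  then show "(\<lambda>z. h (fst z)) \<in> O[principal (Simplex T)](\<lambda>_. 1)" "(\<lambda>z. h (snd z)) \<in> O[principal (Simplex T)](\<lambda>_. 1)"
    "(\<lambda>z. h (fst z)) \<in> O[principal Tri](\<lambda>_. 1)" "(\<lambda>z. h (fst (snd z))) \<in> O[principal Tri](\<lambda>_. 1)"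
    unfolding bigo_principal_iff by (intro exI[of _ C]; auto simp: Simplex_def Tri_def)+
qed

lemma scalar_controlledD:
  assumes "scalar_controlled X h"
  shows "(\<lambda>z. h (fst z) w) \<in> O[principal (Simplex T)](\<lambda>_. 1)" "(\<lambda>z. h (snd z) w) \<in> O[principal (Simplex T)](\<lambda>_. 1)"
    "(\<lambda>z. h (fst z) w) \<in> O[principal Tri](\<lambda>_. 1)" "(\<lambda>z. h (fst (snd z)) w) \<in> O[principal Tri](\<lambda>_. 1)"
    "(\<lambda>z. translate N (X (fst z) (snd z)) (h (fst z)) y - h (snd z) y) \<in> ord2 (N - length y)"
  using assms bounded_path_ord2[of "\<lambda>t. h t w"] unfolding scalar_controlled_def by blast+

text \<open>A general bounded linear form is used because integrands take values in spaces of linear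
  maps, where the form is evaluation followed by an inner product.\<close>

lemma controlled_imp_scalar_controlled:
  fixes X :: "real \<Rightarrow> real \<Rightarrow> 'v::euclidean_space list \<Rightarrow> real"
    and H :: "real \<Rightarrow> 'v list \<Rightarrow> 'u::real_normed_vector"
    and L :: "'u \<Rightarrow> real"
  assumes X: "X \<in> rough_paths p T \<omega>"
    and H: "H \<in> controlled_paths p T \<omega> X"
    and L: "bounded_linear L"
  shows "scalar_controlled X (\<lambda>t. trunc (N - 1) (\<lambda>w. L (H t w)))"
proof -
  interpret L: bounded_linear L by (rule L)
  note H' = H[unfolded controlled_paths_iff]
  let ?h = "\<lambda>t. trunc (N - 1) (\<lambda>w. L (H t w))"
  show ?thesis
    unfolding scalar_controlled_def
  proof (intro conjI allI)
    fix w :: "'v list"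
    show "\<exists>C. \<forall>t\<in>{0..T}. \<bar>?h t w\<bar> \<le> C"
    proof (cases "w \<in> words_upto (N - 1)")
      case True
      have "continuous_on {0..T} (\<lambda>t. H t w)"
        using H True by (auto simp: controlled_paths_def Cp_paths_def)
      then have "continuous_on {0..T} (\<lambda>t. L (H t w))" by (rule L.continuous_on)
      then have "bounded ((\<lambda>t. L (H t w)) ` {0..T})"
        by (intro compact_imp_bounded compact_continuous_image) auto
      then show ?thesis using True by (auto simp: bounded_iff trunc_def)
    qed (auto simp: trunc_def)
  next
    fix y :: "'v list"
    let ?D = "\<lambda>z. translate N (X (fst z) (snd z)) (?h (fst z)) y - ?h (snd z) y"
    consider (out) "y \<notin> words_upto (N - 1)" | (top) "y \<in> words_upto (N - 1)" "length y = N - 1"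
      | (low) "y \<in> words_upto (N - 1)" "length y + 2 \<le> N"
      by (force simp: words_upto_def)
    then show "?D \<in> ord2 (N - length y)"
    proof cases
      case out
      then have "?D z = 0" for z
        by (simp add: translate_trunc_eq_0) (simp add: trunc_def)
      then show ?thesis by simp
    next
      case top
      \<comment> \<open>At the top length only the empty word survives the truncation, and the
        expansion degenerates to an increment.\<close>
      have "?D z = - L (H (snd z) y - H (fst z) y)" if "z \<in> Simplex T" for z
      proof -
        have "translate N (X (fst z) (snd z)) (?h (fst z)) y
            = (\<Sum>w\<in>(words_upto N :: 'v list set). if w = [] then X (fst z) (snd z) [] * L (H (fst z) y) else 0)"
          unfolding translate_def
        proof (rule sum.cong[OF refl])
          fix w :: "'v list"
          show "X (fst z) (snd z) w * ?h (fst z) (w @ y) = (if w = [] then X (fst z) (snd z) [] * L (H (fst z) y) else 0)"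
            using top by (cases w) (auto simp: trunc_def words_upto_def)
        qed
        also have "\<dots> = L (H (fst z) y)"
          using rough_pathsD(2)[OF X, of "fst z" "snd z"] that by simp
        finally show ?thesis using top by (simp add: trunc_def L.diff)
      qed
      moreover have "(\<lambda>z. norm (L (H (snd z) y - H (fst z) y))) \<in> ord2 1"
        by (rule norm_ord2_linear[OF _ L]) (use H' top in blast)
      moreover have "N - length y = 1" using top N_ge_1 by simp
      ultimately show ?thesis
        by (subst bigo_principal_cong[where g = "\<lambda>z. - L (H (snd z) y - H (fst z) y)"]) auto
    next
      case low
      let ?G = "\<lambda>z. H (snd z) y - (\<Sum>w\<in>words_upto (N - 1 - length y). X (fst z) (snd z) w *\<^sub>R H (fst z) (w @ y))"
      have "?D z = - L (?G z)" for z
      proof -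
        have "translate N (X (fst z) (snd z)) (?h (fst z)) y
            = (\<Sum>w\<in>words_upto (N - 1 - length y). X (fst z) (snd z) w * L (H (fst z) (w @ y)))"
          unfolding translate_def
          by (rule sum.mono_neutral_cong_right, rule finite_words_upto) (use low in \<open>auto simp: trunc_def words_upto_def\<close>)
        then show ?thesis using low by (simp add: trunc_def L.diff L.sum L.scaleR)
      qed
      moreover have "(\<lambda>z. norm (L (?G z))) \<in> ord2 (N - length y)"
      proof (rule norm_ord2_linear[OF _ L])
        have "set y \<subseteq> Basis" using low by (simp add: words_upto_def)
        with H' low(2) show "(\<lambda>z. norm (?G z)) \<in> ord2 (N - length y)" by blast
      qed
      ultimately show ?thesis by simp
    qed
  qed
qed

text \<open>A discarded term carries a word \<open>w\<close> with
  \<open>length w + length y \<ge> N\<close>, hence a component of order at least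
  \<open>N - length y\<close>.\<close>

lemma scalar_controlled_trunc:
  fixes X :: "real \<Rightarrow> real \<Rightarrow> 'v::euclidean_space list \<Rightarrow> real"
  assumes X: "X \<in> rough_paths p T \<omega>" and h: "scalar_controlled X h"
  shows "scalar_controlled X (\<lambda>t. trunc (N - 1) (h t))"
  unfolding scalar_controlled_def
proof (intro conjI allI)
  fix w :: "'v list"
  show "\<exists>C. \<forall>t\<in>{0..T}. \<bar>trunc (N - 1) (h t) w\<bar> \<le> C"
    using h by (cases "w \<in> words_upto (N - 1)") (auto simp: scalar_controlled_def trunc_def)
next
  fix y :: "'v list"
  show "(\<lambda>z. translate N (X (fst z) (snd z)) (trunc (N - 1) (h (fst z))) y - trunc (N - 1) (h (snd z)) y) \<in> ord2 (N - length y)"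
  proof (cases "y \<in> words_upto (N - 1)")
    case False
    then have "translate N (X (fst z) (snd z)) (trunc (N - 1) (h (fst z))) y - trunc (N - 1) (h (snd z)) y = 0" for z
      by (simp add: translate_trunc_eq_0) (simp add: trunc_def)
    then show ?thesis by simp
  next
    case True
    let ?e = "\<lambda>z w. X (fst z) (snd z) w * (if length w + length y \<le> N - 1 then 0 else h (fst z) (w @ y))"
    have "(\<lambda>z. \<Sum>w\<in>words_upto N. ?e z w) \<in> ord2 (N - length y)"
    proof (rule big_sum_in_bigo)
      fix w :: "'v list" assume w: "w \<in> words_upto N"
      show "(\<lambda>z. ?e z w) \<in> ord2 (N - length y)"
      proof (cases "length w + length y \<le> N - 1")
        case False
        have "(\<lambda>z. X (fst z) (snd z) w * h (fst z) (w @ y)) \<in> ord2 (length w)"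
          by (intro S2.order_ge_mult_bounded rough_pathsD(3)[OF X] w scalar_controlledD[OF h])
        then have "(\<lambda>z. X (fst z) (snd z) w * h (fst z) (w @ y)) \<in> ord2 (N - length y)"
          by (rule S2.order_ge_mono) (use False in simp)
        then show ?thesis using False by simp
      qed simp
    qed
    from sum_in_bigo(2)[OF scalar_controlledD(5)[OF h] this]
    have "(\<lambda>z. (translate N (X (fst z) (snd z)) (h (fst z)) y - h (snd z) y) - (\<Sum>w\<in>words_upto N. ?e z w)) \<in> ord2 (N - length y)" .
    moreover have "translate N (X (fst z) (snd z)) (h (fst z)) y - (\<Sum>w\<in>words_upto N. ?e z w)
        = translate N (X (fst z) (snd z)) (trunc (N - 1) (h (fst z))) y" for z
      unfolding translate_def sum_subtractf[symmetric]
      by (intro sum.cong refl) (use True in \<open>auto simp: trunc_def words_upto_def\<close>)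
    ultimately show ?thesis using True by (simp add: trunc_def algebra_simps)
  qed
qed

text \<open>The Hoelder condition is recovered from the expansion, in which every term except that
  of the empty word has a component of positive degree.\<close>

lemma scalar_controlled_imp_controlled:
  fixes X :: "real \<Rightarrow> real \<Rightarrow> 'v::euclidean_space list \<Rightarrow> real"
    and H :: "real \<Rightarrow> 'v list \<Rightarrow> 'u::euclidean_space"
  assumes X: "X \<in> rough_paths p T \<omega>"
    and h: "\<And>e. e \<in> Basis \<Longrightarrow> scalar_controlled X (\<lambda>t. trunc (N - 1) (\<lambda>w. H t w \<bullet> e))"
  shows "H \<in> controlled_paths p T \<omega> X"
  unfolding controlled_paths_iff
proof (intro conjI ballI allI impI norm_ord2_coords)
  let ?h = "\<lambda>e t. trunc (N - 1) (\<lambda>w. H t w \<bullet> e)"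
  {
    fix y :: "'v list" and e :: 'u
    assume y: "y \<in> words_upto (N - 1)" and e: "e \<in> Basis"
    have "(\<Sum>w\<in>words_upto (N - 1 - length y). X (fst z) (snd z) w * (H (fst z) (w @ y) \<bullet> e))
        = translate N (X (fst z) (snd z)) (?h e (fst z)) y" for z
      unfolding translate_def
      by (rule sum.mono_neutral_cong_left, rule finite_words_upto) (use y in \<open>auto simp: trunc_def words_upto_def\<close>)
    moreover have "(\<lambda>z. - (translate N (X (fst z) (snd z)) (?h e (fst z)) y - ?h e (snd z) y)) \<in> ord2 (N - length y)"
      using scalar_controlledD(5)[OF h[OF e]] by (subst landau_o.big.uminus_in_iff)
    ultimately have "(\<lambda>z. (H (snd z) y - (\<Sum>w\<in>words_upto (N - 1 - length y). X (fst z) (snd z) w *\<^sub>R H (fst z) (w @ y))) \<bullet> e)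
        \<in> ord2 (N - length y)"
      using y by (simp add: trunc_def inner_diff_left inner_sum_left)
  } note main = this
  {
    fix y :: "'v list" and e :: 'u
    assume "length y + 2 \<le> N" "set y \<subseteq> Basis" "e \<in> Basis"
    then show "(\<lambda>z. (H (snd z) y - (\<Sum>w\<in>words_upto (N - 1 - length y). X (fst z) (snd z) w *\<^sub>R H (fst z) (w @ y))) \<bullet> e)
        \<in> ord2 (N - length y)"
      by (intro main) (auto simp: words_upto_def)
  }
  fix y :: "'v list" and e :: 'u
  assume y: "y \<in> words_upto (N - 1)" and e: "e \<in> Basis"
  have 1: "(\<lambda>z. (H (snd z) y - (\<Sum>w\<in>words_upto (N - 1 - length y). X (fst z) (snd z) w *\<^sub>R H (fst z) (w @ y))) \<bullet> e) \<in> ord2 1"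
    by (rule S2.order_ge_mono[OF main[OF y e]]) (use y N_ge_1 in \<open>auto simp: words_upto_def\<close>)
  have 2: "(\<lambda>z. \<Sum>w\<in>words_upto (N - 1 - length y) - {[]}. X (fst z) (snd z) w * ?h e (fst z) (w @ y)) \<in> ord2 1"
  proof (rule big_sum_in_bigo)
    fix w :: "'v list" assume w: "w \<in> words_upto (N - 1 - length y) - {[]}"
    then have "w \<in> words_upto N" by (auto simp: words_upto_def)
    then have "(\<lambda>z. X (fst z) (snd z) w * ?h e (fst z) (w @ y)) \<in> ord2 (length w)"
      by (intro S2.order_ge_mult_bounded rough_pathsD(3)[OF X] scalar_controlledD(1)[OF h[OF e]])
    then show "(\<lambda>z. X (fst z) (snd z) w * ?h e (fst z) (w @ y)) \<in> ord2 1"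
      by (rule S2.order_ge_mono) (use w in \<open>auto simp: Suc_le_eq\<close>)
  qed
  have "(H (snd z) y - H (fst z) y) \<bullet> e =
     (H (snd z) y - (\<Sum>w\<in>words_upto (N - 1 - length y). X (fst z) (snd z) w *\<^sub>R H (fst z) (w @ y))) \<bullet> e
     + (\<Sum>w\<in>words_upto (N - 1 - length y) - {[]}. X (fst z) (snd z) w * ?h e (fst z) (w @ y))"
    if z: "z \<in> Simplex T" for z
  proof -
    let ?W = "words_upto (N - 1 - length y)"
    have "(\<Sum>w\<in>?W. X (fst z) (snd z) w *\<^sub>R H (fst z) (w @ y)) \<bullet> e
        = (\<Sum>w\<in>?W. X (fst z) (snd z) w * ?h e (fst z) (w @ y))"
      unfolding inner_sum_left by (intro sum.cong refl) (use y in \<open>auto simp: trunc_def words_upto_def\<close>)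
    also have "\<dots> = X (fst z) (snd z) [] * ?h e (fst z) y + (\<Sum>w\<in>?W - {[]}. X (fst z) (snd z) w * ?h e (fst z) (w @ y))"
      by (subst sum.remove[OF finite_words_upto, of "[]"]) (auto simp: words_upto_def)
    finally show ?thesis
      using rough_pathsD(2)[OF X, of "fst z" "snd z"] z y by (simp add: inner_diff_left trunc_def)
  qed
  then show "(\<lambda>z. (H (snd z) y - H (fst z) y) \<bullet> e) \<in> ord2 1"
    using sum_in_bigo(1)[OF 1 2] by (subst bigo_principal_cong) auto
qed

text \<open>Chen's identity regroups the pairing with \<open>X s t\<close> by the cut. Pairs of
  total degree above \<open>N\<close> occur in the iterated pairing only and have order at least
  \<open>N + 1\<close>.\<close>

lemma translate_chen:
  fixes X :: "real \<Rightarrow> real \<Rightarrow> 'v::euclidean_space list \<Rightarrow> real"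
  assumes X: "X \<in> rough_paths p T \<omega>"
    and f: "\<And>w. (\<lambda>z. f z w) \<in> O[principal Tri](\<lambda>_. 1)"
  shows "(\<lambda>z. translate N (X (fst z) (snd (snd z))) (f z) []
     - (\<Sum>y\<in>words_upto N. X (fst (snd z)) (snd (snd z)) y * translate N (X (fst z) (fst (snd z))) (f z) y)) \<in> ord3 (N + 1)"
proof -
  let ?A = "\<lambda>z. X (fst z) (fst (snd z))" and ?B = "\<lambda>z. X (fst (snd z)) (snd (snd z))"
  let ?e = "\<lambda>z y v. if length v + length y \<le> N then 0 else - (?A z v * ?B z y * f z (v @ y))"
  have "(\<lambda>z. \<Sum>y\<in>words_upto N. \<Sum>v\<in>words_upto N. ?e z y v) \<in> ord3 (N + 1)"
  proof (intro big_sum_in_bigo)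
    fix y v :: "'v list" assume y: "y \<in> words_upto N" and v: "v \<in> words_upto N"
    show "(\<lambda>z. ?e z y v) \<in> ord3 (N + 1)"
    proof (cases "length v + length y \<le> N")
      case False
      have "(\<lambda>z. ?A z v * ?B z y * f z (v @ y)) \<in> ord3 (length v + length y)"
        using ord2_to_ord3(1)[OF rough_pathsD(3)[OF X v]] ord2_to_ord3(2)[OF rough_pathsD(3)[OF X y]]
        by (intro S3.order_ge_mult_bounded S3.order_ge_mult f) simp_all
      then have "(\<lambda>z. ?A z v * ?B z y * f z (v @ y)) \<in> ord3 (N + 1)"
        by (rule S3.order_ge_mono) (use False in simp)
      then show ?thesis using False by simp
    qed simp
  qed
  moreover have "translate N (X (fst z) (snd (snd z))) (f z) []
     - (\<Sum>y\<in>words_upto N. ?B z y * translate N (?A z) (f z) y) = (\<Sum>y\<in>words_upto N. \<Sum>v\<in>words_upto N. ?e z y v)"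
    if z: "z \<in> Tri" for z
  proof -
    have t: "(fst z, fst (snd z), snd (snd z)) \<in> Tri" using z by simp
    let ?t = "\<lambda>v y. ?A z v * ?B z y * f z (v @ y)"
    have "translate N (X (fst z) (snd (snd z))) (f z) []
        = (\<Sum>n\<le>N. \<Sum>w\<in>words n. tensor_mult (?A z) (?B z) w * f z w)"
      unfolding translate_def sum_words_upto
      by (intro sum.cong refl) (auto simp: rough_pathsD(4)[OF X t] words_def words_upto_def)
    also have "\<dots> = (\<Sum>n\<le>N. \<Sum>w\<in>words n. \<Sum>k\<le>n. ?A z (take k w) * ?B z (drop k w) * f z w)"
      unfolding tensor_mult_def sum_distrib_right by (intro sum.cong refl) (auto simp: words_def)
    also have "\<dots> = (\<Sum>n\<le>N. \<Sum>k\<le>n. \<Sum>w\<in>words (k + (n - k)). ?A z (take k w) * ?B z (drop k w) * f z w)"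
      by (rule sum.cong[OF refl], rule trans[OF sum.swap], rule sum.cong[OF refl]) simp
    also have "\<dots> = (\<Sum>n\<le>N. \<Sum>k\<le>n. \<Sum>v\<in>words k. \<Sum>y\<in>words (n - k). ?t v y)"
      unfolding sum_words_add by (intro sum.cong refl) (auto simp: words_def)
    also have "\<dots> = (\<Sum>(n, k)\<in>Sigma {..N} (\<lambda>n. {..n}). \<Sum>v\<in>words k. \<Sum>y\<in>words (n - k). ?t v y)"
      by (rule sum.Sigma) auto
    also have "\<dots> = (\<Sum>(j, k)\<in>Sigma {..N} (\<lambda>j. {..N - j}). \<Sum>v\<in>words k. \<Sum>y\<in>words j. ?t v y)"
      by (rule sum.reindex_bij_witness[where i = "\<lambda>(j, k). (j + k, k)" and j = "\<lambda>(n, k). (n - k, k)"]) auto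
    also have "\<dots> = (\<Sum>j\<le>N. \<Sum>k\<le>N - j. \<Sum>v\<in>words k. \<Sum>y\<in>words j. ?t v y)"
      by (rule sum.Sigma[symmetric]) auto
    also have "\<dots> = (\<Sum>j\<le>N. \<Sum>v\<in>words_upto (N - j). \<Sum>y\<in>words j. ?t v y)"
      by (simp add: sum_words_upto)
    also have "\<dots> = (\<Sum>j\<le>N. \<Sum>y\<in>words j. \<Sum>v\<in>words_upto (N - j). ?t v y)"
      by (rule sum.cong[OF refl], rule sum.swap)
    also have "\<dots> = (\<Sum>y\<in>words_upto N. \<Sum>v\<in>words_upto N. if length v + length y \<le> N then ?t v y else 0)"
      unfolding sum_words_upto[of _ N]
    proof (rule sum.cong[OF refl], rule sum.cong[OF refl])
      fix j and y :: "'v list" assume j: "j \<in> {..N}" and y: "y \<in> words j"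
      have "(\<Sum>v\<in>words_upto (N - j). ?t v y) = (\<Sum>v\<in>words_upto N. if length v + length y \<le> N then ?t v y else 0)"
        by (rule sum.mono_neutral_cong_left, rule finite_words_upto) (use j y in \<open>auto simp: words_def words_upto_def\<close>)
      then show "(\<Sum>v\<in>words_upto (N - j). ?t v y) = (\<Sum>n\<le>N. \<Sum>v\<in>words n. if length v + length y \<le> N then ?t v y else 0)"
        by (simp add: sum_words_upto)
    qed
    finally have 1: "translate N (X (fst z) (snd (snd z))) (f z) []
        = (\<Sum>y\<in>words_upto N. \<Sum>v\<in>words_upto N. if length v + length y \<le> N then ?t v y else 0)" .
    have 2: "(\<Sum>y\<in>words_upto N. ?B z y * translate N (?A z) (f z) y) = (\<Sum>y\<in>words_upto N. \<Sum>v\<in>words_upto N. ?t v y)"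
      by (simp add: translate_def sum_distrib_left mult_ac)
    show ?thesis
      unfolding 1 2 sum_subtractf[symmetric] by (rule sum.cong[OF refl], rule sum.cong[OF refl]) simp
  qed
  ultimately show ?thesis by (subst bigo_principal_cong) auto
qed

end

section \<open>Lifts and rough integrals\<close>

lemma finite_listset: "(\<And>A. A \<in> set As \<Longrightarrow> finite A) \<Longrightarrow> finite (listset As)"
  by (induction As) (auto simp: set_Cons_def finite_image_set2)

lemma chop_in_listset:
  assumes "set w \<subseteq> Basis" "length w = sum_list ns"
  shows "chop ns w \<in> listset (map words ns)"
  using assms
proof (induction ns arbitrary: w)
  case (Cons n ns)
  then have "take n w \<in> words n" by (auto simp: words_def dest: in_set_takeD)
  moreover have "chop ns (drop n w) \<in> listset (map words ns)"
    using Cons by (intro Cons.IH) (auto dest: in_set_dropD)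
  ultimately show ?case by (auto simp: set_Cons_def)
qed simp

lemma permute_word_in_words:
  assumes "\<sigma> permutes {..<n}" "w \<in> words n"
  shows "permute_word \<sigma> w \<in> words n"
proof -
  have "\<sigma> i < n" if "i < n" for i using permutes_in_image[OF assms(1), of i] that by simp
  then show ?thesis using assms(2) by (auto simp: permute_word_def words_def)
qed

text \<open>Each permuted basis word is chopped into exactly one list of words, so the coproduct
  collapses to a sum over permutations.\<close>

lemma box_apply_coproduct_osh:
  fixes a :: "'a::euclidean_space list \<Rightarrow> real"
  assumes "u \<in> words (length ns)"
  shows "box_apply h ns (coproduct_osh ns a) u =
    (\<Sum>w\<in>words (sum_list ns). a w * (\<Sum>\<sigma>\<in>ordered_shuffles_of ns.
       \<Prod>i<length ns. h (chop ns (permute_word \<sigma> w) ! i) \<bullet> (u ! i)))"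
proof -
  let ?L = "listset (map words ns) :: 'a list list set" and ?n = "sum_list ns" and ?O = "ordered_shuffles_of ns"
  let ?P = "\<lambda>ws. \<Prod>i<length ns. h (ws ! i) \<bullet> (u ! i)"
  have finL: "finite ?L" by (rule finite_listset) auto
  have len: "length ws = length ns" if "ws \<in> ?L" for ws
    using that by (induction ns arbitrary: ws) (auto simp: set_Cons_def)
  have "box_apply h ns (coproduct_osh ns a) u = (\<Sum>ws\<in>?L. coproduct_osh ns a ws * ?P ws)"
    unfolding box_apply_def
    by (intro sum.cong refl) (use assms(1) in \<open>simp add: pure_tensor_def len\<close>)
  also have "\<dots> = (\<Sum>ws\<in>?L. \<Sum>w\<in>words ?n. \<Sum>\<sigma>\<in>?O. if chop ns (permute_word \<sigma> w) = ws then a w * ?P ws else 0)"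
    unfolding coproduct_osh_def coproduct_def sum_distrib_right
    by (intro sum.cong refl) simp
  also have "\<dots> = (\<Sum>w\<in>words ?n. \<Sum>\<sigma>\<in>?O. \<Sum>ws\<in>?L. if chop ns (permute_word \<sigma> w) = ws then a w * ?P ws else 0)"
    by (rule trans[OF sum.swap], rule sum.cong[OF refl], rule sum.swap)
  also have "\<dots> = (\<Sum>w\<in>words ?n. \<Sum>\<sigma>\<in>?O. a w * ?P (chop ns (permute_word \<sigma> w)))"
  proof (rule sum.cong[OF refl], rule sum.cong[OF refl])
    fix w :: "'a list" and \<sigma> assume w: "w \<in> words ?n" and \<sigma>: "\<sigma> \<in> ?O"
    have "permute_word \<sigma> w \<in> words ?n"
      using w \<sigma> by (intro permute_word_in_words) (auto simp: ordered_shuffles_of_def shuffles_of_def)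
    then have "chop ns (permute_word \<sigma> w) \<in> ?L"
      by (intro chop_in_listset) (auto simp: words_def)
    then show "(\<Sum>ws\<in>?L. if chop ns (permute_word \<sigma> w) = ws then a w * ?P ws else 0) = a w * ?P (chop ns (permute_word \<sigma> w))"
      using finL by simp
  qed
  finally show ?thesis by (simp add: sum_distrib_left)
qed

lemma sum_ordered_shuffles_eq_osh:
  assumes "length u = m" "length w = n"
  shows "(\<Sum>ns\<in>{ns \<in> positive_lists m. sum_list ns = n}. \<Sum>\<sigma>\<in>ordered_shuffles_of ns.
       \<Prod>i<length ns. h (chop ns (permute_word \<sigma> w) ! i) \<bullet> (u ! i)) = osh (\<lambda>e v. h v \<bullet> e) u w"
proof -
  have "(\<Sum>ns\<in>{ns \<in> positive_lists m. sum_list ns = n}. \<Sum>\<sigma>\<in>ordered_shuffles_of ns.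
       \<Prod>i<length ns. h (chop ns (permute_word \<sigma> w) ! i) \<bullet> (u ! i))
     = (\<Sum>ns\<in>{ns \<in> positive_lists m. sum_list ns = n}. \<Sum>\<sigma>\<in>ordered_shuffles_of ns.
       \<Prod>i<m. h (chop ns (permute_word \<sigma> w) ! i) \<bullet> (u ! i))"
    by (intro sum.cong refl) (auto simp: positive_lists_def)
  also have "\<dots> = osh (\<lambda>e v. h v \<bullet> e) u w"
    using sum_ordered_shuffles_eq_ordered_parts[OF assms(2), where \<phi> = "\<lambda>ws. \<Prod>i<m. h (ws ! i) \<bullet> (u ! i)" and m = m]
    by (simp add: osh_eq_sum_ordered_parts assms(1))
  finally show ?thesis .
qed

lemma finite_positive_lists: "finite {ns \<in> positive_lists m. sum_list ns \<le> n}"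
proof (rule finite_subset)
  show "{ns \<in> positive_lists m. sum_list ns \<le> n} \<subseteq> {ns. set ns \<subseteq> {..n} \<and> length ns = m}"
    by (auto simp: positive_lists_def intro: order_trans[OF member_le_sum_list])
qed (simp add: finite_lists_length_eq)

text \<open>With at least two blocks in a word of length at most \<open>N\<close> no block exceeds
  \<open>N - 1\<close> letters, so truncated coordinates give the same value; a single block of
  length \<open>N\<close> would be lost.\<close>

lemma sum_box_apply_eq_translate:
  fixes x :: "'v::euclidean_space list \<Rightarrow> real"
    and h :: "'v list \<Rightarrow> 'u::euclidean_space"
  assumes u: "u \<in> words m" and m: "2 \<le> m" "1 \<le> N"
  shows "(\<Sum>ns\<in>{ns \<in> positive_lists m. sum_list ns \<le> N}.
       box_apply h ns (coproduct_osh ns (component (sum_list ns) x)) u)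
     = translate N x (osh (\<lambda>e. trunc (N - 1) (\<lambda>w. h w \<bullet> e)) u) []"
proof -
  let ?A = "\<lambda>n. {ns \<in> positive_lists m. sum_list ns = n}"
  let ?S = "\<lambda>ns w. \<Sum>\<sigma>\<in>ordered_shuffles_of ns. \<Prod>i<length ns. h (chop ns (permute_word \<sigma> w) ! i) \<bullet> (u ! i)"
  have finA: "finite (?A n)" for n
    by (rule finite_subset[OF _ finite_positive_lists[of m n]]) auto
  have "{ns \<in> positive_lists m. sum_list ns \<le> N} = (\<Union>n\<le>N. ?A n)" by auto
  then have "(\<Sum>ns\<in>{ns \<in> positive_lists m. sum_list ns \<le> N}.
       box_apply h ns (coproduct_osh ns (component (sum_list ns) x)) u)
     = (\<Sum>n\<le>N. \<Sum>ns\<in>?A n. box_apply h ns (coproduct_osh ns (component (sum_list ns) x)) u)"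
    using finA by (simp only:) (rule sum.UNION_disjoint, simp_all, blast)
  also have "\<dots> = (\<Sum>n\<le>N. \<Sum>ns\<in>?A n. \<Sum>w\<in>words n. x w * ?S ns w)"
  proof (rule sum.cong[OF refl], rule sum.cong[OF refl])
    fix n ns assume ns: "ns \<in> ?A n"
    then have "u \<in> words (length ns)" using u by (simp add: positive_lists_def)
    from box_apply_coproduct_osh[OF this, where a = "component n x" and h = h] ns
    show "box_apply h ns (coproduct_osh ns (component (sum_list ns) x)) u = (\<Sum>w\<in>words n. x w * ?S ns w)"
      by (simp add: component_def)
  qed
  also have "\<dots> = (\<Sum>n\<le>N. \<Sum>w\<in>words n. x w * (\<Sum>ns\<in>?A n. ?S ns w))"
    unfolding sum_distrib_left by (rule sum.cong[OF refl], rule sum.swap)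
  also have "\<dots> = (\<Sum>n\<le>N. \<Sum>w\<in>words n. x w * osh (\<lambda>e. trunc (N - 1) (\<lambda>w. h w \<bullet> e)) u w)"
  proof (rule sum.cong[OF refl], rule sum.cong[OF refl])
    fix n and w :: "'v list" assume n: "n \<in> {..N}" and w: "w \<in> words n"
    have "length u = m" "length w = n" using u w by (auto simp: words_def)
    then have "(\<Sum>ns\<in>?A n. ?S ns w) = osh (\<lambda>e v. h v \<bullet> e) u w"
      by (rule sum_ordered_shuffles_eq_osh)
    also have "\<dots> = osh (\<lambda>e. trunc (N - 1) (\<lambda>w. h w \<bullet> e)) u w"
      by (rule osh_cong) (use w n m \<open>length u = m\<close> in \<open>auto simp: trunc_def words_upto_def words_def\<close>)
    finally show "x w * (\<Sum>ns\<in>?A n. ?S ns w) = x w * osh (\<lambda>e. trunc (N - 1) (\<lambda>w. h w \<bullet> e)) u w"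
      by simp
  qed
  finally show ?thesis by (simp add: translate_def sum_words_upto)
qed

context control_setup
begin

text \<open>By induction on length the proper cuts in Chen's identity agree, so the difference at
  \<open>w\<close> is additive; being of order \<open>N + 1\<close> it vanishes.\<close>

lemma rough_path_eqI:
  fixes Y Y' :: "real \<Rightarrow> real \<Rightarrow> 'u::euclidean_space list \<Rightarrow> real"
  assumes Y: "Y \<in> rough_paths p T \<omega>" and Y': "Y' \<in> rough_paths p T \<omega>"
    and close: "\<And>w. w \<in> words_upto N \<Longrightarrow> (\<lambda>z. Y (fst z) (snd z) w - Y' (fst z) (snd z) w) \<in> ord2 (N + 1)"
    and st: "(s, t) \<in> Simplex T"
  shows "Y s t = Y' s t"
proof
  fix w :: "'u list"
  show "Y s t w = Y' s t w"
  proof (cases "w \<in> words_upto N")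
    case True
    then show ?thesis using st
    proof (induction "length w" arbitrary: w s t rule: less_induct)
      case less
      show ?case
      proof (cases "w = []")
        case True
        then show ?thesis using rough_pathsD(2)[OF Y less.prems(2)] rough_pathsD(2)[OF Y' less.prems(2)] by simp
      next
        case False
        define D where "D s t = Y s t w - Y' s t w" for s t
        have add: "D s t = D s u + D u t" if "0 \<le> s" "s \<le> u" "u \<le> t" "t \<le> T" for s u t
        proof -
          have S: "(s, u, t) \<in> Tri" "(s, u) \<in> Simplex T" "(u, t) \<in> Simplex T"
            using that by (auto simp: Tri_def Simplex_def)
          have "(\<Sum>i\<in>{1..<length w}. Y s u (take i w) * Y u t (drop i w))
              = (\<Sum>i\<in>{1..<length w}. Y' s u (take i w) * Y' u t (drop i w))"
          proof (rule sum.cong[OF refl])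
            fix i assume i: "i \<in> {1..<length w}"
            have "Y s u (take i w) = Y' s u (take i w)" "Y u t (drop i w) = Y' u t (drop i w)"
              using i S less.prems(1) by (auto intro!: less.hyps in_words_upto_take_drop)
            then show "Y s u (take i w) * Y u t (drop i w) = Y' s u (take i w) * Y' u t (drop i w)" by simp
          qed
          moreover have "tensor_mult a b w = a [] * b w + (\<Sum>i\<in>{1..<length w}. a (take i w) * b (drop i w)) + a w * b []"
            for a b :: "'u list \<Rightarrow> real"
          proof -
            have "{1..length w} = insert (length w) {1..<length w}" using False by (auto simp: Suc_le_eq)
            then show ?thesis by (simp add: tensor_mult_split_first)
          qed
          ultimately show ?thesis
            unfolding D_def using rough_pathsD(4)[OF Y S(1) less.prems(1)] rough_pathsD(4)[OF Y' S(1) less.prems(1)]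
              rough_pathsD(2)[OF Y S(2)] rough_pathsD(2)[OF Y S(3)] rough_pathsD(2)[OF Y' S(2)] rough_pathsD(2)[OF Y' S(3)]
            by simp
        qed
        have "(\<lambda>z. D (fst z) (snd z)) \<in> ord2 (N + 1)"
          unfolding D_def by (rule close) (rule less.prems)
        moreover have "0 \<le> s" "s \<le> t" "t \<le> T" using less.prems(2) by (auto simp: Simplex_def)
        ultimately have "D s t = 0" using additive_order_eq_0[of D s t] add by blast
        then show ?thesis by (simp add: D_def)
      qed
    qed
  next
    case False
    then show ?thesis using rough_pathsD(1)[OF Y st] rough_pathsD(1)[OF Y' st] by simp
  qed
qed

section \<open>The germ of a lift\<close>

abbreviation coords :: "(real \<Rightarrow> 'v::euclidean_space list \<Rightarrow> 'u::real_inner) \<Rightarrow> real \<Rightarrow> 'u \<Rightarrow> 'v list \<Rightarrow> real" where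
  "coords H s \<equiv> (\<lambda>e. trunc (N - 1) (\<lambda>w. H s w \<bullet> e))"

text \<open>The local approximation from the definition of the lift, extended to words of every
  length so that it can be multiplied and deconcatenated.\<close>

definition lift_germ ::
    "(real \<Rightarrow> real \<Rightarrow> 'v::euclidean_space list \<Rightarrow> real) \<Rightarrow> (real \<Rightarrow> 'u \<Rightarrow> 'v list \<Rightarrow> real)
      \<Rightarrow> real \<Rightarrow> real \<Rightarrow> 'u list \<Rightarrow> real" where
  "lift_germ X h s t us = translate N (X s t) (osh (h s) us) []"

lemma is_rough_lift_iff:
  fixes X :: "real \<Rightarrow> real \<Rightarrow> 'v::euclidean_space list \<Rightarrow> real"
    and H :: "real \<Rightarrow> 'v list \<Rightarrow> 'u::euclidean_space"
  shows "is_rough_lift p T \<omega> X H Y \<longleftrightarrow> Y \<in> rough_paths p T \<omega> \<and>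
     is_trace T Y (\<lambda>t. H t []) \<and>
     (\<forall>us\<in>words_upto N. 2 \<le> length us \<longrightarrow>
        (\<lambda>z. Y (fst z) (snd z) us - lift_germ X (coords H) (fst z) (snd z) us) \<in> ord2 (N + 1))"
proof -
  have "approx p T \<omega> (N + 1) (\<lambda>s t. Y s t u) (\<lambda>s t. \<Sum>ns\<in>{ns \<in> positive_lists m. sum_list ns \<le> N}.
             box_apply (H s) ns (coproduct_osh ns (component (sum_list ns) (X s t))) u) \<longleftrightarrow>
      (\<lambda>z. Y (fst z) (snd z) u - lift_germ X (coords H) (fst z) (snd z) u) \<in> ord2 (N + 1)"
    if "u \<in> words m" "2 \<le> m" for m u
    using that N_ge_1 by (subst approx_iff) (simp_all add: sum_box_apply_eq_translate lift_germ_def)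
  then have "(\<forall>m\<in>{2..N}. \<forall>u\<in>words m. approx p T \<omega> (N + 1) (\<lambda>s t. Y s t u) (\<lambda>s t. \<Sum>ns\<in>{ns \<in> positive_lists m. sum_list ns \<le> N}.
             box_apply (H s) ns (coproduct_osh ns (component (sum_list ns) (X s t))) u)) \<longleftrightarrow>
      (\<forall>m\<in>{2..N}. \<forall>us\<in>words m. (\<lambda>z. Y (fst z) (snd z) us - lift_germ X (coords H) (fst z) (snd z) us) \<in> ord2 (N + 1))"
    by (intro ball_cong refl) simp
  also have "\<dots> \<longleftrightarrow> (\<forall>us\<in>words_upto N. 2 \<le> length us \<longrightarrow>
        (\<lambda>z. Y (fst z) (snd z) us - lift_germ X (coords H) (fst z) (snd z) us) \<in> ord2 (N + 1))"
    by (auto simp: words_def words_upto_def simp del: power_Suc add_Suc_right)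
  finally show ?thesis unfolding is_rough_lift_def by blast
qed

text \<open>Lengths zero and one are fixed exactly, by the normalisation and the trace; only longer
  words are compared through the germ.\<close>

lemma rough_lift_unique:
  fixes X :: "real \<Rightarrow> real \<Rightarrow> 'v::euclidean_space list \<Rightarrow> real"
    and H :: "real \<Rightarrow> 'v list \<Rightarrow> 'u::euclidean_space"
  assumes Y: "is_rough_lift p T \<omega> X H Y"
    and Y': "is_rough_lift p T \<omega> X H Y'"
    and st: "(s, t) \<in> Simplex T"
  shows "Y s t = Y' s t"
proof (rule rough_path_eqI[OF _ _ _ st])
  note I = Y[unfolded is_rough_lift_iff] and I' = Y'[unfolded is_rough_lift_iff]
  show YR: "Y \<in> rough_paths p T \<omega>" and YR': "Y' \<in> rough_paths p T \<omega>" using I I' by auto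
  fix w :: "'u list" assume w: "w \<in> words_upto N"
  consider "w = []" | b where "w = [b]" "b \<in> Basis" | "2 \<le> length w"
  proof -
    have "length w = 0 \<or> length w = 1 \<or> 2 \<le> length w" by linarith
    then show thesis using that w by (auto simp: length_Suc_conv words_upto_def)
  qed
  then show "(\<lambda>z. Y (fst z) (snd z) w - Y' (fst z) (snd z) w) \<in> ord2 (N + 1)"
  proof cases
    case 1
    then show ?thesis using rough_pathsD(2)[OF YR] rough_pathsD(2)[OF YR']
      by (subst bigo_principal_cong[where g = "\<lambda>_. 0"]) auto
  next
    case 2
    have "is_trace T Y (\<lambda>t. H t [])" "is_trace T Y' (\<lambda>t. H t [])" using I I' by blast+
    then have "Y s t w = Y' s t w" if "(s, t) \<in> Simplex T" for s t
      using that 2 unfolding is_trace_def by fastforce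
    then show ?thesis by (subst bigo_principal_cong[where g = "\<lambda>_. 0"]) auto
  next
    case 3
    have "(\<lambda>z. Y (fst z) (snd z) w - lift_germ X (coords H) (fst z) (snd z) w) \<in> ord2 (N + 1)"
      "(\<lambda>z. Y' (fst z) (snd z) w - lift_germ X (coords H) (fst z) (snd z) w) \<in> ord2 (N + 1)"
      using I I' w 3 by blast+
    from sum_in_bigo(2)[OF this] show ?thesis by simp
  qed
qed

lemma rough_lift_eqI:
  assumes "is_rough_lift p T \<omega> X H Y" "\<And>s t. (s, t) \<notin> Simplex T \<Longrightarrow> Y s t = (\<lambda>_. 0)"
  shows "rough_lift p T \<omega> X H = Y"
  unfolding rough_lift_def
proof (rule the_equality)
  show "is_rough_lift p T \<omega> X H Y \<and> (\<forall>s t. (s, t) \<notin> Simplex T \<longrightarrow> Y s t = (\<lambda>_. 0))" using assms by blast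
  fix Y' assume Y': "is_rough_lift p T \<omega> X H Y' \<and> (\<forall>s t. (s, t) \<notin> Simplex T \<longrightarrow> Y' s t = (\<lambda>_. 0))"
  have "Y' s t = Y s t" for s t
    using rough_lift_unique[of X H Y' Y s t] assms Y' by (cases "(s, t) \<in> Simplex T") auto
  then show "Y' = Y" by blast
qed

lemma rough_family_tri:
  assumes "X \<in> rough_paths p T \<omega>"
  shows "rough_family Tri \<rho>3 N (\<lambda>z. X (fst z) (fst (snd z)))"
proof
  fix z :: "real \<times> real \<times> real" assume "z \<in> Tri"
  then show "is_character N (X (fst z) (fst (snd z)))"
    by (intro rough_pathsD(5)[OF assms] Simplex_pairs_of_Tri)
next
  fix w :: "'a list" assume "w \<in> words_upto N"
  from ord2_to_ord3(1)[OF rough_pathsD(3)[OF assms this]]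
  show "(\<lambda>z. X (fst z) (fst (snd z)) w) \<in> ord3 (length w)" by simp
qed

context
  fixes X :: "real \<Rightarrow> real \<Rightarrow> 'v::euclidean_space list \<Rightarrow> real"
    and h :: "real \<Rightarrow> 'u::euclidean_space \<Rightarrow> 'v list \<Rightarrow> real"
  assumes X: "X \<in> rough_paths p T \<omega>" and h: "\<And>e. scalar_controlled X (\<lambda>t. h t e)"
begin

interpretation R2: rough_family "Simplex T" \<rho>2 N "\<lambda>z. X (fst z) (snd z)"
  by (rule rough_family_simplex[OF X])

lemma lift_germ_order: "(\<lambda>z. lift_germ X h (fst z) (snd z) us) \<in> ord2 (length us)"
  unfolding lift_germ_def
  using R2.osh_pairing_order[of "\<lambda>z. h (fst z)"] scalar_controlledD(1)[OF h] by blast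

lemma lift_germ_shuffle:
  assumes "us \<in> words a" "vs \<in> words b"
  shows "(\<lambda>z. lift_germ X h (fst z) (snd z) us * lift_germ X h (fst z) (snd z) vs
     - shuffle_pairing (lift_germ X h (fst z) (snd z)) us vs) \<in> ord2 (N + 1)"
proof -
  have ab: "length us = a" "length vs = b" using assms by (auto simp: words_def)
  show ?thesis
    unfolding lift_germ_def shuffle_pairing_def ab
    using R2.osh_pairing_shuffle[of "\<lambda>z. h (fst z)", OF _ assms] scalar_controlledD(1)[OF h] by blast
qed

text \<open>For one letter the germ is the expansion of a trace component without its constant term.
  Its error has order \<open>N\<close> only, because a controlled path has no level
  \<open>N\<close>.\<close>

lemma lift_germ_single: "(\<lambda>z. lift_germ X h (fst z) (snd z) [e] - (h (snd z) e [] - h (fst z) e [])) \<in> ord2 N"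
proof -
  have "lift_germ X h s t [e] = translate N (X s t) (h s e) [] - h s e []" if "(s, t) \<in> Simplex T" for s t
  proof -
    let ?W = "words_upto N :: 'v list set"
    have "lift_germ X h s t [e] = (\<Sum>w\<in>?W - {[]}. X s t w * h s e w)"
      unfolding lift_germ_def translate_def
      by (rule sum.mono_neutral_cong_right) (auto simp: osh_snoc[of _ "[]", simplified] half_shuffle_unit_left)
    moreover have "translate N (X s t) (h s e) [] = X s t [] * h s e [] + (\<Sum>w\<in>?W - {[]}. X s t w * h s e w)"
      unfolding translate_def by (subst sum.remove[OF finite_words_upto, of "[]"]) auto
    ultimately show ?thesis using rough_pathsD(2)[OF X that] by simp
  qed
  then show ?thesis
    using scalar_controlledD(5)[OF h, of e "[]"] by (subst bigo_principal_cong) auto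
qed

lemma osh_translate_controlled:
  "(\<lambda>z. translate N (X (fst z) (snd z)) (osh (h (fst z)) us) y
      - (\<Sum>i\<le>length us. lift_germ X h (fst z) (snd z) (take i us) * osh (h (snd z)) (drop i us) y))
      \<in> ord2 ((if length us = 1 then N else N + 1) - length y)"
  unfolding lift_germ_def
  by (rule R2.osh_translate_approx) (rule scalar_controlledD[OF h])+

text \<open>The pairing is moved across the middle point by \<open>translate_chen\<close>, and the
  translated functional is expanded there; the component at \<open>y\<close> supplies the
  \<open>length y\<close> orders that the expansion lacks. One-letter words are excluded because
  their expansion is one order short.\<close>

lemma lift_germ_chen:
  assumes "length us \<noteq> 1"
  shows "(\<lambda>z. lift_germ X h (fst z) (snd (snd z)) us
     - tensor_mult (lift_germ X h (fst z) (fst (snd z))) (lift_germ X h (fst (snd z)) (snd (snd z))) us) \<in> ord3 (N + 1)"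
proof -
  interpret R3: rough_family Tri \<rho>3 N "\<lambda>z. X (fst z) (fst (snd z))"
    by (rule rough_family_tri[OF X])
  let ?Z = "lift_germ X h" and ?B = "\<lambda>z. X (fst (snd z)) (snd (snd z))"
  let ?T = "\<lambda>z y. translate N (X (fst z) (fst (snd z))) (osh (h (fst z)) us) y"
  let ?S = "\<lambda>z y. \<Sum>i\<le>length us. ?Z (fst z) (fst (snd z)) (take i us) * osh (h (fst (snd z))) (drop i us) y"
  have 1: "(\<lambda>z. ?Z (fst z) (snd (snd z)) us - (\<Sum>y\<in>words_upto N. ?B z y * ?T z y)) \<in> ord3 (N + 1)"
    unfolding lift_germ_def
    by (rule translate_chen[OF X]) (rule R3.osh_bounded, rule scalar_controlledD[OF h])
  have 2: "(\<lambda>z. \<Sum>y\<in>words_upto N. ?B z y * (?T z y - ?S z y)) \<in> ord3 (N + 1)"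
  proof (rule big_sum_in_bigo)
    fix y :: "'v list" assume y: "y \<in> words_upto N"
    have "(\<lambda>z. ?T z y - ?S z y) \<in> ord3 (N + 1 - length y)"
      using ord2_to_ord3(1)[OF osh_translate_controlled[of us y]] assms by simp
    from S3.order_ge_mult'[OF ord2_to_ord3(2)[OF rough_pathsD(3)[OF X y]] this, of "N + 1"]
    show "(\<lambda>z. ?B z y * (?T z y - ?S z y)) \<in> ord3 (N + 1)" using y by (simp add: words_upto_def)
  qed
  have "(\<Sum>y\<in>words_upto N. ?B z y * ?S z y)
      = tensor_mult (?Z (fst z) (fst (snd z))) (?Z (fst (snd z)) (snd (snd z))) us" for z
    unfolding tensor_mult_def lift_germ_def[of X h "fst (snd z)"] translate_def sum_distrib_left
    by (subst sum.swap) (simp add: mult_ac)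
  then have "(\<Sum>y\<in>words_upto N. ?B z y * ?T z y) = (\<Sum>y\<in>words_upto N. ?B z y * (?T z y - ?S z y))
      + tensor_mult (?Z (fst z) (fst (snd z))) (?Z (fst (snd z)) (snd (snd z))) us" for z
    by (simp add: right_diff_distrib sum_subtractf)
  then show ?thesis using sum_in_bigo(1)[OF 1 2] by simp
qed

end

end

section \<open>Existence of lifts\<close>

lemma shuffle_pairing_Nil:
  assumes "set w \<subseteq> Basis"
  shows "shuffle_pairing x [] w = x w" "shuffle_pairing x w [] = x w"
proof -
  have d: "delta_word [] = unit_word" by (auto simp: delta_word_def unit_word_def)
  have w: "w \<in> words (length w)" using assms by (simp add: words_def)
  have "(\<Sum>u\<in>words (length w). x u * delta_word w u) = (\<Sum>u\<in>words (length w). if w = u then x u else 0)"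
    by (intro sum.cong refl) (auto simp: delta_word_def)
  then have "(\<Sum>u\<in>words (length w). x u * delta_word w u) = x w" using w by simp
  then show "shuffle_pairing x [] w = x w" "shuffle_pairing x w [] = x w"
    by (simp_all add: shuffle_pairing_def d shuffle_prod_commute[of "delta_word w"])
qed

lemma words_upto_cases:
  assumes "us \<in> words_upto N"
  obtains "us = []" | e where "us = [e]" "e \<in> Basis" | "2 \<le> length us"
proof -
  have "length us = 0 \<or> length us = 1 \<or> 2 \<le> length us" by linarith
  then show thesis using that assms by (auto simp: length_Suc_conv words_upto_def)
qed

text \<open>Functional of an integral, the last slot being the integration variable. The value zero
  at the empty word expresses that an increment has no constant term.\<close>

definition curry_last :: "('v::euclidean_space \<Rightarrow> 'v list \<Rightarrow> real) \<Rightarrow> 'v list \<Rightarrow> real" where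
  "curry_last h w = (if w \<noteq> [] \<and> last w \<in> Basis then h (last w) (butlast w) else 0)"

lemma curry_last_simps [simp]:
  "curry_last h [] = 0" "curry_last h (w @ [b]) = (if b \<in> Basis then h b w else 0)"
  by (simp_all add: curry_last_def)

lemma translate_curry_last_snoc:
  "translate N x (curry_last h) (y @ [b]) = (if b \<in> Basis then translate N x (h b) y else 0)"
  by (simp add: translate_def append_assoc[symmetric] del: append_assoc)

context control_setup
begin

lemma coords_scalar_controlled:
  assumes "X \<in> rough_paths p T \<omega>" "H \<in> controlled_paths p T \<omega> X"
  shows "scalar_controlled X (\<lambda>t. coords H t e)"
  by (rule controlled_imp_scalar_controlled[OF assms bounded_linear_inner_left])

text \<open>The germ is replaced on one-letter words by the increments of the trace before it is
  corrected to a rough path. This changes it by order \<open>N\<close>, which the Chen and shuffle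
  relations tolerate.\<close>

lemma rough_lift_exists:
  fixes X :: "real \<Rightarrow> real \<Rightarrow> 'v::euclidean_space list \<Rightarrow> real"
    and H :: "real \<Rightarrow> 'v list \<Rightarrow> 'u::euclidean_space"
  assumes X: "X \<in> rough_paths p T \<omega>" and H: "H \<in> controlled_paths p T \<omega> X"
  obtains Y where "is_rough_lift p T \<omega> X H Y" "\<And>s t. (s, t) \<notin> Simplex T \<Longrightarrow> Y s t = (\<lambda>_. 0)"
proof -
  let ?h = "coords H" and ?G = "lift_germ X (coords H)"
  note h = coords_scalar_controlled[OF X H]
  define Z where "Z s t us = (if length us = 1 then (H t [] - H s []) \<bullet> hd us else ?G s t us)" for s t us
  have Z_G: "(\<lambda>z. Z (fst z) (snd z) us - ?G (fst z) (snd z) us) \<in> ord2 (if length us = 1 then N else N + 1)"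
    if "us \<in> words_upto N" for us
    using that
  proof (cases rule: words_upto_cases)
    case (2 e)
    have "(\<lambda>z. - (?G (fst z) (snd z) [e] - (?h (snd z) e [] - ?h (fst z) e []))) \<in> ord2 N"
      by (subst landau_o.big.uminus_in_iff) (rule lift_germ_single[OF X h])
    then show ?thesis using 2 by (simp add: Z_def trunc_def inner_diff_left)
  qed (simp_all add: Z_def)
  have G_Nil: "?G s t [] = 1" if "(s, t) \<in> Simplex T" for s t
  proof -
    have "?G s t [] = (\<Sum>w\<in>(words_upto N :: 'v list set). if w = [] then X s t [] else 0)"
      unfolding lift_germ_def translate_def by (rule sum.cong[OF refl]) auto
    then show ?thesis using rough_pathsD(2)[OF X that] by simp
  qed
  have G_bound: "(\<lambda>z. ?G (fst z) (snd z) us) \<in> ord2 (length us)" for us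
    by (rule lift_germ_order[OF X h])
  have G_chen: "(\<lambda>z. ?G (fst z) (snd (snd z)) us
     - tensor_mult (?G (fst z) (fst (snd z))) (?G (fst (snd z)) (snd (snd z))) us) \<in> ord3 (N + 1)"
    if "length us \<noteq> 1" for us
    using that by (rule lift_germ_chen[OF X h])
  have G_shuffle: "(\<lambda>z. ?G (fst z) (snd z) us * ?G (fst z) (snd z) vs
     - shuffle_pairing (?G (fst z) (snd z)) us vs) \<in> ord2 (N + 1)"
    if "us \<in> words (length us)" "vs \<in> words (length vs)" for us vs
    using that by (rule lift_germ_shuffle[OF X h])
  have Z_bound: "(\<lambda>z. Z (fst z) (snd z) us) \<in> ord2 (length us)" if us: "us \<in> words_upto N" for us
    using us
  proof (cases rule: words_upto_cases)
    case (2 e)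
    have "(\<lambda>z. norm (H (snd z) [] - H (fst z) [])) \<in> ord2 1"
      by (rule bspec[OF conjunct1[OF H[unfolded controlled_paths_iff]]]) simp
    from norm_ord2_linear[OF this bounded_linear_inner_left[of e]] show ?thesis
      using 2 by (simp add: Z_def)
  next
    case 1
    then show ?thesis using G_bound[of "[]"] by (simp add: Z_def)
  next
    case 3
    then show ?thesis using G_bound[of us] by (simp add: Z_def)
  qed
  show thesis
  proof (rule almost_rough_path[of Z])
    show "Z s t [] = 1" if "(s, t) \<in> Simplex T" for s t using G_Nil[OF that] by (simp add: Z_def)
    show "(\<lambda>z. Z (fst z) (snd z) us) \<in> ord2 (length us)" if "us \<in> words_upto N" for us
      by (rule Z_bound[OF that])
  next
    fix us :: "'u list" assume us: "us \<in> words_upto N"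
    show "(\<lambda>z. Z (fst z) (snd (snd z)) us -
        tensor_mult (Z (fst z) (fst (snd z))) (Z (fst (snd z)) (snd (snd z))) us) \<in> ord3 (N + 1)"
    proof (cases "length us = 1")
      case True
      then obtain e where e: "us = [e]" by (auto simp: length_Suc_conv)
      \<comment> \<open>Increments are exactly additive, so no error arises at length one.\<close>
      have "Z (fst z) (snd (snd z)) us - tensor_mult (Z (fst z) (fst (snd z))) (Z (fst (snd z)) (snd (snd z))) us = 0"
        if "z \<in> Tri" for z
        using G_Nil Simplex_pairs_of_Tri[OF that]
        by (simp add: tensor_mult_split_first e Z_def inner_diff_left)
      then show ?thesis by (subst bigo_principal_cong[where g = "\<lambda>_. 0"]) auto
    next
      case False
      have d: "(\<lambda>z. \<Sum>i\<le>length us. ?G (fst z) (fst (snd z)) (take i us) * ?G (fst (snd z)) (snd (snd z)) (drop i us)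
          - Z (fst z) (fst (snd z)) (take i us) * Z (fst (snd z)) (snd (snd z)) (drop i us)) \<in> ord3 (N + 1)"
      proof (rule big_sum_in_bigo)
        fix i assume i: "i \<in> {..length us}"
        note tw = in_words_upto_take_drop(1)[OF us, of i] and dw = in_words_upto_take_drop(2)[OF us, of i]
        let ?a = "\<lambda>z. ?G (fst z) (fst (snd z)) (take i us)" and ?a' = "\<lambda>z. Z (fst z) (fst (snd z)) (take i us)"
        let ?b = "\<lambda>z. ?G (fst (snd z)) (snd (snd z)) (drop i us)" and ?b' = "\<lambda>z. Z (fst (snd z)) (snd (snd z)) (drop i us)"
        have da: "(\<lambda>z. ?a' z - ?a z) \<in> ord3 (if length (take i us) = 1 then N else N + 1)"
          using ord2_to_ord3(1)[OF Z_G[OF tw]] by simp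
        have db: "(\<lambda>z. ?b' z - ?b z) \<in> ord3 (if length (drop i us) = 1 then N else N + 1)"
          using ord2_to_ord3(2)[OF Z_G[OF dw]] by simp
        have b: "?b \<in> ord3 (length (drop i us))" using ord2_to_ord3(2)[OF G_bound[of "drop i us"]] by simp
        have a': "?a' \<in> ord3 (length (take i us))" using ord2_to_ord3(1)[OF Z_bound[OF tw]] by simp
        have len: "length (take i us) + length (drop i us) = length us" by simp
        \<comment> \<open>An error of order only \<open>N\<close> sits on a one-letter factor. Since
          \<open>us\<close> is not a single letter, the complementary factor is nonempty and
          contributes order at least one.\<close>
        have 1: "(\<lambda>z. (?a' z - ?a z) * ?b z) \<in> ord3 (N + 1)"
          by (rule S3.order_ge_mult'[OF da b]) (use len False in auto)
        have 2: "(\<lambda>z. ?a' z * (?b' z - ?b z)) \<in> ord3 (N + 1)"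
          by (rule S3.order_ge_mult'[OF a' db]) (use len False in auto)
        have "(\<lambda>z. - ((?a' z - ?a z) * ?b z + ?a' z * (?b' z - ?b z))) \<in> ord3 (N + 1)"
          using sum_in_bigo(1)[OF 1 2] by (subst landau_o.big.uminus_in_iff)
        then show "(\<lambda>z. ?a z * ?b z - ?a' z * ?b' z) \<in> ord3 (N + 1)"
          by (simp add: algebra_simps)
      qed
      from sum_in_bigo(1)[OF G_chen[OF False] d] False show ?thesis
        by (simp add: tensor_mult_def sum_subtractf Z_def[of _ _ us])
    qed
  next
    fix v w :: "'u list" assume vw: "v @ w \<in> words_upto N"
    then have v: "v \<in> words_upto N" and w: "w \<in> words_upto N" by (auto simp: words_upto_def)
    then have v': "v \<in> words (length v)" and w': "w \<in> words (length w)" by (auto simp: words_def words_upto_def)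
    let ?Z = "\<lambda>z. Z (fst z) (snd z)" and ?Gz = "\<lambda>z. ?G (fst z) (snd z)"
    show "(\<lambda>z. ?Z z v * ?Z z w - shuffle_pairing (?Z z) v w) \<in> ord2 (N + 1)"
    proof (cases "v = [] \<or> w = []")
      case True
      then have "?Z z v * ?Z z w - shuffle_pairing (?Z z) v w = 0" if "z \<in> Simplex T" for z
        using G_Nil[of "fst z" "snd z"] that v w by (auto simp: shuffle_pairing_Nil words_upto_def Z_def)
      then show ?thesis by (subst bigo_principal_cong[where g = "\<lambda>_. 0"]) auto
    next
      case False
      then have len: "1 \<le> length v" "1 \<le> length w" by (auto simp: Suc_le_eq)
      have 1: "(\<lambda>z. (?Z z v - ?Gz z v) * ?Z z w) \<in> ord2 (N + 1)"
        by (rule S2.order_ge_mult'[OF Z_G[OF v] Z_bound[OF w]]) (use len in auto)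
      have 2: "(\<lambda>z. ?Gz z v * (?Z z w - ?Gz z w)) \<in> ord2 (N + 1)"
        by (rule S2.order_ge_mult'[OF G_bound Z_G[OF w]]) (use len in auto)
      \<comment> \<open>The shuffles of two nonempty words have at least two letters, where
        \<open>Z\<close> is the unchanged germ.\<close>
      have "shuffle_pairing (?Z z) v w = shuffle_pairing (?Gz z) v w" for z
        unfolding shuffle_pairing_def
        by (intro sum.cong refl) (use len in \<open>auto simp: Z_def words_def\<close>)
      with sum_in_bigo(1)[OF sum_in_bigo(1)[OF 1 2] G_shuffle[OF v' w']]
      show ?thesis by (simp add: algebra_simps)
    qed
  next
    fix Y assume Y: "Y \<in> rough_paths p T \<omega>" and off: "\<And>s t. (s, t) \<notin> Simplex T \<Longrightarrow> Y s t = (\<lambda>_. 0)"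
      and close: "\<And>us. us \<in> words_upto N \<Longrightarrow> (\<lambda>z. Y (fst z) (snd z) us - Z (fst z) (snd z) us) \<in> ord2 (N + 1)"
    have "is_rough_lift p T \<omega> X H Y"
      unfolding is_rough_lift_iff
    proof (intro conjI ballI impI Y)
      fix us :: "'u list" assume "us \<in> words_upto N" "2 \<le> length us"
      then show "(\<lambda>z. Y (fst z) (snd z) us - ?G (fst z) (snd z) us) \<in> ord2 (N + 1)"
        using close[of us] by (simp add: Z_def)
    next
      show "is_trace T Y (\<lambda>t. H t [])"
        unfolding is_trace_def
      proof (clarify)
        fix s t and e :: 'u assume st: "(s, t) \<in> Simplex T" and e: "e \<in> Basis"
        then have e': "[e] \<in> words_upto N" using N_ge_1 by (simp add: words_upto_def)
        \<comment> \<open>The first level of \<open>Y\<close> matches the increments to order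
          \<open>N + 1\<close>; both are additive, hence equal.\<close>
        define D where "D s t = Y s t [e] - (H t [] - H s []) \<bullet> e" for s t
        have add: "D s t = D s u + D u t" if "0 \<le> s" "s \<le> u" "u \<le> t" "t \<le> T" for s u t
        proof -
          have "(s, u, t) \<in> Tri" "(s, u) \<in> Simplex T" "(u, t) \<in> Simplex T"
            using that by (auto simp: Tri_def Simplex_def)
          then show ?thesis using rough_pathsD(4)[OF Y _ e'] rough_pathsD(2)[OF Y]
            by (simp add: D_def tensor_mult_split_first inner_diff_left)
        qed
        have "(\<lambda>z. D (fst z) (snd z)) \<in> ord2 (N + 1)"
          using close[OF e'] by (simp add: D_def Z_def)
        moreover have "0 \<le> s" "s \<le> t" "t \<le> T" using st by (auto simp: Simplex_def)
        ultimately have "D s t = 0" using additive_order_eq_0[of D s t] add by blast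
        then show "Y s t [e] = (H t [] - H s []) \<bullet> e" by (simp add: D_def)
      qed
    qed
    then show thesis using off by (rule that)
  qed
qed

lemma is_rough_lift_rough_lift:
  fixes X :: "real \<Rightarrow> real \<Rightarrow> 'v::euclidean_space list \<Rightarrow> real"
    and H :: "real \<Rightarrow> 'v list \<Rightarrow> 'u::euclidean_space"
  assumes "X \<in> rough_paths p T \<omega>" "H \<in> controlled_paths p T \<omega> X"
  shows "is_rough_lift p T \<omega> X H (rough_lift p T \<omega> X H)"
    and "(s, t) \<notin> Simplex T \<Longrightarrow> rough_lift p T \<omega> X H s t = (\<lambda>_. 0)"
proof -
  obtain Y where Y: "is_rough_lift p T \<omega> X H Y" "\<And>s t. (s, t) \<notin> Simplex T \<Longrightarrow> Y s t = (\<lambda>_. 0)"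
    using rough_lift_exists[OF assms] by blast
  then have "rough_lift p T \<omega> X H = Y" by (intro rough_lift_eqI)
  with Y show "is_rough_lift p T \<omega> X H (rough_lift p T \<omega> X H)"
    and "(s, t) \<notin> Simplex T \<Longrightarrow> rough_lift p T \<omega> X H s t = (\<lambda>_. 0)" by simp_all
qed

section \<open>The rough integral\<close>

abbreviation int_coords ::
    "(real \<Rightarrow> 'v::euclidean_space list \<Rightarrow> 'v \<Rightarrow>\<^sub>L 'w::euclidean_space) \<Rightarrow> 'w \<Rightarrow> real \<Rightarrow> 'v list \<Rightarrow> real" where
  "int_coords H e s \<equiv> curry_last (\<lambda>b. trunc (N - 1) (\<lambda>w. blinfun_apply (H s w) b \<bullet> e))"

text \<open>Length \<open>N\<close> is covered although the integrand stops at \<open>N - 1\<close>,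
  since the integration variable takes one letter.\<close>

lemma int_coords_eq:
  assumes "w \<in> words_upto N" "w \<noteq> []"
  shows "int_coords H e s w = uncurry_last (H s) w \<bullet> e"
proof (cases w rule: rev_cases)
  case (snoc v b)
  then have "v \<in> words_upto (N - 1)" "b \<in> Basis" using assms by (auto simp: words_upto_def)
  then show ?thesis by (simp add: snoc trunc_def uncurry_last_def)
qed (use assms in simp)

lemma inner_sum_pair:
  fixes x :: "'v::euclidean_space list \<Rightarrow> real"
    and g :: "'v list \<Rightarrow> 'u::euclidean_space"
  assumes "\<And>w. w \<in> words_upto N \<Longrightarrow> w \<noteq> [] \<Longrightarrow> k w = g w \<bullet> e" "k [] = 0"
  shows "(\<Sum>n\<in>{1..N}. pair n g (component n x)) \<bullet> e = translate N x k []"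
proof -
  have "(\<Sum>n\<in>{1..N}. pair n g (component n x)) \<bullet> e = (\<Sum>n\<in>{1..N}. \<Sum>w\<in>words n. x w * k w)"
    unfolding pair_def inner_sum_left
  proof (rule sum.cong[OF refl], rule sum.cong[OF refl])
    fix n and w :: "'v list" assume "n \<in> {1..N}" "w \<in> words n"
    then have "w \<in> words_upto N" "w \<noteq> []" "w \<in> words n" by (auto simp: words_def words_upto_def)
    then show "(component n x w *\<^sub>R g w) \<bullet> e = x w * k w"
      by (simp add: component_def assms(1))
  qed
  also have "\<dots> = (\<Sum>n\<le>N. \<Sum>w\<in>words n. x w * k w)"
    using assms(2) by (intro sum.mono_neutral_left) (auto simp: Suc_le_eq)
  finally show ?thesis by (simp add: translate_def sum_words_upto)
qed

lemma is_rough_integral_iff: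
  fixes X :: "real \<Rightarrow> real \<Rightarrow> 'v::euclidean_space list \<Rightarrow> real"
    and H :: "real \<Rightarrow> 'v list \<Rightarrow> 'v \<Rightarrow>\<^sub>L 'w::euclidean_space"
  shows "is_rough_integral p T \<omega> X H I \<longleftrightarrow> I \<in> Cp_paths p T \<omega> \<and> I 0 = 0 \<and>
    (\<forall>e\<in>Basis. (\<lambda>z. (I (snd z) - I (fst z)) \<bullet> e - translate N (X (fst z) (snd z)) (int_coords H e (fst z)) []) \<in> ord2 (N + 1))"
proof -
  let ?S = "\<lambda>s t. \<Sum>n\<in>{1..N}. pair n (uncurry_last (H s)) (component n (X s t))"
  have S: "?S s t \<bullet> e = translate N (X s t) (int_coords H e s) []" for s t e
    by (rule inner_sum_pair, rule int_coords_eq) simp_all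
  have "approx p T \<omega> (N + 1) (\<lambda>s t. I t - I s) ?S \<longleftrightarrow>
    (\<forall>e\<in>Basis. (\<lambda>z. (I (snd z) - I (fst z)) \<bullet> e - translate N (X (fst z) (snd z)) (int_coords H e (fst z)) []) \<in> ord2 (N + 1))"
    (is "?A \<longleftrightarrow> ?B")
  proof
    assume ?A
    then have A: "(\<lambda>z. norm (I (snd z) - I (fst z) - ?S (fst z) (snd z))) \<in> ord2 (N + 1)"
      by (subst (asm) approx_iff) simp_all
    show ?B
    proof
      fix e :: 'w
      from norm_ord2_linear[OF A bounded_linear_inner_left[of e]]
      show "(\<lambda>z. (I (snd z) - I (fst z)) \<bullet> e - translate N (X (fst z) (snd z)) (int_coords H e (fst z)) []) \<in> ord2 (N + 1)"
        unfolding inner_diff_left[of _ "?S _ _"] S by simp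
    qed
  next
    assume B: ?B
    have "(\<lambda>z. norm (I (snd z) - I (fst z) - ?S (fst z) (snd z))) \<in> ord2 (N + 1)"
    proof (rule norm_ord2_coords)
      fix e :: 'w assume "e \<in> Basis"
      with B show "(\<lambda>z. (I (snd z) - I (fst z) - ?S (fst z) (snd z)) \<bullet> e) \<in> ord2 (N + 1)"
        unfolding inner_diff_left[of _ "?S _ _"] S by blast
    qed
    then show ?A by (subst approx_iff) simp_all
  qed
  then show ?thesis unfolding is_rough_integral_def by blast
qed

lemma rough_integral_unique:
  fixes H :: "real \<Rightarrow> 'v::euclidean_space list \<Rightarrow> 'v \<Rightarrow>\<^sub>L 'w::euclidean_space"
  assumes I: "is_rough_integral p T \<omega> X H I"
    and I': "is_rough_integral p T \<omega> X H I'"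
    and t: "t \<in> {0..T}"
  shows "I t = I' t"
proof (rule euclidean_eqI)
  fix e :: 'w assume e: "e \<in> Basis"
  let ?G = "\<lambda>z. translate N (X (fst z) (snd z)) (int_coords H e (fst z)) []"
  define D where "D s t = (I t - I s) \<bullet> e - (I' t - I' s) \<bullet> e" for s t
  have "(\<lambda>z. (I (snd z) - I (fst z)) \<bullet> e - ?G z) \<in> ord2 (N + 1)"
    "(\<lambda>z. (I' (snd z) - I' (fst z)) \<bullet> e - ?G z) \<in> ord2 (N + 1)"
    using I I' e unfolding is_rough_integral_iff by blast+
  from sum_in_bigo(2)[OF this] have "(\<lambda>z. D (fst z) (snd z)) \<in> ord2 (N + 1)"
    by (simp add: D_def)
  moreover have "D s t = D s u + D u t" for s u t by (simp add: D_def inner_diff_left)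
  ultimately have "D 0 t = 0" using additive_order_eq_0[of D 0 t] t by auto
  moreover have "I 0 = 0" "I' 0 = 0" using I I' by (auto simp: is_rough_integral_def)
  ultimately show "I t \<bullet> e = I' t \<bullet> e" by (simp add: D_def)
qed

lemma rough_integral_eqI:
  fixes H :: "real \<Rightarrow> 'v::euclidean_space list \<Rightarrow> 'v \<Rightarrow>\<^sub>L 'w::euclidean_space"
  assumes "is_rough_integral p T \<omega> X H I" "\<And>t. t \<notin> {0..T} \<Longrightarrow> I t = 0"
  shows "rough_integral p T \<omega> X H = I"
  unfolding rough_integral_def
proof (rule the_equality)
  show "is_rough_integral p T \<omega> X H I \<and> (\<forall>t. t \<notin> {0..T} \<longrightarrow> I t = 0)" using assms by blast
  fix I' assume I': "is_rough_integral p T \<omega> X H I' \<and> (\<forall>t. t \<notin> {0..T} \<longrightarrow> I' t = 0)"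
  show "I' = I"
  proof
    show "I' t = I t" for t
      using rough_integral_unique[of X H I' I t] assms I' by (cases "t \<in> {0..T}") auto
  qed
qed

lemma int_coords_controlled:
  fixes X :: "real \<Rightarrow> real \<Rightarrow> 'v::euclidean_space list \<Rightarrow> real"
    and H :: "real \<Rightarrow> 'v list \<Rightarrow> 'v \<Rightarrow>\<^sub>L 'w::euclidean_space"
  assumes X: "X \<in> rough_paths p T \<omega>" and H: "H \<in> controlled_paths p T \<omega> X"
  shows "scalar_controlled X (\<lambda>t. trunc (N - 1) (\<lambda>w. blinfun_apply (H t w) b \<bullet> e))"
  by (rule controlled_imp_scalar_controlled[OF X H])
    (intro bounded_linear_compose[OF bounded_linear_inner_left] blinfun.bounded_linear_left)

lemma int_coords_bounded:
  fixes X :: "real \<Rightarrow> real \<Rightarrow> 'v::euclidean_space list \<Rightarrow> real"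
    and H :: "real \<Rightarrow> 'v list \<Rightarrow> 'v \<Rightarrow>\<^sub>L 'w::euclidean_space"
  assumes X: "X \<in> rough_paths p T \<omega>" and H: "H \<in> controlled_paths p T \<omega> X"
  shows "\<exists>C. \<forall>t\<in>{0..T}. \<bar>int_coords H e t w\<bar> \<le> C"
proof (cases w rule: rev_cases)
  case (snoc v b)
  then show ?thesis
    using int_coords_controlled[OF X H, of b e] by (cases "b \<in> Basis") (auto simp: scalar_controlled_def)
qed auto

lemma integral_germ_order:
  fixes X :: "real \<Rightarrow> real \<Rightarrow> 'v::euclidean_space list \<Rightarrow> real"
    and H :: "real \<Rightarrow> 'v list \<Rightarrow> 'v \<Rightarrow>\<^sub>L 'w::euclidean_space"
  assumes X: "X \<in> rough_paths p T \<omega>" and H: "H \<in> controlled_paths p T \<omega> X"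
  shows "(\<lambda>z. translate N (X (fst z) (snd z)) (int_coords H e (fst z)) []) \<in> ord2 1"
proof -
  interpret R2: rough_family "Simplex T" \<rho>2 N "\<lambda>z. X (fst z) (snd z)"
    by (rule rough_family_simplex[OF X])
  show ?thesis
    by (rule R2.translate_Nil_order, rule bounded_path_ord2(1)[OF int_coords_bounded[OF X H]]) simp
qed

text \<open>At a tail \<open>y' @ [b]\<close> only \<open>y'\<close> is an argument of the
  integrand, so the translated germ has error \<open>N - length y'\<close>, one order better than
  for a controlled path. The germ is therefore sewable with no exceptional level.\<close>

lemma rough_integral_exists:
  fixes X :: "real \<Rightarrow> real \<Rightarrow> 'v::euclidean_space list \<Rightarrow> real"
    and H :: "real \<Rightarrow> 'v list \<Rightarrow> 'v \<Rightarrow>\<^sub>L 'w::euclidean_space"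
  assumes X: "X \<in> rough_paths p T \<omega>" and H: "H \<in> controlled_paths p T \<omega> X"
  obtains I where "is_rough_integral p T \<omega> X H I" "\<And>t. t \<notin> {0..T} \<Longrightarrow> I t = 0"
proof -
  let ?\<Xi> = "\<lambda>e s t. translate N (X s t) (int_coords H e s) []"
  have "\<exists>I. I 0 = 0 \<and> (\<lambda>z. I (snd z) - I (fst z) - ?\<Xi> e (fst z) (snd z)) \<in> ord2 (N + 1)" for e
  proof -
    let ?A = "\<lambda>z. X (fst z) (fst (snd z))" and ?B = "\<lambda>z. X (fst (snd z)) (snd (snd z))"
    let ?h = "\<lambda>b t. trunc (N - 1) (\<lambda>w. blinfun_apply (H t w) b \<bullet> e)"
    have 1: "(\<lambda>z. ?\<Xi> e (fst z) (snd (snd z)) - (\<Sum>y\<in>words_upto N. ?B z y * translate N (?A z) (int_coords H e (fst z)) y)) \<in> ord3 (N + 1)"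
      by (rule translate_chen[OF X]) (rule bounded_path_ord2(3)[OF int_coords_bounded[OF X H]])
    have 2: "(\<lambda>z. \<Sum>y\<in>words_upto N - {[]}. ?B z y * (translate N (?A z) (int_coords H e (fst z)) y - int_coords H e (fst (snd z)) y)) \<in> ord3 (N + 1)"
    proof (rule big_sum_in_bigo)
      fix y :: "'v list" assume y: "y \<in> words_upto N - {[]}"
      then obtain y' b where yb: "y = y' @ [b]" by (cases y rule: rev_cases) auto
      have b: "b \<in> Basis" "length y' + 1 \<le> N" "y \<in> words_upto N" using y by (auto simp: yb words_upto_def)
      have "(\<lambda>z. translate N (?A z) (?h b (fst z)) y' - ?h b (fst (snd z)) y') \<in> ord3 (N - length y')"
        using ord2_to_ord3(1)[OF scalar_controlledD(5)[OF int_coords_controlled[OF X H]]] by simp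
      then have "(\<lambda>z. translate N (?A z) (int_coords H e (fst z)) y - int_coords H e (fst (snd z)) y) \<in> ord3 (N - length y')"
        by (simp add: yb translate_curry_last_snoc b(1))
      from S3.order_ge_mult'[OF ord2_to_ord3(2)[OF rough_pathsD(3)[OF X b(3)]] this, of "N + 1"]
      show "(\<lambda>z. ?B z y * (translate N (?A z) (int_coords H e (fst z)) y - int_coords H e (fst (snd z)) y)) \<in> ord3 (N + 1)"
        using b(2) by (simp add: yb)
    qed
    \<comment> \<open>The empty word yields the germ over the first interval; the other words yield
      the germ over the second interval and the estimated error.\<close>
    have eq: "(\<Sum>y\<in>words_upto N. ?B z y * translate N (?A z) (int_coords H e (fst z)) y)
        = ?\<Xi> e (fst z) (fst (snd z)) + ?\<Xi> e (fst (snd z)) (snd (snd z)) +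
          (\<Sum>y\<in>words_upto N - {[]}. ?B z y * (translate N (?A z) (int_coords H e (fst z)) y - int_coords H e (fst (snd z)) y))"
      if "z \<in> Tri" for z
    proof -
      have B1: "?B z [] = 1" using rough_pathsD(2)[OF X] Simplex_pairs_of_Tri(2)[OF that] by simp
      have "?\<Xi> e (fst (snd z)) (snd (snd z)) = (\<Sum>y\<in>words_upto N - {[]}. ?B z y * int_coords H e (fst (snd z)) y)"
        unfolding translate_def by (subst sum.remove[OF finite_words_upto, of "[]"]) simp_all
      moreover have "(\<Sum>y\<in>words_upto N. ?B z y * translate N (?A z) (int_coords H e (fst z)) y)
          = ?\<Xi> e (fst z) (fst (snd z)) + (\<Sum>y\<in>words_upto N - {[]}. ?B z y * translate N (?A z) (int_coords H e (fst z)) y)"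
        by (subst sum.remove[OF finite_words_upto, of "[]"]) (simp_all add: B1)
      ultimately show ?thesis by (simp add: right_diff_distrib sum_subtractf)
    qed
    have "(\<lambda>z. ?\<Xi> e (fst z) (snd (snd z)) - ?\<Xi> e (fst z) (fst (snd z)) - ?\<Xi> e (fst (snd z)) (snd (snd z))) \<in> ord3 (N + 1)"
    proof (subst bigo_principal_cong)
      show "(\<lambda>z. (?\<Xi> e (fst z) (snd (snd z)) - (\<Sum>y\<in>words_upto N. ?B z y * translate N (?A z) (int_coords H e (fst z)) y))
          + (\<Sum>y\<in>words_upto N - {[]}. ?B z y * (translate N (?A z) (int_coords H e (fst z)) y - int_coords H e (fst (snd z)) y))) \<in> ord3 (N + 1)"
        by (rule sum_in_bigo(1)[OF 1 2])
    qed (use eq in simp)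
    then show ?thesis by (rule sewing_order) blast
  qed
  then have "\<exists>J. \<forall>e. J e 0 = 0 \<and> (\<lambda>z. J e (snd z) - J e (fst z) - ?\<Xi> e (fst z) (snd z)) \<in> ord2 (N + 1)"
    by (intro choice allI)
  then obtain J where J: "\<And>e. J e 0 = 0" "\<And>e. (\<lambda>z. J e (snd z) - J e (fst z) - ?\<Xi> e (fst z) (snd z)) \<in> ord2 (N + 1)"
    by blast
  define I where "I t = (if t \<in> {0..T} then \<Sum>e\<in>Basis. J e t *\<^sub>R e else 0)" for t
  have Ie: "I t \<bullet> e = J e t" if "t \<in> {0..T}" "e \<in> Basis" for t e
    using that by (simp add: I_def inner_sum_left inner_Basis if_distrib cong: if_cong)
  have main: "(\<lambda>z. (I (snd z) - I (fst z)) \<bullet> e - ?\<Xi> e (fst z) (snd z)) \<in> ord2 (N + 1)" if e: "e \<in> Basis" for e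
  proof (subst bigo_principal_cong)
    show "(\<lambda>z. J e (snd z) - J e (fst z) - ?\<Xi> e (fst z) (snd z)) \<in> ord2 (N + 1)" by (rule J(2))
  qed (use e in \<open>simp add: inner_diff_left Ie in_Simplex_iff\<close>)
  have Cp: "I \<in> Cp_paths p T \<omega>"
    unfolding Cp_paths_iff
  proof (rule norm_ord2_coords)
    fix e :: 'w assume e: "e \<in> Basis"
    from sum_in_bigo(1)[OF S2.order_ge_mono[OF main[OF e], of 1] integral_germ_order[OF X H, of e]]
    show "(\<lambda>z. (I (snd z) - I (fst z)) \<bullet> e) \<in> ord2 1" by simp
  qed
  have "is_rough_integral p T \<omega> X H I"
    unfolding is_rough_integral_iff using Cp main J(1) T_pos by (simp add: I_def)
  then show thesis by (rule that) (auto simp: I_def)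
qed

lemma is_rough_integral_rough_integral:
  fixes X :: "real \<Rightarrow> real \<Rightarrow> 'v::euclidean_space list \<Rightarrow> real"
    and H :: "real \<Rightarrow> 'v list \<Rightarrow> 'v \<Rightarrow>\<^sub>L 'w::euclidean_space"
  assumes "X \<in> rough_paths p T \<omega>" "H \<in> controlled_paths p T \<omega> X"
  shows "is_rough_integral p T \<omega> X H (rough_integral p T \<omega> X H)"
    and "t \<notin> {0..T} \<Longrightarrow> rough_integral p T \<omega> X H t = 0"
proof -
  obtain I where I: "is_rough_integral p T \<omega> X H I" "\<And>t. t \<notin> {0..T} \<Longrightarrow> I t = 0"
    using rough_integral_exists[OF assms] by blast
  then have "rough_integral p T \<omega> X H = I" by (intro rough_integral_eqI)
  with I show "is_rough_integral p T \<omega> X H (rough_integral p T \<omega> X H)"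
    and "t \<notin> {0..T} \<Longrightarrow> rough_integral p T \<omega> X H t = 0" by simp_all
qed

text \<open>At the empty word the estimate is the definition of the integral, and at
  \<open>y' @ [b]\<close> it is that of the integrand at \<open>y'\<close>, again one order better
  than demanded. The functional is formed up to degree \<open>N\<close> and truncated
  afterwards.\<close>

lemma controlled_integral_controlled:
  fixes X :: "real \<Rightarrow> real \<Rightarrow> 'v::euclidean_space list \<Rightarrow> real"
    and H :: "real \<Rightarrow> 'v list \<Rightarrow> 'v \<Rightarrow>\<^sub>L 'w::euclidean_space"
  assumes X: "X \<in> rough_paths p T \<omega>" and H: "H \<in> controlled_paths p T \<omega> X"
  shows "controlled_integral p T \<omega> X H \<in> controlled_paths p T \<omega> X"
proof (rule scalar_controlled_imp_controlled[OF X])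
  fix e :: 'w assume e: "e \<in> Basis"
  let ?I = "rough_integral p T \<omega> X H"
  note I = is_rough_integral_rough_integral(1)[OF X H, unfolded is_rough_integral_iff]
  define f where "f t w = (if w = [] then ?I t \<bullet> e else int_coords H e t w)" for t w
  have "scalar_controlled X f"
    unfolding scalar_controlled_def
  proof (intro conjI allI)
    fix w :: "'v list"
    show "\<exists>C. \<forall>t\<in>{0..T}. \<bar>f t w\<bar> \<le> C"
    proof (cases "w = []")
      case True
      have "continuous_on {0..T} ?I" using I by (auto simp: Cp_paths_def)
      then have "bounded ((\<lambda>t. ?I t \<bullet> e) ` {0..T})"
        by (intro compact_imp_bounded compact_continuous_image continuous_intros) auto
      then show ?thesis using True by (auto simp: bounded_iff f_def)
    qed (use int_coords_bounded[OF X H, of e w] in \<open>simp add: f_def\<close>)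
  next
    fix y :: "'v list"
    show "(\<lambda>z. translate N (X (fst z) (snd z)) (f (fst z)) y - f (snd z) y) \<in> ord2 (N - length y)"
    proof (cases y rule: rev_cases)
      case Nil
      have "translate N (X (fst z) (snd z)) (f (fst z)) [] - f (snd z) []
          = - ((?I (snd z) - ?I (fst z)) \<bullet> e - translate N (X (fst z) (snd z)) (int_coords H e (fst z)) [])"
        if "z \<in> Simplex T" for z
      proof -
        have "translate N (X (fst z) (snd z)) (f (fst z)) []
            = X (fst z) (snd z) [] * (?I (fst z) \<bullet> e) + (\<Sum>w\<in>words_upto N - {[]}. X (fst z) (snd z) w * int_coords H e (fst z) w)"
          unfolding translate_def by (subst sum.remove[OF finite_words_upto, of "[]"]) (auto simp: f_def)
        moreover have "translate N (X (fst z) (snd z)) (int_coords H e (fst z)) []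
            = (\<Sum>w\<in>words_upto N - {[]}. X (fst z) (snd z) w * int_coords H e (fst z) w)"
          unfolding translate_def by (subst sum.remove[OF finite_words_upto, of "[]"]) auto
        ultimately show ?thesis
          using rough_pathsD(2)[OF X, of "fst z" "snd z"] that by (simp add: f_def inner_diff_left)
      qed
      moreover have "(\<lambda>z. - ((?I (snd z) - ?I (fst z)) \<bullet> e - translate N (X (fst z) (snd z)) (int_coords H e (fst z)) [])) \<in> ord2 (N + 1)"
        using I e by (subst landau_o.big.uminus_in_iff) blast
      ultimately have "(\<lambda>z. translate N (X (fst z) (snd z)) (f (fst z)) [] - f (snd z) []) \<in> ord2 (N + 1)"
        by (subst bigo_principal_cong) auto
      then show ?thesis unfolding Nil by (rule S2.order_ge_mono) simp
    next
      case (snoc y' b)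
      have f: "f t (w @ y' @ [b]) = int_coords H e t (w @ y' @ [b])" for t w by (simp add: f_def)
      have "translate N (X (fst z) (snd z)) (f (fst z)) y = translate N (X (fst z) (snd z)) (int_coords H e (fst z)) y" for z
        by (simp add: translate_def snoc f)
      moreover have "(\<lambda>z. translate N (X (fst z) (snd z)) (int_coords H e (fst z)) (y' @ [b]) - int_coords H e (snd z) (y' @ [b])) \<in> ord2 (N - length y')"
        using scalar_controlledD(5)[OF int_coords_controlled[OF X H, of b e], of y']
        by (cases "b \<in> Basis") (simp_all add: translate_curry_last_snoc)
      from S2.order_ge_mono[OF this, of "N - length y"]
      have "(\<lambda>z. translate N (X (fst z) (snd z)) (int_coords H e (fst z)) (y' @ [b]) - int_coords H e (snd z) (y' @ [b])) \<in> ord2 (N - length y)"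
        by (simp add: snoc)
      ultimately show ?thesis using f[of _ "[]"] by (simp add: snoc)
    qed
  qed
  from scalar_controlled_trunc[OF X this]
  have "scalar_controlled X (\<lambda>t. trunc (N - 1) (f t))" .
  moreover have "trunc (N - 1) (f t) = trunc (N - 1) (\<lambda>w. controlled_integral p T \<omega> X H t w \<bullet> e)" for t
  proof
    fix w :: "'v list"
    have "int_coords H e t w = uncurry_last (H t) w \<bullet> e" if "w \<in> words_upto (N - 1)" "w \<noteq> []"
      using that by (intro int_coords_eq) (auto simp: words_upto_def)
    then show "trunc (N - 1) (f t) w = trunc (N - 1) (\<lambda>w. controlled_integral p T \<omega> X H t w \<bullet> e) w"
      by (simp add: trunc_def f_def controlled_integral_def)
  qed
  ultimately show "scalar_controlled X (\<lambda>t. trunc (N - 1) (\<lambda>w. controlled_integral p T \<omega> X H t w \<bullet> e))" by simp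
qed

end

section \<open>Change of the controlling path\<close>

text \<open>Orthonormality of the basis makes pure tensors of basis words coincide with the dual
  functionals.\<close>

lemma pure_tensor_words:
  assumes "w \<in> words n" "v \<in> words n"
  shows "pure_tensor w v = delta_word w v"
proof (cases "w = v")
  case True
  have "w ! i \<bullet> w ! i = 1" if "i < length w" for i
  proof -
    have "w ! i \<in> Basis" using that assms(1) by (auto simp: words_def)
    then show ?thesis by (simp add: inner_Basis)
  qed
  then show ?thesis using assms True by (simp add: pure_tensor_def delta_word_def words_def)
next
  case False
  have "length w = n" "length v = n" using assms by (auto simp: words_def)
  with False obtain i where i: "i < length w" "w ! i \<noteq> v ! i" by (metis nth_equalityI)
  then have "w ! i \<in> Basis" "v ! i \<in> Basis" using assms by (auto simp: words_def)
  with i have "w ! i \<bullet> v ! i = 0" by (simp add: inner_Basis)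
  with i(1) have "(\<Prod>i<length w. w ! i \<bullet> v ! i) = 0" by (auto intro!: prod_zero)
  then show ?thesis using False by (simp add: pure_tensor_def delta_word_def)
qed

text \<open>On a basis word the coproducts collapse, and the sums over compositions and ordered
  shuffles combine into \<open>osh\<close>; the separate clause for the empty word fits the same
  formula.\<close>

lemma change_path_eq:
  fixes K :: "real \<Rightarrow> 'u::euclidean_space list \<Rightarrow> 's::real_normed_vector"
    and H :: "real \<Rightarrow> 'v::euclidean_space list \<Rightarrow> 'u"
  assumes w: "set w \<subseteq> Basis"
  shows "change_path K H t w = (\<Sum>us\<in>words_upto (length w). osh (\<lambda>e v. H t v \<bullet> e) us w *\<^sub>R K t us)"
proof (cases "w = []")
  case False
  let ?n = "length w" and ?A = "\<lambda>m. {ns \<in> positive_lists m. sum_list ns = length w}"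
  let ?o = "osh (\<lambda>e v. H t v \<bullet> e)"
  have wn: "w \<in> words ?n" using w by (simp add: words_def)
  have inner: "(\<Sum>ns\<in>?A m. pair m (K t) (box_apply (H t) ns (coproduct_osh ns (pure_tensor w))))
      = (\<Sum>us\<in>words m. ?o us w *\<^sub>R K t us)" for m
  proof -
    have b: "box_apply (H t) ns (coproduct_osh ns (pure_tensor w)) u = (\<Sum>\<sigma>\<in>ordered_shuffles_of ns.
        \<Prod>i<length ns. H t (chop ns (permute_word \<sigma> w) ! i) \<bullet> (u ! i))"
      if "u \<in> words m" "ns \<in> ?A m" for u ns
    proof -
      let ?S = "\<lambda>v. \<Sum>\<sigma>\<in>ordered_shuffles_of ns. \<Prod>i<length ns. H t (chop ns (permute_word \<sigma> v) ! i) \<bullet> (u ! i)"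
      have "u \<in> words (length ns)" "sum_list ns = ?n" using that by (auto simp: positive_lists_def)
      then have "box_apply (H t) ns (coproduct_osh ns (pure_tensor w)) u = (\<Sum>v\<in>words ?n. pure_tensor w v * ?S v)"
        by (simp add: box_apply_coproduct_osh)
      also have "\<dots> = (\<Sum>v\<in>words ?n. if v = w then ?S w else 0)"
        by (rule sum.cong[OF refl]) (auto simp: pure_tensor_words[OF wn] delta_word_def)
      also have "\<dots> = ?S w" using wn by simp
      finally show ?thesis .
    qed
    have "(\<Sum>ns\<in>?A m. pair m (K t) (box_apply (H t) ns (coproduct_osh ns (pure_tensor w))))
        = (\<Sum>us\<in>words m. (\<Sum>ns\<in>?A m. box_apply (H t) ns (coproduct_osh ns (pure_tensor w)) us) *\<^sub>R K t us)"
      unfolding pair_def scaleR_sum_left by (rule sum.swap)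
    also have "\<dots> = (\<Sum>us\<in>words m. ?o us w *\<^sub>R K t us)"
    proof (rule sum.cong[OF refl])
      fix us :: "'u list" assume us: "us \<in> words m"
      then have "length us = m" by (simp add: words_def)
      from sum_ordered_shuffles_eq_osh[OF this refl, where w = w and h = "H t"]
      show "(\<Sum>ns\<in>?A m. box_apply (H t) ns (coproduct_osh ns (pure_tensor w)) us) *\<^sub>R K t us = ?o us w *\<^sub>R K t us"
        using b[OF us] by simp
    qed
    finally show ?thesis .
  qed
  have "change_path K H t w = (\<Sum>m\<in>{1..?n}. \<Sum>us\<in>words m. ?o us w *\<^sub>R K t us)"
    using False by (simp add: change_path_def inner)
  also have "\<dots> = (\<Sum>m\<le>?n. \<Sum>us\<in>words m. ?o us w *\<^sub>R K t us)"
    using False by (intro sum.mono_neutral_left) (auto simp: Suc_le_eq)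
  finally show ?thesis by (simp add: sum_words_upto)
qed (simp add: change_path_def)

context control_setup
begin

text \<open>Neither the blocks of \<open>w\<close> nor the words \<open>us\<close> exceed
  \<open>N - 1\<close> letters, so truncation of either functional is invisible.\<close>

lemma change_path_coords:
  fixes K :: "real \<Rightarrow> 'u::euclidean_space list \<Rightarrow> 's::euclidean_space"
    and H :: "real \<Rightarrow> 'v::euclidean_space list \<Rightarrow> 'u"
  assumes w: "w \<in> words_upto (N - 1)"
  shows "change_path K H t w \<bullet> e = osh_comp (coords K t e) (coords H t) w"
proof -
  have "change_path K H t w \<bullet> e = (\<Sum>us\<in>words_upto (length w). osh (\<lambda>e v. H t v \<bullet> e) us w * (K t us \<bullet> e))"
    using w by (simp add: change_path_eq words_upto_def inner_sum_left)
  also have "\<dots> = osh_comp (coords K t e) (coords H t) w"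
    unfolding osh_comp_def
  proof (rule sum.cong[OF refl])
    fix us :: "'u list" assume us: "us \<in> words_upto (length w)"
    have "osh (\<lambda>e v. H t v \<bullet> e) us w = osh (coords H t) us w"
    proof (rule osh_cong)
      fix u v assume "u \<in> set us" "length v + length us \<le> length w + 1" "set v \<subseteq> set w"
      then have "1 \<le> length us" "length v + length us \<le> length w + 1" "set v \<subseteq> set w"
        by (auto simp: Suc_le_eq)
      then have "v \<in> words_upto (N - 1)" using w by (auto simp: words_upto_def)
      then show "H t v \<bullet> u = coords H t u v" by (simp add: trunc_def)
    qed
    moreover have "us \<in> words_upto (N - 1)" using us w by (auto simp: words_upto_def)
    ultimately show "osh (\<lambda>e v. H t v \<bullet> e) us w * (K t us \<bullet> e) = coords K t e us * osh (coords H t) us w"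
      by (simp add: trunc_def)
  qed
  finally show ?thesis .
qed

text \<open>The first level of the lift is exact while the one-letter germ is one order short, which
  explains the exceptional error; all other lengths match to order \<open>N + 1\<close>.\<close>

lemma rough_lift_close_germ:
  fixes X :: "real \<Rightarrow> real \<Rightarrow> 'v::euclidean_space list \<Rightarrow> real"
    and H :: "real \<Rightarrow> 'v list \<Rightarrow> 'u::euclidean_space"
  assumes X: "X \<in> rough_paths p T \<omega>" and H: "H \<in> controlled_paths p T \<omega> X"
    and Y: "is_rough_lift p T \<omega> X H Y" and us: "us \<in> words_upto N"
  shows "(\<lambda>z. Y (fst z) (snd z) us - lift_germ X (coords H) (fst z) (snd z) us)
     \<in> ord2 (if length us = 1 then N else N + 1)"
  using us
proof (cases rule: words_upto_cases)
  case 1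
  have "Y (fst z) (snd z) us - lift_germ X (coords H) (fst z) (snd z) us = 0" if "z \<in> Simplex T" for z
  proof -
    have "lift_germ X (coords H) (fst z) (snd z) []
        = (\<Sum>w\<in>(words_upto N :: 'v list set). if w = [] then X (fst z) (snd z) [] else 0)"
      unfolding lift_germ_def translate_def by (rule sum.cong[OF refl]) auto
    moreover have "Y \<in> rough_paths p T \<omega>" using Y by (simp add: is_rough_lift_def)
    ultimately show ?thesis
      using rough_pathsD(2)[OF X, of "fst z" "snd z"] rough_pathsD(2)[of Y "fst z" "snd z"] that 1 by simp
  qed
  then show ?thesis by (subst bigo_principal_cong[where g = "\<lambda>_. 0"]) auto
next
  case (2 e)
  have "is_trace T Y (\<lambda>t. H t [])" using Y by (simp add: is_rough_lift_def)
  then have tr: "Y s t [e] = (H t [] - H s []) \<bullet> e" if "(s, t) \<in> Simplex T" for s t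
    using that 2 unfolding is_trace_def by fastforce
  have "(\<lambda>z. - (lift_germ X (coords H) (fst z) (snd z) [e] - (coords H (snd z) e [] - coords H (fst z) e []))) \<in> ord2 N"
    by (subst landau_o.big.uminus_in_iff) (rule lift_germ_single[OF X coords_scalar_controlled[OF X H]])
  then show ?thesis
    using 2 tr by (subst bigo_principal_cong) (auto simp: trunc_def inner_diff_left)
next
  case 3
  then show ?thesis using Y us by (simp add: is_rough_lift_iff)
qed

text \<open>Three errors add up: the expansion of the iterated half-shuffle products along
  \<open>X\<close>, the replacement of the germ by \<open>Y\<close>, and the expansion of
  \<open>K\<close> along \<open>Y\<close>. The target order \<open>N - length y\<close> leaves room
  for the one-letter exception.\<close>

lemma change_path_controlled:
  fixes X :: "real \<Rightarrow> real \<Rightarrow> 'v::euclidean_space list \<Rightarrow> real"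
    and H :: "real \<Rightarrow> 'v list \<Rightarrow> 'u::euclidean_space"
    and K :: "real \<Rightarrow> 'u list \<Rightarrow> 's::euclidean_space"
  assumes X: "X \<in> rough_paths p T \<omega>" and H: "H \<in> controlled_paths p T \<omega> X"
    and Y: "is_rough_lift p T \<omega> X H Y" and K: "K \<in> controlled_paths p T \<omega> Y"
  shows "change_path K H \<in> controlled_paths p T \<omega> X"
proof (rule scalar_controlled_imp_controlled[OF X])
  fix e :: 's
  interpret R2: rough_family "Simplex T" \<rho>2 N "\<lambda>z. X (fst z) (snd z)"
    by (rule rough_family_simplex[OF X])
  have YR: "Y \<in> rough_paths p T \<omega>" using Y by (simp add: is_rough_lift_def)
  define h where "h = coords H"
  define k where "k t = coords K t e" for t
  have h: "scalar_controlled X (\<lambda>t. h t u)" for u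
    unfolding h_def by (rule coords_scalar_controlled[OF X H])
  have k: "scalar_controlled Y k"
    unfolding k_def by (rule coords_scalar_controlled[OF YR K])
  have k0: "k t us = 0" if "us \<notin> words_upto (N - 1)" for t us
    using that by (simp add: k_def trunc_def)
  define f where "f t = osh_comp (k t) (h t)" for t
  have f: "f t w = (\<Sum>us\<in>words_upto N. k t us * osh (h t) us w)" for t w
  proof -
    have "f t w = (\<Sum>us\<in>words_upto (max N (length w)). k t us * osh (h t) us w)"
      unfolding f_def by (rule osh_comp_eq) simp
    also have "\<dots> = (\<Sum>us\<in>words_upto N. k t us * osh (h t) us w)"
      by (rule sum.mono_neutral_right, rule finite_words_upto)
        (auto simp: words_upto_def intro!: disjI1 k0)
    finally show ?thesis .
  qed
  have ob: "(\<lambda>z. osh (h (fst z)) us w) \<in> O[principal (Simplex T)](\<lambda>_. 1)"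
    "(\<lambda>z. osh (h (snd z)) us w) \<in> O[principal (Simplex T)](\<lambda>_. 1)" for us w
    by (rule R2.osh_bounded, rule scalar_controlledD[OF h])+
  have "scalar_controlled X f"
    unfolding scalar_controlled_def
  proof (intro conjI allI)
    fix w :: "'v list"
    have "(\<lambda>z. f (fst z) w) \<in> O[principal (Simplex T)](\<lambda>_. 1)"
      unfolding f by (intro big_sum_in_bigo bounded_mult ob scalar_controlledD(1)[OF k])
    then obtain C where C: "\<And>z. z \<in> Simplex T \<Longrightarrow> \<bar>f (fst z) w\<bar> \<le> C"
      unfolding bigo_principal_iff by auto
    have "\<bar>f t w\<bar> \<le> C" if "t \<in> {0..T}" for t
      using C[of "(t, t)"] that by (simp add: Simplex_def)
    then show "\<exists>C. \<forall>t\<in>{0..T}. \<bar>f t w\<bar> \<le> C" by blast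
  next
    fix y :: "'v list"
    let ?X = "\<lambda>z. X (fst z) (snd z)" and ?Y = "\<lambda>z. Y (fst z) (snd z)" and ?G = "\<lambda>z. lift_germ X h (fst z) (snd z)"
    let ?k = "\<lambda>z. k (fst z)" and ?o = "\<lambda>z us. osh (h (snd z)) us y"
    have 1: "(\<lambda>z. \<Sum>us\<in>words_upto N. ?k z us * (translate N (?X z) (osh (h (fst z)) us) y
        - (\<Sum>i\<le>length us. ?G z (take i us) * ?o z (drop i us)))) \<in> ord2 (N - length y)"
    proof (rule big_sum_in_bigo, rule S2.bounded_mult_order_ge)
      fix us :: "'u list"
      show "(\<lambda>z. ?k z us) \<in> O[principal (Simplex T)](\<lambda>_. 1)" by (rule scalar_controlledD[OF k])
      show "(\<lambda>z. translate N (?X z) (osh (h (fst z)) us) y - (\<Sum>i\<le>length us. ?G z (take i us) * ?o z (drop i us)))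
          \<in> ord2 (N - length y)"
        by (rule S2.order_ge_mono[OF osh_translate_controlled[OF X h]]) (auto intro: diff_le_mono)
    qed
    have 2: "(\<lambda>z. \<Sum>us\<in>words_upto N. ?k z us * (\<Sum>i\<le>length us. (?Y z (take i us) - ?G z (take i us)) * ?o z (drop i us)))
        \<in> ord2 (N - length y)"
    proof (rule big_sum_in_bigo, rule S2.bounded_mult_order_ge, rule scalar_controlledD[OF k],
        rule big_sum_in_bigo, rule S2.order_ge_mult_bounded)
      fix us :: "'u list" and i assume us: "us \<in> words_upto N"
      have "(\<lambda>z. ?Y z (take i us) - ?G z (take i us)) \<in> ord2 (if length (take i us) = 1 then N else N + 1)"
        unfolding h_def by (rule rough_lift_close_germ[OF X H Y in_words_upto_take_drop(1)[OF us]])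
      then show "(\<lambda>z. ?Y z (take i us) - ?G z (take i us)) \<in> ord2 (N - length y)"
        by (rule S2.order_ge_mono) (simp only: split: if_split, linarith)
    qed (rule ob)
    \<comment> \<open>Words \<open>us\<close> longer than \<open>y\<close> are annihilated by
      \<open>osh\<close>, so order \<open>N - length us\<close> in the expansion of \<open>K\<close>
      suffices.\<close>
    have 3: "(\<lambda>z. \<Sum>us\<in>words_upto N. (translate N (?Y z) (?k z) us - k (snd z) us) * ?o z us) \<in> ord2 (N - length y)"
    proof (rule big_sum_in_bigo)
      fix us :: "'u list"
      show "(\<lambda>z. (translate N (?Y z) (?k z) us - k (snd z) us) * ?o z us) \<in> ord2 (N - length y)"
      proof (cases "length us \<le> length y")
        case True
        have "(\<lambda>z. (translate N (?Y z) (?k z) us - k (snd z) us) * ?o z us) \<in> ord2 (N - length us)"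
          by (intro S2.order_ge_mult_bounded ob scalar_controlledD(5)[OF k])
        then show ?thesis by (rule S2.order_ge_mono) (use True in simp)
      qed (simp add: osh_eq_0)
    qed
    \<comment> \<open>Regrouping by the suffix of \<open>us\<close>. The truncation of
      \<open>k\<close> kills the pairs of total length above \<open>N\<close>, so the identity is
      exact.\<close>
    have deconc: "(\<Sum>us\<in>words_upto N. k s us * (\<Sum>i\<le>length us. Y s t (take i us) * g (drop i us)))
        = (\<Sum>vs\<in>words_upto N. translate N (Y s t) (k s) vs * g vs)" for s t and g :: "'u list \<Rightarrow> real"
    proof -
      have "(\<Sum>us\<in>words_upto N. k s us * (\<Sum>i\<le>length us. Y s t (take i us) * g (drop i us)))
          = (\<Sum>n\<le>N. \<Sum>us\<in>words n. \<Sum>i\<le>n. k s us * (Y s t (take i us) * g (drop i us)))"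
        unfolding sum_words_upto sum_distrib_left by (intro sum.cong refl) (auto simp: words_def)
      also have "\<dots> = (\<Sum>n\<le>N. \<Sum>i\<le>n. \<Sum>us\<in>words (i + (n - i)). k s us * (Y s t (take i us) * g (drop i us)))"
        by (rule sum.cong[OF refl], rule trans[OF sum.swap], rule sum.cong[OF refl]) simp
      also have "\<dots> = (\<Sum>n\<le>N. \<Sum>i\<le>n. \<Sum>v\<in>words i. \<Sum>w\<in>words (n - i). k s (v @ w) * (Y s t v * g w))"
        unfolding sum_words_add by (intro sum.cong refl) (auto simp: words_def)
      also have "\<dots> = (\<Sum>(n, i)\<in>Sigma {..N} (\<lambda>n. {..n}). \<Sum>v\<in>words i. \<Sum>w\<in>words (n - i). k s (v @ w) * (Y s t v * g w))"
        by (rule sum.Sigma) auto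
      also have "\<dots> = (\<Sum>(j, i)\<in>Sigma {..N} (\<lambda>j. {..N - j}). \<Sum>v\<in>words i. \<Sum>w\<in>words j. k s (v @ w) * (Y s t v * g w))"
        by (rule sum.reindex_bij_witness[where i = "\<lambda>(j, i). (j + i, i)" and j = "\<lambda>(n, i). (n - i, i)"]) auto
      also have "\<dots> = (\<Sum>j\<le>N. \<Sum>i\<le>N - j. \<Sum>v\<in>words i. \<Sum>w\<in>words j. k s (v @ w) * (Y s t v * g w))"
        by (rule sum.Sigma[symmetric]) auto
      also have "\<dots> = (\<Sum>j\<le>N. \<Sum>v\<in>words_upto (N - j). \<Sum>w\<in>words j. k s (v @ w) * (Y s t v * g w))"
        by (simp add: sum_words_upto)
      also have "\<dots> = (\<Sum>j\<le>N. \<Sum>w\<in>words j. \<Sum>v\<in>words_upto (N - j). k s (v @ w) * (Y s t v * g w))"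
        by (rule sum.cong[OF refl], rule sum.swap)
      also have "\<dots> = (\<Sum>j\<le>N. \<Sum>w\<in>words j. translate N (Y s t) (k s) w * g w)"
      proof (rule sum.cong[OF refl], rule sum.cong[OF refl])
        fix j and w :: "'u list" assume j: "j \<in> {..N}" and w: "w \<in> words j"
        have "translate N (Y s t) (k s) w = (\<Sum>v\<in>words_upto (N - j). Y s t v * k s (v @ w))"
          unfolding translate_def
        proof (rule sum.mono_neutral_right)
          show "\<forall>v\<in>words_upto N - words_upto (N - j). Y s t v * k s (v @ w) = 0"
          proof
            fix v :: "'u list" assume "v \<in> words_upto N - words_upto (N - j)"
            then have "v @ w \<notin> words_upto (N - 1)" using w N_ge_1 by (auto simp: words_upto_def words_def)
            from k0[OF this] show "Y s t v * k s (v @ w) = 0" by (simp only: mult_zero_right)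
          qed
        qed (rule finite_words_upto, rule words_upto_mono, simp)
        then show "(\<Sum>v\<in>words_upto (N - j). k s (v @ w) * (Y s t v * g w)) = translate N (Y s t) (k s) w * g w"
          by (simp add: sum_distrib_left mult_ac)
      qed
      finally show ?thesis by (simp add: sum_words_upto)
    qed
    have "translate N (?X z) (f (fst z)) y = (\<Sum>us\<in>words_upto N. ?k z us * translate N (?X z) (osh (h (fst z)) us) y)" for z
      unfolding translate_def f sum_distrib_left by (subst sum.swap) (simp add: mult_ac)
    moreover have "f (snd z) y = (\<Sum>us\<in>words_upto N. k (snd z) us * ?o z us)" for z by (rule f)
    ultimately have eq: "translate N (?X z) (f (fst z)) y - f (snd z) y =
       (\<Sum>us\<in>words_upto N. ?k z us * (translate N (?X z) (osh (h (fst z)) us) y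
        - (\<Sum>i\<le>length us. ?G z (take i us) * ?o z (drop i us))))
       - (\<Sum>us\<in>words_upto N. ?k z us * (\<Sum>i\<le>length us. (?Y z (take i us) - ?G z (take i us)) * ?o z (drop i us)))
       + (\<Sum>us\<in>words_upto N. (translate N (?Y z) (?k z) us - k (snd z) us) * ?o z us)" for z
      using deconc[of "fst z" "snd z" "?o z"]
      by (simp add: right_diff_distrib left_diff_distrib sum_subtractf)
    show "(\<lambda>z. translate N (?X z) (f (fst z)) y - f (snd z) y) \<in> ord2 (N - length y)"
      unfolding eq by (rule sum_in_bigo(1)[OF sum_in_bigo(2)[OF 1 2] 3])
  qed
  from scalar_controlled_trunc[OF X this]
  have "scalar_controlled X (\<lambda>t. trunc (N - 1) (f t))" .
  moreover have "trunc (N - 1) (f t) = trunc (N - 1) (\<lambda>w. change_path K H t w \<bullet> e)" for t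
    by (rule ext) (simp add: trunc_def change_path_coords f_def k_def h_def)
  ultimately show "scalar_controlled X (\<lambda>t. trunc (N - 1) (\<lambda>w. change_path K H t w \<bullet> e))" by simp
qed

text \<open>The delicate point is to replace \<open>Y\<close> by its germ to order
  \<open>N + 1\<close>. For \<open>length us \<ge> 2\<close> the words \<open>vs\<close> shorter
  than \<open>us\<close> are annihilated by \<open>osh\<close>, so the one-letter exception does not
  enter.\<close>

lemma rough_lift_change_path:
  fixes X :: "real \<Rightarrow> real \<Rightarrow> 'v::euclidean_space list \<Rightarrow> real"
    and H :: "real \<Rightarrow> 'v list \<Rightarrow> 'u::euclidean_space"
    and K :: "real \<Rightarrow> 'u list \<Rightarrow> 's::euclidean_space"
  assumes X: "X \<in> rough_paths p T \<omega>" and H: "H \<in> controlled_paths p T \<omega> X"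
    and Y: "is_rough_lift p T \<omega> X H Y" and K: "K \<in> controlled_paths p T \<omega> Y"
    and Y': "is_rough_lift p T \<omega> Y K Y'"
  shows "is_rough_lift p T \<omega> X (change_path K H) Y'"
  unfolding is_rough_lift_iff
proof (intro conjI ballI impI)
  show "Y' \<in> rough_paths p T \<omega>" using Y' by (simp add: is_rough_lift_def)
  show "is_trace T Y' (\<lambda>t. change_path K H t [])"
    using Y' by (simp add: is_rough_lift_def change_path_def)
  fix us :: "'s list" assume us: "us \<in> words_upto N" "2 \<le> length us"
  have YR: "Y \<in> rough_paths p T \<omega>" using Y by (simp add: is_rough_lift_def)
  interpret RY: rough_family "Simplex T" \<rho>2 N "\<lambda>z. Y (fst z) (snd z)"
    by (rule rough_family_simplex[OF YR])
  let ?h = "coords H" and ?k = "coords K" and ?M = "coords (change_path K H)"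
  have 1: "(\<lambda>z. Y' (fst z) (snd z) us - lift_germ Y ?k (fst z) (snd z) us) \<in> ord2 (N + 1)"
    using Y' us unfolding is_rough_lift_iff by blast
  have 2: "(\<lambda>z. \<Sum>vs\<in>words_upto N. (Y (fst z) (snd z) vs - lift_germ X ?h (fst z) (snd z) vs) * osh (?k (fst z)) us vs) \<in> ord2 (N + 1)"
  proof (rule big_sum_in_bigo)
    fix vs :: "'u list" assume vs: "vs \<in> words_upto N"
    show "(\<lambda>z. (Y (fst z) (snd z) vs - lift_germ X ?h (fst z) (snd z) vs) * osh (?k (fst z)) us vs) \<in> ord2 (N + 1)"
    proof (cases "length vs < length us")
      case False
      then have "length vs \<noteq> 1" using us(2) by simp
      moreover have "(\<lambda>z. osh (?k (fst z)) us vs) \<in> O[principal (Simplex T)](\<lambda>_. 1)"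
        by (rule RY.osh_bounded) (rule scalar_controlledD(1)[OF coords_scalar_controlled[OF YR K]])
      ultimately show ?thesis
        using S2.order_ge_mult_bounded[OF rough_lift_close_germ[OF X H Y vs]] by simp
    qed (simp add: osh_eq_0)
  qed
  have eq: "(\<Sum>vs\<in>words_upto N. lift_germ X ?h s t vs * osh (?k s) us vs) = lift_germ X ?M s t us" for s t
  proof -
    have "(\<Sum>vs\<in>words_upto N. lift_germ X ?h s t vs * osh (?k s) us vs)
        = (\<Sum>w\<in>words_upto N. X s t w * (\<Sum>vs\<in>words_upto N. osh (?k s) us vs * osh (?h s) vs w))"
      unfolding lift_germ_def translate_def sum_distrib_left sum_distrib_right
      by (subst sum.swap) (simp add: mult_ac)
    also have "\<dots> = (\<Sum>w\<in>words_upto N. X s t w * osh (?M s) us w)"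
    proof (rule sum.cong[OF refl])
      fix w :: "'v list" assume w: "w \<in> words_upto N"
      then have "(\<Sum>vs\<in>words_upto N. osh (?k s) us vs * osh (?h s) vs w) = osh_comp (osh (?k s) us) (?h s) w"
        by (subst osh_comp_eq[of _ N]) (auto simp: words_upto_def)
      also have "\<dots> = osh (\<lambda>e. osh_comp (?k s e) (?h s)) us w" by (rule osh_osh_comp)
      also have "\<dots> = osh (?M s) us w"
      proof (rule osh_cong)
        fix u v assume "length v + length us \<le> length w + 1" "set v \<subseteq> set w"
        then have "v \<in> words_upto (N - 1)" using w us(2) by (auto simp: words_upto_def)
        then show "osh_comp (?k s u) (?h s) v = ?M s u v"
          by (simp add: trunc_def change_path_coords)
      qed
      finally show "X s t w * (\<Sum>vs\<in>words_upto N. osh (?k s) us vs * osh (?h s) vs w) = X s t w * osh (?M s) us w"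
        by simp
    qed
    finally show ?thesis by (simp add: lift_germ_def translate_def)
  qed
  have "lift_germ Y ?k s t us = (\<Sum>vs\<in>words_upto N. Y s t vs * osh (?k s) us vs)" for s t
    by (simp add: lift_germ_def translate_def)
  then have eq2: "Y' (fst z) (snd z) us - lift_germ X ?M (fst z) (snd z) us =
      (Y' (fst z) (snd z) us - lift_germ Y ?k (fst z) (snd z) us) +
      (\<Sum>vs\<in>words_upto N. (Y (fst z) (snd z) vs - lift_germ X ?h (fst z) (snd z) vs) * osh (?k (fst z)) us vs)" for z
    unfolding eq[symmetric] by (simp add: left_diff_distrib sum_subtractf)
  show "(\<lambda>z. Y' (fst z) (snd z) us - lift_germ X ?M (fst z) (snd z) us) \<in> ord2 (N + 1)"
    unfolding eq2 by (rule sum_in_bigo(1)[OF 1 2])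
qed

end

section \<open>Taylor expansion of smooth functions\<close>

lemma iter_deriv_append: "iter_deriv f (v @ w) = iter_deriv (iter_deriv f w) v"
  by (induction v) simp_all

lemma smooth_iter_deriv: "smooth f \<Longrightarrow> smooth (iter_deriv f w)"
  by (simp add: smooth_def iter_deriv_append[symmetric])

lemma iter_deriv_has_derivative:
  "smooth f \<Longrightarrow> (iter_deriv f w has_derivative (\<lambda>v. iter_deriv f (v # w) x)) (at x)"
  by (simp add: smooth_def frechet_derivative_works[symmetric])

lemma iter_deriv_Cons_linear: "smooth f \<Longrightarrow> linear (\<lambda>v. iter_deriv f (v # w) x)"
  by (rule has_derivative_linear[OF iter_deriv_has_derivative])

lemma iter_deriv_continuous: "smooth f \<Longrightarrow> continuous_on UNIV (iter_deriv f w)"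
  by (intro continuous_at_imp_continuous_on ballI has_derivative_continuous[OF iter_deriv_has_derivative])

lemma iter_deriv_inner:
  fixes F :: "'v::real_normed_vector \<Rightarrow> 'u::real_inner"
  assumes "smooth F"
  shows "iter_deriv (\<lambda>x. F x \<bullet> e) w = (\<lambda>x. iter_deriv F w x \<bullet> e)"
proof (induction w)
  case (Cons v w)
  have "((\<lambda>x. iter_deriv F w x \<bullet> e) has_derivative (\<lambda>v. iter_deriv F (v # w) x \<bullet> e)) (at x)" for x
    by (rule has_derivative_inner_left[OF iter_deriv_has_derivative[OF assms]])
  then have "frechet_derivative (\<lambda>x. iter_deriv F w x \<bullet> e) (at x) = (\<lambda>v. iter_deriv F (v # w) x \<bullet> e)" for x
    by (rule frechet_derivative_at[symmetric])
  with Cons show ?case by simp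
qed simp

lemma smooth_inner:
  fixes F :: "'v::real_normed_vector \<Rightarrow> 'u::real_inner"
  assumes "smooth F"
  shows "smooth (\<lambda>x. F x \<bullet> e)"
  unfolding smooth_def iter_deriv_inner[OF assms]
  using has_derivative_inner_left[OF iter_deriv_has_derivative[OF assms]] by (blast intro: differentiableI)

section \<open>Symmetry of derivatives\<close>

lemma iter_deriv_line:
  fixes g :: "'v::real_normed_vector \<Rightarrow> real"
  assumes "smooth g"
  shows "((\<lambda>s. iter_deriv g w (y + s *\<^sub>R a)) has_real_derivative iter_deriv g (a # w) (y + s *\<^sub>R a)) (at s)"
proof -
  have "((\<lambda>s. y + s *\<^sub>R a) has_derivative (\<lambda>s. s *\<^sub>R a)) (at s)"
    by (auto intro!: derivative_eq_intros)
  from has_derivative_compose[OF this iter_deriv_has_derivative[OF assms]]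
  have "((\<lambda>s. iter_deriv g w (y + s *\<^sub>R a)) has_derivative (\<lambda>r. iter_deriv g ((r *\<^sub>R a) # w) (y + s *\<^sub>R a))) (at s)" .
  moreover have "iter_deriv g ((r *\<^sub>R a) # w) z = iter_deriv g (a # w) z * r" for r z
    using linear_cmul[OF iter_deriv_Cons_linear[OF assms, where w = w and x = z], of r a] by simp
  ultimately show ?thesis by (simp add: has_field_derivative_def)
qed

text \<open>The mean value theorem is applied to the difference of \<open>g\<close> along two
  parallel segments, then to the first derivative in the other direction.\<close>

lemma second_difference:
  fixes g :: "'v::real_normed_vector \<Rightarrow> real"
  assumes g: "smooth g" and h: "0 < h"
  obtains \<sigma> \<tau> where "0 < \<sigma>" "\<sigma> < h" "0 < \<tau>" "\<tau> < h"
    "g (x + h *\<^sub>R a + h *\<^sub>R b) - g (x + h *\<^sub>R a) - g (x + h *\<^sub>R b) + g x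
       = h * (h * iter_deriv g [b, a] (x + \<sigma> *\<^sub>R a + \<tau> *\<^sub>R b))"
proof -
  let ?u = "\<lambda>s. g ((x + h *\<^sub>R b) + s *\<^sub>R a) - g (x + s *\<^sub>R a)"
  have "(?u has_real_derivative (iter_deriv g [a] ((x + h *\<^sub>R b) + s *\<^sub>R a) - iter_deriv g [a] (x + s *\<^sub>R a))) (at s)" for s
    by (rule DERIV_diff; rule iter_deriv_line[OF g, of "[]", simplified iter_deriv.simps(1)])
  from MVT2[OF h this] obtain \<sigma> where \<sigma>: "0 < \<sigma>" "\<sigma> < h"
    "?u h - ?u 0 = (h - 0) * (iter_deriv g [a] ((x + h *\<^sub>R b) + \<sigma> *\<^sub>R a) - iter_deriv g [a] (x + \<sigma> *\<^sub>R a))"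
    by blast
  have "((\<lambda>s. iter_deriv g [a] ((x + \<sigma> *\<^sub>R a) + s *\<^sub>R b)) has_real_derivative iter_deriv g [b, a] ((x + \<sigma> *\<^sub>R a) + s *\<^sub>R b)) (at s)" for s
    by (rule iter_deriv_line[OF g])
  from MVT2[OF h this] obtain \<tau> where \<tau>: "0 < \<tau>" "\<tau> < h"
    "iter_deriv g [a] ((x + \<sigma> *\<^sub>R a) + h *\<^sub>R b) - iter_deriv g [a] ((x + \<sigma> *\<^sub>R a) + 0 *\<^sub>R b)
      = (h - 0) * iter_deriv g [b, a] ((x + \<sigma> *\<^sub>R a) + \<tau> *\<^sub>R b)"
    by blast
  have "x + \<sigma> *\<^sub>R a + h *\<^sub>R b = x + h *\<^sub>R b + \<sigma> *\<^sub>R a" "x + h *\<^sub>R a + h *\<^sub>R b = x + h *\<^sub>R b + h *\<^sub>R a"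
    by (simp_all add: algebra_simps)
  then show thesis
    using \<sigma> \<tau> by (intro that[of \<sigma> \<tau>]) (simp_all add: algebra_simps)
qed

text \<open>The second difference is symmetric in \<open>a\<close> and \<open>b\<close>. Evaluated
  both ways it equates the two mixed derivatives at points close to \<open>x\<close>, and continuity
  of both contradicts a gap at \<open>x\<close>.\<close>

lemma iter_deriv_swap2:
  fixes g :: "'v::real_normed_vector \<Rightarrow> real"
  assumes g: "smooth g"
  shows "iter_deriv g [a, b] x = iter_deriv g [b, a] x"
proof (rule ccontr)
  assume ne: "\<not> ?thesis"
  define \<epsilon> where "\<epsilon> = \<bar>iter_deriv g [a, b] x - iter_deriv g [b, a] x\<bar> / 2"
  have \<epsilon>: "0 < \<epsilon>" using ne by (simp add: \<epsilon>_def)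
  have close: "\<bar>r - q\<bar> < 2 * e" if "u = v" "\<bar>u - q\<bar> < e" "\<bar>v - r\<bar> < e" for u v q r e :: real
    using that by linarith
  have cont: "\<exists>d>0. \<forall>y. dist y x < d \<longrightarrow> \<bar>iter_deriv g w y - iter_deriv g w x\<bar> < \<epsilon>" for w
    using iter_deriv_continuous[OF g, of w] \<epsilon> unfolding continuous_on_iff dist_real_def by blast
  obtain d1 d2 where d: "0 < d1" "0 < d2"
    "\<And>y. dist y x < d1 \<Longrightarrow> \<bar>iter_deriv g [a, b] y - iter_deriv g [a, b] x\<bar> < \<epsilon>"
    "\<And>y. dist y x < d2 \<Longrightarrow> \<bar>iter_deriv g [b, a] y - iter_deriv g [b, a] x\<bar> < \<epsilon>"
    using cont[of "[a, b]"] cont[of "[b, a]"] by blast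
  \<comment> \<open>Intermediate points have distance at most \<open>h * (norm a + norm b)\<close>
    from \<open>x\<close> and stay in both neighbourhoods; the summand one keeps the denominator
    positive.\<close>
  define h where "h = min d1 d2 / (norm a + norm b + 1)"
  have pos: "0 < norm a + norm b + 1" by (smt (verit) norm_ge_zero)
  have h: "0 < h" using d pos by (simp add: h_def)
  have near: "dist (x + \<sigma> *\<^sub>R u + \<tau> *\<^sub>R v) x < min d1 d2"
    if st: "0 < \<sigma>" "\<sigma> < h" "0 < \<tau>" "\<tau> < h" and uv: "norm u + norm v = norm a + norm b" for \<sigma> \<tau> u v
  proof -
    have "dist (x + \<sigma> *\<^sub>R u + \<tau> *\<^sub>R v) x = norm (\<sigma> *\<^sub>R u + \<tau> *\<^sub>R v)"
      by (simp add: dist_norm add.assoc)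
    also have "\<dots> \<le> \<sigma> * norm u + \<tau> * norm v"
      using norm_triangle_ineq[of "\<sigma> *\<^sub>R u" "\<tau> *\<^sub>R v"] st by simp
    also have "\<dots> \<le> h * norm u + h * norm v"
      using st by (intro add_mono mult_right_mono) auto
    also have "\<dots> = h * (norm a + norm b)" by (simp add: uv[symmetric] distrib_left)
    also have "\<dots> < h * (norm a + norm b + 1)" using h by simp
    also have "\<dots> = min d1 d2" using pos by (simp add: h_def)
    finally show ?thesis .
  qed
  obtain \<sigma> \<tau> where 1: "0 < \<sigma>" "\<sigma> < h" "0 < \<tau>" "\<tau> < h"
    "g (x + h *\<^sub>R a + h *\<^sub>R b) - g (x + h *\<^sub>R a) - g (x + h *\<^sub>R b) + g x
       = h * (h * iter_deriv g [b, a] (x + \<sigma> *\<^sub>R a + \<tau> *\<^sub>R b))"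
    by (rule second_difference[OF g h])
  obtain \<sigma>' \<tau>' where 2: "0 < \<sigma>'" "\<sigma>' < h" "0 < \<tau>'" "\<tau>' < h"
    "g (x + h *\<^sub>R b + h *\<^sub>R a) - g (x + h *\<^sub>R b) - g (x + h *\<^sub>R a) + g x
       = h * (h * iter_deriv g [a, b] (x + \<sigma>' *\<^sub>R b + \<tau>' *\<^sub>R a))"
    by (rule second_difference[OF g h])
  have "g (x + h *\<^sub>R a + h *\<^sub>R b) - g (x + h *\<^sub>R a) - g (x + h *\<^sub>R b) + g x
      = g (x + h *\<^sub>R b + h *\<^sub>R a) - g (x + h *\<^sub>R b) - g (x + h *\<^sub>R a) + g x"
    by (simp add: algebra_simps)
  then have "h * (h * iter_deriv g [b, a] (x + \<sigma> *\<^sub>R a + \<tau> *\<^sub>R b)) = h * (h * iter_deriv g [a, b] (x + \<sigma>' *\<^sub>R b + \<tau>' *\<^sub>R a))"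
    by (simp only: 1(5) 2(5))
  then have "iter_deriv g [b, a] (x + \<sigma> *\<^sub>R a + \<tau> *\<^sub>R b) = iter_deriv g [a, b] (x + \<sigma>' *\<^sub>R b + \<tau>' *\<^sub>R a)"
    using h by simp
  moreover have "\<bar>iter_deriv g [b, a] (x + \<sigma> *\<^sub>R a + \<tau> *\<^sub>R b) - iter_deriv g [b, a] x\<bar> < \<epsilon>"
    using near[OF 1(1-4), of a b] by (intro d) simp
  moreover have "\<bar>iter_deriv g [a, b] (x + \<sigma>' *\<^sub>R b + \<tau>' *\<^sub>R a) - iter_deriv g [a, b] x\<bar> < \<epsilon>"
    using near[OF 2(1-4), of b a] by (intro d) simp
  ultimately have "\<bar>iter_deriv g [a, b] x - iter_deriv g [b, a] x\<bar> < 2 * \<epsilon>"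
    by (rule close)
  moreover have "2 * \<epsilon> = \<bar>iter_deriv g [a, b] x - iter_deriv g [b, a] x\<bar>"
    unfolding \<epsilon>_def by simp
  ultimately show False by (metis less_irrefl)
qed

lemma iter_deriv_swap:
  fixes g :: "'v::real_normed_vector \<Rightarrow> real"
  assumes g: "smooth g"
  shows "iter_deriv g (a # b # w) = iter_deriv g (b # a # w)"
proof -
  have "iter_deriv g ([a, b] @ w) x = iter_deriv g ([b, a] @ w) x" for x
    unfolding iter_deriv_append by (rule iter_deriv_swap2[OF smooth_iter_deriv[OF g]])
  then show ?thesis by auto
qed

lemma iter_deriv_Cons_eq_snoc:
  fixes g :: "'v::real_normed_vector \<Rightarrow> real"
  assumes g: "smooth g"
  shows "iter_deriv g (b # w) = iter_deriv g (w @ [b])"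
proof (induction w)
  case (Cons c w)
  have "iter_deriv g (b # c # w) = iter_deriv g (c # b # w)" by (rule iter_deriv_swap[OF g])
  also have "\<dots> = iter_deriv g ((c # w) @ [b])"
    using Cons by (simp only: iter_deriv.simps(2)[of _ c] append_Cons)
  finally show ?case .
qed simp

lemma iter_deriv_move_last:
  fixes g :: "'v::real_normed_vector \<Rightarrow> real"
  assumes g: "smooth g"
  shows "iter_deriv g (v @ b # w) = iter_deriv g (v @ w @ [b])"
  unfolding iter_deriv_append[of g v] iter_deriv_Cons_eq_snoc[OF g, of b w] ..

text \<open>One copy of \<open>v\<close> is expanded in the basis and moved to the innermost slot by
  symmetry, so that the remaining copies differentiate the smooth function
  \<open>iter_deriv g [b]\<close>.\<close>

lemma iter_deriv_replicate_Suc: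
  fixes g :: "'v::euclidean_space \<Rightarrow> real"
  assumes g: "smooth g"
  shows "iter_deriv g (replicate (Suc k) v) x = (\<Sum>b\<in>Basis. (v \<bullet> b) * iter_deriv (iter_deriv g [b]) (replicate k v) x)"
proof -
  have "iter_deriv g (replicate (Suc k) v) x = iter_deriv g ((\<Sum>b\<in>Basis. (v \<bullet> b) *\<^sub>R b) # replicate k v) x"
    unfolding euclidean_representation by simp
  also have "\<dots> = (\<Sum>b\<in>Basis. (v \<bullet> b) * iter_deriv g (b # replicate k v) x)"
    unfolding linear_sum[OF iter_deriv_Cons_linear[OF g]] linear_cmul[OF iter_deriv_Cons_linear[OF g]] by simp
  also have "\<dots> = (\<Sum>b\<in>Basis. (v \<bullet> b) * iter_deriv (iter_deriv g [b]) (replicate k v) x)"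
    unfolding iter_deriv_Cons_eq_snoc[OF g, of _ "replicate k v"] iter_deriv_append ..
  finally show ?thesis .
qed

text \<open>Compactness of the ball bounds the partial derivatives, and homogeneity in
  \<open>v\<close> is gained one factor at a time through
  \<open>iter_deriv_replicate_Suc\<close>.\<close>

lemma iter_deriv_replicate_bound:
  fixes g :: "'v::euclidean_space \<Rightarrow> real"
  assumes "smooth g"
  shows "\<exists>C\<ge>0. \<forall>y\<in>cball 0 R. \<forall>v. \<bar>iter_deriv g (replicate k v) y\<bar> \<le> C * norm v ^ k"
  using assms
proof (induction k arbitrary: g)
  case 0
  have "continuous_on (cball 0 R) g"
    using iter_deriv_continuous[OF 0, of "[]"] by (auto intro: continuous_on_subset)
  then have "bounded (g ` cball 0 R)" by (intro compact_imp_bounded compact_continuous_image) auto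
  then obtain C where "\<And>y. y \<in> cball 0 R \<Longrightarrow> \<bar>g y\<bar> \<le> C"
    unfolding bounded_iff real_norm_def by blast
  then have "\<forall>y\<in>cball 0 R. \<bar>g y\<bar> \<le> \<bar>C\<bar>" by (meson abs_ge_self order_trans)
  then show ?case by (intro exI[of _ "\<bar>C\<bar>"]) simp
next
  case (Suc k)
  have "\<forall>b. \<exists>C\<ge>0. \<forall>y\<in>cball 0 R. \<forall>v. \<bar>iter_deriv (iter_deriv g [b]) (replicate k v) y\<bar> \<le> C * norm v ^ k"
    by (intro allI Suc.IH smooth_iter_deriv Suc.prems)
  from choice[OF this] obtain C where C: "\<And>b. 0 \<le> C b"
    "\<And>b y v. y \<in> cball 0 R \<Longrightarrow> \<bar>iter_deriv (iter_deriv g [b]) (replicate k v) y\<bar> \<le> C b * norm v ^ k"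
    by blast
  have "\<bar>iter_deriv g (replicate (Suc k) v) y\<bar> \<le> (\<Sum>b\<in>Basis. C b) * norm v ^ Suc k" if y: "y \<in> cball 0 R" for y v
  proof -
    have "\<bar>iter_deriv g (replicate (Suc k) v) y\<bar> \<le> (\<Sum>b\<in>Basis. \<bar>(v \<bullet> b) * iter_deriv (iter_deriv g [b]) (replicate k v) y\<bar>)"
      unfolding iter_deriv_replicate_Suc[OF Suc.prems] by (rule sum_abs)
    also have "\<dots> \<le> (\<Sum>b\<in>Basis. norm v * (C b * norm v ^ k))"
      unfolding abs_mult by (intro sum_mono mult_mono C y) (auto intro: Basis_le_norm)
    finally show ?thesis by (simp add: sum_distrib_left sum_distrib_right mult_ac)
  qed
  then show ?case using C(1) by (intro exI[of _ "\<Sum>b\<in>Basis. C b"]) (simp add: sum_nonneg)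
qed

section \<open>Symmetric functionals paired with a character\<close>

lemma split_sum_right_Nil: "split_sum (\<lambda>l r. if r = [] then \<phi> l else 0) u = \<phi> u"
  by (induction u arbitrary: \<phi> rule: rev_induct) simp_all

text \<open>Each of the \<open>length u\<close> letters can be taken out alone, and by symmetry it
  may be appended at the end without changing the value.\<close>

lemma split_sum_remove_letter:
  fixes \<phi> :: "'a list \<Rightarrow> real"
  assumes "\<And>v b w. \<phi> (v @ b # w) = \<phi> (v @ w @ [b])"
  shows "split_sum (\<lambda>l r. if length r = 1 then \<phi> (l @ r) else 0) u = real (length u) * \<phi> u"
  using assms
proof (induction u arbitrary: \<phi> rule: rev_induct)
  case (snoc b u)
  have "split_sum (\<lambda>l r. if length r = 1 then \<phi> ((l @ [b]) @ r) else 0) u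
      = split_sum (\<lambda>l r. if length r = 1 then \<phi> ((l @ r) @ [b]) else 0) u"
  proof (rule split_sum_cong)
    fix l r
    have "\<phi> ((l @ [b]) @ r) = \<phi> ((l @ r) @ [b])" using snoc.prems[of l b r] by simp
    then show "(if length r = 1 then \<phi> ((l @ [b]) @ r) else 0) = (if length r = 1 then \<phi> ((l @ r) @ [b]) else 0)"
      by simp
  qed
  also have "\<dots> = real (length u) * \<phi> (u @ [b])"
  proof (rule snoc.IH)
    \<comment> \<open>The symmetry passes to the functional with \<open>b\<close> appended: move
      \<open>c\<close> to the very end, then exchange the last two letters.\<close>
    fix v c w
    have "\<phi> (v @ c # w @ [b]) = \<phi> (v @ (w @ [b]) @ [c])" by (rule snoc.prems)
    also have "\<dots> = \<phi> ((v @ w) @ b # [c])" by simp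
    also have "\<dots> = \<phi> ((v @ w) @ [c] @ [b])" by (rule snoc.prems)
    finally show "\<phi> ((v @ c # w) @ [b]) = \<phi> ((v @ w @ [c]) @ [b])" by simp
  qed
  finally have 1: "split_sum (\<lambda>l r. if length r = 1 then \<phi> ((l @ [b]) @ r) else 0) u = real (length u) * \<phi> (u @ [b])" .
  have "split_sum (\<lambda>l r. if length (r @ [b]) = 1 then \<phi> (l @ r @ [b]) else 0) u
      = split_sum (\<lambda>l r. if r = [] then \<phi> (l @ [b]) else 0) u"
    by (rule split_sum_cong) auto
  also have "\<dots> = \<phi> (u @ [b])" by (rule split_sum_right_Nil)
  finally show ?case using 1 by (simp add: algebra_simps)
qed simp

text \<open>
  A symmetric functional only sees the symmetric part of \<open>x\<close>, which for a character consists of the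
  divided powers of its first level.
\<close>

lemma character_symmetric_pairing:
  fixes x :: "'v::euclidean_space list \<Rightarrow> real" and \<phi> :: "'v list \<Rightarrow> real"
  assumes x: "is_character N x" and k: "Suc k \<le> N"
    and sym: "\<And>v b w. \<phi> (v @ b # w) = \<phi> (v @ w @ [b])"
  shows "real (Suc k) * (\<Sum>w\<in>words (Suc k). x w * \<phi> w) = (\<Sum>b\<in>Basis. x [b] * (\<Sum>w\<in>words k. x w * \<phi> (w @ [b])))"
proof -
  have "(\<Sum>b\<in>Basis. x [b] * (\<Sum>w\<in>words k. x w * \<phi> (w @ [b])))
      = (\<Sum>b\<in>Basis. \<Sum>w\<in>words k. (\<Sum>u\<in>words (Suc k). x u * shuffle_prod (delta_word w) (delta_word [b]) u) * \<phi> (w @ [b]))"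
    unfolding sum_distrib_left
  proof (rule sum.cong[OF refl], rule sum.cong[OF refl])
    fix b :: 'v and w :: "'v list" assume b: "b \<in> Basis" and w: "w \<in> words k"
    have "x w * x [b] = (\<Sum>u\<in>words (length w + length [b]). x u * shuffle_prod (delta_word w) (delta_word [b]) u)"
      using x b w k unfolding is_character_def by (auto simp: words_def)
    also have "length w + length [b] = Suc k" using w by (simp add: words_def)
    finally show "x [b] * (x w * \<phi> (w @ [b])) = (\<Sum>u\<in>words (Suc k). x u * shuffle_prod (delta_word w) (delta_word [b]) u) * \<phi> (w @ [b])"
      by (simp add: mult_ac)
  qed
  also have "\<dots> = (\<Sum>b\<in>Basis. \<Sum>u\<in>words (Suc k). \<Sum>w\<in>words k. x u * (\<phi> (w @ [b]) * shuffle_prod (delta_word w) (delta_word [b]) u))"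
    unfolding sum_distrib_right
    by (rule sum.cong[OF refl], rule trans[OF sum.swap], rule sum.cong[OF refl], rule sum.cong[OF refl]) simp
  also have "\<dots> = (\<Sum>u\<in>words (Suc k). \<Sum>b\<in>Basis. \<Sum>w\<in>words k. x u * (\<phi> (w @ [b]) * shuffle_prod (delta_word w) (delta_word [b]) u))"
    by (rule sum.swap)
  also have "\<dots> = (\<Sum>u\<in>words (Suc k). x u * (\<Sum>b\<in>Basis. \<Sum>w\<in>words k. \<phi> (w @ [b]) * shuffle_prod (delta_word w) (delta_word [b]) u))"
    by (simp add: sum_distrib_left)
  also have "\<dots> = (\<Sum>u\<in>words (Suc k). x u * (real (Suc k) * \<phi> u))"
  proof (rule sum.cong[OF refl], rule arg_cong[where f = "\<lambda>a. _ * a"])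
    fix u :: "'v list" assume u: "u \<in> words (Suc k)"
    have "(\<Sum>b\<in>Basis. \<Sum>w\<in>words k. \<phi> (w @ [b]) * shuffle_prod (delta_word w) (delta_word [b]) u)
        = split_sum (\<lambda>l r. \<Sum>b\<in>Basis. \<Sum>w\<in>words k. \<phi> (w @ [b]) * (delta_word w l * delta_word [b] r)) u"
      by (simp add: shuffle_prod_def split_sum_sum split_sum_mult_left)
    also have "\<dots> = split_sum (\<lambda>l r. if length r = 1 then \<phi> (l @ r) else 0) u"
    proof (rule split_sum_cong)
      fix l r assume lr: "(l, r) \<in> set (splits u)"
      note D = in_splitsD[OF lr]
      show "(\<Sum>b\<in>Basis. \<Sum>w\<in>words k. \<phi> (w @ [b]) * (delta_word w l * delta_word [b] r)) = (if length r = 1 then \<phi> (l @ r) else 0)"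
      proof (cases "length r = 1")
        case True
        then obtain c where c: "r = [c]" by (auto simp: length_Suc_conv)
        have lc: "l \<in> words k" "c \<in> Basis" using D u c by (auto simp: words_def)
        have "(\<Sum>w\<in>words k. \<phi> (w @ [b]) * (delta_word w l * delta_word [b] r)) = (if b = c then \<phi> (l @ [c]) else 0)" for b
        proof -
          have "(\<Sum>w\<in>words k. \<phi> (w @ [b]) * (delta_word w l * delta_word [b] r))
              = (\<Sum>w\<in>words k. if w = l then (if b = c then \<phi> (l @ [c]) else 0) else 0)"
            by (intro sum.cong refl) (auto simp: delta_word_def c)
          then show ?thesis using lc by simp
        qed
        then show ?thesis using lc True by (simp add: c)
      next
        case False
        then have "delta_word [b] r = 0" for b by (auto simp: delta_word_def)
        with False show ?thesis by simp
      qed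
    qed
    also have "\<dots> = real (length u) * \<phi> u" by (rule split_sum_remove_letter[OF sym])
    finally show "(\<Sum>b\<in>Basis. \<Sum>w\<in>words k. \<phi> (w @ [b]) * shuffle_prod (delta_word w) (delta_word [b]) u) = real (Suc k) * \<phi> u"
      using u by (simp add: words_def)
  qed
  finally show ?thesis by (simp add: sum_distrib_left mult_ac)
qed

text \<open>The symmetric pairing gives a recursion in which level \<open>Suc k\<close>, multiplied
  by \<open>Suc k\<close>, comes from levels one and \<open>k\<close>; solving it produces the
  factorial of Taylor's formula.\<close>

lemma character_iter_deriv:
  fixes x :: "'v::euclidean_space list \<Rightarrow> real" and g :: "'v \<Rightarrow> real"
  assumes x: "is_character N x"
    and v: "\<And>b. b \<in> Basis \<Longrightarrow> x [b] = v \<bullet> b"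
    and "smooth g" "k \<le> N"
  shows "(\<Sum>w\<in>words k. x w * iter_deriv g w a) = iter_deriv g (replicate k v) a / fact k"
  using assms(3,4)
proof (induction k arbitrary: g)
  case 0
  then show ?case using x by (simp add: is_character_def)
next
  case (Suc k)
  have "real (Suc k) * (\<Sum>w\<in>words (Suc k). x w * iter_deriv g w a)
      = (\<Sum>b\<in>Basis. x [b] * (\<Sum>w\<in>words k. x w * iter_deriv g (w @ [b]) a))"
    by (rule character_symmetric_pairing[OF x Suc.prems(2)]) (simp only: iter_deriv_move_last[OF Suc.prems(1)])
  also have "\<dots> = (\<Sum>b\<in>Basis. (v \<bullet> b) * (iter_deriv (iter_deriv g [b]) (replicate k v) a / fact k))"
  proof (rule sum.cong[OF refl])
    fix b :: 'v assume b: "b \<in> Basis"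
    have "(\<Sum>w\<in>words k. x w * iter_deriv (iter_deriv g [b]) w a) = iter_deriv (iter_deriv g [b]) (replicate k v) a / fact k"
      using Suc.prems by (intro Suc.IH smooth_iter_deriv) auto
    then show "x [b] * (\<Sum>w\<in>words k. x w * iter_deriv g (w @ [b]) a) = (v \<bullet> b) * (iter_deriv (iter_deriv g [b]) (replicate k v) a / fact k)"
      using v[OF b] by (simp only: iter_deriv_append)
  qed
  also have "\<dots> = iter_deriv g (replicate (Suc k) v) a / fact k"
    unfolding iter_deriv_replicate_Suc[OF Suc.prems(1)] by (simp add: sum_divide_distrib)
  finally have "(\<Sum>w\<in>words (Suc k). x w * iter_deriv g w a) = iter_deriv g (replicate (Suc k) v) a / fact k / real (Suc k)"
    by (simp add: eq_divide_eq mult.commute del: of_nat_Suc iter_deriv.simps replicate_Suc)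
  then show ?case by (simp add: fact_Suc mult.commute del: of_nat_Suc iter_deriv.simps replicate_Suc)
qed

context control_setup
begin

section \<open>Taylor expansion along the trace\<close>

lemma trace_increment:
  fixes X :: "real \<Rightarrow> real \<Rightarrow> 'v::euclidean_space list \<Rightarrow> real"
  assumes X: "X \<in> rough_paths p T \<omega>" and x: "is_trace T X x"
  shows "(\<lambda>z. norm (x (snd z) - x (fst z))) \<in> ord2 1"
proof (rule norm_ord2_coords)
  fix b :: 'v assume b: "b \<in> Basis"
  then have "[b] \<in> words_upto N" using N_ge_1 by (simp add: words_upto_def)
  from rough_pathsD(3)[OF X this] have "(\<lambda>z. X (fst z) (snd z) [b]) \<in> ord2 1" by simp
  moreover have "X s t [b] = (x t - x s) \<bullet> b" if "(s, t) \<in> Simplex T" for s t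
    using x that b unfolding is_trace_def by fastforce
  ultimately show "(\<lambda>z. (x (snd z) - x (fst z)) \<bullet> b) \<in> ord2 1"
    by (subst bigo_principal_cong[where g = "\<lambda>z. X (fst z) (snd z) [b]"]) auto
qed

text \<open>By \<open>character_iter_deriv\<close> the sum is the Taylor polynomial along the
  segment from \<open>x s\<close> to \<open>x t\<close>, so the Lagrange remainder bounds the error
  by a power of the increment.\<close>

lemma smooth_expansion:
  fixes X :: "real \<Rightarrow> real \<Rightarrow> 'v::euclidean_space list \<Rightarrow> real"
    and g :: "'v \<Rightarrow> real"
  assumes X: "X \<in> rough_paths p T \<omega>"
    and x: "is_trace T X x"
    and g: "smooth g"
    and m: "m \<le> N"
  shows "(\<lambda>z. g (x (snd z)) - (\<Sum>w\<in>words_upto m. X (fst z) (snd z) w * iter_deriv g w (x (fst z)))) \<in> ord2 (Suc m)"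
proof -
  have "x \<in> Cp_paths p T \<omega>" unfolding Cp_paths_iff by (rule trace_increment[OF X x])
  then have "continuous_on {0..T} x" by (simp add: Cp_paths_def)
  then have "bounded (x ` {0..T})" by (intro compact_imp_bounded compact_continuous_image) auto
  then obtain R where "\<And>t. t \<in> {0..T} \<Longrightarrow> norm (x t) \<le> R"
    unfolding bounded_iff by blast
  \<comment> \<open>A ball that contains the trace is convex, so it also contains the intermediate
    point of the remainder.\<close>
  then have R: "x t \<in> cball 0 R" if "t \<in> {0..T}" for t using that by simp
  obtain C where C: "0 \<le> C" "\<And>y v. y \<in> cball 0 R \<Longrightarrow> \<bar>iter_deriv g (replicate (Suc m) v) y\<bar> \<le> C * norm v ^ Suc m"
    using iter_deriv_replicate_bound[OF g, of R "Suc m"] by blast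
  have main: "\<bar>g (x t) - (\<Sum>w\<in>words_upto m. X s t w * iter_deriv g w (x s))\<bar> \<le> C * norm (x t - x s) ^ Suc m"
    if st: "(s, t) \<in> Simplex T" for s t
  proof -
    define v where "v = x t - x s"
    let ?d = "\<lambda>k \<tau>. iter_deriv g (replicate k v) (x s + \<tau> *\<^sub>R v)"
    have "\<exists>\<tau>>0. \<tau> < 1 \<and> g (x s + 1 *\<^sub>R v) = (\<Sum>k<Suc m. ?d k 0 / fact k * 1 ^ k) + ?d (Suc m) \<tau> / fact (Suc m) * 1 ^ Suc m"
    proof (rule Maclaurin)
      show "\<forall>k \<tau>. k < Suc m \<and> 0 \<le> \<tau> \<and> \<tau> \<le> 1 \<longrightarrow> DERIV (?d k) \<tau> :> ?d (Suc k) \<tau>"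
        using iter_deriv_line[OF g] by (simp only: replicate_Suc) blast
    qed auto
    then obtain \<tau> where \<tau>: "0 < \<tau>" "\<tau> < 1"
      "g (x t) = (\<Sum>k<Suc m. ?d k 0 / fact k) + ?d (Suc m) \<tau> / fact (Suc m)"
      by (auto simp: v_def simp del: replicate_Suc iter_deriv.simps fact_Suc)
    have "(\<Sum>w\<in>words_upto m. X s t w * iter_deriv g w (x s)) = (\<Sum>k<Suc m. ?d k 0 / fact k)"
      unfolding sum_words_upto lessThan_Suc_atMost
    proof (rule sum.cong[OF refl])
      fix k assume k: "k \<in> {..m}"
      have tr: "X s t [b] = v \<bullet> b" if "b \<in> Basis" for b
        using x st that unfolding is_trace_def v_def by fastforce
      show "(\<Sum>w\<in>words k. X s t w * iter_deriv g w (x s)) = ?d k 0 / fact k"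
        using character_iter_deriv[OF rough_pathsD(5)[OF X st] tr g, of k "x s"] k m by simp
    qed
    with \<tau>(3) have "\<bar>g (x t) - (\<Sum>w\<in>words_upto m. X s t w * iter_deriv g w (x s))\<bar> = \<bar>?d (Suc m) \<tau>\<bar> / fact (Suc m)"
      by (simp del: replicate_Suc iter_deriv.simps fact_Suc)
    also have "\<dots> \<le> \<bar>?d (Suc m) \<tau>\<bar> / 1"
      by (intro divide_left_mono) (auto simp del: replicate_Suc iter_deriv.simps fact_Suc simp: fact_ge_1)
    also have "\<dots> \<le> C * norm v ^ Suc m"
    proof -
      have "x s + \<tau> *\<^sub>R v = (1 - \<tau>) *\<^sub>R x s + \<tau> *\<^sub>R x t" by (simp add: v_def algebra_simps)
      moreover have "(1 - \<tau>) *\<^sub>R x s + \<tau> *\<^sub>R x t \<in> cball 0 R"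
        using \<tau> st by (intro convexD_alt[OF convex_cball] R) (auto simp: Simplex_def)
      ultimately show ?thesis using C(2) by simp
    qed
    finally show ?thesis by (simp add: v_def)
  qed
  have "(\<lambda>z. norm (x (snd z) - x (fst z)) ^ Suc m) \<in> O[principal (Simplex T)](\<lambda>z. (\<rho>2 z ^ 1) ^ Suc m)"
    by (rule landau_o.big_power[OF trace_increment[OF X x]])
  then have "(\<lambda>z. norm (x (snd z) - x (fst z)) ^ Suc m) \<in> ord2 (Suc m)" by simp
  then show ?thesis
  proof (rule landau_o.big_trans[rotated])
    show "(\<lambda>z. g (x (snd z)) - (\<Sum>w\<in>words_upto m. X (fst z) (snd z) w * iter_deriv g w (x (fst z))))
        \<in> O[principal (Simplex T)](\<lambda>z. norm (x (snd z) - x (fst z)) ^ Suc m)"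
      unfolding bigo_principal_iff using main by (intro exI[of _ C]) auto
  qed
qed

text \<open>The expansion applies to every derivative of \<open>F\<close>:
  \<open>m = N - 1 - length y\<close> gives the controlled estimate and \<open>m = 0\<close> the
  Hoelder condition.\<close>

lemma smooth_controlled_controlled:
  fixes X :: "real \<Rightarrow> real \<Rightarrow> 'v::euclidean_space list \<Rightarrow> real"
    and F :: "'v \<Rightarrow> 'w::euclidean_space"
  assumes X: "X \<in> rough_paths p T \<omega>" and x: "is_trace T X x" and F: "smooth F"
  shows "smooth_controlled F x \<in> controlled_paths p T \<omega> X"
proof -
  have *: "(\<lambda>z. norm (smooth_controlled F x (snd z) y -
      (\<Sum>w\<in>words_upto m. X (fst z) (snd z) w *\<^sub>R smooth_controlled F x (fst z) (w @ y)))) \<in> ord2 (Suc m)"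
    if "m \<le> N" for m and y :: "'v list"
  proof (rule norm_ord2_coords)
    fix e :: 'w
    have sm: "smooth (iter_deriv F y)" by (rule smooth_iter_deriv[OF F])
    show "(\<lambda>z. (smooth_controlled F x (snd z) y -
      (\<Sum>w\<in>words_upto m. X (fst z) (snd z) w *\<^sub>R smooth_controlled F x (fst z) (w @ y))) \<bullet> e) \<in> ord2 (Suc m)"
      using smooth_expansion[OF X x smooth_inner[OF sm, of e] that]
      by (simp add: iter_deriv_inner[OF sm] smooth_controlled_def inner_diff_left inner_sum_left iter_deriv_append)
  qed
  show ?thesis
    unfolding controlled_paths_iff
  proof (intro conjI ballI allI impI)
    fix w :: "'v list"
    have "(\<lambda>z. norm (smooth_controlled F x (snd z) w - X (fst z) (snd z) [] *\<^sub>R smooth_controlled F x (fst z) w)) \<in> ord2 1"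
      using *[of 0 w] by simp
    then show "(\<lambda>z. norm (smooth_controlled F x (snd z) w - smooth_controlled F x (fst z) w)) \<in> ord2 1"
      by (subst bigo_principal_cong[where g = "\<lambda>z. norm (smooth_controlled F x (snd z) w - X (fst z) (snd z) [] *\<^sub>R smooth_controlled F x (fst z) w)"])
        (auto simp: rough_pathsD(2)[OF X])
  next
    fix y :: "'v list" assume "length y + 2 \<le> N"
    then have n: "N - 1 - length y \<le> N" "Suc (N - 1 - length y) = N - length y" by auto
    show "(\<lambda>z. norm (smooth_controlled F x (snd z) y - (\<Sum>w\<in>words_upto (N - 1 - length y).
        X (fst z) (snd z) w *\<^sub>R smooth_controlled F x (fst z) (w @ y)))) \<in> ord2 (N - length y)"
      by (rule *[OF n(1), unfolded n(2)])
  qed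
qed

end

section \<open>Change of variables\<close>

text \<open>Expanding the argument in the basis writes \<open>Dfun F\<close> as a sum of rank-one
  maps that depend linearly on the partial derivatives of \<open>F\<close>, and differentiation
  passes through bounded linear maps. The argument lands in the last slot, as
  \<open>uncurry_last\<close> expects.\<close>

lemma iter_deriv_Dfun_eq_sum:
  fixes F :: "'v::euclidean_space \<Rightarrow> 'w::euclidean_space"
  assumes F: "smooth F"
  shows "iter_deriv (Dfun F) w x = (\<Sum>b\<in>Basis. blinfun_scaleR_left (iter_deriv F (w @ [b]) x) o\<^sub>L blinfun_inner_left b)"
proof (induction w arbitrary: x)
  case Nil
  let ?D = "frechet_derivative F (at x)"
  have D: "bounded_linear ?D"
    using iter_deriv_has_derivative[OF F, of "[]" x] by (simp add: has_derivative_bounded_linear)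
  show ?case
  proof (rule blinfun_eqI)
    fix v
    have "?D v = ?D (\<Sum>b\<in>Basis. (v \<bullet> b) *\<^sub>R b)"
      unfolding euclidean_representation ..
    also have "\<dots> = (\<Sum>b\<in>Basis. (v \<bullet> b) *\<^sub>R ?D b)"
      unfolding linear_sum[OF bounded_linear.linear[OF D]] linear_cmul[OF bounded_linear.linear[OF D]] ..
    finally have "?D v = (\<Sum>b\<in>Basis. (v \<bullet> b) *\<^sub>R ?D b)" .
    moreover have "blinfun_apply (Dfun F x) v = ?D v"
      unfolding Dfun_def by (rule bounded_linear_Blinfun_apply[OF D, THEN fun_cong])
    ultimately show "blinfun_apply (iter_deriv (Dfun F) [] x) v
        = blinfun_apply (\<Sum>b\<in>Basis. blinfun_scaleR_left (iter_deriv F ([] @ [b]) x) o\<^sub>L blinfun_inner_left b) v"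
      unfolding blinfun.sum_left by (auto simp only: iter_deriv.simps append_Nil blinfun_apply_blinfun_compose blinfun_scaleR_left.rep_eq blinfun_inner_left.rep_eq inner_commute)
  qed
next
  case (Cons c w)
  have IH: "iter_deriv (Dfun F) w = (\<lambda>x. \<Sum>b\<in>Basis. blinfun_scaleR_left (iter_deriv F (w @ [b]) x) o\<^sub>L blinfun_inner_left b)"
    by (rule ext) (rule Cons)
  have "((\<lambda>x. \<Sum>b\<in>Basis. blinfun_scaleR_left (iter_deriv F (w @ [b]) x) o\<^sub>L blinfun_inner_left b) has_derivative
      (\<lambda>v. \<Sum>b\<in>Basis. blinfun_scaleR_left (iter_deriv F (v # w @ [b]) x) o\<^sub>L blinfun_inner_left b)) (at x)"
  proof (rule has_derivative_sum)
    fix b :: 'v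
    have "bounded_linear (\<lambda>y. blinfun_scaleR_left y o\<^sub>L blinfun_inner_left b :: 'v \<Rightarrow>\<^sub>L 'w)"
      by (rule bounded_linear_compose[OF bounded_bilinear.bounded_linear_left[OF bounded_bilinear_blinfun_compose]
            bounded_linear_blinfun_scaleR_left])
    from bounded_linear.has_derivative[OF this iter_deriv_has_derivative[OF F, of "w @ [b]" x]]
    show "((\<lambda>x. blinfun_scaleR_left (iter_deriv F (w @ [b]) x) o\<^sub>L blinfun_inner_left b) has_derivative
        (\<lambda>v. blinfun_scaleR_left (iter_deriv F (v # w @ [b]) x) o\<^sub>L blinfun_inner_left b)) (at x)"
      by simp
  qed
  from frechet_derivative_at[OF this]
  show ?case unfolding iter_deriv.simps(2)[of _ c w] IH append_Cons by (simp add: fun_eq_iff)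
qed

lemma iter_deriv_Dfun:
  fixes F :: "'v::euclidean_space \<Rightarrow> 'w::euclidean_space"
  assumes "smooth F" "b \<in> Basis"
  shows "blinfun_apply (iter_deriv (Dfun F) w x) b = iter_deriv F (w @ [b]) x"
  unfolding iter_deriv_Dfun_eq_sum[OF assms(1)] using assms(2)
  by (simp add: blinfun.sum_left inner_Basis if_distrib[of "\<lambda>a. a *\<^sub>R _"] cong: if_cong)

text \<open>Written with dual functionals, the sums over lengths and pairs of basis words select the
  pair \<open>l\<close>, \<open>r\<close> of each splitting exactly once.\<close>

lemma leibniz_product_eq:
  assumes w: "set w \<subseteq> Basis"
  shows "leibniz_product K H t w = split_sum (\<lambda>l r. K t l o\<^sub>L H t r) w"
proof -
  let ?n = "length w"
  have wn: "w \<in> words ?n" using w by (simp add: words_def)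
  have cop: "coproduct_sh a (?n - a) (pure_tensor w) [v1, v2] = shuffle_prod (delta_word v1) (delta_word v2) w"
    if a: "a \<le> ?n" and v: "v1 \<in> words a" "v2 \<in> words (?n - a)" for a v1 v2
  proof -
    have "component (a + (?n - a)) (pure_tensor w) = pure_tensor w"
      using a by (auto simp: component_def pure_tensor_def fun_eq_iff)
    then have "coproduct_sh a (?n - a) (pure_tensor w) [v1, v2]
        = (\<Sum>u\<in>words ?n. pure_tensor w u * shuffle_prod (delta_word v1) (delta_word v2) u)"
      using coproduct_sh_component[OF v, of "pure_tensor w"] a by simp
    also have "\<dots> = (\<Sum>u\<in>words ?n. if u = w then shuffle_prod (delta_word v1) (delta_word v2) w else 0)"
      by (rule sum.cong[OF refl]) (auto simp: pure_tensor_words[OF wn] delta_word_def)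
    finally show ?thesis using wn by simp
  qed
  let ?\<Phi> = "\<lambda>v1 v2. K t v1 o\<^sub>L H t v2"
  have "leibniz_product K H t w = (\<Sum>a\<le>?n. \<Sum>v1\<in>words a. \<Sum>v2\<in>words (?n - a).
      split_sum (\<lambda>l r. (delta_word v1 l * delta_word v2 r) *\<^sub>R ?\<Phi> v1 v2) w)"
    unfolding leibniz_product_def
    by (intro sum.cong refl)
      (simp add: cop shuffle_prod_def split_sum_hom[where h = "\<lambda>c. c *\<^sub>R _"] scaleR_add_left)
  also have "\<dots> = split_sum (\<lambda>l r. \<Sum>a\<le>?n. \<Sum>v1\<in>words a. \<Sum>v2\<in>words (?n - a).
      (delta_word v1 l * delta_word v2 r) *\<^sub>R ?\<Phi> v1 v2) w"
    by (simp add: split_sum_sum)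
  also have "\<dots> = split_sum ?\<Phi> w"
  proof (rule split_sum_cong)
    fix l r assume lr: "(l, r) \<in> set (splits w)"
    note D = in_splitsD[OF lr]
    have l: "l \<in> words (length l)" "r \<in> words (?n - length l)" "length l \<le> ?n"
      using D w by (auto simp: words_def)
    have inner2: "(\<Sum>v2\<in>words m. (c * delta_word v2 r) *\<^sub>R ?\<Phi> v1 v2) = (if length r = m then c *\<^sub>R ?\<Phi> v1 r else 0)" for m c v1
    proof -
      have "(\<Sum>v2\<in>words m. (c * delta_word v2 r) *\<^sub>R ?\<Phi> v1 v2) = (\<Sum>v2\<in>words m. if v2 = r then c *\<^sub>R ?\<Phi> v1 r else 0)"
        by (rule sum.cong[OF refl]) (auto simp: delta_word_def)
      moreover have "r \<in> words m \<longleftrightarrow> length r = m" using D w by (auto simp: words_def)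
      ultimately show ?thesis by simp
    qed
    have inner1: "(\<Sum>v1\<in>words a. delta_word v1 l *\<^sub>R ?\<Phi> v1 r) = (if length l = a then ?\<Phi> l r else 0)" for a
    proof -
      have "(\<Sum>v1\<in>words a. delta_word v1 l *\<^sub>R ?\<Phi> v1 r) = (\<Sum>v1\<in>words a. if v1 = l then ?\<Phi> l r else 0)"
        by (rule sum.cong[OF refl]) (auto simp: delta_word_def)
      moreover have "l \<in> words a \<longleftrightarrow> length l = a" using D w by (auto simp: words_def)
      ultimately show ?thesis by simp
    qed
    have "(\<Sum>a\<le>?n. \<Sum>v1\<in>words a. \<Sum>v2\<in>words (?n - a). (delta_word v1 l * delta_word v2 r) *\<^sub>R ?\<Phi> v1 v2)
        = (\<Sum>a\<le>?n. if a = length l then ?\<Phi> l r else 0)"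
    proof (rule sum.cong[OF refl])
      fix a assume a: "a \<in> {..?n}"
      show "(\<Sum>v1\<in>words a. \<Sum>v2\<in>words (?n - a). (delta_word v1 l * delta_word v2 r) *\<^sub>R ?\<Phi> v1 v2)
          = (if a = length l then ?\<Phi> l r else 0)"
      proof (cases "a = length l")
        case True
        then have "length r = ?n - a" using D by simp
        then show ?thesis using True by (simp add: inner2 inner1)
      next
        case False
        then have "length r \<noteq> ?n - a" using D a by auto
        then show ?thesis using False by (simp add: inner2)
      qed
    qed
    then show "(\<Sum>a\<le>?n. \<Sum>v1\<in>words a. \<Sum>v2\<in>words (?n - a). (delta_word v1 l * delta_word v2 r) *\<^sub>R ?\<Phi> v1 v2) = ?\<Phi> l r"
      using l by simp
  qed
  finally show ?thesis .
qed

context control_setup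
begin

text \<open>
  The last block of an ordered partition of \<open>w @ [b]\<close> contains \<open>b\<close>; splitting it off is the Leibniz
  product with \<open>DF\<close>.
\<close>

lemma int_coords_pullback:
  fixes F :: "'v::euclidean_space \<Rightarrow> 'w::euclidean_space"
    and H :: "real \<Rightarrow> 'w list \<Rightarrow> 'w \<Rightarrow>\<^sub>L 'u::euclidean_space"
  assumes F: "smooth F" and w: "w \<in> words_upto N"
  shows "osh_comp (int_coords H e t) (\<lambda>u. trunc N (\<lambda>w. smooth_controlled F x t w \<bullet> u)) w = int_coords (pullback F x H) e t w"
proof (cases w rule: rev_cases)
  case (snoc v b)
  \<comment> \<open>Truncation at \<open>N\<close>, not at \<open>N - 1\<close>: if \<open>w\<close>
    has length \<open>N\<close> and forms one block, the derivative of order \<open>N\<close> of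
    \<open>F\<close> occurs. On the other side it is the derivative of order \<open>N - 1\<close> of
    \<open>Dfun F\<close>.\<close>
  let ?h = "\<lambda>u. trunc N (\<lambda>w. smooth_controlled F x t w \<bullet> u)" and ?S = "smooth_controlled F x t"
  have b: "b \<in> Basis" "v \<in> words_upto (N - 1)" "set v \<subseteq> Basis" using w by (auto simp: snoc words_upto_def)
  have "osh_comp (int_coords H e t) ?h w
     = (\<Sum>u\<in>Basis. shuffle_prod (osh_comp (\<lambda>us. int_coords H e t (us @ [u])) ?h) (\<lambda>r. ?h u (r @ [b])) v)"
    by (simp only: snoc osh_comp_snoc)
  also have "\<dots> = split_sum (\<lambda>l r. \<Sum>u\<in>Basis. osh_comp (\<lambda>us. int_coords H e t (us @ [u])) ?h l * ?h u (r @ [b])) v"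
    by (simp only: shuffle_prod_def split_sum_sum)
  also have "\<dots> = split_sum (\<lambda>l r. blinfun_apply (change_path H (smooth_controlled F x) t l o\<^sub>L
      smooth_controlled (Dfun F) x t r) b \<bullet> e) v"
  proof (rule split_sum_cong)
    fix l r assume lr: "(l, r) \<in> set (splits v)"
    note D = in_splitsD[OF lr]
    have l: "set l \<subseteq> Basis" "length l \<le> N - 1" "r @ [b] \<in> words_upto N"
      using D b w by (auto simp: snoc words_upto_def)
    have o: "osh ?h us l = osh (\<lambda>e v. ?S v \<bullet> e) us l" if "us \<in> words_upto (length l)" for us
    proof (rule osh_cong)
      fix u v assume "u \<in> set us" "length v + length us \<le> length l + 1" "set v \<subseteq> set l"
      then have "1 \<le> length us" "length v + length us \<le> length l + 1" "set v \<subseteq> set l" by (auto simp: Suc_le_eq)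
      then have "v \<in> words_upto N" using l(1,2) by (auto simp: words_upto_def)
      then show "?h u v = ?S v \<bullet> u" by (simp add: trunc_def)
    qed
    have c: "osh_comp (\<lambda>us. int_coords H e t (us @ [u])) ?h l =
        (\<Sum>us\<in>words_upto (length l). osh (\<lambda>e v. ?S v \<bullet> e) us l * (blinfun_apply (H t us) u \<bullet> e))" if "u \<in> Basis" for u
      unfolding osh_comp_def
    proof (rule sum.cong[OF refl])
      fix us :: "'w list" assume us: "us \<in> words_upto (length l)"
      then have "us \<in> words_upto (N - 1)" using l(2) by (auto simp: words_upto_def)
      then show "int_coords H e t (us @ [u]) * osh ?h us l = osh (\<lambda>e v. ?S v \<bullet> e) us l * (blinfun_apply (H t us) u \<bullet> e)"
        using that by (simp add: o[OF us] trunc_def)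
    qed
    have "blinfun_apply (smooth_controlled (Dfun F) x t r) b = ?S (r @ [b])"
      by (simp add: smooth_controlled_def iter_deriv_Dfun[OF F b(1)])
    also have "\<dots> = (\<Sum>u\<in>Basis. (?S (r @ [b]) \<bullet> u) *\<^sub>R u)" by (simp add: euclidean_representation)
    finally have "blinfun_apply (change_path H (smooth_controlled F x) t l o\<^sub>L smooth_controlled (Dfun F) x t r) b \<bullet> e
        = (\<Sum>u\<in>Basis. (?S (r @ [b]) \<bullet> u) * (blinfun_apply (change_path H (smooth_controlled F x) t l) u \<bullet> e))"
      by (simp add: blinfun.sum_right blinfun.scaleR_right inner_sum_left)
    also have "\<dots> = (\<Sum>u\<in>Basis. osh_comp (\<lambda>us. int_coords H e t (us @ [u])) ?h l * ?h u (r @ [b]))"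
    proof (rule sum.cong[OF refl])
      fix u :: 'w assume u: "u \<in> Basis"
      have "blinfun_apply (change_path H (smooth_controlled F x) t l) u \<bullet> e = osh_comp (\<lambda>us. int_coords H e t (us @ [u])) ?h l"
        unfolding c[OF u] change_path_eq[OF l(1)] by (simp add: blinfun.sum_left blinfun.scaleR_left inner_sum_left)
      then show "(?S (r @ [b]) \<bullet> u) * (blinfun_apply (change_path H (smooth_controlled F x) t l) u \<bullet> e)
          = osh_comp (\<lambda>us. int_coords H e t (us @ [u])) ?h l * ?h u (r @ [b])"
        using l(3) by (simp add: trunc_def)
    qed
    finally show "(\<Sum>u\<in>Basis. osh_comp (\<lambda>us. int_coords H e t (us @ [u])) ?h l * ?h u (r @ [b]))
      = blinfun_apply (change_path H (smooth_controlled F x) t l o\<^sub>L smooth_controlled (Dfun F) x t r) b \<bullet> e" ..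
  qed
  also have "\<dots> = blinfun_apply (pullback F x H t v) b \<bullet> e"
    unfolding pullback_def leibniz_product_eq[OF b(3)]
    by (rule split_sum_hom[symmetric, where h = "\<lambda>a. blinfun_apply a b \<bullet> e"]) (simp add: blinfun.add_left inner_add_left)
  also have "\<dots> = int_coords (pullback F x H) e t w" using b by (simp add: snoc trunc_def)
  finally show ?thesis .
qed simp

text \<open>Smoothness supplies the derivative of order \<open>N\<close>, so the first level is
  expanded to order \<open>N + 1\<close>, in contrast to \<open>rough_lift_close_germ\<close>. For
  longer words both truncations give the same iterated products.\<close>

lemma pushforward_expansion:
  fixes X :: "real \<Rightarrow> real \<Rightarrow> 'v::euclidean_space list \<Rightarrow> real"
    and F :: "'v \<Rightarrow> 'w::euclidean_space"
  assumes X: "X \<in> rough_paths p T \<omega>" and x: "is_trace T X x" and F: "smooth F"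
    and Y: "is_rough_lift p T \<omega> X (smooth_controlled F x) Y"
    and us: "us \<in> words_upto N" "us \<noteq> []"
  shows "(\<lambda>z. Y (fst z) (snd z) us -
      translate N (X (fst z) (snd z)) (osh (\<lambda>u. trunc N (\<lambda>w. smooth_controlled F x (fst z) w \<bullet> u)) us) []) \<in> ord2 (N + 1)"
  using us(1)
proof (cases rule: words_upto_cases)
  case 1
  then show ?thesis using us(2) by simp
next
  case (2 e)
  have tr: "Y s t [e] = (F (x t) - F (x s)) \<bullet> e" if "(s, t) \<in> Simplex T" for s t
    using Y 2 that unfolding is_rough_lift_def is_trace_def smooth_controlled_def by fastforce
  have exp: "(\<lambda>z. F (x (snd z)) \<bullet> e - (\<Sum>w\<in>words_upto N. X (fst z) (snd z) w * (iter_deriv F w (x (fst z)) \<bullet> e))) \<in> ord2 (N + 1)"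
    using smooth_expansion[OF X x smooth_inner[OF F, of e] order_refl] by (simp add: iter_deriv_inner[OF F])
  have "Y s t [e] - translate N (X s t) (osh (\<lambda>u. trunc N (\<lambda>w. smooth_controlled F x s w \<bullet> u)) [e]) []
      = F (x t) \<bullet> e - (\<Sum>w\<in>words_upto N. X s t w * (iter_deriv F w (x s) \<bullet> e))"
    if st: "(s, t) \<in> Simplex T" for s t
  proof -
    have "translate N (X s t) (osh (\<lambda>u. trunc N (\<lambda>w. smooth_controlled F x s w \<bullet> u)) [e]) []
        = (\<Sum>w\<in>words_upto N - {[]}. X s t w * (iter_deriv F w (x s) \<bullet> e))"
      unfolding translate_def
      by (rule sum.mono_neutral_cong_right)
        (auto simp: osh_snoc[of _ "[]", simplified] half_shuffle_unit_left trunc_def smooth_controlled_def)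
    moreover have "(\<Sum>w\<in>words_upto N. X s t w * (iter_deriv F w (x s) \<bullet> e))
        = X s t [] * (F (x s) \<bullet> e) + (\<Sum>w\<in>words_upto N - {[]}. X s t w * (iter_deriv F w (x s) \<bullet> e))"
      by (subst sum.remove[OF finite_words_upto, of "[]"]) auto
    ultimately show ?thesis using tr[OF st] rough_pathsD(2)[OF X st] by (simp add: inner_diff_left)
  qed
  then show ?thesis using exp 2 by (subst bigo_principal_cong) auto
next
  case 3
  have "translate N (X s t) (osh (\<lambda>u. trunc N (\<lambda>w. smooth_controlled F x s w \<bullet> u)) us) []
     = lift_germ X (coords (smooth_controlled F x)) s t us" for s t
    unfolding lift_germ_def translate_def
  proof (rule sum.cong[OF refl], rule arg_cong[where f = "\<lambda>a. _ * a"], rule osh_cong)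
    fix w v :: "'v list" and u assume "w \<in> words_upto N" "length v + length us \<le> length (w @ []) + 1" "set v \<subseteq> set (w @ [])"
    then have "v \<in> words_upto (N - 1)" "v \<in> words_upto N" using 3 by (auto simp: words_upto_def)
    then show "trunc N (\<lambda>w. smooth_controlled F x s w \<bullet> u) v = coords (smooth_controlled F x) s u v"
      by (simp add: trunc_def)
  qed
  then show ?thesis using Y us 3 unfolding is_rough_lift_iff by simp
qed

text \<open>The coefficients in the germ along \<open>Y\<close> are merely bounded, so
  \<open>Y\<close> must be known to order \<open>N + 1\<close> on one-letter words as well;
  \<open>pushforward_expansion\<close> provides this. What remains is a composition, identified by
  \<open>int_coords_pullback\<close>.\<close>

lemma rough_integral_pullback:
  fixes X :: "real \<Rightarrow> real \<Rightarrow> 'v::euclidean_space list \<Rightarrow> real"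
    and F :: "'v \<Rightarrow> 'w::euclidean_space"
    and H :: "real \<Rightarrow> 'w list \<Rightarrow> 'w \<Rightarrow>\<^sub>L 'u::euclidean_space"
  assumes X: "X \<in> rough_paths p T \<omega>" and x: "is_trace T X x" and F: "smooth F"
    and Y: "is_rough_lift p T \<omega> X (smooth_controlled F x) Y"
    and H: "H \<in> controlled_paths p T \<omega> Y"
    and I: "is_rough_integral p T \<omega> Y H I"
  shows "is_rough_integral p T \<omega> X (pullback F x H) I"
  unfolding is_rough_integral_iff
proof (intro conjI ballI)
  have YR: "Y \<in> rough_paths p T \<omega>" using Y by (simp add: is_rough_lift_def)
  note I' = I[unfolded is_rough_integral_iff]
  show "I \<in> Cp_paths p T \<omega>" "I 0 = 0" using I' by auto
  fix e :: 'u assume e: "e \<in> Basis"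
  let ?h = "\<lambda>s u. trunc N (\<lambda>w. smooth_controlled F x s w \<bullet> u)"
  let ?X = "\<lambda>z. X (fst z) (snd z)" and ?Y = "\<lambda>z. Y (fst z) (snd z)" and ?k = "\<lambda>z. int_coords H e (fst z)"
  have 1: "(\<lambda>z. (I (snd z) - I (fst z)) \<bullet> e - translate N (?Y z) (?k z) []) \<in> ord2 (N + 1)"
    using I' e by blast
  have 2: "(\<lambda>z. \<Sum>us\<in>words_upto N. (?Y z us - translate N (?X z) (osh (?h (fst z)) us) []) * ?k z us) \<in> ord2 (N + 1)"
  proof (rule big_sum_in_bigo)
    fix us :: "'w list" assume us: "us \<in> words_upto N"
    show "(\<lambda>z. (?Y z us - translate N (?X z) (osh (?h (fst z)) us) []) * ?k z us) \<in> ord2 (N + 1)"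
    \<comment> \<open>At the empty word the functional of an integral vanishes.\<close>
    proof (cases "us = []")
      case False
      then show ?thesis
        by (intro S2.order_ge_mult_bounded pushforward_expansion[OF X x F Y us]
            bounded_path_ord2(1)[OF int_coords_bounded[OF YR H]])
    qed simp
  qed
  have "(\<Sum>us\<in>words_upto N. translate N (?X z) (osh (?h (fst z)) us) [] * ?k z us)
      = translate N (?X z) (int_coords (pullback F x H) e (fst z)) []" for z
  proof -
    have "(\<Sum>us\<in>words_upto N. translate N (?X z) (osh (?h (fst z)) us) [] * ?k z us)
        = (\<Sum>w\<in>words_upto N. ?X z w * (\<Sum>us\<in>words_upto N. ?k z us * osh (?h (fst z)) us w))"
      unfolding translate_def sum_distrib_left sum_distrib_right by (subst sum.swap) (simp add: mult_ac)
    also have "\<dots> = (\<Sum>w\<in>words_upto N. ?X z w * int_coords (pullback F x H) e (fst z) w)"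
    proof (rule sum.cong[OF refl], rule arg_cong[where f = "\<lambda>a. _ * a"])
      fix w :: "'v list" assume w: "w \<in> words_upto N"
      then have "(\<Sum>us\<in>words_upto N. ?k z us * osh (?h (fst z)) us w) = osh_comp (?k z) (?h (fst z)) w"
        by (subst osh_comp_eq[of _ N]) (auto simp: words_upto_def)
      then show "(\<Sum>us\<in>words_upto N. ?k z us * osh (?h (fst z)) us w) = int_coords (pullback F x H) e (fst z) w"
        by (simp only: int_coords_pullback[OF F w])
    qed
    finally show ?thesis by (simp add: translate_def)
  qed
  moreover have "translate N (?Y z) (?k z) [] = (\<Sum>us\<in>words_upto N. ?Y z us * ?k z us)" for z
    by (simp add: translate_def)
  ultimately have eq: "(I (snd z) - I (fst z)) \<bullet> e - translate N (?X z) (int_coords (pullback F x H) e (fst z)) []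
     = ((I (snd z) - I (fst z)) \<bullet> e - translate N (?Y z) (?k z) [])
       + (\<Sum>us\<in>words_upto N. (?Y z us - translate N (?X z) (osh (?h (fst z)) us) []) * ?k z us)" for z
    by (simp add: left_diff_distrib sum_subtractf)
  show "(\<lambda>z. (I (snd z) - I (fst z)) \<bullet> e - translate N (?X z) (int_coords (pullback F x H) e (fst z)) []) \<in> ord2 (N + 1)"
    unfolding eq by (rule sum_in_bigo(1)[OF 1 2])
qed

text \<open>In positive degree the composition is annihilated at \<open>us = []\<close>, so the
  value of the integral does not enter. As \<open>w\<close> has at most \<open>N - 1\<close>
  letters, truncation at \<open>N\<close> and at \<open>N - 1\<close> agree on its blocks.\<close>

lemma change_path_integral_eq:
  fixes F :: "'v::euclidean_space \<Rightarrow> 'w::euclidean_space"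
    and H :: "real \<Rightarrow> 'w list \<Rightarrow> 'w \<Rightarrow>\<^sub>L 'u::euclidean_space"
  assumes F: "smooth F" and w: "w \<in> words_upto (N - 1)" "w \<noteq> []"
  shows "change_path (controlled_integral p T \<omega> Y H) (smooth_controlled F x) t w
     = controlled_integral p T \<omega> X (pullback F x H) t w"
proof (rule euclidean_eqI)
  fix e :: 'u assume e: "e \<in> Basis"
  let ?K = "controlled_integral p T \<omega> Y H" and ?h = "\<lambda>u. trunc N (\<lambda>w. smooth_controlled F x t w \<bullet> u)"
  have wN: "w \<in> words_upto N" using w by (auto simp: words_upto_def)
  have "change_path ?K (smooth_controlled F x) t w \<bullet> e = osh_comp (coords ?K t e) (coords (smooth_controlled F x) t) w"
    by (rule change_path_coords[OF w(1)])
  also have "\<dots> = osh_comp (int_coords H e t) ?h w"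
    unfolding osh_comp_def
  proof (rule sum.cong[OF refl])
    fix us :: "'w list" assume us: "us \<in> words_upto (length w)"
    show "coords ?K t e us * osh (coords (smooth_controlled F x) t) us w = int_coords H e t us * osh ?h us w"
    proof (cases "us = []")
      case True
      then show ?thesis using w(2) by simp
    next
      case False
      have usN: "us \<in> words_upto N" "us \<in> words_upto (N - 1)" using us w by (auto simp: words_upto_def)
      have "coords ?K t e us = int_coords H e t us"
        using usN False by (subst int_coords_eq) (simp_all add: trunc_def controlled_integral_def)
      moreover have "osh (coords (smooth_controlled F x) t) us w = osh ?h us w"
      proof (rule osh_cong)
        fix u v assume "length v + length us \<le> length w + 1" "set v \<subseteq> set w"
        moreover have "1 \<le> length us" using False by (simp add: Suc_le_eq)
        ultimately have "v \<in> words_upto N" "v \<in> words_upto (N - 1)" using w by (auto simp: words_upto_def)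
        then show "coords (smooth_controlled F x) t u v = ?h u v" by (simp add: trunc_def)
      qed
      ultimately show ?thesis by simp
    qed
  qed
  also have "\<dots> = int_coords (pullback F x H) e t w" by (rule int_coords_pullback[OF F wN])
  also have "\<dots> = uncurry_last (pullback F x H t) w \<bullet> e" by (rule int_coords_eq[OF wN w(2)])
  finally show "change_path ?K (smooth_controlled F x) t w \<bullet> e = controlled_integral p T \<omega> X (pullback F x H) t w \<bullet> e"
    using w(2) by (simp add: controlled_integral_def)
qed

text \<open>Representatives may differ at meaningless arguments, so membership has to be transported
  along \<open>controlled_eq\<close>.\<close>

lemma controlled_paths_cong:
  fixes X :: "real \<Rightarrow> real \<Rightarrow> 'v::euclidean_space list \<Rightarrow> real"
    and H K :: "real \<Rightarrow> 'v list \<Rightarrow> 'u::real_normed_vector"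
  assumes eq: "controlled_eq p T H K" and H: "H \<in> controlled_paths p T \<omega> X"
  shows "K \<in> controlled_paths p T \<omega> X"
proof -
  have E: "K t w = H t w" if "t \<in> {0..T}" "w \<in> words_upto (N - 1)" for t w
    using eq that by (simp add: controlled_eq_def)
  note H' = H[unfolded controlled_paths_iff]
  show ?thesis
    unfolding controlled_paths_iff
  proof (intro conjI ballI allI impI)
    fix w :: "'v list" assume w: "w \<in> words_upto (N - 1)"
    then have "(\<lambda>z. norm (H (snd z) w - H (fst z) w)) \<in> ord2 1" using H' by blast
    then show "(\<lambda>z. norm (K (snd z) w - K (fst z) w)) \<in> ord2 1"
      using E[OF _ w] by (subst bigo_principal_cong[where g = "\<lambda>z. norm (H (snd z) w - H (fst z) w)"]) (auto simp: in_Simplex_iff)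
  next
    fix y :: "'v list" assume y: "length y + 2 \<le> N" "set y \<subseteq> Basis"
    let ?G = "\<lambda>H :: real \<Rightarrow> 'v list \<Rightarrow> 'u. \<lambda>z. norm (H (snd z) y - (\<Sum>w\<in>words_upto (N - 1 - length y). X (fst z) (snd z) w *\<^sub>R H (fst z) (w @ y)))"
    have "?G K z = ?G H z" if z: "z \<in> Simplex T" for z
    proof -
      have "K (snd z) y = H (snd z) y" using y z by (intro E) (auto simp: in_Simplex_iff words_upto_def)
      moreover have "(\<Sum>w\<in>words_upto (N - 1 - length y). X (fst z) (snd z) w *\<^sub>R K (fst z) (w @ y))
          = (\<Sum>w\<in>words_upto (N - 1 - length y). X (fst z) (snd z) w *\<^sub>R H (fst z) (w @ y))"
      proof (rule sum.cong[OF refl])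
        fix w :: "'v list" assume "w \<in> words_upto (N - 1 - length y)"
        then have "K (fst z) (w @ y) = H (fst z) (w @ y)"
          using y z by (intro E) (auto simp: in_Simplex_iff words_upto_def)
        then show "X (fst z) (snd z) w *\<^sub>R K (fst z) (w @ y) = X (fst z) (snd z) w *\<^sub>R H (fst z) (w @ y)" by simp
      qed
      ultimately show ?thesis by simp
    qed
    moreover have "?G H \<in> ord2 (N - length y)" using H' y by blast
    ultimately show "?G K \<in> ord2 (N - length y)" by (subst bigo_principal_cong) auto
  qed
qed

lemma is_rough_lift_cong:
  fixes X :: "real \<Rightarrow> real \<Rightarrow> 'v::euclidean_space list \<Rightarrow> real"
    and H K :: "real \<Rightarrow> 'v list \<Rightarrow> 'u::euclidean_space"
  assumes eq: "controlled_eq p T H K" and Y: "is_rough_lift p T \<omega> X H Y"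
  shows "is_rough_lift p T \<omega> X K Y"
proof -
  have E: "K t w = H t w" if "t \<in> {0..T}" "w \<in> words_upto (N - 1)" for t w
    using eq that by (simp add: controlled_eq_def)
  have c: "coords K s = coords H s" if "s \<in> {0..T}" for s
    using E[OF that] by (auto simp: trunc_def fun_eq_iff)
  note Y' = Y[unfolded is_rough_lift_iff]
  show ?thesis
    unfolding is_rough_lift_iff
  proof (intro conjI ballI impI)
    show "Y \<in> rough_paths p T \<omega>" using Y' by blast
    have "K t [] = H t []" if "t \<in> {0..T}" for t by (rule E[OF that]) simp
    then show "is_trace T Y (\<lambda>t. K t [])"
      using Y' by (auto simp: is_trace_def Simplex_def)
    fix us :: "'u list" assume "us \<in> words_upto N" "2 \<le> length us"
    then have "(\<lambda>z. Y (fst z) (snd z) us - lift_germ X (coords H) (fst z) (snd z) us) \<in> ord2 (N + 1)"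
      using Y' by blast
    moreover have "lift_germ X (coords K) s t us = lift_germ X (coords H) s t us" if "(s, t) \<in> Simplex T" for s t
      using c[of s] that by (simp add: lift_germ_def Simplex_def)
    ultimately show "(\<lambda>z. Y (fst z) (snd z) us - lift_germ X (coords K) (fst z) (snd z) us) \<in> ord2 (N + 1)"
      by (subst bigo_principal_cong[where g = "\<lambda>z. Y (fst z) (snd z) us - lift_germ X (coords H) (fst z) (snd z) us"]) auto
  qed
qed

text \<open>The integral of the pullback inherits membership in the controlled paths from the
  composed path with which it agrees; lifting that common path gives the second equality.\<close>

lemma change_of_variables:
  fixes X :: "real \<Rightarrow> real \<Rightarrow> 'v::euclidean_space list \<Rightarrow> real"
    and F :: "'v \<Rightarrow> 'w::euclidean_space"
    and H :: "real \<Rightarrow> 'w list \<Rightarrow> 'w \<Rightarrow>\<^sub>L 'u::euclidean_space"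
  assumes X: "X \<in> rough_paths p T \<omega>" and x: "is_trace T X x" and F: "smooth F"
    and H: "H \<in> controlled_paths p T \<omega> (pushforward p T \<omega> F X x)"
  defines "M \<equiv> change_path (controlled_integral p T \<omega> (pushforward p T \<omega> F X x) H) (smooth_controlled F x)"
  shows "M \<in> controlled_paths p T \<omega> X"
    and "controlled_integral p T \<omega> X (pullback F x H) \<in> controlled_paths p T \<omega> X"
    and "controlled_eq p T M (controlled_integral p T \<omega> X (pullback F x H))"
    and "rough_path_integral p T \<omega> (pushforward p T \<omega> F X x) H \<in> rough_paths p T \<omega>"
    and "rough_path_integral p T \<omega> (pushforward p T \<omega> F X x) H = rough_path_integral p T \<omega> X (pullback F x H)"
proof -
  let ?Y = "pushforward p T \<omega> F X x" and ?S = "smooth_controlled F x"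
  let ?K = "controlled_integral p T \<omega> ?Y H" and ?P = "controlled_integral p T \<omega> X (pullback F x H)"
  have S: "?S \<in> controlled_paths p T \<omega> X" by (rule smooth_controlled_controlled[OF X x F])
  have Y: "is_rough_lift p T \<omega> X ?S ?Y"
    unfolding pushforward_def by (rule is_rough_lift_rough_lift[OF X S])
  have YR: "?Y \<in> rough_paths p T \<omega>" using Y by (simp add: is_rough_lift_def)
  have K: "?K \<in> controlled_paths p T \<omega> ?Y" by (rule controlled_integral_controlled[OF YR H])
  show M: "M \<in> controlled_paths p T \<omega> X"
    unfolding M_def by (rule change_path_controlled[OF X S Y K])
  \<comment> \<open>The integral along the push-forward meets the description of the integral of the
    pullback, which settles existence of the latter together with the equality.\<close>
  have "rough_integral p T \<omega> X (pullback F x H) = rough_integral p T \<omega> ?Y H"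
    by (rule rough_integral_eqI[OF rough_integral_pullback[OF X x F Y H]])
      (rule is_rough_integral_rough_integral[OF YR H])+
  then have "M t w = ?P t w" if "w \<in> words_upto (N - 1)" for t w
    using change_path_integral_eq[OF F that]
    by (cases "w = []") (simp_all add: M_def change_path_def controlled_integral_def)
  then show eq: "controlled_eq p T M ?P"
    by (simp add: controlled_eq_def)
  show "?P \<in> controlled_paths p T \<omega> X" by (rule controlled_paths_cong[OF eq M])
  have L: "is_rough_lift p T \<omega> ?Y ?K (rough_path_integral p T \<omega> ?Y H)"
    unfolding rough_path_integral_def by (rule is_rough_lift_rough_lift[OF YR K])
  then show "rough_path_integral p T \<omega> ?Y H \<in> rough_paths p T \<omega>" by (simp add: is_rough_lift_def)
  have "is_rough_lift p T \<omega> X M (rough_path_integral p T \<omega> ?Y H)"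
    unfolding M_def by (rule rough_lift_change_path[OF X S Y K L])
  then have "is_rough_lift p T \<omega> X ?P (rough_path_integral p T \<omega> ?Y H)"
    by (rule is_rough_lift_cong[OF eq])
  \<comment> \<open>Uniqueness of the lift, with the convention of zero off the simplex, gives
    equality as functions on all pairs of reals.\<close>
  then have "rough_lift p T \<omega> X ?P = rough_path_integral p T \<omega> ?Y H"
    by (rule rough_lift_eqI) (simp add: rough_path_integral_def is_rough_lift_rough_lift(2)[OF YR K])
  then show "rough_path_integral p T \<omega> ?Y H = rough_path_integral p T \<omega> X (pullback F x H)"
    by (simp add: rough_path_integral_def)
qed

end

theorem theorem2p22:
  fixes p T :: real
    and \<omega> :: "real \<Rightarrow> real \<Rightarrow> real"
    and X :: "real \<Rightarrow> real \<Rightarrow> 'v::euclidean_space list \<Rightarrow> real"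
    and x :: "real \<Rightarrow> 'v"
    and F :: "'v \<Rightarrow> 'w::euclidean_space"
    and H :: "real \<Rightarrow> 'w list \<Rightarrow> 'w \<Rightarrow>\<^sub>L 'u::euclidean_space"
  assumes "0 < T" and "1 \<le> p" and "is_control T \<omega>"
    and "X \<in> rough_paths p T \<omega>" and "is_trace T X x"
    and "smooth F"
    and "H \<in> controlled_paths p T \<omega> (pushforward p T \<omega> F X x)"
  shows "change_path (controlled_integral p T \<omega> (pushforward p T \<omega> F X x) H)
             (smooth_controlled F x) \<in> controlled_paths p T \<omega> X
       \<and> controlled_integral p T \<omega> X (pullback F x H) \<in> controlled_paths p T \<omega> X
       \<and> controlled_eq p T
           (change_path (controlled_integral p T \<omega> (pushforward p T \<omega> F X x) H)
             (smooth_controlled F x))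
           (controlled_integral p T \<omega> X (pullback F x H))
       \<and> rough_path_integral p T \<omega> (pushforward p T \<omega> F X x) H \<in> rough_paths p T \<omega>
       \<and> rough_path_integral p T \<omega> (pushforward p T \<omega> F X x) H
           = rough_path_integral p T \<omega> X (pullback F x H)"
proof -
  interpret control_setup p T \<omega> by (rule control_setup.intro) (rule assms)+
  show ?thesis
    using change_of_variables[OF assms(4-7)] by blast
qed

end
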